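(* Let $(X,\mu)$ be an atomless standard Borel probability space, let $G=\mathrm{Aut}(\mu)$ be the Polish group of measure preserving automorphisms of $(X,\mu)$ with the weak topology, and let $\mathcal{J}$ be the compact space of Markov operators on $L_2(\mu)$ with the weak operator topology. Then the uniform structure induced on $G$ from the unique compatible uniform structure of $\mathcal{J}$, via the embedding $G\to\mathcal{J}$, $T\mapsto U_T$, coincides with the Roelcke uniform structure $\mathcal{L}(G)\wedge\mathcal{R}(G)$. Consequently, the Roelcke uniform structure on $G$ is precompact, and the natural embedding $G\to\mathcal{J}$, $T\mapsto U_T$, is a realization of the Roelcke compactification of $G$.
   Context: Elements of $\mathrm{Aut}(\mu)$ are invertible measure preserving transformations of $(X,\mu)$, identified when they agree $\mu$-a.e. For $T\in G$ the Koopman operator $U_T:L_2(\mu)\to L_2(\mu)$ is the unitary operator $U_Tf(x)=f(T^{-1}x)$. The weak topology on $G$ is the one for which $T\mapsto U_T$ is a topological embedding of $G$ into the unitary group of $H=L_2(\mu)$ (complex Hilbert space) with the strong operator topology (on the unitary group the strong and weak operator topologies coincide). Let $\Theta$ be the closed unit ball of the algebra $\mathcal{B}(H)$ of bounded linear operators on $H$, with the weak operator topology; it is compact Hausdorff. An operator $K\in\Theta$ is Markov if $K(\mathbf{1})=K^*(\mathbf{1})=\mathbf{1}$ and $Kf\ge 0$ whenever $f\ge 0$, where $\mathbf{1}$ is the constant function $1$. $\mathcal{J}\subset\Theta$ is the set of Markov operators; it is closed in $\Theta$, hence compact, and so carries a unique compatible uniform structure. The image of $G$ under $T\mapsto U_T$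 lies in $\mathcal{J}$. For a topological group $G$ with a base $\mathcal{N}$ of neighborhoods of the neutral element $e$, the uniform structures $\mathcal{R}(G)$ and $\mathcal{L}(G)$ have as bases the sets $\{(x,y): xy^{-1}\in U\}$, $U\in\mathcal{N}$, and $\{(x,y): x^{-1}y\in U\}$, $U\in\mathcal{N}$, respectively. The Roelcke (or lower) uniform structure is $\mathcal{L}(G)\wedge\mathcal{R}(G)$, the finest uniform structure coarser than both; a base for it consists of the sets $V_U=\{(x,y):\exists\, z,w\in U,\ y=zxw\}$, $U\in\mathcal{N}$. A uniform structure is precompact if its completion is compact (equivalently, it is totally bounded). The Roelcke compactification of $G$ is the compactification corresponding to the algebra of bounded complex-valued functions on $G$ that are uniformly continuous for both $\mathcal{R}(G)$ and $\mathcal{L}(G)$ (equivalently, uniformly continuous for the Roelcke uniform structure); when the Roelcke uniform structure is precompact, it is the completion of $G$ with respect to this structure. *)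

theory Defs
  imports "HOL-Probability.Probability" "HOL-Algebra.Group"
begin

section \<open>Uniform structures on a carrier set\<close>

text \<open>
  A uniform structure on \<open>S\<close> is represented, as in the class \<^class>\<open>uniform_space\<close>, by the filter
  of its entourages.  The first clause relativises it to \<open>S\<close>; the others are the axioms of
  \<^class>\<open>uniform_space\<close>.  In the order of filters \<open>E \<le> E'\<close> means that \<open>E\<close> is finer than \<open>E'\<close>.
\<close>

definition uniform_structure :: "'a set \<Rightarrow> ('a \<times> 'a) filter \<Rightarrow> bool" where
  "uniform_structure S E \<longleftrightarrow>
     E \<le> principal (S \<times> S) \<and>
     (\<forall>P. eventually P E \<longrightarrow> (\<forall>x\<in>S. P (x, x))) \<and>
     (\<forall>P. eventually P E \<longrightarrow> eventually (\<lambda>(x, y). P (y, x)) E) \<and>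
     (\<forall>P. eventually P E \<longrightarrow>
        (\<exists>D. eventually D E \<and> (\<forall>x y z. D (x, y) \<longrightarrow> D (y, z) \<longrightarrow> P (x, z))))"

definition uniform_topology :: "'a set \<Rightarrow> ('a \<times> 'a) filter \<Rightarrow> 'a topology" where
  "uniform_topology S E =
     topology (\<lambda>U. U \<subseteq> S \<and> (\<forall>x\<in>U. eventually (\<lambda>(x', y). x' = x \<longrightarrow> y \<in> U) E))"

definition compatible_uniformity :: "'a topology \<Rightarrow> ('a \<times> 'a) filter \<Rightarrow> bool" where
  "compatible_uniformity T E \<longleftrightarrow>
     uniform_structure (topspace T) E \<and> uniform_topology (topspace T) E = T"

definition the_compatible_uniformity :: "'a topology \<Rightarrow> ('a \<times> 'a) filter" where
  "the_compatible_uniformity T = (THE E. compatible_uniformity T E)"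

definition induced_uniformity ::
    "'a set \<Rightarrow> ('a \<Rightarrow> 'b) \<Rightarrow> ('b \<times> 'b) filter \<Rightarrow> ('a \<times> 'a) filter" where
  "induced_uniformity S f E = inf (filtercomap (map_prod f f) E) (principal (S \<times> S))"

definition cauchy_filter_in :: "'a set \<Rightarrow> ('a \<times> 'a) filter \<Rightarrow> 'a filter \<Rightarrow> bool" where
  "cauchy_filter_in S E F \<longleftrightarrow> F \<noteq> bot \<and> F \<le> principal S \<and> F \<times>\<^sub>F F \<le> E"

definition complete_uniformity :: "'a set \<Rightarrow> ('a \<times> 'a) filter \<Rightarrow> bool" where
  "complete_uniformity S E \<longleftrightarrow>
     (\<forall>F. cauchy_filter_in S E F \<longrightarrow> (\<exists>x\<in>S. F \<le> nhdsin (uniform_topology S E) x))"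

definition uniform_completion ::
    "'a set \<Rightarrow> ('a \<times> 'a) filter \<Rightarrow> 'b set \<Rightarrow> ('b \<times> 'b) filter \<Rightarrow> ('a \<Rightarrow> 'b) \<Rightarrow> bool" where
  "uniform_completion S E C EC i \<longleftrightarrow>
     uniform_structure C EC \<and> complete_uniformity C EC \<and>
     Hausdorff_space (uniform_topology C EC) \<and>
     i ` S \<subseteq> C \<and> uniform_topology C EC closure_of (i ` S) = C \<and>
     induced_uniformity S i EC = E"

text \<open>
  The Hausdorff completion is unique up to isomorphism and can be realised on the set of minimal
  Cauchy filters, so a carrier of type \<open>'a filter set\<close> is always large enough.
\<close>

definition precompact_uniformity :: "'a set \<Rightarrow> ('a \<times> 'a) filter \<Rightarrow> bool" where
  "precompact_uniformity S E \<longleftrightarrow>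
     uniform_structure S E \<and>
     (\<exists>(C :: 'a filter set) EC i.
        uniform_completion S E C EC i \<and> compact_space (uniform_topology C EC))"


section \<open>Uniform structures of a topological group\<close>

definition right_uniformity ::
    "('a, 'm) monoid_scheme \<Rightarrow> 'a topology \<Rightarrow> ('a \<times> 'a) filter" where
  "right_uniformity G T =
     (INF U \<in> {U. openin T U \<and> \<one>\<^bsub>G\<^esub> \<in> U}.
        principal {(x, y) \<in> carrier G \<times> carrier G. x \<otimes>\<^bsub>G\<^esub> inv\<^bsub>G\<^esub> y \<in> U})"

definition left_uniformity ::
    "('a, 'm) monoid_scheme \<Rightarrow> 'a topology \<Rightarrow> ('a \<times> 'a) filter" where
  "left_uniformity G T =
     (INF U \<in> {U. openin T U \<and> \<one>\<^bsub>G\<^esub> \<in> U}.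
        principal {(x, y) \<in> carrier G \<times> carrier G. inv\<^bsub>G\<^esub> x \<otimes>\<^bsub>G\<^esub> y \<in> U})"

text \<open>
  The finest uniform structure coarser than both.  The infimum (in the order of filters) of a
  family of uniform structures is again a uniform structure; the supremum of the filters
  \<^const>\<open>left_uniformity\<close> and \<^const>\<open>right_uniformity\<close> need not be one.
\<close>

definition roelcke_uniformity ::
    "('a, 'm) monoid_scheme \<Rightarrow> 'a topology \<Rightarrow> ('a \<times> 'a) filter" where
  "roelcke_uniformity G T =
     Inf {E. uniform_structure (carrier G) E \<and> left_uniformity G T \<le> E \<and> right_uniformity G T \<le> E}"

text \<open>
  Only the values on \<^term>\<open>carrier G\<close> matter for membership in the following algebra.
\<close>

definition roelcke_algebra ::
    "('a, 'm) monoid_scheme \<Rightarrow> 'a topology \<Rightarrow> ('a \<Rightarrow> complex) set" where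
  "roelcke_algebra G T =
     {f. bounded (f ` carrier G) \<and>
         (LIM (x, y) left_uniformity G T. (f x, f y) :> uniformity) \<and>
         (LIM (x, y) right_uniformity G T. (f x, f y) :> uniformity)}"

text \<open>
  A compactification \<open>i\<close> of \<open>T\<close> corresponds to the algebra \<open>A\<close> if \<open>A\<close> consists of the functions
  that factor through \<open>i\<close> and a continuous function on \<open>K\<close>.
\<close>

definition compactification_of_algebra ::
    "'a topology \<Rightarrow> ('a \<Rightarrow> complex) set \<Rightarrow> 'b topology \<Rightarrow> ('a \<Rightarrow> 'b) \<Rightarrow> bool" where
  "compactification_of_algebra T A K i \<longleftrightarrow>
     compact_space K \<and> Hausdorff_space K \<and>
     continuous_map T K i \<and> K closure_of (i ` topspace T) = topspace K \<and>
     (\<forall>f. f \<in> A \<longleftrightarrow> (\<exists>h. continuous_map K euclidean h \<and> (\<forall>x\<in>topspace T. f x = h (i x))))"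

definition roelcke_compactification ::
    "('a, 'm) monoid_scheme \<Rightarrow> 'a topology \<Rightarrow> 'b topology \<Rightarrow> ('a \<Rightarrow> 'b) \<Rightarrow> bool" where
  "roelcke_compactification G T K i \<longleftrightarrow>
     compactification_of_algebra T (roelcke_algebra G T) K i"


section \<open>Atomless standard Borel spaces\<close>

definition standard_borel_space :: "'a measure \<Rightarrow> bool" where
  "standard_borel_space M \<longleftrightarrow>
     (\<exists>T. topspace T = space M \<and> completely_metrizable_space T \<and> second_countable T \<and>
          sets M = sigma_sets (space M) {U. openin T U})"

definition atomless :: "'a measure \<Rightarrow> bool" where
  "atomless M \<longleftrightarrow>
     (\<forall>A\<in>sets M. 0 < emeasure M A \<longrightarrow>
        (\<exists>B\<in>sets M. B \<subseteq> A \<and> 0 < emeasure M B \<and> emeasure M B < emeasure M A))"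


section \<open>The complex Hilbert space $L_2(\mu)$\<close>

text \<open>
  Elements of $L_2(\mu)$ are classes of square integrable functions modulo equality almost
  everywhere.
\<close>

type_synonym 'a l2 = "('a \<Rightarrow> complex) set"

definition square_integrable :: "'a measure \<Rightarrow> ('a \<Rightarrow> complex) set" where
  "square_integrable M =
     {f. f \<in> borel_measurable M \<and> integrable M (\<lambda>x. (cmod (f x))\<^sup>2)}"

definition l2_class :: "'a measure \<Rightarrow> ('a \<Rightarrow> complex) \<Rightarrow> 'a l2" where
  "l2_class M f = {g \<in> square_integrable M. AE x in M. g x = f x}"

definition L2 :: "'a measure \<Rightarrow> 'a l2 set" where
  "L2 M = l2_class M ` square_integrable M"

definition rep :: "'b set \<Rightarrow> 'b" where
  "rep F = (SOME f. f \<in> F)"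

definition l2_add :: "'a measure \<Rightarrow> 'a l2 \<Rightarrow> 'a l2 \<Rightarrow> 'a l2" where
  "l2_add M F G = l2_class M (\<lambda>x. rep F x + rep G x)"

definition l2_scale :: "'a measure \<Rightarrow> complex \<Rightarrow> 'a l2 \<Rightarrow> 'a l2" where
  "l2_scale M c F = l2_class M (\<lambda>x. c * rep F x)"

definition l2_inner :: "'a measure \<Rightarrow> 'a l2 \<Rightarrow> 'a l2 \<Rightarrow> complex" where
  "l2_inner M F G = (LINT x|M. rep F x * cnj (rep G x))"

definition l2_norm :: "'a measure \<Rightarrow> 'a l2 \<Rightarrow> real" where
  "l2_norm M F = sqrt (Re (l2_inner M F F))"

definition l2_dist :: "'a measure \<Rightarrow> 'a l2 \<Rightarrow> 'a l2 \<Rightarrow> real" where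
  "l2_dist M F G = sqrt (LINT x|M. (cmod (rep F x - rep G x))\<^sup>2)"

definition l2_one :: "'a measure \<Rightarrow> 'a l2" where
  "l2_one M = l2_class M (\<lambda>_. 1)"

definition l2_nonneg :: "'a measure \<Rightarrow> 'a l2 \<Rightarrow> bool" where
  "l2_nonneg M F \<longleftrightarrow> (AE x in M. rep F x \<in> \<real>\<^sub>\<ge>\<^sub>0)"


section \<open>Bounded operators and Markov operators\<close>

text \<open>
  Operators are extensional functions on \<^term>\<open>L2 M\<close>, so that equality of operators is equality
  of functions.
\<close>

type_synonym 'a l2_op = "'a l2 \<Rightarrow> 'a l2"

definition bounded_ops :: "'a measure \<Rightarrow> 'a l2_op set" where
  "bounded_ops M =
     {K \<in> L2 M \<rightarrow>\<^sub>E L2 M.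
        (\<forall>F\<in>L2 M. \<forall>G\<in>L2 M. K (l2_add M F G) = l2_add M (K F) (K G)) \<and>
        (\<forall>c. \<forall>F\<in>L2 M. K (l2_scale M c F) = l2_scale M c (K F)) \<and>
        (\<exists>B. \<forall>F\<in>L2 M. l2_norm M (K F) \<le> B * l2_norm M F)}"

definition op_norm :: "'a measure \<Rightarrow> 'a l2_op \<Rightarrow> real" where
  "op_norm M K = (SUP F \<in> {F \<in> L2 M. l2_norm M F \<le> 1}. l2_norm M (K F))"

definition contractions :: "'a measure \<Rightarrow> 'a l2_op set" where
  "contractions M = {K \<in> bounded_ops M. op_norm M K \<le> 1}"

definition op_adjoint :: "'a measure \<Rightarrow> 'a l2_op \<Rightarrow> 'a l2_op" where
  "op_adjoint M K =
     (\<lambda>G\<in>L2 M. THE H. H \<in> L2 M \<and> (\<forall>F\<in>L2 M. l2_inner M (K F) G = l2_inner M F H))"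

definition unitary_ops :: "'a measure \<Rightarrow> 'a l2_op set" where
  "unitary_ops M =
     {U \<in> bounded_ops M. bij_betw U (L2 M) (L2 M) \<and>
        (\<forall>F\<in>L2 M. \<forall>G\<in>L2 M. l2_inner M (U F) (U G) = l2_inner M F G)}"

definition weak_operator_topology :: "'a measure \<Rightarrow> 'a l2_op topology" where
  "weak_operator_topology M =
     pullback_topology (bounded_ops M)
       (\<lambda>K. \<lambda>(F, G)\<in>L2 M \<times> L2 M. l2_inner M (K F) G)
       (product_topology (\<lambda>_. euclidean) (L2 M \<times> L2 M))"

definition strong_operator_topology :: "'a measure \<Rightarrow> 'a l2_op topology" where
  "strong_operator_topology M =
     subtopology
       (product_topology (\<lambda>_. Metric_space.mtopology (L2 M) (l2_dist M)) (L2 M))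
       (bounded_ops M)"

definition markov_ops :: "'a measure \<Rightarrow> 'a l2_op set" where
  "markov_ops M =
     {K \<in> contractions M.
        K (l2_one M) = l2_one M \<and> op_adjoint M K (l2_one M) = l2_one M \<and>
        (\<forall>F\<in>L2 M. l2_nonneg M F \<longrightarrow> l2_nonneg M (K F))}"

definition markov_topology :: "'a measure \<Rightarrow> 'a l2_op topology" where
  "markov_topology M = subtopology (weak_operator_topology M) (markov_ops M)"


section \<open>The automorphism group with the weak topology\<close>

definition mp_transformations :: "'a measure \<Rightarrow> ('a \<Rightarrow> 'a) set" where
  "mp_transformations M =
     {T \<in> M \<rightarrow>\<^sub>M M. bij_betw T (space M) (space M) \<and>
        inv_into (space M) T \<in> M \<rightarrow>\<^sub>M M \<and> distr M M T = M}"

definition aut_class :: "'a measure \<Rightarrow> ('a \<Rightarrow> 'a) \<Rightarrow> ('a \<Rightarrow> 'a) set" where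
  "aut_class M T = {S \<in> mp_transformations M. AE x in M. S x = T x}"

definition Aut :: "'a measure \<Rightarrow> ('a \<Rightarrow> 'a) set monoid" where
  "Aut M = \<lparr>carrier = aut_class M ` mp_transformations M,
            mult = (\<lambda>S T. aut_class M (rep S \<circ> rep T)),
            one = aut_class M (\<lambda>x. x)\<rparr>"

definition koopman :: "'a measure \<Rightarrow> ('a \<Rightarrow> 'a) set \<Rightarrow> 'a l2_op" where
  "koopman M T = (\<lambda>F\<in>L2 M. l2_class M (\<lambda>x. rep F (inv_into (space M) (rep T) x)))"

definition weak_topology :: "'a measure \<Rightarrow> ('a \<Rightarrow> 'a) set topology" where
  "weak_topology M =
     pullback_topology (carrier (Aut M)) (koopman M)
       (subtopology (strong_operator_topology M) (unitary_ops M))"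

end

theory Submission
  imports Defs
begin

text \<open>
  A Markov operator is determined by the numbers $\langle K 1_A, 1_B\rangle$, and for $U_T$ these
  are the measures of $A \cap T^{-1} B$.  Let $S$ and $T$ distribute the atoms $A_i$ of a finite
  partition among each other almost equally.  As the space is atomless and standard Borel, there is
  an automorphism $Z$ carrying most of each $S A_i \cap A_j$ onto most of $T A_i \cap A_j$.  Then both
  $Z$ and $W = S^{-1} Z^{-1} T$ nearly preserve every $A_i$, and $T = Z S W$: the operators $U_S$ and
  $U_T$ are close only if $S$ and $T$ are Roelcke close.  The same construction realises the numbers
  $\langle K 1_{A_i}, 1_{A_j}\rangle$ of any Markov operator by an automorphism, so the Koopman
  operators are dense.  The remaining assertions are formal consequences of the compactness of the
  space of Markov operators.
\<close>

section \<open>Compact uniform structures\<close>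

text \<open>The Roelcke structure is the finest uniform structure coarser than the left and the
  right one, so its equality with the induced structure consists of two comparisons. The Koopman
  structure is coarser than both, by estimates of inner products. Conversely, an entourage of any
  structure \<open>E\<close> coarser than both contains some \<open>D\<close> composed with itself,
  and the factorisation of \<open>T\<close> as \<open>Z S W\<close> is a walk of two steps: from
  \<open>S\<close> to \<open>S W\<close>, small on the left, and from \<open>S W\<close> to
  \<open>T\<close>, small on the right. Everything topological is expressed by families of
  pseudometrics, so that closures, induced structures and extensions become statements about
  finitely many indices and one bound. Two obstacles shape the rest. Automorphisms must have
  measurable inverses, so images under injective measurable maps have to be controlled; this is done
  outside null sets, with compact subsets of graphs. And a limit of matrices of Markov operators is
  at first only a sesquilinear form; positivity turns it back into an operator, because a positive
  functional has a Radon-Nikodym density.\<close>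

lemma openin_uniform_topology:
  assumes "uniform_structure S E"
  shows "openin (uniform_topology S E) U \<longleftrightarrow>
    U \<subseteq> S \<and> (\<forall>x\<in>U. eventually (\<lambda>(x', y). x' = x \<longrightarrow> y \<in> U) E)"
proof -
  have "istopology (\<lambda>U. U \<subseteq> S \<and> (\<forall>x\<in>U. eventually (\<lambda>(x', y). x' = x \<longrightarrow> y \<in> U) E))"
    unfolding istopology_def
  proof (intro conjI allI impI)
    fix A B assume *: "A \<subseteq> S \<and> (\<forall>x\<in>A. eventually (\<lambda>(x', y). x' = x \<longrightarrow> y \<in> A) E)"
      "B \<subseteq> S \<and> (\<forall>x\<in>B. eventually (\<lambda>(x', y). x' = x \<longrightarrow> y \<in> B) E)"
    show "A \<inter> B \<subseteq> S" using * by auto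
    show "\<forall>x\<in>A \<inter> B. eventually (\<lambda>(x', y). x' = x \<longrightarrow> y \<in> A \<inter> B) E"
    proof
      fix x assume "x \<in> A \<inter> B"
      then have "eventually (\<lambda>(x', y). x' = x \<longrightarrow> y \<in> A) E" "eventually (\<lambda>(x', y). x' = x \<longrightarrow> y \<in> B) E"
        using * by auto
      then show "eventually (\<lambda>(x', y). x' = x \<longrightarrow> y \<in> A \<inter> B) E"
        by eventually_elim auto
    qed
  next
    fix K assume *: "\<forall>A\<in>K. A \<subseteq> S \<and> (\<forall>x\<in>A. eventually (\<lambda>(x', y). x' = x \<longrightarrow> y \<in> A) E)"
    show "\<Union>K \<subseteq> S" using * by auto
    show "\<forall>x\<in>\<Union>K. eventually (\<lambda>(x', y). x' = x \<longrightarrow> y \<in> \<Union>K) E"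
    proof
      fix x assume "x \<in> \<Union>K"
      then obtain A where "A \<in> K" "x \<in> A" by auto
      then have "eventually (\<lambda>(x', y). x' = x \<longrightarrow> y \<in> A) E" using * by auto
      then show "eventually (\<lambda>(x', y). x' = x \<longrightarrow> y \<in> \<Union>K) E"
        by (rule eventually_mono) (use \<open>A \<in> K\<close> in auto)
    qed
  qed
  then show ?thesis
    unfolding uniform_topology_def by (simp add: topology_inverse')
qed

lemma topspace_uniform_topology:
  assumes "uniform_structure S E"
  shows "topspace (uniform_topology S E) = S"
proof
  show "topspace (uniform_topology S E) \<subseteq> S"
    using openin_topspace openin_uniform_topology[OF assms] by blast
  have "eventually (\<lambda>(x', y). x' = x \<longrightarrow> y \<in> S) E" if "x \<in> S" for x
  proof -
    have "eventually (\<lambda>p. p \<in> S \<times> S) E"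
      using assms by (simp add: uniform_structure_def le_principal)
    then show ?thesis by eventually_elim auto
  qed
  then have "openin (uniform_topology S E) S"
    by (simp add: openin_uniform_topology[OF assms])
  then show "S \<subseteq> topspace (uniform_topology S E)" by (rule openin_subset)
qed

lemma uniform_structure_comp:
  assumes "uniform_structure S E" "eventually P E"
  obtains D where "eventually D E" "\<And>x y z. D (x, y) \<Longrightarrow> D (y, z) \<Longrightarrow> P (x, z)"
proof -
  have "\<forall>P. eventually P E \<longrightarrow>
      (\<exists>D. eventually D E \<and> (\<forall>x y z. D (x, y) \<longrightarrow> D (y, z) \<longrightarrow> P (x, z)))"
    using assms(1) unfolding uniform_structure_def by (elim conjE)
  with assms(2) that show ?thesis by metis
qed

lemma uniform_structure_refl:
  assumes "uniform_structure S E" "eventually P E" "x \<in> S"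
  shows "P (x, x)"
proof -
  have "\<forall>P. eventually P E \<longrightarrow> (\<forall>x\<in>S. P (x, x))"
    using assms(1) unfolding uniform_structure_def by (elim conjE)
  with assms(2,3) show ?thesis by metis
qed

text \<open>The section of an entourage at \<open>x\<close> need not be open, but the points of
  which it is a neighbourhood form an open set: halving the entourage at such a point shows that all
  nearby points are again of this kind. Reflexivity keeps this set inside the section.\<close>

lemma uniform_neighbourhood:
  assumes E: "uniform_structure S E" and P: "eventually P E" and x: "x \<in> S"
  obtains V where "openin (uniform_topology S E) V" "x \<in> V" "\<And>y. y \<in> V \<Longrightarrow> P (x, y)"
proof
  let ?V = "{y \<in> S. eventually (\<lambda>(y', z). y' = y \<longrightarrow> P (x, z)) E}"
  have "eventually (\<lambda>(y', z). y' = y \<longrightarrow> z \<in> ?V) E" if "y \<in> ?V" for y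
  proof -
    from that have "eventually (\<lambda>(y', z). y' = y \<longrightarrow> P (x, z)) E" by simp
    then obtain D where D: "eventually D E"
      "\<And>u v w. D (u, v) \<Longrightarrow> D (v, w) \<Longrightarrow> u = y \<longrightarrow> P (x, w)"
      using uniform_structure_comp[OF E] by (smt (verit) case_prod_conv)
    have S: "eventually (\<lambda>p. p \<in> S \<times> S) E"
      using E by (simp add: uniform_structure_def le_principal)
    have "eventually (\<lambda>p. D p \<and> p \<in> S \<times> S) E"
      using D(1) S by (rule eventually_conj)
    then show ?thesis
    proof (rule eventually_mono)
      fix p assume p: "D p \<and> p \<in> S \<times> S"
      show "case p of (y', z) \<Rightarrow> y' = y \<longrightarrow> z \<in> ?V"
      proof (cases p)
        case (Pair y' z)
        have "eventually (\<lambda>(z', w). z' = z \<longrightarrow> P (x, w)) E" if "y' = y"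
          using D(1) by (rule eventually_mono) (use D(2) p Pair that in auto)
        then show ?thesis using p Pair by auto
      qed
    qed
  qed
  then show "openin (uniform_topology S E) ?V"
    by (simp add: openin_uniform_topology[OF E])
  show "x \<in> ?V"
    using x P by (auto elim!: eventually_mono)
  show "P (x, y)" if "y \<in> ?V" for y
    using that uniform_structure_refl[OF E, of _ y] by force
qed

text \<open>The Lebesgue number lemma. At each \<open>x\<close> a halved entourage
  \<open>D x\<close> ensures that whatever is near a point near \<open>x\<close> stays in the chosen
  set, and compactness leaves finitely many \<open>x\<close>. The cover is described by a predicate
  \<open>Q\<close>, so that it can consist of small sets as well as of sets outside a given
  filter.\<close>

lemma compact_uniform_Lebesgue:
  assumes E: "uniform_structure S E" and cpt: "compact_space (uniform_topology S E)"
    and cover: "\<And>x. x \<in> S \<Longrightarrow> \<exists>U. openin (uniform_topology S E) U \<and> x \<in> U \<and> Q U"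
  obtains D where "eventually D E" "\<And>y. y \<in> S \<Longrightarrow> \<exists>U. Q U \<and> (\<forall>z. D (y, z) \<longrightarrow> z \<in> U)"
proof -
  have "\<forall>x\<in>S. \<exists>D V U. eventually D E \<and> openin (uniform_topology S E) V \<and> x \<in> V \<and> Q U \<and>
      (\<forall>y\<in>V. \<forall>z. D (y, z) \<longrightarrow> z \<in> U)"
  proof
    fix x assume x: "x \<in> S"
    obtain U where U: "openin (uniform_topology S E) U" "x \<in> U" "Q U"
      using cover[OF x] by auto
    then have "eventually (\<lambda>(x', y). x' = x \<longrightarrow> y \<in> U) E"
      using openin_uniform_topology[OF E] by auto
    then obtain D where D: "eventually D E" "\<And>u v w. D (u, v) \<Longrightarrow> D (v, w) \<Longrightarrow> u = x \<longrightarrow> w \<in> U"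
      using uniform_structure_comp[OF E] by (smt (verit) case_prod_conv)
    obtain V where V: "openin (uniform_topology S E) V" "x \<in> V" "\<And>y. y \<in> V \<Longrightarrow> D (x, y)"
      using uniform_neighbourhood[OF E D(1) x] by blast
    show "\<exists>D V U. eventually D E \<and> openin (uniform_topology S E) V \<and> x \<in> V \<and> Q U \<and>
      (\<forall>y\<in>V. \<forall>z. D (y, z) \<longrightarrow> z \<in> U)"
      using D V U(3) by blast
  qed
  from this[unfolded bchoice_iff] obtain D V U where DV': "\<forall>x\<in>S. eventually (D x) E \<and>
      openin (uniform_topology S E) (V x) \<and> x \<in> V x \<and> Q (U x) \<and>
      (\<forall>y\<in>V x. \<forall>z. D x (y, z) \<longrightarrow> z \<in> U x)"
    by (elim exE) (rule that)
  have DV: "\<And>x. x \<in> S \<Longrightarrow> eventually (D x) E"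
    "\<And>x. x \<in> S \<Longrightarrow> openin (uniform_topology S E) (V x)" "\<And>x. x \<in> S \<Longrightarrow> x \<in> V x"
    "\<And>x. x \<in> S \<Longrightarrow> Q (U x)"
    "\<And>x y z. x \<in> S \<Longrightarrow> y \<in> V x \<Longrightarrow> D x (y, z) \<Longrightarrow> z \<in> U x"
    using DV' by simp_all
  have "compactin (uniform_topology S E) S"
    using cpt by (simp add: compact_space_def topspace_uniform_topology[OF E])
  then have "\<exists>\<F>. finite \<F> \<and> \<F> \<subseteq> V ` S \<and> S \<subseteq> \<Union>\<F>"
    by (rule compactinD) (use DV(2,3) in auto)
  then obtain X where X: "finite X" "X \<subseteq> S" "S \<subseteq> (\<Union>x\<in>X. V x)"
    by (metis finite_subset_image)
  show ?thesis
  proof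
    show "eventually (\<lambda>p. \<forall>x\<in>X. D x p) E"
      using X DV(1) by (simp add: eventually_ball_finite subset_iff)
    show "\<exists>U. Q U \<and> (\<forall>z. (\<forall>x\<in>X. D x (y, z)) \<longrightarrow> z \<in> U)" if yS: "y \<in> S" for y
    proof -
      obtain x where "x \<in> X" "y \<in> V x" using X yS by auto
      then show ?thesis using DV(4,5)[of x] X(2) by blast
    qed
  qed
qed

text \<open>In the compact case neighbourhoods of the diagonal are entourages: for a
  \<open>D\<close>-close pair the covering lemma puts \<open>z\<close> into a set \<open>U\<close>
  attached to \<open>y\<close>, and reflexivity of \<open>D\<close> puts \<open>y\<close> into the
  same set.\<close>

lemma compact_uniform_diagonal:
  assumes E: "uniform_structure S E" and cpt: "compact_space (uniform_topology S E)"
    and W: "\<And>x. x \<in> S \<Longrightarrow> \<exists>U. openin (uniform_topology S E) U \<and> x \<in> U \<and> (\<forall>y\<in>U. \<forall>z\<in>U. W (y, z))"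
  shows "eventually W E"
proof -
  obtain D where D: "eventually D E"
    "\<And>y. y \<in> S \<Longrightarrow> \<exists>U. (\<forall>y\<in>U. \<forall>z\<in>U. W (y, z)) \<and> (\<forall>z. D (y, z) \<longrightarrow> z \<in> U)"
    using compact_uniform_Lebesgue[OF E cpt, of "\<lambda>U. \<forall>y\<in>U. \<forall>z\<in>U. W (y, z)"] W by blast
  have "eventually (\<lambda>p. p \<in> S \<times> S) E"
    using E by (simp add: uniform_structure_def le_principal)
  with D(1) show ?thesis
  proof eventually_elim
    case (elim p)
    then obtain y z where p: "p = (y, z)" "y \<in> S" by (cases p) auto
    then show ?case using D(2)[of y] uniform_structure_refl[OF E D(1), of y] elim(1) by blast
  qed
qed

text \<open>Compactness makes the entourages exactly the neighbourhoods of the diagonal, a notion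
  that depends on the topology alone.\<close>

lemma compatible_uniformity_unique:
  assumes "compact_space T" "compatible_uniformity T E" "compatible_uniformity T E'"
  shows "E = E'"
proof -
  have le: "A \<le> B" if A: "compatible_uniformity T A" and B: "compatible_uniformity T B" for A B
  proof (rule filter_leI)
    fix P assume P: "eventually P B"
    have uA: "uniform_structure (topspace T) A" "uniform_topology (topspace T) A = T"
      and uB: "uniform_structure (topspace T) B" "uniform_topology (topspace T) B = T"
      using A B by (auto simp: compatible_uniformity_def)
    show "eventually P A"
    proof (rule compact_uniform_diagonal[OF uA(1)])
      show "compact_space (uniform_topology (topspace T) A)" using assms uA by simp
      fix x assume x: "x \<in> topspace T"
      obtain D where D: "eventually D B" "\<And>x y z. D (x, y) \<Longrightarrow> D (y, z) \<Longrightarrow> P (x, z)"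
        using uniform_structure_comp[OF uB(1) P] by blast
      \<comment> \<open>Both orders are recorded, since \<open>P (y, z)\<close> is reached through
        the centre, by \<open>D (y, x)\<close> and \<open>D (x, z)\<close>.\<close>
      have "eventually (\<lambda>(x, y). D (y, x)) B" using uB(1) D(1) by (auto simp: uniform_structure_def)
      with D(1) have "eventually (\<lambda>(x, y). D (x, y) \<and> D (y, x)) B"
        by eventually_elim auto
      then obtain V where "openin T V" "x \<in> V" "\<And>y. y \<in> V \<Longrightarrow> D (x, y) \<and> D (y, x)"
        using uniform_neighbourhood[OF uB(1) _ x, of "\<lambda>(x, y). D (x, y) \<and> D (y, x)"] uB(2)
        by auto
      then show "\<exists>U. openin (uniform_topology (topspace T) A) U \<and> x \<in> U \<and> (\<forall>y\<in>U. \<forall>z\<in>U. P (y, z))"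
        using D(2) uA(2) by metis
    qed
  qed
  show ?thesis using le assms by (metis antisym)
qed

text \<open>If \<open>F\<close> converged nowhere, every point would have an open neighbourhood
  outside \<open>F\<close>, and the covering lemma makes this uniform. A Cauchy filter contains a
  \<open>D\<close>-small set, which then lies in one of those neighbourhoods, a
  contradiction.\<close>

lemma compact_uniform_complete:
  assumes E: "uniform_structure S E" and cpt: "compact_space (uniform_topology S E)"
  shows "complete_uniformity S E"
  unfolding complete_uniformity_def
proof (intro allI impI, rule ccontr)
  fix F assume F: "cauchy_filter_in S E F" and no: "\<not> (\<exists>x\<in>S. F \<le> nhdsin (uniform_topology S E) x)"
  have FS: "F \<noteq> bot" "eventually (\<lambda>x. x \<in> S) F" "F \<times>\<^sub>F F \<le> E"
    using F by (auto simp: cauchy_filter_in_def le_principal)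
  have "\<exists>U. openin (uniform_topology S E) U \<and> x \<in> U \<and> \<not> eventually (\<lambda>v. v \<in> U) F" if xS: "x \<in> S" for x
  proof -
    have "\<not> F \<le> nhdsin (uniform_topology S E) x" using no xS by auto
    then obtain P where "eventually P (nhdsin (uniform_topology S E) x)" "\<not> eventually P F"
      by (auto simp: le_filter_def)
    moreover from this obtain U where "openin (uniform_topology S E) U" "x \<in> U" "\<forall>y\<in>U. P y"
      using xS by (auto simp: eventually_nhdsin topspace_uniform_topology[OF E])
    ultimately show ?thesis by (metis (mono_tags, lifting) eventually_mono)
  qed
  then obtain D where D: "eventually D E"
    "\<And>y. y \<in> S \<Longrightarrow> \<exists>U. \<not> eventually (\<lambda>v. v \<in> U) F \<and> (\<forall>z. D (y, z) \<longrightarrow> z \<in> U)"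
    using compact_uniform_Lebesgue[OF E cpt, of "\<lambda>U. \<not> eventually (\<lambda>v. v \<in> U) F"] by blast
  have "eventually D (F \<times>\<^sub>F F)" using D(1) FS(3) by (simp add: filter_leD)
  then obtain Q where Q: "eventually Q F" "\<And>y z. Q y \<Longrightarrow> Q z \<Longrightarrow> D (y, z)"
    by (auto simp: eventually_prod_same)
  have "eventually (\<lambda>y. Q y \<and> y \<in> S) F" using Q(1) FS(2) by (rule eventually_conj)
  then obtain y where y: "Q y" "y \<in> S" using eventually_happens' FS(1) by blast
  then obtain U where U: "\<not> eventually (\<lambda>v. v \<in> U) F" "\<forall>z. D (y, z) \<longrightarrow> z \<in> U"
    using D(2) by blast
  have "eventually (\<lambda>v. v \<in> U) F"
    using Q(1) by (rule eventually_mono) (use Q(2) y U in auto)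
  then show False using U by simp
qed

section \<open>Uniform structures given by pseudometrics\<close>

locale gauge =
  fixes S :: "'a set" and I :: "'i set" and d :: "'i \<Rightarrow> 'a \<Rightarrow> 'a \<Rightarrow> real"
  assumes gauge_refl: "\<And>i x. i \<in> I \<Longrightarrow> x \<in> S \<Longrightarrow> d i x x = 0"
    and gauge_sym: "\<And>i x y. i \<in> I \<Longrightarrow> x \<in> S \<Longrightarrow> y \<in> S \<Longrightarrow> d i x y = d i y x"
    and gauge_triangle:
      "\<And>i x y z. i \<in> I \<Longrightarrow> x \<in> S \<Longrightarrow> y \<in> S \<Longrightarrow> z \<in> S \<Longrightarrow> d i x z \<le> d i x y + d i y z"

text \<open>Finitely many indices share one bound. The choice \<open>J = {}\<close> contributes the
  full square, so the infimum runs over a nonempty family even if there are no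
  pseudometrics.\<close>

definition gauge_uniformity ::
    "'a set \<Rightarrow> 'i set \<Rightarrow> ('i \<Rightarrow> 'a \<Rightarrow> 'a \<Rightarrow> real) \<Rightarrow> ('a \<times> 'a) filter" where
  "gauge_uniformity S I d =
     (INF (J, e) \<in> {(J, e). finite J \<and> J \<subseteq> I \<and> 0 < e}.
        principal {(x, y) \<in> S \<times> S. \<forall>i\<in>J. d i x y < e})"

lemma eventually_gauge_uniformity:
  "eventually P (gauge_uniformity S I d) \<longleftrightarrow>
     (\<exists>J e. finite J \<and> J \<subseteq> I \<and> 0 < e \<and> (\<forall>x\<in>S. \<forall>y\<in>S. (\<forall>i\<in>J. d i x y < e) \<longrightarrow> P (x, y)))"
  unfolding gauge_uniformity_def
proof (subst eventually_INF_base, goal_cases)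
  case 1
  have "({}, 1) \<in> {(J, e). finite J \<and> J \<subseteq> I \<and> (0::real) < e}" by auto
  then show ?case by blast
next
  case (2 a b)
  obtain J e K f where "a = (J, e)" "b = (K, f)" by fastforce
  with 2 show ?case
    by (intro bexI[of _ "(J \<union> K, min e f)"]) (auto simp: principal_le_iff)
next
  case 3
  have "(\<forall>p\<in>{(x, y) \<in> S \<times> S. \<forall>i\<in>J. d i x y < e}. P p) \<longleftrightarrow>
      (\<forall>x\<in>S. \<forall>y\<in>S. (\<forall>i\<in>J. d i x y < e) \<longrightarrow> P (x, y))" for J e
    by auto
  then show ?case by (simp add: Bex_def eventually_principal)
qed

context gauge
begin

lemma uniform_structure_gauge: "uniform_structure S (gauge_uniformity S I d)"
  unfolding uniform_structure_def
proof (intro conjI allI impI ballI)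
  show "gauge_uniformity S I d \<le> principal (S \<times> S)"
    unfolding le_principal eventually_gauge_uniformity
    by (rule exI[of _ "{}"], rule exI[of _ 1]) simp
next
  fix P x assume "eventually P (gauge_uniformity S I d)" "x \<in> S"
  then show "P (x, x)" unfolding eventually_gauge_uniformity using gauge_refl by (metis subsetD)
next
  fix P assume "eventually P (gauge_uniformity S I d)"
  then obtain J e where *: "finite J" "J \<subseteq> I" "0 < e"
    "\<And>x y. x \<in> S \<Longrightarrow> y \<in> S \<Longrightarrow> (\<forall>i\<in>J. d i x y < e) \<Longrightarrow> P (x, y)"
    unfolding eventually_gauge_uniformity by blast
  show "eventually (\<lambda>(x, y). P (y, x)) (gauge_uniformity S I d)"
    unfolding eventually_gauge_uniformity using * gauge_sym
    by (intro exI[of _ J] exI[of _ e]) (auto simp: subset_iff)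
  show "\<exists>D. eventually D (gauge_uniformity S I d) \<and> (\<forall>x y z. D (x, y) \<longrightarrow> D (y, z) \<longrightarrow> P (x, z))"
  proof (intro exI conjI allI impI)
    let ?D = "\<lambda>(x, y). x \<in> S \<and> y \<in> S \<and> (\<forall>i\<in>J. d i x y < e / 2)"
    show "eventually ?D (gauge_uniformity S I d)"
      unfolding eventually_gauge_uniformity using * by (intro exI[of _ J] exI[of _ "e/2"]) auto
    fix x y z assume D: "?D (x, y)" "?D (y, z)"
    have "d i x z < e" if "i \<in> J" for i
      using D that gauge_triangle[of i x y z] *(2) by fastforce
    then show "P (x, z)" using *(4) D by auto
  qed
qed

lemma openin_gauge:
  "openin (uniform_topology S (gauge_uniformity S I d)) U \<longleftrightarrow>
    U \<subseteq> S \<and> (\<forall>x\<in>U. \<exists>J e. finite J \<and> J \<subseteq> I \<and> 0 < e \<and> {y \<in> S. \<forall>i\<in>J. d i x y < e} \<subseteq> U)"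
proof -
  have "(\<forall>u\<in>S. \<forall>y\<in>S. (\<forall>i\<in>J. d i u y < e) \<longrightarrow> u = x \<longrightarrow> y \<in> U) \<longleftrightarrow> {y \<in> S. \<forall>i\<in>J. d i x y < e} \<subseteq> U"
    if "x \<in> S" for x e J
    using that by auto
  then show ?thesis
    unfolding openin_uniform_topology[OF uniform_structure_gauge] eventually_gauge_uniformity
    by (auto simp: subset_iff cong: conj_cong)
qed

lemma openin_gauge_ball:
  assumes "x \<in> S" "finite J" "J \<subseteq> I"
  shows "openin (uniform_topology S (gauge_uniformity S I d)) {y \<in> S. \<forall>i\<in>J. d i x y < e}"
  unfolding openin_gauge
proof (intro conjI ballI)
  fix y assume y: "y \<in> {y \<in> S. \<forall>i\<in>J. d i x y < e}"
  \<comment> \<open>The least slack left at \<open>y\<close>. The entry 1 keeps the minimum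
    meaningful for empty \<open>J\<close>; the same device recurs below.\<close>
  define r where "r = Min (insert 1 ((\<lambda>i. e - d i x y) ` J))"
  have r: "0 < r" "\<And>i. i \<in> J \<Longrightarrow> r \<le> e - d i x y"
    using assms y unfolding r_def by auto
  have "{z \<in> S. \<forall>i\<in>J. d i y z < r} \<subseteq> {y \<in> S. \<forall>i\<in>J. d i x y < e}"
  proof safe
    fix z i assume *: "z \<in> S" "\<forall>i\<in>J. d i y z < r" "i \<in> J"
    then have "d i x z \<le> d i x y + d i y z" using gauge_triangle[of i x y z] assms y by auto
    then show "d i x z < e" using r(2)[of i] * by force
  qed
  then show "\<exists>J' e'. finite J' \<and> J' \<subseteq> I \<and> 0 < e' \<and> {z \<in> S. \<forall>i\<in>J'. d i y z < e'} \<subseteq> {y \<in> S. \<forall>i\<in>J. d i x y < e}"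
    using assms r by blast
qed auto

lemma Hausdorff_gauge:
  assumes "\<And>x y. x \<in> S \<Longrightarrow> y \<in> S \<Longrightarrow> (\<forall>i\<in>I. d i x y = 0) \<Longrightarrow> x = y"
  shows "Hausdorff_space (uniform_topology S (gauge_uniformity S I d))"
  unfolding Hausdorff_space_def topspace_uniform_topology[OF uniform_structure_gauge]
proof (intro allI impI)
  fix x y assume xy: "x \<in> S \<and> y \<in> S \<and> x \<noteq> y"
  then obtain i where i: "i \<in> I" "d i x y \<noteq> 0" using assms by blast
  \<comment> \<open>Nonnegativity is a consequence of the axioms: \<open>0 = d i x x\<close> is at
    most \<open>d i x y + d i y x\<close>, which is twice \<open>d i x y\<close>.\<close>
  have "0 \<le> d i x y"
    using xy gauge_refl[OF i(1), of x] gauge_sym[OF i(1), of x y] gauge_triangle[OF i(1), of x y x] by auto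
  then have pos: "0 < d i x y" using i by simp
  let ?U = "\<lambda>x'. {z \<in> S. \<forall>j\<in>{i}. d j x' z < d i x y / 2}"
  show "\<exists>U V. openin (uniform_topology S (gauge_uniformity S I d)) U \<and>
     openin (uniform_topology S (gauge_uniformity S I d)) V \<and> x \<in> U \<and> y \<in> V \<and> disjnt U V"
  proof (intro exI conjI)
    show "openin (uniform_topology S (gauge_uniformity S I d)) (?U x)"
      "openin (uniform_topology S (gauge_uniformity S I d)) (?U y)"
      using xy i by (intro openin_gauge_ball; simp)+
    show "x \<in> ?U x" "y \<in> ?U y" using xy i pos gauge_refl by auto
    show "disjnt (?U x) (?U y)"
      unfolding disjnt_iff
    proof (intro allI notI)
      fix z assume "z \<in> ?U x \<and> z \<in> ?U y"
      then show False
        using gauge_triangle[OF i(1), of x z y] gauge_sym[OF i(1), of z y] xy by auto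
    qed
  qed
qed

lemma in_closure_gauge:
  assumes "x \<in> S" "A \<subseteq> S"
    "\<And>J e. finite J \<Longrightarrow> J \<subseteq> I \<Longrightarrow> 0 < e \<Longrightarrow> \<exists>y\<in>A. \<forall>i\<in>J. d i x y < e"
  shows "x \<in> uniform_topology S (gauge_uniformity S I d) closure_of A"
  unfolding in_closure_of topspace_uniform_topology[OF uniform_structure_gauge]
proof (intro conjI allI impI)
  fix T assume "x \<in> T \<and> openin (uniform_topology S (gauge_uniformity S I d)) T"
  then obtain J e where J: "finite J" "J \<subseteq> I" "0 < e" "{y \<in> S. \<forall>i\<in>J. d i x y < e} \<subseteq> T"
    unfolding openin_gauge by blast
  obtain y where "y \<in> A" "\<forall>i\<in>J. d i x y < e" using assms(3)[OF J(1,2,3)] by blast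
  then show "\<exists>y. y \<in> A \<and> y \<in> T" using assms(2) J(4) by blast
qed (use assms in auto)

end

text \<open>It suffices to dominate one pseudometric at a time: for finitely many of them the
  controlling index sets are united and the smallest bound is taken.\<close>

lemma gauge_uniformity_mono:
  assumes "\<And>i e. i \<in> I' \<Longrightarrow> 0 < e \<Longrightarrow> \<exists>J r. finite J \<and> J \<subseteq> I \<and> 0 < r \<and>
     (\<forall>x\<in>S. \<forall>y\<in>S. (\<forall>j\<in>J. d j x y < r) \<longrightarrow> d' i x y < e)"
  shows "gauge_uniformity S I d \<le> gauge_uniformity S I' d'"
proof (rule filter_leI)
  fix P assume "eventually P (gauge_uniformity S I' d')"
  then obtain J e where J: "finite J" "J \<subseteq> I'" "0 < e"
    "\<And>x y. x \<in> S \<Longrightarrow> y \<in> S \<Longrightarrow> (\<forall>i\<in>J. d' i x y < e) \<Longrightarrow> P (x, y)"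
    unfolding eventually_gauge_uniformity by blast
  have "\<forall>i\<in>J. \<exists>K r. finite K \<and> K \<subseteq> I \<and> 0 < r \<and>
     (\<forall>x\<in>S. \<forall>y\<in>S. (\<forall>j\<in>K. d j x y < r) \<longrightarrow> d' i x y < e)"
    using assms[OF subsetD[OF J(2)] J(3)] by simp
  from this[unfolded bchoice_iff] obtain K r where K': "\<forall>i\<in>J. finite (K i) \<and> K i \<subseteq> I \<and> (0::real) < r i \<and>
     (\<forall>x\<in>S. \<forall>y\<in>S. (\<forall>j\<in>K i. d j x y < r i) \<longrightarrow> d' i x y < e)"
    by (elim exE) (rule that)
  then have K: "\<And>i. i \<in> J \<Longrightarrow> finite (K i)" "\<And>i. i \<in> J \<Longrightarrow> K i \<subseteq> I" "\<And>i. i \<in> J \<Longrightarrow> 0 < r i"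
     "\<And>i x y. i \<in> J \<Longrightarrow> x \<in> S \<Longrightarrow> y \<in> S \<Longrightarrow> \<forall>j\<in>K i. d j x y < r i \<Longrightarrow> d' i x y < e"
    by simp_all
  define m where "m = Min (insert 1 (r ` J))"
  have m: "0 < m" "\<And>i. i \<in> J \<Longrightarrow> m \<le> r i" using J(1) K(3) by (auto simp: m_def)
  show "eventually P (gauge_uniformity S I d)"
    unfolding eventually_gauge_uniformity
  proof (intro exI conjI ballI impI)
    show "finite (\<Union>i\<in>J. K i)" "(\<Union>i\<in>J. K i) \<subseteq> I" "0 < m" using J(1) K(1,2) m by auto
    fix x y assume xy: "x \<in> S" "y \<in> S" "\<forall>j\<in>\<Union>i\<in>J. K i. d j x y < m"
    show "P (x, y)"
    proof (rule J(4)[OF xy(1,2)], rule ballI)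
      fix i assume i: "i \<in> J"
      have "\<forall>j\<in>K i. d j x y < r i" using xy(3) m(2)[OF i] i by fastforce
      then show "d' i x y < e" using K(4)[OF i xy(1,2)] by simp
    qed
  qed
qed

section \<open>Pseudometrics under maps: induced structures, products, embeddings and
  completions\<close>

lemma induced_gauge_uniformity:
  assumes "f ` S \<subseteq> S'"
  shows "induced_uniformity S f (gauge_uniformity S' I d) = gauge_uniformity S I (\<lambda>i x y. d i (f x) (f y))"
proof (rule filter_eqI)
  fix P
  show "eventually P (induced_uniformity S f (gauge_uniformity S' I d)) \<longleftrightarrow>
    eventually P (gauge_uniformity S I (\<lambda>i x y. d i (f x) (f y)))" (is "?L \<longleftrightarrow> ?R")
  proof
    assume ?L
    then obtain Q where Q: "eventually Q (gauge_uniformity S' I d)" "\<And>x y. Q (f x, f y) \<Longrightarrow> x \<in> S \<Longrightarrow> y \<in> S \<Longrightarrow> P (x, y)"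
      by (auto simp: induced_uniformity_def eventually_inf_principal eventually_filtercomap)
    from Q(1) obtain J e where J: "finite J" "J \<subseteq> I" "0 < e"
      "\<And>x y. x \<in> S' \<Longrightarrow> y \<in> S' \<Longrightarrow> (\<forall>i\<in>J. d i x y < e) \<Longrightarrow> Q (x, y)"
      unfolding eventually_gauge_uniformity by blast
    have "P (x, y)" if "x \<in> S" "y \<in> S" "\<forall>i\<in>J. d i (f x) (f y) < e" for x y
      using Q(2) J(4)[of "f x" "f y"] assms that by blast
    then show ?R
      unfolding eventually_gauge_uniformity using J(1-3) by blast
  next
    assume ?R
    then obtain J e where J: "finite J" "J \<subseteq> I" "0 < e"
      "\<And>x y. x \<in> S \<Longrightarrow> y \<in> S \<Longrightarrow> (\<forall>i\<in>J. d i (f x) (f y) < e) \<Longrightarrow> P (x, y)"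
      unfolding eventually_gauge_uniformity by blast
    then have ev: "eventually (\<lambda>(x, y). \<forall>i\<in>J. d i x y < e) (gauge_uniformity S' I d)"
      unfolding eventually_gauge_uniformity by (intro exI[of _ J] exI[of _ e]) auto
    show ?L
      unfolding induced_uniformity_def eventually_inf_principal eventually_filtercomap
      by (rule exI[of _ "\<lambda>(x, y). \<forall>i\<in>J. d i x y < e"]) (use J(4) ev in auto)
  qed
qed

text \<open>The bridge from topologies defined by pullback of products to pseudometrics. It serves
  twice: for the weak operator topology, with one complex factor for each pair of vectors, and for
  the strong one, with one factor \<open>L2 M\<close> for each vector.\<close>

lemma pullback_product_gauge:
  assumes "\<And>i. i \<in> I \<Longrightarrow> Metric_space (X i) (D i)"
    and f: "\<And>x. x \<in> S \<Longrightarrow> f x \<in> (\<Pi>\<^sub>E i\<in>I. X i)"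
  defines "d \<equiv> \<lambda>i x y. D i (f x i) (f y i)"
  shows "gauge S I d"
    and "pullback_topology S f (product_topology (\<lambda>i. Metric_space.mtopology (X i) (D i)) I) =
      uniform_topology S (gauge_uniformity S I d)"
proof -
  have fX: "f x i \<in> X i" if "x \<in> S" "i \<in> I" for x i using f[OF that(1)] that(2) by auto
  show G: "gauge S I d"
  proof
    fix i x y z assume i: "i \<in> I"
    interpret Metric_space "X i" "D i" using assms(1)[OF i] .
    show "x \<in> S \<Longrightarrow> d i x x = 0" using fX[OF _ i] by (simp add: d_def)
    show "x \<in> S \<Longrightarrow> y \<in> S \<Longrightarrow> d i x y = d i y x" by (simp add: d_def commute)
    show "x \<in> S \<Longrightarrow> y \<in> S \<Longrightarrow> z \<in> S \<Longrightarrow> d i x z \<le> d i x y + d i y z"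
      using fX[OF _ i] by (simp add: d_def triangle)
  qed
  interpret gauge S I d by fact
  let ?T = "\<lambda>i. Metric_space.mtopology (X i) (D i)"
  let ?P = "product_topology ?T I"
  have top: "topspace (?T i) = X i" if "i \<in> I" for i
    using Metric_space.topspace_mtopology[OF assms(1)[OF that]] .
  show "pullback_topology S f ?P = uniform_topology S (gauge_uniformity S I d)"
    unfolding topology_eq
  proof (intro allI iffI)
    fix V assume "openin (pullback_topology S f ?P) V"
    then obtain U where U: "openin ?P U" "V = f -` U \<inter> S"
      unfolding openin_pullback_topology by blast
    show "openin (uniform_topology S (gauge_uniformity S I d)) V"
      unfolding openin_gauge
    proof (intro conjI ballI)
      show "V \<subseteq> S" using U by auto
      fix x assume "x \<in> V"
      then have x: "x \<in> S" "f x \<in> U" using U by auto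
      obtain W where W: "f x \<in> (\<Pi>\<^sub>E i\<in>I. W i)" "\<And>i. openin (?T i) (W i)"
        "finite {i. W i \<noteq> topspace (?T i)}" "(\<Pi>\<^sub>E i\<in>I. W i) \<subseteq> U"
        using product_topology_open_contains_basis[OF U(1) x(2)] by blast
      \<comment> \<open>Outside \<open>J\<close> the basic open box imposes no condition, so only
        finitely many pseudometrics are involved.\<close>
      define J where "J = {i \<in> I. W i \<noteq> X i}"
      have J: "finite J" "J \<subseteq> I"
        using W(3) top by (auto simp: J_def elim!: rev_finite_subset)
      have "\<forall>i\<in>J. \<exists>r>0. Metric_space.mball (X i) (D i) (f x i) r \<subseteq> W i"
      proof
        fix i assume "i \<in> J"
        then have i: "i \<in> I" by (auto simp: J_def)
        have "f x i \<in> W i" using W(1) i by auto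
        then show "\<exists>r>0. Metric_space.mball (X i) (D i) (f x i) r \<subseteq> W i"
          using W(2)[of i] Metric_space.openin_mtopology[OF assms(1)[OF i]] by auto
      qed
      from this[unfolded bchoice_iff] obtain r where
        "\<forall>i\<in>J. 0 < r i \<and> Metric_space.mball (X i) (D i) (f x i) (r i) \<subseteq> W i"
        by (elim exE) (rule that)
      then have r: "\<And>i. i \<in> J \<Longrightarrow> 0 < r i"
        "\<And>i. i \<in> J \<Longrightarrow> Metric_space.mball (X i) (D i) (f x i) (r i) \<subseteq> W i" by simp_all
      define e where "e = Min (insert 1 (r ` J))"
      have e: "0 < e" "\<And>i. i \<in> J \<Longrightarrow> e \<le> r i" using J(1) r(1) by (auto simp: e_def)
      have "{y \<in> S. \<forall>i\<in>J. d i x y < e} \<subseteq> V"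
      proof
        fix y assume y: "y \<in> {y \<in> S. \<forall>i\<in>J. d i x y < e}"
        have "f y i \<in> W i" if i: "i \<in> I" for i
        proof (cases "i \<in> J")
          case True
          have "d i x y < r i" using y e(2)[OF True] True by force
          then have "f y i \<in> Metric_space.mball (X i) (D i) (f x i) (r i)"
            using fX[OF _ i] x y by (simp add: Metric_space.in_mball[OF assms(1)[OF i]] d_def)
          then show ?thesis using r(2)[OF True] by blast
        next
          case False
          then show ?thesis using fX[OF _ i] y i by (auto simp: J_def)
        qed
        then have "f y \<in> (\<Pi>\<^sub>E i\<in>I. W i)" using f[of y] y by (auto simp: PiE_iff)
        then show "y \<in> V" using W(4) U(2) y by auto
      qed
      then show "\<exists>J e. finite J \<and> J \<subseteq> I \<and> 0 < e \<and> {y \<in> S. \<forall>i\<in>J. d i x y < e} \<subseteq> V"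
        using J e(1) by blast
    qed
  next
    fix V assume V: "openin (uniform_topology S (gauge_uniformity S I d)) V"
    have cont: "continuous_map (pullback_topology S f ?P) (?T i) (\<lambda>x. f x i)" if "i \<in> I" for i
      using continuous_map_pullback[OF continuous_map_product_projection[OF that, of ?T], of S f]
      by (simp add: o_def)
    have topP: "topspace (pullback_topology S f ?P) = S"
      using f top by (auto simp: topspace_pullback_topology PiE_iff)
    have "\<exists>U. openin (pullback_topology S f ?P) U \<and> x \<in> U \<and> U \<subseteq> V" if xV: "x \<in> V" for x
    proof -
      obtain J e where J: "finite J" "J \<subseteq> I" "0 < e" "{y \<in> S. \<forall>i\<in>J. d i x y < e} \<subseteq> V"
        using V xV unfolding openin_gauge by blast
      have x: "x \<in> S" using V xV unfolding openin_gauge by blast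
      define U where "U = S \<inter> (\<Inter>i\<in>J. {y \<in> S. f y i \<in> Metric_space.mball (X i) (D i) (f x i) e})"
      have "openin (pullback_topology S f ?P) {y \<in> S. f y i \<in> Metric_space.mball (X i) (D i) (f x i) e}"
        if "i \<in> J" for i
        using openin_continuous_map_preimage[OF cont[of i] Metric_space.openin_mball[OF assms(1)[of i]]]
          that J(2) topP by auto
      moreover have "openin (pullback_topology S f ?P) S" using topP openin_topspace by metis
      ultimately have "openin (pullback_topology S f ?P) U"
        unfolding U_def using J(1) by (cases "J = {}") (auto intro!: openin_Int openin_Inter)
      moreover have "x \<in> U"
        using x J(2,3) fX by (auto simp: U_def Metric_space.in_mball[OF assms(1)] Metric_space.mdist_zero[OF assms(1)] subset_iff)
      moreover have "U \<subseteq> V"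
        using J(2,4) by (auto simp: U_def d_def Metric_space.in_mball[OF assms(1)] subset_iff)
      ultimately show ?thesis by blast
    qed
    then show "openin (pullback_topology S f ?P) V"
      by (subst openin_subopen) blast
  qed
qed

lemma gauge_uniformity_cong:
  assumes "\<And>i x y. i \<in> I \<Longrightarrow> x \<in> S \<Longrightarrow> y \<in> S \<Longrightarrow> d i x y = d' i x y"
  shows "gauge_uniformity S I d = gauge_uniformity S I d'"
proof (rule antisym; rule gauge_uniformity_mono)
  fix i and e :: real assume "i \<in> I" "0 < e"
  then show "\<exists>J r. finite J \<and> J \<subseteq> I \<and> 0 < r \<and> (\<forall>x\<in>S. \<forall>y\<in>S. (\<forall>j\<in>J. d j x y < r) \<longrightarrow> d' i x y < e)"
    "\<exists>J r. finite J \<and> J \<subseteq> I \<and> 0 < r \<and> (\<forall>x\<in>S. \<forall>y\<in>S. (\<forall>j\<in>J. d' j x y < r) \<longrightarrow> d i x y < e)"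
    by (intro exI[of _ "{i}"] exI[of _ e]; simp add: assms)+
qed

lemma gauge_comp:
  assumes "gauge S' I d" "f ` S \<subseteq> S'"
  shows "gauge S I (\<lambda>i x y. d i (f x) (f y))"
proof -
  interpret gauge S' I d by fact
  have f: "f x \<in> S'" if "x \<in> S" for x using assms(2) that by auto
  show ?thesis
    by unfold_locales (blast intro: gauge_refl gauge_sym gauge_triangle f)+
qed

text \<open>For each index \<open>f\<close> preserves the pseudometric, so balls in \<open>S\<close>
  are the preimages of balls around image points. This gives continuity and relative openness at
  once, and injectivity makes \<open>f\<close> a homeomorphism onto its image.\<close>

lemma embedding_gauge:
  assumes "gauge S' I d" and f: "f ` S \<subseteq> S'" "inj_on f S"
  shows "embedding_map (uniform_topology S (gauge_uniformity S I (\<lambda>i x y. d i (f x) (f y))))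
     (uniform_topology S' (gauge_uniformity S' I d)) f"
proof -
  interpret G': gauge S' I d by fact
  interpret G: gauge S I "\<lambda>i x y. d i (f x) (f y)"
    using assms(1) f(1) by (rule gauge_comp)
  let ?T = "uniform_topology S (gauge_uniformity S I (\<lambda>i x y. d i (f x) (f y)))"
  let ?T' = "uniform_topology S' (gauge_uniformity S' I d)"
  have top: "topspace ?T = S" "topspace ?T' = S'"
    by (simp_all add: topspace_uniform_topology G.uniform_structure_gauge G'.uniform_structure_gauge)
  have cont: "continuous_map ?T ?T' f"
    unfolding continuous_map_def top
  proof (intro conjI allI impI)
    show "f \<in> S \<rightarrow> S'" using f by auto
    fix U assume U: "openin ?T' U"
    show "openin ?T {x \<in> S. f x \<in> U}"
      unfolding G.openin_gauge
    proof (intro conjI ballI)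
      fix x assume x: "x \<in> {x \<in> S. f x \<in> U}"
      then obtain J e where J: "finite J" "J \<subseteq> I" "0 < e" "{y \<in> S'. \<forall>i\<in>J. d i (f x) y < e} \<subseteq> U"
        using U unfolding G'.openin_gauge by blast
      have "{y \<in> S. \<forall>i\<in>J. d i (f x) (f y) < e} \<subseteq> {x \<in> S. f x \<in> U}" using J(4) f(1) by auto
      then show "\<exists>J e. finite J \<and> J \<subseteq> I \<and> 0 < e \<and>
          {y \<in> S. \<forall>i\<in>J. d i (f x) (f y) < e} \<subseteq> {x \<in> S. f x \<in> U}" using J(1-3) by blast
    qed auto
  qed
  have "open_map ?T (subtopology ?T' (f ` S)) f"
    unfolding open_map_def
  proof (intro allI impI)
    fix U assume U: "openin ?T U"
    have US: "U \<subseteq> S" using U unfolding G.openin_gauge by blast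
    have "\<exists>V. openin ?T' V \<and> f x \<in> V \<and> V \<inter> f ` S \<subseteq> f ` U" if x: "x \<in> U" for x
    proof -
      obtain J e where J: "finite J" "J \<subseteq> I" "0 < e" "{y \<in> S. \<forall>i\<in>J. d i (f x) (f y) < e} \<subseteq> U"
        using U x unfolding G.openin_gauge by blast
      let ?V = "{y \<in> S'. \<forall>i\<in>J. d i (f x) y < e}"
      have fx: "f x \<in> S'" using x US f(1) by auto
      have "openin ?T' ?V" using fx J(1,2) by (rule G'.openin_gauge_ball)
      moreover have "f x \<in> ?V" using fx J G'.gauge_refl by auto
      moreover have "?V \<inter> f ` S \<subseteq> f ` U" using J(4) by auto
      ultimately show ?thesis by blast
    qed
    then have "\<forall>x\<in>U. \<exists>V. openin ?T' V \<and> f x \<in> V \<and> V \<inter> f ` S \<subseteq> f ` U" by blast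
    from this[unfolded bchoice_iff] obtain V where
      V: "\<forall>x\<in>U. openin ?T' (V x) \<and> f x \<in> V x \<and> V x \<inter> f ` S \<subseteq> f ` U"
      by (elim exE) (rule that)
    have "f ` U = (\<Union>x\<in>U. V x) \<inter> f ` S" using V US by blast
    moreover have "openin ?T' (\<Union>x\<in>U. V x)" using V by blast
    ultimately show "openin (subtopology ?T' (f ` S)) (f ` U)"
      unfolding openin_subtopology by blast
  qed
  moreover have "topspace (subtopology ?T' (f ` S)) = f ` S"
    using f(1) top(2) by auto
  ultimately show ?thesis
    unfolding embedding_map_def top
    by (intro bijective_open_imp_homeomorphic_map)
       (use cont f top in \<open>simp_all add: continuous_map_in_subtopology\<close>)
qed

text \<open>
  The completion is realised on the traces on \<open>S\<close> of the neighbourhood filters of the compact space.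
\<close>

lemma precompact_uniformity_dense:
  fixes f :: "'a \<Rightarrow> 'b"
  assumes "gauge S' I d"
    and f: "f ` S \<subseteq> S'"
    and cpt: "compact_space (uniform_topology S' (gauge_uniformity S' I d))"
    and sep: "\<And>x y. x \<in> S' \<Longrightarrow> y \<in> S' \<Longrightarrow> (\<forall>i\<in>I. d i x y = 0) \<Longrightarrow> x = y"
    and dense: "(uniform_topology S' (gauge_uniformity S' I d)) closure_of (f ` S) = S'"
    and dE: "E = gauge_uniformity S I (\<lambda>i x y. d i (f x) (f y))"
  shows "precompact_uniformity S E"
proof -
  interpret G': gauge S' I d by fact
  interpret G: gauge S I "\<lambda>i x y. d i (f x) (f y)"
    using assms(1) f by (rule gauge_comp)
  define T' where "T' = uniform_topology S' (gauge_uniformity S' I d)"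
  have topT': "topspace T' = S'"
    by (simp add: T'_def topspace_uniform_topology G'.uniform_structure_gauge)
  have haus: "Hausdorff_space T'" unfolding T'_def by (rule G'.Hausdorff_gauge) (rule sep)
  \<comment> \<open>\<open>precompact_uniformity\<close> demands a carrier of filters on
    \<open>S\<close>, hence the points of \<open>S'\<close> are relabelled by such filters.\<close>
  define \<phi> where "\<phi> y = inf (filtercomap f (nhdsin T' y)) (principal S)" for y
  have ev: "eventually P (\<phi> y) \<longleftrightarrow> (\<exists>U. openin T' U \<and> y \<in> U \<and> (\<forall>x\<in>S. f x \<in> U \<longrightarrow> P x))"
    if "y \<in> S'" for P y
  proof -
    have "eventually P (\<phi> y) \<longleftrightarrow> (\<exists>Q. (\<exists>U. openin T' U \<and> y \<in> U \<and> (\<forall>z\<in>U. Q z)) \<and> (\<forall>x. Q (f x) \<longrightarrow> x \<in> S \<longrightarrow> P x))"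
      using that by (simp add: \<phi>_def eventually_inf_principal eventually_filtercomap eventually_nhdsin topT')
    also have "\<dots> \<longleftrightarrow> (\<exists>U. openin T' U \<and> y \<in> U \<and> (\<forall>x\<in>S. f x \<in> U \<longrightarrow> P x))"
    proof
      assume "\<exists>U. openin T' U \<and> y \<in> U \<and> (\<forall>x\<in>S. f x \<in> U \<longrightarrow> P x)"
      then obtain U where "openin T' U" "y \<in> U" "\<forall>x\<in>S. f x \<in> U \<longrightarrow> P x" by blast
      then show "\<exists>Q. (\<exists>U. openin T' U \<and> y \<in> U \<and> (\<forall>z\<in>U. Q z)) \<and> (\<forall>x. Q (f x) \<longrightarrow> x \<in> S \<longrightarrow> P x)"
        by (intro exI[of _ "\<lambda>z. z \<in> U"]) auto
    qed blast
    finally show ?thesis .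
  qed
  \<comment> \<open>Density is what makes the labels distinct: neighbourhoods of \<open>y\<close>
    and \<open>z\<close> are only seen through the points of the image, and every neighbourhood of
    \<open>z\<close> contains some.\<close>
  have inj: "inj_on \<phi> S'"
  proof (rule inj_onI, rule ccontr)
    fix y z assume yz: "y \<in> S'" "z \<in> S'" "\<phi> y = \<phi> z" "y \<noteq> z"
    then obtain U V where UV: "openin T' U" "openin T' V" "y \<in> U" "z \<in> V" "disjnt U V"
      using haus unfolding Hausdorff_space_def topT' by blast
    have "eventually (\<lambda>x. f x \<in> U) (\<phi> z)"
      unfolding yz(3)[symmetric] ev[OF yz(1)] using UV by blast
    then obtain W where W: "openin T' W" "z \<in> W" "\<forall>x\<in>S. f x \<in> W \<longrightarrow> f x \<in> U"
      unfolding ev[OF yz(2)] by blast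
    have "openin T' (W \<inter> V)" "z \<in> W \<inter> V" using W UV by auto
    moreover have "z \<in> T' closure_of (f ` S)" using dense yz(2) by (simp add: T'_def)
    ultimately have "\<exists>y\<in>f ` S. y \<in> W \<inter> V" unfolding in_closure_of by blast
    then show False using W(3) UV(5) by (auto simp: disjnt_iff)
  qed
  define \<psi> where "\<psi> = the_inv_into S' \<phi>"
  have \<psi>: "\<psi> (\<phi> y) = y" if "y \<in> S'" for y
    unfolding \<psi>_def by (rule the_inv_into_f_f[OF inj that])
  define C where "C = \<phi> ` S'"
  \<comment> \<open>The structure on \<open>C\<close> is transported along \<open>\<psi>\<close>,
    which preserves every pseudometric; compactness and separation then pass over through a
    homeomorphism.\<close>
  define dC where "dC i a b = d i (\<psi> a) (\<psi> b)" for i a b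
  define i where "i = \<phi> \<circ> f"
  have \<psi>C: "\<psi> ` C = S'" "inj_on \<psi> C" using \<psi> by (force simp: C_def inj_on_def)+
  interpret GC: gauge C I dC
    unfolding dC_def by (rule gauge_comp[OF assms(1)]) (use \<psi>C(1) in auto)
  define EC where "EC = gauge_uniformity C I dC"
  have emb: "embedding_map (uniform_topology C EC) T' \<psi>"
    unfolding EC_def T'_def dC_def by (rule embedding_gauge) (use assms(1) \<psi>C in auto)
  have topC: "topspace (uniform_topology C EC) = C"
    by (simp add: EC_def topspace_uniform_topology GC.uniform_structure_gauge)
  have hom: "homeomorphic_map (uniform_topology C EC) T' \<psi>"
  proof -
    have "subtopology T' S' = T'" using topT' subtopology_topspace by metis
    with emb show ?thesis by (simp only: embedding_map_def topC \<psi>C(1))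
  qed
  have cptC: "compact_space (uniform_topology C EC)"
    using homeomorphic_compact_space[OF homeomorphic_map_imp_homeomorphic_space[OF hom]] cpt
    by (simp only: T'_def)
  have unifC: "uniform_structure C EC" unfolding EC_def by (rule GC.uniform_structure_gauge)
  have fS': "f x \<in> S'" if "x \<in> S" for x using f that by auto
  have "uniform_completion S E C EC i"
    unfolding uniform_completion_def
  proof (intro conjI)
    show "uniform_structure C EC" by fact
    show "complete_uniformity C EC" by (rule compact_uniform_complete[OF unifC cptC])
    show "Hausdorff_space (uniform_topology C EC)"
      using homeomorphic_Hausdorff_space[OF homeomorphic_map_imp_homeomorphic_space[OF hom]] haus
      by simp
    show "i ` S \<subseteq> C" using f by (auto simp: i_def C_def)
    show "uniform_topology C EC closure_of (i ` S) = C"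
    proof
      show "uniform_topology C EC closure_of (i ` S) \<subseteq> C"
        using closure_of_subset_topspace topC by metis
      show "C \<subseteq> uniform_topology C EC closure_of (i ` S)"
      proof
        fix a assume a: "a \<in> C"
        then have a': "\<psi> a \<in> T' closure_of (f ` S)" using \<psi>C(1) dense by (auto simp: T'_def)
        show "a \<in> uniform_topology C EC closure_of (i ` S)"
          unfolding EC_def
        proof (rule GC.in_closure_gauge)
          fix J and e :: real assume J: "finite J" "J \<subseteq> I" "0 < e"
          let ?V = "{y \<in> S'. \<forall>i\<in>J. d i (\<psi> a) y < e}"
          have aS: "\<psi> a \<in> S'" using a \<psi>C(1) by auto
          have "openin T' ?V" unfolding T'_def using aS J(1,2) by (rule G'.openin_gauge_ball)
          moreover have "\<psi> a \<in> ?V" using aS J G'.gauge_refl by auto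
          ultimately have "\<exists>y. y \<in> f ` S \<and> y \<in> ?V"
            using a'[unfolded in_closure_of, THEN conjunct2, rule_format, of ?V] by simp
          then obtain x where "x \<in> S" "f x \<in> ?V" by (elim exE conjE imageE) simp
          then show "\<exists>b\<in>i ` S. \<forall>j\<in>J. dC j a b < e"
            by (intro bexI[of _ "i x"]) (auto simp: dC_def i_def \<psi>)
        qed (use a f in \<open>auto simp: i_def C_def\<close>)
      qed
    qed
    show "induced_uniformity S i EC = E"
    proof -
      have "induced_uniformity S i EC = gauge_uniformity S I (\<lambda>j x y. dC j (i x) (i y))"
        unfolding EC_def by (rule induced_gauge_uniformity) (use f in \<open>auto simp: i_def C_def\<close>)
      also have "\<dots> = E"
        unfolding dE by (rule gauge_uniformity_cong) (simp add: dC_def i_def \<psi> fS')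
      finally show ?thesis .
    qed
  qed
  then show ?thesis
    unfolding precompact_uniformity_def
    using cptC G.uniform_structure_gauge unfolding dE by (intro conjI exI)
qed

section \<open>Continuous functions on a compact space and uniformly continuous functions on a dense
  subset\<close>

text \<open>The Heine-Cantor theorem: sets on which \<open>h\<close> stays within \<open>e/2\<close>
  of \<open>h x\<close> are small enough for the diagonal criterion.\<close>

lemma compact_uniform_continuous:
  fixes h :: "'a \<Rightarrow> 'b::metric_space"
  assumes E: "uniform_structure S E" and cpt: "compact_space (uniform_topology S E)"
    and h: "continuous_map (uniform_topology S E) euclidean h" and "0 < e"
  shows "eventually (\<lambda>(x, y). dist (h x) (h y) < e) E"
proof (rule compact_uniform_diagonal[OF E cpt])
  fix x assume x: "x \<in> S"
  let ?U = "{y \<in> S. h y \<in> ball (h x) (e/2)}"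
  have "openin (uniform_topology S E) ?U"
    using openin_continuous_map_preimage[OF h, of "ball (h x) (e/2)"]
    by (simp add: topspace_uniform_topology[OF E])
  moreover have "x \<in> ?U" using x \<open>0 < e\<close> by simp
  moreover have "dist (h y) (h z) < e" if yz: "y \<in> ?U" "z \<in> ?U" for y z
    using yz dist_triangle_half_r[of "h x" "h y" e "h z"] by (simp add: dist_commute)
  ultimately show "\<exists>U. openin (uniform_topology S E) U \<and> x \<in> U \<and>
      (\<forall>y\<in>U. \<forall>z\<in>U. case (y, z) of (x, y) \<Rightarrow> dist (h x) (h y) < e)"
    by (intro exI[of _ ?U]) simp
qed

text \<open>Uniform continuity turns the trace of a neighbourhood filter on the image into a filter
  whose image under the function is Cauchy, so a limit exists at each missing point. Regularity of
  the target makes the pointwise extension continuous.\<close>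

lemma gauge_extension:
  fixes h :: "'a \<Rightarrow> 'c::complete_space"
  assumes "gauge S' I d" and f: "f ` S \<subseteq> S'" and inj: "inj_on f S"
    and dense: "(uniform_topology S' (gauge_uniformity S' I d)) closure_of (f ` S) = S'"
    and h: "\<And>e. 0 < e \<Longrightarrow> eventually (\<lambda>(x, y). dist (h x) (h y) < e)
        (gauge_uniformity S I (\<lambda>i x y. d i (f x) (f y)))"
  shows "\<exists>H. continuous_map (uniform_topology S' (gauge_uniformity S' I d)) euclidean H \<and> (\<forall>x\<in>S. h x = H (f x))"
proof -
  interpret G': gauge S' I d by fact
  define T' where "T' = uniform_topology S' (gauge_uniformity S' I d)"
  have top: "topspace T' = S'"
    by (simp add: T'_def topspace_uniform_topology G'.uniform_structure_gauge)
  define A where "A = f ` S"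
  \<comment> \<open>By injectivity of \<open>f\<close> the function descends to the image; only its
    values there matter.\<close>
  define k where "k = (\<lambda>y. h (inv_into S f y))"
  have k: "k (f x) = h x" if "x \<in> S" for x using that by (simp add: k_def inj)
  have A: "A \<subseteq> S'" using f by (simp add: A_def)
  have unif: "\<exists>J r. finite J \<and> J \<subseteq> I \<and> 0 < r \<and>
      (\<forall>x\<in>A. \<forall>y\<in>A. (\<forall>i\<in>J. d i x y < r) \<longrightarrow> dist (k x) (k y) < e)" if e: "0 < e" for e
  proof -
    obtain J r where J: "finite J" "J \<subseteq> I" "0 < r"
      "\<forall>x\<in>S. \<forall>y\<in>S. (\<forall>i\<in>J. d i (f x) (f y) < r) \<longrightarrow> dist (h x) (h y) < e"
      using h[OF e] unfolding eventually_gauge_uniformity by auto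
    then have "\<forall>x\<in>A. \<forall>y\<in>A. (\<forall>i\<in>J. d i x y < r) \<longrightarrow> dist (k x) (k y) < e"
      by (simp add: A_def k)
    then show ?thesis using J(1-3) by blast
  qed
  have evI: "eventually P (atin_within T' t A)"
    if t: "t \<in> S'" and J: "finite J" "J \<subseteq> I" "0 < r" and P: "\<And>y. y \<in> A \<Longrightarrow> (\<forall>i\<in>J. d i t y < r) \<Longrightarrow> P y"
    for P t J r
  proof -
    let ?U = "{y \<in> S'. \<forall>i\<in>J. d i t y < r}"
    have "openin T' ?U" unfolding T'_def using t J(1,2) by (rule G'.openin_gauge_ball)
    moreover have "t \<in> ?U" using t J G'.gauge_refl by (simp add: subset_iff)
    ultimately show ?thesis
      unfolding eventually_atin_within by (intro disjI2 exI[of _ ?U]) (simp add: P)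
  qed
  have cont: "continuous_map (subtopology T' A) euclidean k"
    unfolding continuous_map_atin
  proof
    fix t assume "t \<in> topspace (subtopology T' A)"
    then have t: "t \<in> A" "t \<in> S'" using A top by auto
    have "(k \<longlongrightarrow> k t) (atin_within T' t A)"
    proof (rule tendstoI)
      fix e :: real assume "0 < e"
      from unif[OF this] obtain J r where J: "finite J" "J \<subseteq> I" "0 < r"
        "\<forall>x\<in>A. \<forall>y\<in>A. (\<forall>i\<in>J. d i x y < r) \<longrightarrow> dist (k x) (k y) < e" by blast
      have "dist (k y) (k t) < e" if "y \<in> A" "\<forall>i\<in>J. d i t y < r" for y
        using J(4) t(1) that by (metis dist_commute)
      then show "eventually (\<lambda>x. dist (k x) (k t) < e) (atin_within T' t A)"
        using t(2) J(1-3) by (intro evI[of t J r])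
    qed
    then show "limitin euclidean k (k t) (atin (subtopology T' A) t)"
      using t(1) by (simp add: atin_subtopology_within limitin_canonical_iff)
  qed
  have lim: "\<exists>l. limitin euclidean k l (atin_within T' t A)" if t: "t \<in> S' - A" for t
  proof -
    let ?F = "filtermap k (atin_within T' t A)"
    have tS: "t \<in> S'" using t by simp
    \<comment> \<open>The punctured filter is nontrivial because the image is dense and
      \<open>t\<close> lies outside it.\<close>
    have nb: "?F \<noteq> bot"
    proof
      assume "?F = bot"
      then have "eventually (\<lambda>_. False) (atin_within T' t A)"
        by (simp add: filtermap_bot_iff)
      then obtain T where T: "openin T' T" "t \<in> T" "\<forall>x\<in>T. \<not> (x \<in> A \<and> x \<noteq> t)"
        unfolding eventually_atin_within using t top by auto
      have "t \<in> T' closure_of A" using dense tS by (simp add: T'_def A_def)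
      then obtain y where "y \<in> A" "y \<in> T" using T(1,2) unfolding in_closure_of by metis
      then show False using T(3) t by auto
    qed
    have "cauchy_filter ?F"
      unfolding cauchy_filter_def
    proof (rule filter_leI)
      fix P :: "'c \<times> 'c \<Rightarrow> bool" assume "eventually P uniformity"
      then obtain e where e: "0 < e" "\<And>x y. dist x y < e \<Longrightarrow> P (x, y)"
        unfolding eventually_uniformity_metric by auto
      from unif[OF e(1)] obtain J r where J: "finite J" "J \<subseteq> I" "0 < r"
        "\<forall>x\<in>A. \<forall>y\<in>A. (\<forall>i\<in>J. d i x y < r) \<longrightarrow> dist (k x) (k y) < e" by blast
      \<comment> \<open>Two points within \<open>r / 2\<close> of \<open>t\<close> are within
        \<open>r\<close> of each other, which is what the modulus of continuity requires.\<close>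
      let ?Q = "\<lambda>y. y \<in> A \<and> (\<forall>i\<in>J. d i t y < r / 2)"
      have ev: "eventually ?Q (atin_within T' t A)"
        using tS J(1,2) by (rule evI[where r = "r/2"]) (use J(3) in auto)
      have close: "P (k x, k y)" if xy: "?Q x" "?Q y" for x y
      proof (rule e(2), rule J(4)[rule_format])
        fix i assume i: "i \<in> J"
        have "x \<in> S'" "y \<in> S'" using xy A by auto
        then have "d i x y \<le> d i t x + d i t y"
          using G'.gauge_triangle[of i x t y] G'.gauge_sym[of i x t] i J(2) tS by auto
        also have "\<dots> < r / 2 + r / 2" using xy i by (intro add_strict_mono) auto
        finally show "d i x y < r" by simp
      qed (use xy in auto)
      show "eventually P (?F \<times>\<^sub>F ?F)"
        unfolding eventually_prod_same
      proof (intro exI conjI allI impI)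
        show "eventually (\<lambda>z. \<exists>y. z = k y \<and> ?Q y) ?F"
          unfolding eventually_filtermap using ev by eventually_elim auto
      qed (use close in auto)
    qed
    then obtain l where "?F \<le> nhds l"
      using complete_UNIV nb unfolding complete_uniform by (metis principal_UNIV top_greatest)
    then have "(k \<longlongrightarrow> l) (atin_within T' t A)" by (simp add: filterlim_def)
    then show ?thesis unfolding limitin_canonical_iff by blast
  qed
  obtain H where H: "continuous_map (subtopology T' S') euclidean H" "\<And>x. x \<in> A \<Longrightarrow> H x = k x"
  proof (rule continuous_map_extension_pointwise_alt[OF _ A _ cont lim])
    show "regular_space (euclidean :: 'c topology)"
      by (simp add: metrizable_imp_regular_space metrizable_space_euclidean)
    show "S' \<subseteq> T' closure_of A" using dense by (simp add: T'_def A_def)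
  qed blast+
  have "continuous_map T' euclidean H" using H(1) top subtopology_topspace by metis
  moreover have "\<forall>x\<in>S. h x = H (f x)" using H(2) k by (simp add: A_def)
  ultimately show ?thesis unfolding T'_def by blast
qed

section \<open>Standard Borel spaces\<close>

lemma gdelta_in_euclidean_borel:
  assumes "gdelta_in euclidean S"
  shows "S \<in> sets borel"
proof -
  obtain \<U> where "countable \<U>" "\<And>U. U \<in> \<U> \<Longrightarrow> open U" "S = \<Inter>\<U>"
    using assms unfolding gdelta_in_alt intersection_of_def by auto
  then show ?thesis
    using sets.countable_INT''[of borel \<U> "\<lambda>x. x"] by simp
qed

text \<open>The distances to a dense sequence embed a separable metric space into the sequence
  space. Complete metrizability makes the image a G-delta set, hence Borel, and this is what lets
  measurable sets have Borel images.\<close>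

lemma standard_borel_embedding:
  assumes "standard_borel_space M"
  obtains e :: "'a \<Rightarrow> nat \<Rightarrow> real" where
    "inj_on e (space M)" "e \<in> borel_measurable M" "\<And>A. A \<in> sets M \<Longrightarrow> e ` A \<in> sets borel"
proof -
  obtain T where T: "topspace T = space M" "completely_metrizable_space T" "second_countable T"
    "sets M = sigma_sets (space M) {U. openin T U}"
    using assms unfolding standard_borel_space_def by blast
  obtain S d where d: "Metric_space S d" "T = Metric_space.mtopology S d"
    using T(2) unfolding completely_metrizable_space_def by blast
  interpret Metric_space S d by fact
  have S: "S = space M" using T(1) d(2) by simp
  obtain Q where Q: "countable Q" "Q \<subseteq> S" "T closure_of Q = S"
    using second_countable_imp_separable_space[OF T(3)] unfolding separable_space_def d(2) by auto
  define a where "a = from_nat_into Q"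
  define e where "e x n = d x (a n)" for x n
  show ?thesis
  \<comment> \<open>The empty space is separated off because the enumeration of the dense set has
    values in it only if it is nonempty.\<close>
  proof (cases "S = {}")
    case True
    then have "sets M = {{}}" using S sets.sets_into_space[of _ M] sets.empty_sets[of M] by force
    then show ?thesis
      using that[of "\<lambda>_ _. 0"] S True by (auto simp: inj_on_def intro!: measurableI)
  next
    case False
    then have "Q \<noteq> {}" using Q(3) closure_of_empty by metis
    then have a: "a n \<in> Q" "a n \<in> S" for n
      using from_nat_into[of Q n] Q(2) by (auto simp: a_def)
    have near: "\<exists>n. d x (a n) < r" if "x \<in> S" "0 < r" for x r
    proof -
      have "x \<in> T closure_of Q" using Q(3) that by simp
      moreover have "openin T (mball x r)" "x \<in> mball x r" using d(2) that by auto
      ultimately obtain y where "y \<in> Q" "y \<in> mball x r" unfolding in_closure_of by metis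
      then show ?thesis using from_nat_into_surj[OF Q(1)] by (auto simp: a_def in_mball)
    qed
    have inj: "inj_on e S"
    proof (rule inj_onI, rule ccontr)
      fix x y assume xy: "x \<in> S" "y \<in> S" "e x = e y" "x \<noteq> y"
      then obtain n where n: "d x (a n) < d x y / 2" using near[of x "d x y / 2"] by auto
      then have "d y (a n) < d x y / 2" using fun_cong[OF xy(3), of n] by (simp add: e_def)
      then show False using n triangle[of x "a n" y] xy a commute by fastforce
    qed
    have cont1: "continuous_map T euclideanreal (\<lambda>x. e x n)" for n
      unfolding continuous_map_def
  proof (intro conjI allI impI)
    fix V :: "real set" assume "openin euclideanreal V"
    then have V: "open V" by simp
    have "\<exists>r>0. mball x r \<subseteq> {x \<in> S. e x n \<in> V}" if x: "x \<in> S" "e x n \<in> V" for x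
    proof -
      obtain r where r: "0 < r" "ball (e x n) r \<subseteq> V" using V x(2) open_contains_ball by metis
      have "mball x r \<subseteq> {x \<in> S. e x n \<in> V}"
      proof
        fix z assume "z \<in> mball x r"
        then have z: "z \<in> S" "d x z < r" by (auto simp: in_mball)
        have "\<bar>e x n - e z n\<bar> \<le> d x z"
          using triangle[of x z "a n"] triangle[of z x "a n"] commute[of x z] x(1) z(1) a(2)
          by (simp add: e_def abs_le_iff)
        then have "e z n \<in> ball (e x n) r" using z(2) by (simp add: dist_real_def)
        then show "z \<in> {x \<in> S. e x n \<in> V}" using r(2) z(1) by blast
      qed
      then show ?thesis using r(1) by blast
    qed
    then show "openin T {x \<in> topspace T. e x n \<in> V}"
      unfolding d(2) openin_mtopology by simp
  qed simp
    then have cont: "continuous_map T euclidean e"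
      unfolding euclidean_product_topology[symmetric] continuous_map_componentwise_UNIV by blast
    have op: "\<exists>V. open V \<and> e ` U = V \<inter> e ` S" if U: "openin T U" for U
    proof -
      have US: "U \<subseteq> S" using openin_subset[OF U] T(1) S by auto
      have "\<exists>V. open V \<and> e x \<in> V \<and> V \<inter> e ` S \<subseteq> e ` U" if x: "x \<in> U" for x
      proof -
        obtain r where r: "0 < r" "mball x r \<subseteq> U"
          using U x unfolding d(2) openin_mtopology by blast
        have xS: "x \<in> S" using x US by auto
        \<comment> \<open>One coordinate suffices: if \<open>a n\<close> is within
          \<open>r / 3\<close> of \<open>x\<close>, every point within \<open>2 * r / 3\<close> of
          \<open>a n\<close> is within \<open>r\<close> of \<open>x\<close>.\<close>
        obtain n where n: "d x (a n) < r / 3" using near[of x "r/3"] xS r by auto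
        let ?V = "(\<lambda>y::nat \<Rightarrow> real. y n) -` {..< 2 * r / 3}"
        have "open ?V"
          by (intro open_vimage continuous_on_product_coordinates) auto
        moreover have "e x \<in> ?V" using n r(1) by (simp add: e_def)
        moreover have "z \<in> U" if z: "z \<in> S" "e z \<in> ?V" for z
        proof -
          have "d z (a n) < 2 * r / 3" using z by (simp add: e_def)
          then have "d x z < r"
            using n triangle[of x "a n" z] commute[of z "a n"] xS z(1) a(2)[of n] by linarith
          then show ?thesis using r(2) xS z(1) by (auto simp: in_mball)
        qed
        ultimately show ?thesis by (intro exI[of _ ?V]) auto
      qed
      then have "\<forall>x\<in>U. \<exists>V. open V \<and> e x \<in> V \<and> V \<inter> e ` S \<subseteq> e ` U" by blast
      from this[unfolded bchoice_iff] obtain V where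
        "\<forall>x\<in>U. open (V x) \<and> e x \<in> V x \<and> V x \<inter> e ` S \<subseteq> e ` U" by (elim exE) (rule that)
      then have "open (\<Union>x\<in>U. V x)" "e ` U = (\<Union>x\<in>U. V x) \<inter> e ` S" using US by (blast, blast)
      then show ?thesis by blast
    qed
    have "embedding_map T euclidean e"
      unfolding embedding_map_def
    proof (rule bijective_open_imp_homeomorphic_map)
      show "continuous_map T (top_of_set (e ` topspace T)) e"
        using cont by (simp add: continuous_map_in_subtopology)
      show "open_map T (top_of_set (e ` topspace T)) e"
        unfolding open_map_def using op S T(1) by (metis inf_commute openin_open)
    qed (use inj S T(1) in auto)
    then have "T homeomorphic_space top_of_set (e ` S)"
      using S T(1) embedding_map_imp_homeomorphic_space by metis
    then have "completely_metrizable_space (top_of_set (e ` S))"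
      using T(2) homeomorphic_completely_metrizable_space by blast
    then have "gdelta_in euclidean (e ` S)"
      using completely_metrizable_space_eq_gdelta_in[OF completely_metrizable_space_euclidean] by auto
    then have eS: "e ` S \<in> sets borel" by (rule gdelta_in_euclidean_borel)
    \<comment> \<open>Images under the injective \<open>e\<close> commute with complements in
      \<open>S\<close> and with countable unions, so an induction over the generated sigma-algebra
      reduces the claim to open sets.\<close>
    have "e ` A \<in> sets borel" if "A \<in> sets M" for A
      using that unfolding T(4)
    proof (induction A rule: sigma_sets.induct)
      case (Basic U)
      then have "\<exists>V. open V \<and> e ` U = V \<inter> e ` S" by (intro op) simp
      then obtain V where "open V" "e ` U = V \<inter> e ` S" by (elim exE conjE)
      then show ?case using eS by simp
    next
      case (Compl A)
      then have "A \<in> sets M" using T(4) by simp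
      then have "e ` (space M - A) = e ` S - e ` A"
        using inj_on_image_set_diff[OF inj, of S A] S sets.sets_into_space by auto
      then show ?case using eS Compl.IH by simp
    next
      case (Union A)
      then show ?case by (simp add: image_UN sets.countable_UN)
    qed simp
    moreover have "e \<in> borel_measurable M"
    proof (rule measurable_coordinatewise_then_product, rule borel_measurableI)
      fix n and V :: "real set" assume "open V"
      then have "openin T {x \<in> topspace T. e x n \<in> V}"
        using openin_continuous_map_preimage[OF cont1] by simp
      moreover have "(\<lambda>x. e x n) -` V \<inter> space M = {x \<in> topspace T. e x n \<in> V}" using T(1) by auto
      ultimately show "(\<lambda>x. e x n) -` V \<inter> space M \<in> sets M" using T(4) by auto
    qed
    ultimately show ?thesis using that inj S by blast
  qed
qed

section \<open>Countable separation and injections into the real line\<close>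

text \<open>The sets are the rational sublevel sets of the coordinates of the embedding, enumerated
  over pairs of a coordinate and a rational; distinct reals have a rational between them.\<close>

lemma standard_borel_separating:
  assumes "standard_borel_space M"
  obtains A :: "nat \<Rightarrow> 'a set" where "\<And>n. A n \<in> sets M"
    "\<And>x y. x \<in> space M \<Longrightarrow> y \<in> space M \<Longrightarrow> (\<And>n. x \<in> A n \<longleftrightarrow> y \<in> A n) \<Longrightarrow> x = y"
proof -
  obtain e :: "'a \<Rightarrow> nat \<Rightarrow> real" where e: "inj_on e (space M)" "e \<in> borel_measurable M"
    using standard_borel_embedding[OF assms] by blast
  define A where "A k = {x \<in> space M. e x (fst (from_nat k :: nat \<times> rat)) < of_rat (snd (from_nat k :: nat \<times> rat))}" for k
  have [measurable]: "(\<lambda>x. e x n) \<in> borel_measurable M" for n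
    using e(2) by (rule measurable_product_then_coordinatewise)
  show ?thesis
  proof
    show "A n \<in> sets M" for n unfolding A_def by measurable
    fix x y assume xy: "x \<in> space M" "y \<in> space M" "\<And>n. x \<in> A n \<longleftrightarrow> y \<in> A n"
    have iff: "e x n < of_rat q \<longleftrightarrow> e y n < of_rat q" for n and q :: rat
      using xy(3)[of "to_nat (n, q)"] xy(1,2) by (simp add: A_def)
    have "e x n = e y n" for n
    proof (rule ccontr)
      assume "e x n \<noteq> e y n"
      then consider "e x n < e y n" | "e y n < e x n" by linarith
      then show False
        by cases (use of_rat_dense iff in \<open>metis less_asym\<close>)+
    qed
    then show "x = y" using e(1) xy(1,2) by (auto simp: inj_on_def fun_eq_iff)
  qed
qed

text \<open>The tail of the geometric series of ratio $1/3$ is smaller than the preceding term.\<close>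

lemma ternary_expansion_zero:
  fixes u :: "nat \<Rightarrow> real"
  assumes u: "\<And>k. \<bar>u k\<bar> \<le> 1" "\<And>k. u k \<noteq> 0 \<Longrightarrow> \<bar>u k\<bar> = 1"
    and z: "(\<Sum>k. u k * (1/3)^k) = 0"
  shows "u k = 0"
proof (rule ccontr)
  assume "u k \<noteq> 0"
  define m where "m = (LEAST k. u k \<noteq> 0)"
  have m: "u m \<noteq> 0" "\<And>k. k < m \<Longrightarrow> u k = 0"
    using LeastI[of "\<lambda>k. u k \<noteq> 0", OF \<open>u k \<noteq> 0\<close>] not_less_Least unfolding m_def by blast+
  have g: "summable (\<lambda>k. (1/3::real)^k)" by (simp add: summable_geometric)
  have le: "norm (u k * (1/3)^k) \<le> (1/3)^k" for k
    using u(1)[of k] by (simp add: abs_mult mult_left_le_one_le)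
  have su: "summable (\<lambda>k. u k * (1/3)^k)" using g le by (rule summable_comparison_test'[of _ 0])
  have "0 = (\<Sum>k. u (k + Suc m) * (1/3)^(k + Suc m)) + (\<Sum>k<Suc m. u k * (1/3)^k)"
    using suminf_split_initial_segment[OF su, of "Suc m"] z by simp
  also have "(\<Sum>k<Suc m. u k * (1/3)^k) = u m * (1/3)^m" using m(2) by simp
  finally have "u m * (1/3)^m = - (\<Sum>k. u (k + Suc m) * (1/3)^(k + Suc m))"
    by linarith
  then have "\<bar>u m * (1/3)^m\<bar> = \<bar>\<Sum>k. u (k + Suc m) * (1/3)^(k + Suc m)\<bar>"
    by (simp only: abs_minus_cancel)
  then have "\<bar>u m\<bar> * (1/3)^m = \<bar>\<Sum>k. u (k + Suc m) * (1/3)^(k + Suc m)\<bar>"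
    by (simp add: abs_mult power_abs)
  also have "\<dots> \<le> (\<Sum>k. (1/3)^(k + Suc m))"
  proof -
    have s: "summable (\<lambda>k. norm (u (k + Suc m) * (1/3)^(k + Suc m)))"
    proof (rule summable_comparison_test'[OF summable_ignore_initial_segment[OF g, of "Suc m"], of 0])
      show "norm (norm (u (k + Suc m) * (1/3)^(k + Suc m))) \<le> (1/3)^(k + Suc m)" for k
        using le[of "k + Suc m"] by (simp only: real_norm_def abs_abs)
    qed
    have "\<bar>\<Sum>k. u (k + Suc m) * (1/3)^(k + Suc m)\<bar> \<le> (\<Sum>k. norm (u (k + Suc m) * (1/3)^(k + Suc m)))"
      using summable_norm[OF s] by simp
    also have "\<dots> \<le> (\<Sum>k. (1/3)^(k + Suc m))"
      by (rule suminf_le[OF le s summable_ignore_initial_segment[OF g]])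
    finally show ?thesis .
  qed
  also have "\<dots> = (1/3)^m / 2"
    using suminf_mult[OF g, of "(1/3)^Suc m"] by (simp add: power_add suminf_geometric mult.commute)
  finally show False using u(2)[OF m(1)] by simp
qed

text \<open>The sequence of memberships in a separating family is encoded by digits 0 and 1 in base
  3. Differences of digits lie between -1 and 1, and in this base such a difference series vanishes
  only if all its digits do, so the code is injective.\<close>

lemma standard_borel_injection:
  assumes "standard_borel_space M"
  obtains g :: "'a \<Rightarrow> real" where "g \<in> borel_measurable M" "inj_on g (space M)"
proof -
  obtain A :: "nat \<Rightarrow> 'a set" where A: "\<And>n. A n \<in> sets M"
    "\<And>x y. x \<in> space M \<Longrightarrow> y \<in> space M \<Longrightarrow> (\<And>n. x \<in> A n \<longleftrightarrow> y \<in> A n) \<Longrightarrow> x = y"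
    using standard_borel_separating[OF assms] by blast
  define g where "g x = (\<Sum>k. indicator (A k) x * (1/3)^k :: real)" for x
  have su: "summable (\<lambda>k. indicator (A k) x * (1/3)^k :: real)" for x
    by (rule summable_comparison_test'[of "\<lambda>k. (1/3)^k" 0])
       (auto simp: summable_geometric indicator_def)
  show ?thesis
  proof
    note A(1)[measurable]
    show "g \<in> borel_measurable M" unfolding g_def by measurable
    show "inj_on g (space M)"
    proof (rule inj_onI)
      fix x y assume xy: "x \<in> space M" "y \<in> space M" "g x = g y"
      let ?u = "\<lambda>k. indicator (A k) x - indicator (A k) y :: real"
      have "(\<Sum>k. ?u k * (1/3)^k) = 0"
        using suminf_diff[OF su[of x] su[of y]] xy(3) by (simp add: g_def algebra_simps)
      then have u0: "?u k = 0" for k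
        by (rule ternary_expansion_zero[rotated 2]) (auto simp: indicator_def)
      have "x \<in> A k \<longleftrightarrow> y \<in> A k" for k
        using u0[of k] by (cases "x \<in> A k"; cases "y \<in> A k") simp_all
      then show "x = y" using A(2) xy(1,2) by blast
    qed
  qed
qed

section \<open>Borel images under injective maps, up to null sets\<close>

text \<open>On a compact set a continuous injection has a continuous inverse, so the image of a
  Borel set is a preimage under that inverse.\<close>

lemma borel_inj_image_compact:
  fixes f :: "'a::topological_space \<Rightarrow> 'b::t2_space"
  assumes "compact K" "continuous_on K f" "inj_on f K" "D \<in> sets borel"
  shows "f ` (D \<inter> K) \<in> sets borel"
proof -
  define g where "g = inv_into K f"
  have g: "g (f x) = x" if "x \<in> K" for x using assms(3) that by (simp add: g_def)
  have "continuous_on (f ` K) g" using assms(1,2) g by (intro continuous_on_inv) auto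
  then have "g \<in> restrict_space borel (f ` K) \<rightarrow>\<^sub>M borel"
    by (rule borel_measurable_continuous_on_restrict)
  then have "g -` D \<inter> space (restrict_space borel (f ` K)) \<in> sets (restrict_space borel (f ` K))"
    using assms(4) by (rule measurable_sets)
  moreover have fK: "f ` K \<in> sets borel"
    using compact_continuous_image[OF assms(2,1)] by (simp add: borel_compact)
  moreover have "g -` D \<inter> f ` K = f ` (D \<inter> K)" using g by (auto simp: image_iff)
  ultimately show ?thesis
    by (auto simp: space_restrict_space sets_restrict_space_iff)
qed

locale standard_measure = finite_measure M for M :: "'a measure" +
  assumes standard: "standard_borel_space M"
begin

text \<open>
  On the graph of an injective measurable function the second projection is injective and
  continuous, so inner regularity replaces the theorem of Lusin and Souslin up to a null set.
\<close>

lemma injective_images_borel: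
  fixes h :: "'a \<Rightarrow> real"
  assumes h: "h \<in> borel_measurable M" and A: "A \<in> sets M" "inj_on h A"
  obtains A0 where "A0 \<in> sets M" "A0 \<subseteq> A" "measure M (A - A0) = 0"
    "\<And>B. B \<in> sets M \<Longrightarrow> B \<subseteq> A0 \<Longrightarrow> h ` B \<in> sets borel"
proof -
  obtain e :: "'a \<Rightarrow> nat \<Rightarrow> real" where e: "inj_on e (space M)" "e \<in> borel_measurable M"
    "\<And>A. A \<in> sets M \<Longrightarrow> e ` A \<in> sets borel"
    using standard_borel_embedding[OF standard] by blast
  have AS: "A \<subseteq> space M" using A(1) sets.sets_into_space by auto
  \<comment> \<open>\<open>h\<close> is carried over to the embedded copy of the space and extended
    by 0; this default is the reason for the case \<open>0 \<in> V\<close> in the preimage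
    below.\<close>
  define hh where "hh y = (if y \<in> e ` space M then h (inv_into (space M) e y) else 0)" for y
  have hh: "hh (e x) = h x" if "x \<in> space M" for x using that e(1) by (simp add: hh_def)
  have hhm [measurable]: "hh \<in> borel_measurable borel"
  proof (rule measurableI)
    fix V :: "real set" assume V: "V \<in> sets borel"
    have "hh -` V \<inter> space borel = e ` (h -` V \<inter> space M) \<union> (if 0 \<in> V then - e ` space M else {})"
    proof (rule Set.set_eqI)
      fix y show "y \<in> hh -` V \<inter> space borel \<longleftrightarrow>
          y \<in> e ` (h -` V \<inter> space M) \<union> (if 0 \<in> V then - e ` space M else {})"
      proof (cases "y \<in> e ` space M")
        case True
        then obtain x where x: "x \<in> space M" "y = e x" by blast
        have "e x \<in> e ` (h -` V \<inter> space M) \<longleftrightarrow> h x \<in> V"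
          using x(1) inj_on_image_mem_iff[OF e(1), of x "h -` V \<inter> space M"] by simp
        then show ?thesis using x hh by simp
      next
        case False
        then show ?thesis by (auto simp: hh_def)
      qed
    qed
    moreover have "e ` (h -` V \<inter> space M) \<in> sets borel" by (intro e(3) measurable_sets[OF h V])
    moreover have "- e ` space M \<in> sets borel" using e(3)[OF sets.top] by (metis Compl_eq_Diff_UNIV sets.compl_sets space_borel)
    ultimately show "hh -` V \<inter> space borel \<in> sets borel" by (simp add: sets.Un)
  qed simp
  \<comment> \<open>The graph is taken over the embedded copy of the space, so that it lies in a
    Polish space, where finite Borel measures are inner regular with respect to compact
    sets.\<close>
  define G where "G x = (e x, h x)" for x
  have Gm: "G \<in> borel_measurable M" unfolding G_def using e(2) h by (intro borel_measurable_Pair)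
  have Ginj: "inj_on G (space M)" using e(1) by (auto simp: G_def inj_on_def)
  have GB: "G ` B \<in> sets borel" if B: "B \<in> sets M" for B
  proof -
    have [measurable]: "e ` B \<in> sets borel" using e(3) B .
    let ?P = "borel \<Otimes>\<^sub>M borel :: ((nat \<Rightarrow> real) \<times> real) measure"
    have "G ` B = {p \<in> space ?P. fst p \<in> e ` B \<and> snd p = hh (fst p)}"
      using hh sets.sets_into_space[OF B] by (auto simp: G_def image_iff subset_iff space_pair_measure)
    moreover have "{p \<in> space ?P. fst p \<in> e ` B \<and> snd p = hh (fst p)} \<in> sets ?P"
      by measurable
    moreover have "sets ?P = sets borel" by (simp only: borel_prod)
    ultimately show ?thesis by simp
  qed
  define N where "N = distr M borel G"
  have "\<exists>K. compact K \<and> K \<subseteq> G ` A \<and> measure M A < measure M (G -` K \<inter> space M) + 1 / Suc n" for n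
  proof -
    have "emeasure N (space N) \<noteq> \<infinity>" unfolding N_def using Gm by (simp add: emeasure_distr)
    then have reg: "emeasure N (G ` A) = (SUP K \<in> {K. K \<subseteq> G ` A \<and> compact K}. emeasure N K)"
      by (intro inner_regular GB A(1)) (simp_all add: N_def)
    have NK: "emeasure N K = ennreal (measure M (G -` K \<inter> space M))" if "K \<in> sets borel" for K
      unfolding N_def using Gm that by (simp add: emeasure_distr emeasure_eq_measure)
    have GA: "G -` (G ` A) \<inter> space M = A"
      using AS inj_on_image_mem_iff[OF Ginj _ AS] by blast
    have "\<exists>K. K \<subseteq> G ` A \<and> compact K \<and> measure M A - 1 / Suc n < measure M (G -` K \<inter> space M)"
    \<comment> \<open>\<open>ennreal\<close> truncates negative numbers, so a negative bound is
      treated apart, with the empty compact set.\<close>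
    proof (cases "measure M A - 1 / Suc n < 0")
      case True
      then show ?thesis using measure_nonneg[of M "G -` {} \<inter> space M"] by (intro exI[of _ "{}"]) auto
    next
      case False
      have "ennreal (measure M A - 1 / Suc n) < emeasure N (G ` A)"
        using NK[OF GB[OF A(1)]] GA False by (simp add: ennreal_less_iff)
      then obtain K where K: "K \<subseteq> G ` A" "compact K" "ennreal (measure M A - 1 / Suc n) < emeasure N K"
        unfolding reg less_SUP_iff by blast
      have "ennreal (measure M A - 1 / Suc n) < ennreal (measure M (G -` K \<inter> space M))"
        using K(3) NK[OF borel_compact[OF K(2)]] by simp
      then have "measure M A - 1 / Suc n < measure M (G -` K \<inter> space M)"
        using False by (simp only: ennreal_less_iff not_less)
      then show ?thesis using K(1,2) by blast
    qed
    then obtain K where "K \<subseteq> G ` A" "compact K" "measure M A - 1 / Suc n < measure M (G -` K \<inter> space M)"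
      by blast
    then show ?thesis by (intro exI[of _ K]) simp
  qed
  then have "\<forall>n. \<exists>K. compact K \<and> K \<subseteq> G ` A \<and> measure M A < measure M (G -` K \<inter> space M) + 1 / Suc n" by blast
  from choice[OF this] obtain K where K: "\<And>n. compact (K n)" "\<And>n. K n \<subseteq> G ` A"
    "\<And>n. measure M A < measure M (G -` K n \<inter> space M) + 1 / Suc n" by blast
  define L where "L n = G -` K n \<inter> space M" for n
  have L: "L n \<in> sets M" "L n \<subseteq> A" for n
  proof -
    show "L n \<in> sets M" unfolding L_def using Gm borel_compact[OF K(1)] by (rule measurable_sets)
    show "L n \<subseteq> A"
    proof
      fix x assume "x \<in> L n"
      then obtain y where "y \<in> A" "G x = G y" "x \<in> space M" using K(2)[of n] by (auto simp: L_def)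
      then show "x \<in> A" using Ginj AS by (auto simp: inj_on_def)
    qed
  qed
  show ?thesis
  proof
    show A0: "(\<Union>n. L n) \<in> sets M" "(\<Union>n. L n) \<subseteq> A" using L by auto
    show "measure M (A - (\<Union>n. L n)) = 0"
    proof -
      have "measure M (A - (\<Union>n. L n)) \<le> 1 / Suc n" for n
      proof -
        have "measure M (A - (\<Union>n. L n)) \<le> measure M (A - L n)"
          using A(1) A0 L by (intro finite_measure_mono) auto
        also have "\<dots> = measure M A - measure M (L n)"
          using A(1) L by (intro finite_measure_Diff) auto
        also have "\<dots> \<le> 1 / Suc n" using K(3)[of n] by (simp add: L_def)
        finally show ?thesis .
      qed
      then have "measure M (A - (\<Union>n. L n)) \<le> 0"
        by (intro LIMSEQ_le_const[OF LIMSEQ_Suc[OF lim_1_over_n]]) auto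
      then show ?thesis by (simp add: measure_le_0_iff)
    qed
    fix B assume B: "B \<in> sets M" "B \<subseteq> (\<Union>n. L n)"
    \<comment> \<open>The part of \<open>B\<close> in \<open>L n\<close> is seen inside the compact
      set \<open>K n\<close>, on which the second projection is continuous, and injective because
      \<open>h\<close> is injective on \<open>A\<close>.\<close>
    have "h ` B = (\<Union>n. snd ` (G ` B \<inter> K n))"
    proof
      show "h ` B \<subseteq> (\<Union>n. snd ` (G ` B \<inter> K n))"
      proof
        fix t assume "t \<in> h ` B"
        then obtain x n where x: "x \<in> B" "t = h x" "x \<in> L n" using B(2) by blast
        then have "G x \<in> G ` B \<inter> K n" "t = snd (G x)" by (auto simp: L_def G_def)
        then show "t \<in> (\<Union>n. snd ` (G ` B \<inter> K n))" by blast
      qed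
    qed (auto simp: G_def)
    also have "\<dots> \<in> sets borel"
    proof (intro sets.countable_UN image_subsetI)
      fix n
      have "inj_on snd (K n)"
      proof (rule inj_onI)
        fix p q assume pq: "p \<in> K n" "q \<in> K n" "snd p = snd q"
        then obtain x y where "x \<in> A" "y \<in> A" "p = G x" "q = G y" using K(2)[of n] by blast
        then show "p = q" using pq(3) inj_onD[OF A(2), of x y] by (simp add: G_def)
      qed
      then show "snd ` (G ` B \<inter> K n) \<in> sets borel"
        using K(1) GB[OF B(1)] by (intro borel_inj_image_compact continuous_on_snd continuous_on_id)
    qed
    finally show "h ` B \<in> sets borel" .
  qed
qed

end

section \<open>Atomless laws on the line and their distribution functions\<close>

lemma standard_atomless_singleton:
  assumes "atomless M" "finite_measure M" "{x} \<in> sets M"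
  shows "measure M {x} = 0"
proof (rule ccontr)
  interpret finite_measure M by fact
  assume "measure M {x} \<noteq> 0"
  then have "0 < emeasure M {x}" by (simp add: emeasure_eq_measure zero_less_measure_iff)
  then obtain B where "B \<in> sets M" "B \<subseteq> {x}" "0 < emeasure M B" "emeasure M B < emeasure M {x}"
    using assms unfolding atomless_def by blast
  then show False by (cases "B = {}") (auto simp: subset_singleton_iff)
qed

text \<open>Without atoms the distribution function is continuous, so for a level strictly between 0
  and the total mass the sublevel set is a half line at whose end the level is attained. At level 0
  the set may be empty; there the bound comes from small positive levels.\<close>

lemma (in finite_borel_measure) measure_cdf_le:
  assumes atom: "\<And>x. measure M {x} = 0" and t: "0 \<le> t" "t \<le> measure M (space M)"
  shows "measure M {s. cdf M s \<le> t} = t"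
proof -
  let ?b = "measure M (space M)" and ?F = "cdf M"
  have cont: "isCont ?F s" for s using atom by (simp add: isCont_cdf)
  then have contS: "continuous_on S ?F" for S by (simp add: continuous_at_imp_continuous_on)
  have mono: "s \<le> s' \<Longrightarrow> ?F s \<le> ?F s'" for s s' by (rule cdf_nondecreasing)
  have meas [measurable]: "?F \<in> borel_measurable borel"
    using contS by (rule borel_measurable_continuous_onI)
  have inner: "measure M {s. ?F s \<le> t} = t" if t: "0 < t" "t < ?b" for t
  proof -
    obtain s1 where s1: "?F s1 < t"
      using order_tendstoD(2)[OF cdf_lim_at_bot t(1)] eventually_happens'[OF trivial_limit_at_bot_linorder] by blast
    obtain s2 where s2: "t < ?F s2"
      using order_tendstoD(1)[OF cdf_lim_at_top t(2)] eventually_happens'[OF trivial_limit_at_top_linorder] by blast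
    have "s1 \<le> s2" using mono[of s2 s1] s1 s2 by linarith
    then obtain s0 where s0: "?F s0 = t"
      using IVT'[of ?F s1 t s2] s1 s2 contS by auto
    define D where "D = {s. ?F s \<le> t}"
    have D: "D \<noteq> {}" "bdd_above D"
    proof -
      show "D \<noteq> {}" using s0 by (auto simp: D_def)
      have "s \<le> s2" if "?F s \<le> t" for s
        using mono[of s2 s] s2 that by (cases "s \<le> s2") auto
      then show "bdd_above D" by (intro bdd_aboveI[of _ s2]) (simp add: D_def)
    qed
    have "closed D" unfolding D_def using contS by (intro closed_Collect_le) auto
    then have SD: "Sup D \<in> D" using D closed_contains_Sup by blast
    have "D = {..Sup D}"
    proof
      show "D \<subseteq> {..Sup D}" using D(2) by (auto intro: cSup_upper)
      show "{..Sup D} \<subseteq> D" using SD mono by (auto simp: D_def intro: order_trans)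
    qed
    moreover have "?F (Sup D) = t"
    proof (rule antisym)
      show "?F (Sup D) \<le> t" using SD by (simp add: D_def)
      have "s0 \<le> Sup D" using D(2) s0 by (intro cSup_upper) (auto simp: D_def)
      then show "t \<le> ?F (Sup D)" using mono s0 by metis
    qed
    ultimately have "measure M D = t" by (metis cdf_def)
    then show ?thesis by (simp only: D_def)
  qed
  consider "t = ?b" | "0 < t" "t < ?b" | "t = 0" "0 < ?b" using t by linarith
  then show ?thesis
  proof cases
    case 1
    then show ?thesis using cdf_bounded sets_eq_imp_space_eq[OF M_is_borel] by simp
  next
    case 2
    then show ?thesis by (rule inner)
  next
    case 3
    have "measure M {s. ?F s \<le> 0} \<le> 0 + e" if e: "0 < e" for e
    proof -
      define r where "r = min e (?b / 2)"
      have r: "0 < r" "r < ?b" "r \<le> e" using e 3 by (auto simp: r_def)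
      have "measure M {s. ?F s \<le> 0} \<le> measure M {s. ?F s \<le> r}"
        using r by (intro finite_measure_mono) auto
      then show ?thesis using inner[OF r(1,2)] r(3) by simp
    qed
    then have "measure M {s. ?F s \<le> 0} \<le> 0" by (rule field_le_epsilon)
    then show ?thesis using 3 by (simp add: measure_le_0_iff)
  qed
qed

section \<open>Isomorphisms modulo null sets\<close>

locale atomless_standard_measure = standard_measure +
  assumes atomless: "atomless M"
begin

text \<open>A real injection \<open>g\<close> has an atomless law on \<open>B\<close>, and composing
  it with the distribution function of that law gives the uniform law on the interval from 0 to the
  measure of \<open>B\<close>. Injectivity is lost only where the distribution function is constant,
  and such stretches carry no mass.\<close>

lemma uniform_coordinate:
  assumes B: "B \<in> sets M"
  obtains h :: "'a \<Rightarrow> real" and A where "h \<in> borel_measurable M" "A \<in> sets M" "A \<subseteq> B"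
    "measure M (B - A) = 0" "inj_on h A"
    "\<And>t. measure M {x \<in> B. h x \<le> t} = max 0 (min t (measure M B))"
proof -
  obtain g :: "'a \<Rightarrow> real" where g [measurable]: "g \<in> borel_measurable M" and ginj: "inj_on g (space M)"
    using standard_borel_injection[OF standard] by blast
  have BS: "B \<subseteq> space M" using B sets.sets_into_space by auto
  have level0: "measure M {x \<in> space M. g x = c} = 0" for c
  proof (cases "\<exists>x\<in>space M. g x = c")
    case True
    then obtain x where x: "x \<in> space M" "g x = c" by blast
    then have eq: "{x \<in> space M. g x = c} = {x}" using ginj by (auto simp: inj_on_def)
    have "{x \<in> space M. g x = c} \<in> sets M" by measurable
    then show ?thesis
      using standard_atomless_singleton[OF atomless finite_measure_axioms] by (simp add: eq)
  next
    case False
    then have e: "{x \<in> space M. g x = c} = {}" by auto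
    show ?thesis by (simp only: e measure_empty)
  qed
  define N where "N = distr (restrict_space M B) borel g"
  have gB: "g \<in> restrict_space M B \<rightarrow>\<^sub>M borel" by (rule measurable_restrict_space1) measurable
  have N: "measure N D = measure M {x \<in> B. g x \<in> D}" if "D \<in> sets borel" for D
  proof -
    have "measure N D = measure (restrict_space M B) (g -` D \<inter> B)"
      unfolding N_def using gB that BS by (simp add: measure_distr space_restrict_space Int_absorb2)
    also have "\<dots> = measure M (g -` D \<inter> B)"
      using B by (intro measure_restrict_space) auto
    also have "g -` D \<inter> B = {x \<in> B. g x \<in> D}" by auto
    finally show ?thesis .
  qed
  interpret R: finite_measure "restrict_space M B"
    using B by (intro finite_measure_restrict_space) (auto intro: finite_measure_axioms)
  interpret N: finite_borel_measure N
    using R.finite_measure_distr[OF gB] by (auto simp: N_def finite_borel_measure_def finite_borel_measure_axioms_def)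
  have Nb: "measure N (space N) = measure M B"
    using N[of UNIV] by (simp add: N_def)
  have Natom: "measure N {c} = 0" for c
  proof -
    have "measure N {c} \<le> measure M {x \<in> space M. g x = c}"
      using N[of "{c}"] BS by (auto intro!: finite_measure_mono)
    then show ?thesis using level0 by (simp add: measure_le_0_iff)
  qed
  define F where "F = cdf N"
  have Fmeas [measurable]: "F \<in> borel_measurable borel"
    unfolding F_def using Natom
    by (intro borel_measurable_continuous_onI continuous_at_imp_continuous_on ballI)
       (simp add: N.isCont_cdf)
  have Frange: "0 \<le> F s" "F s \<le> measure M B" for s
    unfolding F_def using N.cdf_nonneg N.cdf_bounded Nb by auto
  have Fmono: "s \<le> s' \<Longrightarrow> F s \<le> F s'" for s s' unfolding F_def by (rule N.cdf_nondecreasing)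
  have NF: "measure N {s. F s \<le> t} = t" if "0 \<le> t" "t \<le> measure M B" for t
    unfolding F_def using that by (intro N.measure_cdf_le Natom) (simp_all add: Nb)
  have dist: "measure M {x \<in> B. F (g x) \<le> t} = max 0 (min t (measure M B))" for t
  proof -
    consider "t < 0" | "0 \<le> t" "t \<le> measure M B" | "measure M B < t" by linarith
    then show ?thesis
    proof cases
      case 1
      then have "\<not> F (g x) \<le> t" for x using Frange(1)[of "g x"] by linarith
      then show ?thesis using 1 by simp
    next
      case 2
      have "{s. F s \<le> t} \<in> sets borel" by measurable
      from N[OF this] NF[OF 2] 2 show ?thesis by simp
    next
      case 3
      then have "{x \<in> B. F (g x) \<le> t} = B" using Frange(2) by (force intro: order_trans)
      then show ?thesis using 3 by simp
    qed
  qed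
  have Nlevel: "measure N {s. F s = c} = 0" if c: "0 \<le> c" "c \<le> measure M B" for c
  proof (rule ccontr)
    define m where "m = measure N {s. F s = c}"
    assume "measure N {s. F s = c} \<noteq> 0"
    then have m: "0 < m" by (simp add: m_def zero_less_measure_iff)
    have S: "{s. F s \<le> t} \<in> sets N" "{s. F s = t} \<in> sets N" for t
      by (intro N.sets_M; measurable)+
    have "m \<le> c"
      using N.finite_measure_mono[of "{s. F s = c}" "{s. F s \<le> c}"] NF[OF c] S by (auto simp: m_def)
    \<comment> \<open>Half of the supposed mass: the sublevel sets at \<open>c - m / 2\<close> and
      at \<open>c\<close> differ in measure by \<open>m / 2\<close>, although a level set of mass
      \<open>m\<close> lies between them.\<close>
    then have "measure N {s. F s \<le> c - m / 2} = c - m / 2" using c m by (intro NF) auto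
    moreover have "m + measure N {s. F s \<le> c - m / 2} \<le> measure N {s. F s \<le> c}"
    proof -
      have "m + measure N {s. F s \<le> c - m / 2} = measure N ({s. F s = c} \<union> {s. F s \<le> c - m / 2})"
        unfolding m_def[symmetric] using m S by (subst N.finite_measure_Union) (auto simp: m_def)
      also have "\<dots> \<le> measure N {s. F s \<le> c}"
        using m S by (intro N.finite_measure_mono) auto
      finally show ?thesis .
    qed
    ultimately show False using NF[OF c] m by simp
  qed
  \<comment> \<open>Two points with \<open>g x < g y\<close> and equal values have a rational
    between them, at which the value is the same. Hence it is enough to remove countably many null
    level sets.\<close>
  define Q where "Q = (\<Union>q::rat. {s. F s = F (of_rat q)})"
  have Q [measurable]: "Q \<in> sets borel" unfolding Q_def by measurable
  have "measure N Q = 0"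
  proof -
    have "{s. F s = F (of_rat q)} \<in> null_sets N" for q :: rat
      using Nlevel[OF Frange] by (intro null_setsI N.sets_M) (auto simp: N.emeasure_eq_measure)
    then have "Q \<in> null_sets N" unfolding Q_def by (intro null_sets_UN) auto
    then show ?thesis by (rule measure_eq_0_null_sets)
  qed
  define A where "A = {x \<in> B. g x \<notin> Q}"
  show ?thesis
  proof
    show "(\<lambda>x. F (g x)) \<in> borel_measurable M" by measurable
    have "A = B \<inter> {x \<in> space M. g x \<notin> Q}" using BS by (auto simp: A_def)
    also have "\<dots> \<in> sets M" using B by measurable
    finally show "A \<in> sets M" .
    show "A \<subseteq> B" by (auto simp: A_def)
    have "B - A = {x \<in> B. g x \<in> Q}" by (auto simp: A_def)
    then show "measure M (B - A) = 0" using N[OF Q] \<open>measure N Q = 0\<close> by simp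
    show "measure M {x \<in> B. F (g x) \<le> t} = max 0 (min t (measure M B))" for t by (rule dist)
    have less: False if xy: "x \<in> A" "y \<in> A" "F (g x) = F (g y)" "g x < g y" for x y
    proof -
      obtain q where q: "g x < of_rat q" "of_rat q < g y" using of_rat_dense xy(4) by blast
      then have "F (g x) = F (of_rat q)"
        using Fmono[of "g x" "of_rat q"] Fmono[of "of_rat q" "g y"] xy(3) by linarith
      then show False using xy(1) by (auto simp: A_def Q_def)
    qed
    show "inj_on (\<lambda>x. F (g x)) A"
    proof (rule inj_onI)
      fix x y assume xy: "x \<in> A" "y \<in> A" "F (g x) = F (g y)"
      have "g x = g y" using less[of x y] less[of y x] xy by (metis linorder_neqE_linordered_idom)
      then show "x = y" using inj_onD[OF ginj, of x y] xy BS by (auto simp: A_def)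
    qed
  qed
qed

text \<open>Sets of equal measure have the same uniform law under their coordinates, so matching
  points with equal coordinate preserves measure. Null sets are discarded until both coordinates are
  injective, have Borel images of measurable sets and take the same values.\<close>

lemma mod_null_isomorphism:
  assumes B: "B \<in> sets M" and C: "C \<in> sets M" and eq: "measure M B = measure M C"
  obtains f B1 C1 where "B1 \<in> sets M" "C1 \<in> sets M" "B1 \<subseteq> B" "C1 \<subseteq> C"
    "measure M (B - B1) = 0" "measure M (C - C1) = 0" "bij_betw f B1 C1"
    "\<And>A. A \<in> sets M \<Longrightarrow> A \<subseteq> B1 \<Longrightarrow> f ` A \<in> sets M"
    "\<And>A. A \<in> sets M \<Longrightarrow> A \<subseteq> B1 \<Longrightarrow> measure M (f ` A) = measure M A"
    "\<And>A. A \<in> sets M \<Longrightarrow> A \<subseteq> C1 \<Longrightarrow> {x \<in> B1. f x \<in> A} \<in> sets M"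
proof -
  have ex: "\<exists>h A. h \<in> borel_measurable M \<and> A \<in> sets M \<and> A \<subseteq> Y \<and> measure M (Y - A) = 0 \<and> inj_on h A \<and>
      (\<forall>t. measure M {x \<in> Y. h x \<le> t} = max 0 (min t (measure M Y))) \<and>
      (\<forall>D\<in>sets M. D \<subseteq> A \<longrightarrow> h ` D \<in> sets borel)" if Y: "Y \<in> sets M" for Y
  proof -
    obtain h :: "'a \<Rightarrow> real" and A where h: "h \<in> borel_measurable M" "A \<in> sets M" "A \<subseteq> Y"
      "measure M (Y - A) = 0" "inj_on h A" "\<And>t. measure M {x \<in> Y. h x \<le> t} = max 0 (min t (measure M Y))"
      by (rule uniform_coordinate[OF Y]) (rule that)
    obtain A0 where A0: "A0 \<in> sets M" "A0 \<subseteq> A" "measure M (A - A0) = 0"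
      "\<And>D. D \<in> sets M \<Longrightarrow> D \<subseteq> A0 \<Longrightarrow> h ` D \<in> sets borel"
      by (rule injective_images_borel[OF h(1,2,5)]) (rule that)
    have "Y - A0 = (Y - A) \<union> (A - A0)" using h(3) A0(2) by auto
    then have "measure M (Y - A0) \<le> measure M (Y - A) + measure M (A - A0)"
      using Y h(2) A0(1) by (simp add: measure_Un_le)
    then have "measure M (Y - A0) = 0" using h(4) A0(3) by (simp add: measure_le_0_iff)
    then show ?thesis
      using h(1,6) A0 inj_on_subset[OF h(5) A0(2)] h(3) by (intro exI[of _ h] exI[of _ A0]) auto
  qed
  from ex[OF B] obtain hB B0 where hB': "hB \<in> borel_measurable M \<and> B0 \<in> sets M \<and> B0 \<subseteq> B \<and>
      measure M (B - B0) = 0 \<and> inj_on hB B0 \<and>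
      (\<forall>t. measure M {x \<in> B. hB x \<le> t} = max 0 (min t (measure M B))) \<and>
      (\<forall>D\<in>sets M. D \<subseteq> B0 \<longrightarrow> hB ` D \<in> sets borel)"
    by (elim exE) (rule that)
  have hB: "hB \<in> borel_measurable M" "B0 \<in> sets M" "B0 \<subseteq> B" "measure M (B - B0) = 0"
    "inj_on hB B0" "\<And>t. measure M {x \<in> B. hB x \<le> t} = max 0 (min t (measure M B))"
    "\<And>D. D \<in> sets M \<Longrightarrow> D \<subseteq> B0 \<Longrightarrow> hB ` D \<in> sets (borel :: real measure)"
    using hB' by blast+
  from ex[OF C] obtain hC C0 where hC': "hC \<in> borel_measurable M \<and> C0 \<in> sets M \<and> C0 \<subseteq> C \<and>
      measure M (C - C0) = 0 \<and> inj_on hC C0 \<and>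
      (\<forall>t. measure M {x \<in> C. hC x \<le> t} = max 0 (min t (measure M C))) \<and>
      (\<forall>D\<in>sets M. D \<subseteq> C0 \<longrightarrow> hC ` D \<in> sets borel)"
    by (elim exE) (rule that)
  have hC: "hC \<in> borel_measurable M" "C0 \<in> sets M" "C0 \<subseteq> C" "measure M (C - C0) = 0"
    "inj_on hC C0" "\<And>t. measure M {x \<in> C. hC x \<le> t} = max 0 (min t (measure M C))"
    "\<And>D. D \<in> sets M \<Longrightarrow> D \<subseteq> C0 \<Longrightarrow> hC ` D \<in> sets (borel :: real measure)"
    using hC' by blast+
  note hB(1)[measurable] hC(1)[measurable]
  have restr: "{x \<in> Y. h x \<in> D} \<in> sets M" if "Y \<in> sets M" "h \<in> borel_measurable M" "D \<in> sets borel"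
    for Y D and h :: "'a \<Rightarrow> real"
  proof -
    have "{x \<in> Y. h x \<in> D} = Y \<inter> (h -` D \<inter> space M)" using sets.sets_into_space[OF that(1)] by auto
    then show ?thesis using that measurable_sets by (metis sets.Int)
  qed
  have law: "emeasure (distr (restrict_space M Y) borel h) D = ennreal (measure M {x \<in> Y. h x \<in> D})"
    if "Y \<in> sets M" "h \<in> borel_measurable M" "D \<in> sets borel" for Y D and h :: "'a \<Rightarrow> real"
  proof -
    have YS: "Y \<subseteq> space M" using that(1) sets.sets_into_space by auto
    have "emeasure (distr (restrict_space M Y) borel h) D = emeasure (restrict_space M Y) (h -` D \<inter> Y)"
      using that(3) measurable_restrict_space1[OF that(2)] YS
      by (simp add: emeasure_distr space_restrict_space Int_absorb2)
    also have "\<dots> = emeasure M (h -` D \<inter> Y)" using that(1) by (intro emeasure_restrict_space) auto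
    also have "h -` D \<inter> Y = {x \<in> Y. h x \<in> D}" by auto
    finally show ?thesis by (simp add: emeasure_eq_measure)
  qed
  \<comment> \<open>Laws on the line are compared on open upper half lines, hence the complementary
    form of the distribution.\<close>
  have tail: "measure M {x \<in> Y. h x \<in> {t<..}} = measure M Y - max 0 (min t (measure M Y))"
    if "Y \<in> sets M" "h \<in> borel_measurable M" "\<And>t. measure M {x \<in> Y. h x \<le> t} = max 0 (min t (measure M Y))"
    for Y t and h :: "'a \<Rightarrow> real"
  proof -
    have "{x \<in> Y. h x \<in> {t<..}} = Y - {x \<in> Y. h x \<in> {..t}}" by auto
    then show ?thesis
      using finite_measure_Diff[OF that(1) restr[OF that(1,2), of "{..t}"]] that(3)[of t] by auto
  qed
  have "distr (restrict_space M B) borel hB = distr (restrict_space M C) borel hC"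
    by (rule measure_eqI_lessThan)
       (simp_all add: law[OF B hB(1)] law[OF C hC(1)] tail[OF B hB(1,6)] tail[OF C hC(1,6)] eq del: greaterThan_iff)
  then have same: "measure M {x \<in> B. hB x \<in> D} = measure M {x \<in> C. hC x \<in> D}" if "D \<in> sets borel" for D
    using law[OF B hB(1) that] law[OF C hC(1) that] by simp
  \<comment> \<open>Restricting to the common values \<open>D\<close> costs only null sets: values
    missed by \<open>hB\<close> on \<open>B0\<close> are null for its law, those missed by
    \<open>hC\<close> on \<open>C0\<close> are null for the law of \<open>hC\<close>, and the two
    laws agree.\<close>
  define D where "D = hB ` B0 \<inter> hC ` C0"
  have D: "hB ` B0 \<in> sets borel" "hC ` C0 \<in> sets borel" "D \<in> sets borel"
    using hB(7)[OF hB(2)] hC(7)[OF hC(2)] by (auto simp: D_def)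
  define B1 where "B1 = {x \<in> B0. hB x \<in> D}"
  define C1 where "C1 = {x \<in> C0. hC x \<in> D}"
  define f where "f x = inv_into C1 hC (hB x)" for x
  have B1: "B1 \<in> sets M" "B1 \<subseteq> B" unfolding B1_def using restr hB D by auto
  have C1: "C1 \<in> sets M" "C1 \<subseteq> C" unfolding C1_def using restr hC D by auto
  have injB: "inj_on hB B1" using hB(5) by (rule inj_on_subset) (auto simp: B1_def)
  have injC: "inj_on hC C1" using hC(5) by (rule inj_on_subset) (auto simp: C1_def)
  have imB: "hB ` B1 = D" and imC: "hC ` C1 = D"
  proof -
    have im: "h ` {x \<in> Y. h x \<in> D} = D" if "D \<subseteq> h ` Y" for h :: "'a \<Rightarrow> real" and Y using that by blast
    show "hB ` B1 = D" "hC ` C1 = D"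
      unfolding B1_def C1_def by (intro im; simp add: D_def)+
  qed
  have f: "f x \<in> C1" "hC (f x) = hB x" if "x \<in> B1" for x
    using that imB imC inv_into_into[of "hB x" hC C1] f_inv_into_f[of "hB x" hC C1] by (auto simp: f_def)
  have fimage: "f ` A = {y \<in> C1. hC y \<in> hB ` A}" if "A \<subseteq> B1" for A
  proof
    show "f ` A \<subseteq> {y \<in> C1. hC y \<in> hB ` A}" using f that by auto
    show "{y \<in> C1. hC y \<in> hB ` A} \<subseteq> f ` A"
    proof
      fix y assume "y \<in> {y \<in> C1. hC y \<in> hB ` A}"
      then obtain x where x: "x \<in> A" "y \<in> C1" "hC y = hB x" by auto
      then have "f x = y" using f[of x] that inj_onD[OF injC, of "f x" y] by auto
      then show "y \<in> f ` A" using x(1) by auto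
    qed
  qed
  have null: "measure M (Y - {x \<in> Y0. h x \<in> D}) = 0"
    if Y: "Y \<in> sets M" "Y0 \<in> sets M" "Y0 \<subseteq> Y" "measure M (Y - Y0) = 0" "h \<in> borel_measurable M"
      "measure M {x \<in> Y. h x \<in> - D} = 0" for Y Y0 and h :: "'a \<Rightarrow> real"
  proof -
    have "measure M (Y - {x \<in> Y0. h x \<in> D}) \<le> measure M ((Y - Y0) \<union> {x \<in> Y. h x \<in> - D})"
      using Y D(3) restr[OF Y(1,5), of "- D"] by (intro finite_measure_mono) auto
    also have "\<dots> \<le> measure M (Y - Y0) + measure M {x \<in> Y. h x \<in> - D}"
      using Y D(3) restr[OF Y(1,5), of "- D"] by (intro measure_Un_le) auto
    finally show ?thesis using Y by (simp add: measure_le_0_iff)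
  qed
  have outB: "measure M {x \<in> B. hB x \<in> - hB ` B0} = 0"
    using finite_measure_mono[of "{x \<in> B. hB x \<in> - hB ` B0}" "B - B0"] hB B by (auto simp: measure_le_0_iff)
  have outC: "measure M {x \<in> C. hC x \<in> - hC ` C0} = 0"
    using finite_measure_mono[of "{x \<in> C. hC x \<in> - hC ` C0}" "C - C0"] hC C by (auto simp: measure_le_0_iff)
  have nullB: "measure M {x \<in> B. hB x \<in> - D} = 0"
  proof -
    have "{x \<in> B. hB x \<in> - D} = {x \<in> B. hB x \<in> - hB ` B0} \<union> {x \<in> B. hB x \<in> - hC ` C0}"
      by (auto simp: D_def)
    then have "measure M {x \<in> B. hB x \<in> - D} \<le>
        measure M {x \<in> B. hB x \<in> - hB ` B0} + measure M {x \<in> B. hB x \<in> - hC ` C0}"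
      using restr[OF B hB(1)] D by (simp only: measure_Un_le borel_comp)
    also have "\<dots> = 0" using outB outC same[of "- hC ` C0"] D by simp
    finally show ?thesis by (simp add: measure_le_0_iff)
  qed
  have nullC: "measure M {x \<in> C. hC x \<in> - D} = 0"
    using nullB same[of "- D"] D by simp
  show ?thesis
  proof
    show "B1 \<in> sets M" "C1 \<in> sets M" "B1 \<subseteq> B" "C1 \<subseteq> C" using B1 C1 by auto
    show "measure M (B - B1) = 0" unfolding B1_def using B hB nullB by (intro null) auto
    show "measure M (C - C1) = 0" unfolding C1_def using C hC nullC by (intro null) auto
    show "bij_betw f B1 C1"
    proof (rule bij_betw_imageI)
      show "inj_on f B1" using f injB by (metis inj_onD inj_onI)
      show "f ` B1 = C1" using fimage[of B1] imB imC by auto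
    qed
    fix A assume A: "A \<in> sets M" "A \<subseteq> B1"
    have hA: "hB ` A \<in> sets borel" using A B1 by (intro hB(7)) (auto simp: B1_def)
    then show "f ` A \<in> sets M"
      unfolding fimage[OF A(2)] using restr[OF C1(1) hC(1)] by simp
    have eqA: "{x \<in> B1. hB x \<in> hB ` A} = A" using A(2) injB by (auto simp: inj_on_def)
    have *: "measure M {x \<in> Y. h x \<in> E} = measure M {x \<in> Y1. h x \<in> E}"
      if Y: "Y \<in> sets M" "Y1 \<in> sets M" "Y1 \<subseteq> Y" "measure M (Y - Y1) = 0" "h \<in> borel_measurable M" "E \<in> sets borel"
      for Y Y1 E and h :: "'a \<Rightarrow> real"
    proof (rule antisym)
      have "measure M {x \<in> Y. h x \<in> E} \<le> measure M ({x \<in> Y1. h x \<in> E} \<union> (Y - Y1))"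
        using Y restr by (intro finite_measure_mono) auto
      also have "\<dots> \<le> measure M {x \<in> Y1. h x \<in> E} + measure M (Y - Y1)"
        using Y restr by (intro measure_Un_le) auto
      finally show "measure M {x \<in> Y. h x \<in> E} \<le> measure M {x \<in> Y1. h x \<in> E}" using Y by simp
      show "measure M {x \<in> Y1. h x \<in> E} \<le> measure M {x \<in> Y. h x \<in> E}"
        using Y restr by (intro finite_measure_mono) auto
    qed
    have "measure M (f ` A) = measure M {x \<in> C. hC x \<in> hB ` A}"
      unfolding fimage[OF A(2)]
      using *[OF C C1 \<open>measure M (C - C1) = 0\<close> hC(1) hA] by simp
    also have "\<dots> = measure M A"
      using *[OF B B1 \<open>measure M (B - B1) = 0\<close> hB(1) hA] same[OF hA] eqA by simp
    finally show "measure M (f ` A) = measure M A" .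
  next
    fix A assume A: "A \<in> sets M" "A \<subseteq> C1"
    have "f x \<in> A \<longleftrightarrow> hB x \<in> hC ` A" if "x \<in> B1" for x
      using f[OF that] inj_on_image_mem_iff[OF injC, of "f x" A] A(2) by simp
    then have "{x \<in> B1. f x \<in> A} = {x \<in> B1. hB x \<in> hC ` A}" by auto
    moreover have "hC ` A \<in> sets borel" using A by (intro hC(7)) (auto simp: C1_def)
    ultimately show "{x \<in> B1. f x \<in> A} \<in> sets M" using restr[OF B1(1) hB(1)] by simp
  qed
qed

end

lemma (in finite_measure) mp_transformationsI:
  assumes bij: "bij_betw z (space M) (space M)"
    and im: "\<And>A. A \<in> sets M \<Longrightarrow> z ` A \<in> sets M"
    and eq: "\<And>A. A \<in> sets M \<Longrightarrow> measure M (z ` A) = measure M A"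
    and pre: "\<And>A. A \<in> sets M \<Longrightarrow> z -` A \<inter> space M \<in> sets M"
  shows "z \<in> mp_transformations M"
proof -
  have z: "z \<in> M \<rightarrow>\<^sub>M M"
    using bij pre by (intro measurableI) (auto simp: bij_betw_def)
  have inv: "inv_into (space M) z \<in> M \<rightarrow>\<^sub>M M"
  proof (rule measurableI)
    show "x \<in> space M \<Longrightarrow> inv_into (space M) z x \<in> space M" for x
      using bij inv_into_into[of x z "space M"] by (simp add: bij_betw_def)
    fix A assume A: "A \<in> sets M"
    have AS: "A \<subseteq> space M" using A sets.sets_into_space by auto
    have "inv_into (space M) z -` A \<inter> space M = z ` A"
    proof
      show "inv_into (space M) z -` A \<inter> space M \<subseteq> z ` A"
      proof
        fix y assume y: "y \<in> inv_into (space M) z -` A \<inter> space M"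
        then have "z (inv_into (space M) z y) = y" using bij f_inv_into_f[of y z] by (simp add: bij_betw_def)
        then show "y \<in> z ` A" using y by (metis IntD1 image_eqI vimageE)
      qed
      show "z ` A \<subseteq> inv_into (space M) z -` A \<inter> space M"
      proof
        fix y assume "y \<in> z ` A"
        then obtain x where x: "x \<in> A" "y = z x" "x \<in> space M" using AS by blast
        then have "inv_into (space M) z y = x" "y \<in> space M"
          using bij inv_into_f_f[of z "space M" x] by (auto simp: bij_betw_def)
        then show "y \<in> inv_into (space M) z -` A \<inter> space M" using x by simp
      qed
    qed
    then show "inv_into (space M) z -` A \<inter> space M \<in> sets M" using im[OF A] by simp
  qed
  have "distr M M z = M"
  proof (rule measure_eqI)
    fix A assume A: "A \<in> sets (distr M M z)"
    then have AS: "A \<subseteq> space M" using sets.sets_into_space[of A M] by auto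
    have zS: "z ` space M = space M" using bij by (simp add: bij_betw_def)
    have "z ` (z -` A \<inter> space M) = A"
    proof
      show "A \<subseteq> z ` (z -` A \<inter> space M)"
      proof
        fix a assume a: "a \<in> A"
        then have "a \<in> z ` space M" using AS zS by auto
        then obtain x where "x \<in> space M" "a = z x" by (rule imageE)
        then show "a \<in> z ` (z -` A \<inter> space M)" using a by auto
      qed
    qed auto
    then have "measure M (z -` A \<inter> space M) = measure M A"
      using eq[OF pre[of A]] A by simp
    then show "emeasure (distr M M z) A = emeasure M A"
      using A z by (simp add: emeasure_distr emeasure_eq_measure)
  qed simp
  then show ?thesis using z inv bij by (simp add: mp_transformations_def)
qed

text \<open>
  An automorphism up to null sets is a bijection of the intersection of all its forward and
  backward images of the common domain; outside this conull set it is replaced by the identity.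
\<close>

lemma (in finite_measure) mp_transformation_from_mod_null:
  assumes B0: "B0 \<in> sets M" "measure M B0 = measure M (space M)"
    and C0: "C0 \<in> sets M" "measure M C0 = measure M (space M)"
    and bij: "bij_betw z0 B0 C0"
    and im: "\<And>A. A \<in> sets M \<Longrightarrow> A \<subseteq> B0 \<Longrightarrow> z0 ` A \<in> sets M"
    and eq: "\<And>A. A \<in> sets M \<Longrightarrow> A \<subseteq> B0 \<Longrightarrow> measure M (z0 ` A) = measure M A"
    and pre: "\<And>A. A \<in> sets M \<Longrightarrow> A \<subseteq> C0 \<Longrightarrow> {x \<in> B0. z0 x \<in> A} \<in> sets M"
  obtains z D where "z \<in> mp_transformations M" "D \<in> sets M" "D \<subseteq> B0"
    "measure M D = measure M (space M)" "\<And>x. x \<in> D \<Longrightarrow> z x = z0 x"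
proof -
  \<comment> \<open>Both descriptions of a conull set are used: a null complement for intersections,
    and full measure for images and preimages under \<open>z0\<close>.\<close>
  define full where "full X \<longleftrightarrow> X \<in> sets M \<and> measure M (space M - X) = 0" for X
  have full: "full X \<longleftrightarrow> X \<in> sets M \<and> measure M X = measure M (space M)" for X
    using finite_measure_compl[of X] by (auto simp: full_def)
  have fullI: "full (X \<inter> Y)" if "full X" "full Y" for X Y
  proof -
    have "space M - X \<inter> Y = (space M - X) \<union> (space M - Y)" by auto
    then have "measure M (space M - X \<inter> Y) \<le> measure M (space M - X) + measure M (space M - Y)"
      using that by (metis full_def measure_Un_le sets.compl_sets)
    then show ?thesis using that by (auto simp: full_def measure_le_0_iff)
  qed
  define D where "D n = ((\<lambda>X. X \<inter> z0 ` X \<inter> {x \<in> B0. z0 x \<in> X}) ^^ n) (B0 \<inter> C0)" for n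
  have D0: "D 0 = B0 \<inter> C0" by (simp add: D_def)
  have DSuc: "D (Suc n) = D n \<inter> z0 ` D n \<inter> {x \<in> B0. z0 x \<in> D n}" for n by (simp add: D_def)
  have D: "full (D n) \<and> D n \<subseteq> B0 \<inter> C0" for n
  proof (induction n)
    case 0
    then show ?case unfolding D0 using B0 C0 by (intro conjI fullI) (auto simp: full)
  next
    case (Suc n)
    let ?P = "{x \<in> B0. z0 x \<in> D n}"
    have Dn: "D n \<in> sets M" "D n \<subseteq> B0" "D n \<subseteq> C0" "measure M (D n) = measure M (space M)"
      using Suc by (auto simp: full)
    have "full (z0 ` D n)" using im[OF Dn(1,2)] eq[OF Dn(1,2)] Dn(4) by (simp add: full)
    moreover have "full ?P"
    proof -
      have P: "?P \<in> sets M" "?P \<subseteq> B0" using pre[OF Dn(1,3)] by auto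
      have "z0 ` ?P = D n" using bij Dn(3) by (auto simp: bij_betw_def)
      then show ?thesis using eq[OF P] P Dn(4) by (simp add: full)
    qed
    ultimately show ?case unfolding DSuc using Suc by (intro conjI fullI) auto
  qed
  define E where "E = (\<Inter>n. D n)"
  have Es: "E \<in> sets M" unfolding E_def using D by (auto simp: full)
  have EB: "E \<subseteq> B0" "E \<subseteq> C0" unfolding E_def using D[of 0] by auto
  have "measure M (space M - E) = 0"
  proof -
    have "space M - D n \<in> null_sets M" for n
      using D[of n] by (intro null_setsI) (auto simp: full_def emeasure_eq_measure)
    then have "(\<Union>n. space M - D n) \<in> null_sets M" by (rule null_sets_UN)
    moreover have "space M - E = (\<Union>n. space M - D n)" by (auto simp: E_def)
    ultimately show ?thesis by (simp add: measure_eq_0_null_sets)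
  qed
  then have Efull: "measure M E = measure M (space M)" using Es full full_def by blast
  have inj: "inj_on z0 B0" using bij by (simp add: bij_betw_def)
  have zE: "z0 ` E = E"
  proof
    show "z0 ` E \<subseteq> E"
    proof
      fix y assume "y \<in> z0 ` E"
      then obtain x where x: "y = z0 x" "x \<in> E" by auto
      then have "x \<in> D (Suc n)" for n by (auto simp: E_def)
      then show "y \<in> E" unfolding DSuc E_def x(1) by auto
    qed
    show "E \<subseteq> z0 ` E"
    proof
      fix y assume y: "y \<in> E"
      then have yD: "y \<in> z0 ` D n" for n using DSuc[of n] by (auto simp: E_def)
      from yD[of 0] obtain x where x: "y = z0 x" "x \<in> B0" by (auto simp: D0)
      \<comment> \<open>The preimages of \<open>y\<close> supplied by the different stages coincide,
        because \<open>z0\<close> is injective.\<close>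
      have "x \<in> D n" for n
      proof -
        obtain x' where x': "y = z0 x'" "x' \<in> D n" using yD[of n] by auto
        then have "x' = x" using inj_onD[OF inj, of x' x] x D[of n] by auto
        then show ?thesis using x' by simp
      qed
      then show "y \<in> z0 ` E" using x(1) by (auto simp: E_def)
    qed
  qed
  define z where "z x = (if x \<in> E then z0 x else x)" for x
  have ES: "E \<subseteq> space M" using Es sets.sets_into_space by auto
  have zim: "z ` A = z0 ` (A \<inter> E) \<union> (A - E)" for A by (auto simp: z_def image_iff)
  have "bij_betw z (space M) (space M)"
  proof -
    have "bij_betw z E E"
      using inj_on_subset[OF inj EB(1)] zE by (simp add: bij_betw_def z_def inj_on_def cong: image_cong)
    moreover have "bij_betw z (space M - E) (space M - E)"
      using bij_betw_cong[of "space M - E" z id] by (simp add: z_def)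
    ultimately have "bij_betw z (E \<union> (space M - E)) (E \<union> (space M - E))"
      by (rule bij_betw_combine) auto
    then show ?thesis using ES by (simp add: Un_absorb1)
  qed
  moreover have zA: "z ` A \<in> sets M" "measure M (z ` A) = measure M A" if A: "A \<in> sets M" for A
  proof -
    have AE: "A \<inter> E \<in> sets M" "A \<inter> E \<subseteq> B0" using A Es EB by auto
    show "z ` A \<in> sets M" unfolding zim using im[OF AE] A Es by auto
    have "z0 ` (A \<inter> E) \<inter> (A - E) = {}" using zE by auto
    then have "measure M (z ` A) = measure M (z0 ` (A \<inter> E)) + measure M (A - E)"
      unfolding zim using im[OF AE] A Es by (intro finite_measure_Union) auto
    also have "\<dots> = measure M ((A \<inter> E) \<union> (A - E))"
      unfolding eq[OF AE] using A Es by (intro finite_measure_Union[symmetric]) auto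
    also have "(A \<inter> E) \<union> (A - E) = A" by auto
    finally show "measure M (z ` A) = measure M A" .
  qed
  moreover have "z -` A \<inter> space M \<in> sets M" if A: "A \<in> sets M" for A
  proof -
    have "z -` A \<inter> space M = ({x \<in> B0. z0 x \<in> A \<inter> E} \<inter> E) \<union> (A - E)"
      using ES EB zE sets.sets_into_space[OF A] by (auto simp: z_def split: if_splits)
    then show ?thesis using pre[of "A \<inter> E"] A Es EB by auto
  qed
  ultimately have "z \<in> mp_transformations M" by (intro mp_transformationsI)
  then show ?thesis
    by (rule that[OF _ Es EB(1) Efull]) (simp add: z_def)
qed

section \<open>Automorphisms with prescribed behaviour on finite families of disjoint sets\<close>

context atomless_standard_measure
begin

text \<open>The isomorphisms of corresponding pieces have disjoint domains and disjoint images, so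
  they glue to an isomorphism of conull sets, which is then completed to an automorphism. The null
  sets lost on the way are the reason for the set \<open>D\<close>.\<close>

lemma matching_partition:
  assumes I: "finite I"
    and B: "\<And>k. k \<in> I \<Longrightarrow> B k \<in> sets M" "disjoint_family_on B I" "(\<Union>k\<in>I. B k) = space M"
    and C: "\<And>k. k \<in> I \<Longrightarrow> C k \<in> sets M" "disjoint_family_on C I" "(\<Union>k\<in>I. C k) = space M"
    and eq: "\<And>k. k \<in> I \<Longrightarrow> measure M (B k) = measure M (C k)"
  obtains z D where "z \<in> mp_transformations M" "D \<in> sets M" "measure M D = measure M (space M)"
    "\<And>k x. k \<in> I \<Longrightarrow> x \<in> D \<Longrightarrow> x \<in> B k \<Longrightarrow> z x \<in> C k"
proof -
  have "\<forall>k\<in>I. \<exists>f B1 C1. B1 \<in> sets M \<and> C1 \<in> sets M \<and> B1 \<subseteq> B k \<and> C1 \<subseteq> C k \<and>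
    measure M (B k - B1) = 0 \<and> measure M (C k - C1) = 0 \<and> bij_betw f B1 C1 \<and>
    (\<forall>A\<in>sets M. A \<subseteq> B1 \<longrightarrow> f ` A \<in> sets M \<and> measure M (f ` A) = measure M A) \<and>
    (\<forall>A\<in>sets M. A \<subseteq> C1 \<longrightarrow> {x \<in> B1. f x \<in> A} \<in> sets M)"
  proof
    fix k assume k: "k \<in> I"
    show "\<exists>f B1 C1. B1 \<in> sets M \<and> C1 \<in> sets M \<and> B1 \<subseteq> B k \<and> C1 \<subseteq> C k \<and>
      measure M (B k - B1) = 0 \<and> measure M (C k - C1) = 0 \<and> bij_betw f B1 C1 \<and>
      (\<forall>A\<in>sets M. A \<subseteq> B1 \<longrightarrow> f ` A \<in> sets M \<and> measure M (f ` A) = measure M A) \<and>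
      (\<forall>A\<in>sets M. A \<subseteq> C1 \<longrightarrow> {x \<in> B1. f x \<in> A} \<in> sets M)"
      by (rule mod_null_isomorphism[OF B(1)[OF k] C(1)[OF k] eq[OF k]]) (intro exI conjI ballI impI)
  qed
  from this[unfolded bchoice_iff] obtain f B1 C1 where *: "\<forall>k\<in>I. B1 k \<in> sets M \<and> C1 k \<in> sets M \<and>
    B1 k \<subseteq> B k \<and> C1 k \<subseteq> C k \<and>
    measure M (B k - B1 k) = 0 \<and> measure M (C k - C1 k) = 0 \<and> bij_betw (f k) (B1 k) (C1 k) \<and>
    (\<forall>A\<in>sets M. A \<subseteq> B1 k \<longrightarrow> f k ` A \<in> sets M \<and> measure M (f k ` A) = measure M A) \<and>
    (\<forall>A\<in>sets M. A \<subseteq> C1 k \<longrightarrow> {x \<in> B1 k. f k x \<in> A} \<in> sets M)"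
    by (elim exE) (rule that)
  have B1: "B1 k \<in> sets M" "B1 k \<subseteq> B k" "measure M (B k - B1 k) = 0"
    and C1: "C1 k \<in> sets M" "C1 k \<subseteq> C k" "measure M (C k - C1 k) = 0"
    and f: "bij_betw (f k) (B1 k) (C1 k)"
      "\<And>A. A \<in> sets M \<Longrightarrow> A \<subseteq> B1 k \<Longrightarrow> f k ` A \<in> sets M"
      "\<And>A. A \<in> sets M \<Longrightarrow> A \<subseteq> B1 k \<Longrightarrow> measure M (f k ` A) = measure M A"
      "\<And>A. A \<in> sets M \<Longrightarrow> A \<subseteq> C1 k \<Longrightarrow> {x \<in> B1 k. f k x \<in> A} \<in> sets M" if "k \<in> I" for k
    using *[rule_format, OF that] by blast+
  define K where "K x = (THE k. k \<in> I \<and> x \<in> B k)" for x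
  have K: "K x = k" if "k \<in> I" "x \<in> B k" for k x
    unfolding K_def using that B(2) by (intro the_equality) (auto simp: disjoint_family_on_def)
  define z0 where "z0 x = f (K x) x" for x
  have z0: "z0 x = f k x" if "k \<in> I" "x \<in> B1 k" for k x
    using K[of k x] B1(2)[OF that(1)] that by (auto simp: z0_def)
  define B0 where "B0 = (\<Union>k\<in>I. B1 k)"
  define C0 where "C0 = (\<Union>k\<in>I. C1 k)"
  have null: "measure M (\<Union>k\<in>I. Y1 k) = measure M (space M)"
    if "\<And>k. k \<in> I \<Longrightarrow> Y k \<in> sets M" "\<And>k. k \<in> I \<Longrightarrow> Y1 k \<in> sets M" "(\<Union>k\<in>I. Y k) = space M"
      "\<And>k. k \<in> I \<Longrightarrow> measure M (Y k - Y1 k) = 0" for Y Y1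
  proof -
    have "(\<Union>k\<in>I. Y k - Y1 k) \<in> null_sets M"
      using that I by (intro null_sets_UN' null_setsI) (auto simp: emeasure_eq_measure countable_finite)
    moreover have "space M - (\<Union>k\<in>I. Y1 k) \<subseteq> (\<Union>k\<in>I. Y k - Y1 k)" using that(3) by blast
    moreover have U: "(\<Union>k\<in>I. Y1 k) \<in> sets M" using that(2) I by auto
    ultimately have "space M - (\<Union>k\<in>I. Y1 k) \<in> null_sets M"
      using null_sets_subset[of "\<Union>k\<in>I. Y k - Y1 k" M "space M - (\<Union>k\<in>I. Y1 k)"] by simp
    then show ?thesis using finite_measure_compl[OF U] by (simp add: measure_eq_0_null_sets)
  qed
  have decomp: "z0 ` A = (\<Union>k\<in>I. f k ` (A \<inter> B1 k))" if AB: "A \<subseteq> B0" for A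
  proof
    show "z0 ` A \<subseteq> (\<Union>k\<in>I. f k ` (A \<inter> B1 k))"
    proof
      fix y assume "y \<in> z0 ` A"
      then obtain x where x: "x \<in> A" "y = z0 x" by auto
      then obtain k where "k \<in> I" "x \<in> B1 k" using AB by (auto simp: B0_def)
      then show "y \<in> (\<Union>k\<in>I. f k ` (A \<inter> B1 k))" using x z0 by auto
    qed
    show "(\<Union>k\<in>I. f k ` (A \<inter> B1 k)) \<subseteq> z0 ` A"
    proof
      fix y assume "y \<in> (\<Union>k\<in>I. f k ` (A \<inter> B1 k))"
      then obtain k x where x: "k \<in> I" "x \<in> A" "x \<in> B1 k" "y = f k x" by auto
      then show "y \<in> z0 ` A" using z0[of k x] by (metis image_eqI)
    qed
  qed
  have disjC: "disjoint_family_on (\<lambda>k. f k ` (A \<inter> B1 k)) I" for A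
    unfolding disjoint_family_on_def
  proof (intro ballI impI)
    fix k l assume kl: "k \<in> I" "l \<in> I" "k \<noteq> l"
    have "f j ` (A \<inter> B1 j) \<subseteq> C j" if "j \<in> I" for j
      using f(1)[OF that] C1(2)[OF that] by (auto simp: bij_betw_def)
    then show "f k ` (A \<inter> B1 k) \<inter> f l ` (A \<inter> B1 l) = {}"
      using kl C(2) unfolding disjoint_family_on_def by blast
  qed
  have B0s: "B0 \<in> sets M" "C0 \<in> sets M" using I B1(1) C1(1) by (auto simp: B0_def C0_def)
  have bij: "bij_betw z0 B0 C0"
  proof (rule bij_betw_imageI)
    show "z0 ` B0 = C0"
    proof -
      have "f k ` (B0 \<inter> B1 k) = C1 k" if k: "k \<in> I" for k
      proof -
        have "B0 \<inter> B1 k = B1 k" using k by (auto simp: B0_def)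
        then show ?thesis using f(1)[OF k] by (simp add: bij_betw_def)
      qed
      then show ?thesis unfolding decomp[OF subset_refl] C0_def by simp
    qed
    show "inj_on z0 B0"
    proof (rule inj_onI)
      fix x y assume xy: "x \<in> B0" "y \<in> B0" "z0 x = z0 y"
      obtain k l where kl: "k \<in> I" "x \<in> B1 k" "l \<in> I" "y \<in> B1 l" using xy by (auto simp: B0_def)
      have mem: "z0 u \<in> C j" if "j \<in> I" "u \<in> B1 j" for j u
        using z0[OF that] bij_betwE[OF f(1)[OF that(1)]] C1(2)[OF that(1)] that(2) by auto
      have "z0 x \<in> C k" "z0 y \<in> C l" using mem kl by auto
      then have "k = l" using xy(3) kl C(2) unfolding disjoint_family_on_def by auto
      then show "x = y" using xy(3) kl z0 f(1)[OF kl(1)] by (auto simp: bij_betw_def inj_on_def)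
    qed
  qed
  have im: "z0 ` A \<in> sets M" and eqA: "measure M (z0 ` A) = measure M A" if A: "A \<in> sets M" "A \<subseteq> B0" for A
  proof -
    have k: "f k ` (A \<inter> B1 k) \<in> sets M" "measure M (f k ` (A \<inter> B1 k)) = measure M (A \<inter> B1 k)" if "k \<in> I" for k
      using f(2,3)[OF that, of "A \<inter> B1 k"] A(1) B1(1)[OF that] by auto
    show "z0 ` A \<in> sets M" unfolding decomp[OF A(2)] using k I by auto
    have "measure M (z0 ` A) = (\<Sum>k\<in>I. measure M (f k ` (A \<inter> B1 k)))"
      unfolding decomp[OF A(2)] using k(1) I disjC by (intro finite_measure_finite_Union) auto
    also have "\<dots> = (\<Sum>k\<in>I. measure M (A \<inter> B1 k))" using k(2) by simp
    also have "\<dots> = measure M (\<Union>k\<in>I. A \<inter> B1 k)"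
    proof (rule finite_measure_finite_Union[symmetric])
      show "disjoint_family_on (\<lambda>k. A \<inter> B1 k) I"
        using B(2) B1(2) unfolding disjoint_family_on_def by blast
    qed (use I A B1 in auto)
    also have "(\<Union>k\<in>I. A \<inter> B1 k) = A" using A(2) by (auto simp: B0_def)
    finally show "measure M (z0 ` A) = measure M A" .
  qed
  have pre: "{x \<in> B0. z0 x \<in> A} \<in> sets M" if A: "A \<in> sets M" "A \<subseteq> C0" for A
  proof -
    have "{x \<in> B0. z0 x \<in> A} = (\<Union>k\<in>I. {x \<in> B1 k. f k x \<in> A \<inter> C1 k})"
      using z0 f(1) by (force simp: B0_def bij_betw_def)
    moreover have "{x \<in> B1 k. f k x \<in> A \<inter> C1 k} \<in> sets M" if "k \<in> I" for k
      using f(4)[OF that, of "A \<inter> C1 k"] A C1(1)[OF that] by auto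
    ultimately show ?thesis using I by auto
  qed
  obtain z D where zD: "z \<in> mp_transformations M" "D \<in> sets M" "D \<subseteq> B0"
    "measure M D = measure M (space M)" "\<And>x. x \<in> D \<Longrightarrow> z x = z0 x"
    using mp_transformation_from_mod_null[OF B0s(1) _ B0s(2) _ bij im eqA pre]
      null[OF B(1) B1(1) B(3) B1(3)] null[OF C(1) C1(1) C(3) C1(3)] unfolding B0_def[symmetric] C0_def[symmetric]
    by blast
  show ?thesis
  proof (rule that[OF zD(1,2,4)])
    fix k x assume kx: "k \<in> I" "x \<in> D" "x \<in> B k"
    then obtain l where l: "l \<in> I" "x \<in> B1 l" using zD(3) by (auto simp: B0_def)
    then have "l = k" using kx B(2) B1(2) unfolding disjoint_family_on_def by blast
    then show "z x \<in> C k" using l kx zD(5) z0 f(1)[OF kx(1)] C1(2)[OF kx(1)] by (auto simp: bij_betw_def)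
  qed
qed

text \<open>By finite additivity the complements of the two families have equal measure as well;
  they are matched as one more piece, with index \<open>None\<close>.\<close>

lemma matching:
  fixes I :: "'b set"
  assumes I: "finite I"
    and B: "\<And>k. k \<in> I \<Longrightarrow> B k \<in> sets M" "disjoint_family_on B I"
    and C: "\<And>k. k \<in> I \<Longrightarrow> C k \<in> sets M" "disjoint_family_on C I"
    and eq: "\<And>k. k \<in> I \<Longrightarrow> measure M (B k) = measure M (C k)"
  obtains z D where "z \<in> mp_transformations M" "D \<in> sets M" "measure M D = measure M (space M)"
    "\<And>k x. k \<in> I \<Longrightarrow> x \<in> D \<Longrightarrow> x \<in> B k \<Longrightarrow> z x \<in> C k"
proof -
  define X where "X Y k = (case k of None \<Rightarrow> space M - (\<Union>k\<in>I. Y k) | Some k \<Rightarrow> Y k)" for Y :: "'b \<Rightarrow> 'a set" and k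
  define J where "J = insert None (Some ` I)"
  have X: "\<And>k. k \<in> J \<Longrightarrow> X Y k \<in> sets M" "disjoint_family_on (X Y) J" "(\<Union>k\<in>J. X Y k) = space M"
    if "\<And>k. k \<in> I \<Longrightarrow> Y k \<in> sets M" "disjoint_family_on Y I" for Y
  proof -
    show "\<And>k. k \<in> J \<Longrightarrow> X Y k \<in> sets M"
      using that(1) sets.finite_UN[OF I, of Y M] by (auto simp: X_def J_def)
    show "disjoint_family_on (X Y) J"
      using that(2) unfolding disjoint_family_on_def J_def X_def by (fastforce split: option.split)
    show "(\<Union>k\<in>J. X Y k) = space M"
      using sets.sets_into_space[OF that(1)] by (auto simp: X_def J_def)
  qed
  have "measure M (X B k) = measure M (X C k)" if "k \<in> J" for k
  proof (cases k)
    case None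
    have "measure M (\<Union>k\<in>I. Y k) = (\<Sum>k\<in>I. measure M (Y k))"
      if "\<And>k. k \<in> I \<Longrightarrow> Y k \<in> sets M" "disjoint_family_on Y I" for Y
      using that I by (intro finite_measure_finite_Union) auto
    from this[OF B] this[OF C] have "measure M (\<Union>k\<in>I. B k) = measure M (\<Union>k\<in>I. C k)"
      using eq by simp
    then show ?thesis
      using None I B(1) C(1) by (simp add: X_def finite_measure_compl sets.finite_UN)
  next
    case (Some l)
    then show ?thesis using that eq by (auto simp: X_def J_def)
  qed
  then obtain z D where zD: "z \<in> mp_transformations M" "D \<in> sets M" "measure M D = measure M (space M)"
    "\<And>k x. k \<in> J \<Longrightarrow> x \<in> D \<Longrightarrow> x \<in> X B k \<Longrightarrow> z x \<in> X C k"
    using matching_partition[OF _ X[OF B] X[OF C]] I unfolding J_def by blast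
  show ?thesis
    by (rule that[OF zD(1-3)]) (use zD(4)[of "Some _"] in \<open>auto simp: X_def J_def\<close>)
qed

end

section \<open>Square integrable functions\<close>

lemma borel_measurable_cnj [measurable (raw)]:
  "f \<in> borel_measurable M \<Longrightarrow> (\<lambda>x. cnj (f x)) \<in> borel_measurable M"
  by (rule borel_measurable_continuous_on) (auto intro: continuous_intros)

text \<open>Inner product and norm of functions instead of classes: estimates are made here, free of
  the choice hidden in \<open>rep\<close>, and transferred by \<open>l2_inner_class\<close> and its
  companions.\<close>

definition ip :: "'a measure \<Rightarrow> ('a \<Rightarrow> complex) \<Rightarrow> ('a \<Rightarrow> complex) \<Rightarrow> complex" where
  "ip M f g = (LINT x|M. f x * cnj (g x))"

definition nrm :: "'a measure \<Rightarrow> ('a \<Rightarrow> complex) \<Rightarrow> real" where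
  "nrm M f = sqrt (LINT x|M. (cmod (f x))\<^sup>2)"

lemma sq_measurable: "f \<in> square_integrable M \<Longrightarrow> f \<in> borel_measurable M"
  and sq_integrable: "f \<in> square_integrable M \<Longrightarrow> integrable M (\<lambda>x. (cmod (f x))\<^sup>2)"
  by (auto simp: square_integrable_def)

lemma sq_scale: "f \<in> square_integrable M \<Longrightarrow> (\<lambda>x. c * f x) \<in> square_integrable M"
  by (auto simp: square_integrable_def norm_mult power_mult_distrib)

lemma sq_mult_integrable:
  assumes "f \<in> square_integrable M" "g \<in> square_integrable M"
  shows "integrable M (\<lambda>x. f x * cnj (g x))"
    and "integrable M (\<lambda>x. cmod (f x) * cmod (g x))"
proof -
  have [measurable]: "f \<in> borel_measurable M" "g \<in> borel_measurable M"
    using assms by (auto intro: sq_measurable)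
  have I: "integrable M (\<lambda>x. (cmod (f x))\<^sup>2 + (cmod (g x))\<^sup>2)"
    using assms by (intro Bochner_Integration.integrable_add sq_integrable)
  have *: "cmod (f x) * cmod (g x) \<le> (cmod (f x))\<^sup>2 + (cmod (g x))\<^sup>2" for x
    using sum_squares_bound[of "cmod (f x)" "cmod (g x)"] mult_nonneg_nonneg[of "cmod (f x)" "cmod (g x)"]
    unfolding mult.assoc by (simp del: mult_nonneg_nonneg)
  show "integrable M (\<lambda>x. f x * cnj (g x))"
    by (rule Bochner_Integration.integrable_bound[OF I]) (measurable, simp add: norm_mult *)
  show "integrable M (\<lambda>x. cmod (f x) * cmod (g x))"
    by (rule Bochner_Integration.integrable_bound[OF I]) (measurable, simp add: *)
qed

lemma sq_add:
  assumes "f \<in> square_integrable M" "g \<in> square_integrable M"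
  shows "(\<lambda>x. f x + g x) \<in> square_integrable M"
proof -
  have [measurable]: "f \<in> borel_measurable M" "g \<in> borel_measurable M"
    using assms by (auto intro: sq_measurable)
  have I: "integrable M (\<lambda>x. 2 * (cmod (f x))\<^sup>2 + 2 * (cmod (g x))\<^sup>2)"
    using assms by (intro Bochner_Integration.integrable_add integrable_mult_right sq_integrable)
  have "(cmod (f x + g x))\<^sup>2 \<le> 2 * (cmod (f x))\<^sup>2 + 2 * (cmod (g x))\<^sup>2" for x
  proof -
    have "(cmod (f x + g x))\<^sup>2 \<le> (cmod (f x) + cmod (g x))\<^sup>2"
      by (intro power_mono norm_triangle_ineq) simp
    also have "\<dots> \<le> 2 * (cmod (f x))\<^sup>2 + 2 * (cmod (g x))\<^sup>2"
      using sum_squares_bound[of "cmod (f x)" "cmod (g x)"] by (simp add: power2_sum)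
    finally show ?thesis .
  qed
  then have "integrable M (\<lambda>x. (cmod (f x + g x))\<^sup>2)"
    by (intro Bochner_Integration.integrable_bound[OF I]) auto
  then show ?thesis by (simp add: square_integrable_def)
qed

lemma sq_diff:
  assumes "f \<in> square_integrable M" "g \<in> square_integrable M"
  shows "(\<lambda>x. f x - g x) \<in> square_integrable M"
  using sq_add[OF assms(1) sq_scale[OF assms(2), of "-1"]] by simp

lemma sq_zero: "(\<lambda>x. 0) \<in> square_integrable M"
  by (simp add: square_integrable_def)

lemma sq_sum:
  assumes "\<And>i. i \<in> I \<Longrightarrow> f i \<in> square_integrable M"
  shows "(\<lambda>x. \<Sum>i\<in>I. f i x) \<in> square_integrable M"
  using assms by (induction I rule: infinite_finite_induct) (auto intro: sq_zero sq_add)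

lemma (in finite_measure) sq_bounded:
  assumes "f \<in> borel_measurable M" "\<And>x. x \<in> space M \<Longrightarrow> cmod (f x) \<le> C"
  shows "f \<in> square_integrable M"
proof -
  have "integrable M (\<lambda>x. (cmod (f x))\<^sup>2)"
  proof (rule integrable_const_bound[where B = "C\<^sup>2"])
    show "AE x in M. norm ((cmod (f x))\<^sup>2) \<le> C\<^sup>2"
      using assms(2) by (intro AE_I2) (simp add: power_mono)
  qed (use assms(1) in measurable)
  then show ?thesis using assms by (simp add: square_integrable_def)
qed

lemma (in finite_measure) sq_indicator: "A \<in> sets M \<Longrightarrow> indicator A \<in> square_integrable M"
  by (rule sq_bounded[where C = 1]) (auto simp: indicator_def)

lemma (in finite_measure) sq_one: "(\<lambda>x. 1) \<in> square_integrable M"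
  by (rule sq_bounded[where C = 1]) auto

lemma nrm_nonneg: "0 \<le> nrm M f" by (simp add: nrm_def)

lemma nrm_power2: "(nrm M f)\<^sup>2 = (LINT x|M. (cmod (f x))\<^sup>2)" by (simp add: nrm_def)

lemma ip_self: "f \<in> square_integrable M \<Longrightarrow> ip M f f = complex_of_real ((nrm M f)\<^sup>2)"
  unfolding ip_def nrm_power2 complex_norm_square[symmetric] by (simp only: integral_complex_of_real)

lemma ip_cnj: "ip M g f = cnj (ip M f g)"
proof -
  have "(\<lambda>x. g x * cnj (f x)) = (\<lambda>x. cnj (f x * cnj (g x)))" by (simp add: mult.commute)
  then show ?thesis unfolding ip_def by (simp only: Bochner_Integration.integral_cnj)
qed

lemma ip_add_left:
  assumes "f \<in> square_integrable M" "g \<in> square_integrable M" "h \<in> square_integrable M"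
  shows "ip M (\<lambda>x. f x + g x) h = ip M f h + ip M g h"
  using assms unfolding ip_def by (simp add: algebra_simps sq_mult_integrable)

lemma ip_scale_left: "ip M (\<lambda>x. c * f x) h = c * ip M f h"
  unfolding ip_def by (simp add: mult.assoc)

lemma ip_diff_left:
  assumes "f \<in> square_integrable M" "g \<in> square_integrable M" "h \<in> square_integrable M"
  shows "ip M (\<lambda>x. f x - g x) h = ip M f h - ip M g h"
  using assms unfolding ip_def by (simp add: algebra_simps sq_mult_integrable)

lemma ip_add_right:
  assumes "f \<in> square_integrable M" "g \<in> square_integrable M" "h \<in> square_integrable M"
  shows "ip M h (\<lambda>x. f x + g x) = ip M h f + ip M h g"
  using ip_add_left[OF assms] ip_cnj by (metis complex_cnj_add)

lemma ip_diff_right: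
  assumes "f \<in> square_integrable M" "g \<in> square_integrable M" "h \<in> square_integrable M"
  shows "ip M h (\<lambda>x. f x - g x) = ip M h f - ip M h g"
  using ip_diff_left[OF assms] ip_cnj by (metis complex_cnj_diff)

lemma ip_scale_right: "ip M h (\<lambda>x. c * f x) = cnj c * ip M h f"
  using ip_scale_left[of M c f h] ip_cnj by (metis complex_cnj_mult)

lemma ip_cong_AE:
  assumes "f \<in> borel_measurable M" "f' \<in> borel_measurable M" "g \<in> borel_measurable M" "g' \<in> borel_measurable M"
    "AE x in M. f x = f' x" "AE x in M. g x = g' x"
  shows "ip M f g = ip M f' g'"
  unfolding ip_def
proof (rule integral_cong_AE)
  show "AE x in M. f x * cnj (g x) = f' x * cnj (g' x)" using assms(5,6) by eventually_elim simp
qed (use assms in simp_all)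

lemma nrm_cong_AE:
  assumes "f \<in> borel_measurable M" "f' \<in> borel_measurable M" "AE x in M. f x = f' x"
  shows "nrm M f = nrm M f'"
proof -
  have "(LINT x|M. (cmod (f x))\<^sup>2) = (LINT x|M. (cmod (f' x))\<^sup>2)"
    using assms by (intro integral_cong_AE) auto
  then show ?thesis by (simp add: nrm_def)
qed

text \<open>The optimal weight is \<open>t = b / a\<close>, which is not admissible when
  \<open>a\<close> or \<open>b\<close> vanishes. Shifting both numbers by a small \<open>r\<close>
  gives an admissible weight at the cost of \<open>r * (a + b)\<close>, and \<open>r\<close> is
  chosen to make this at most \<open>e\<close>.\<close>

lemma le_mult_of_scaled:
  fixes a b c :: real
  assumes "0 \<le> a" "0 \<le> b" and c: "\<And>t. 0 < t \<Longrightarrow> 2 * c \<le> t * a\<^sup>2 + b\<^sup>2 / t"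
  shows "c \<le> a * b"
proof (rule field_le_epsilon)
  fix e :: real assume e: "0 < e"
  define r where "r = e / (a + b + 1)"
  have r: "0 < r" "r * (a + b) \<le> e" using assms(1,2) e by (auto simp: r_def field_simps)
  define t where "t = (b + r) / (a + r)"
  have t: "0 < t" using assms r by (simp add: t_def)
  have "a * a \<le> a * (a + r)" "b * b \<le> b * (b + r)" using assms r by (auto intro!: mult_left_mono)
  then have "t * a\<^sup>2 \<le> (b + r) * a" "b\<^sup>2 / t \<le> (a + r) * b"
    using assms r by (auto simp: t_def power2_eq_square field_simps)
  then have "2 * c \<le> (b + r) * a + (a + r) * b" using c[OF t] by linarith
  also have "\<dots> = 2 * (a * b) + r * (a + b)" by (simp add: algebra_simps)
  finally show "c \<le> a * b + e" using r(2) e by linarith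
qed

text \<open>The weighted inequality between arithmetic and geometric mean is integrated for every
  weight \<open>t\<close>; the optimisation over \<open>t\<close> is the preceding lemma.\<close>

lemma ip_Cauchy_Schwarz:
  assumes f: "f \<in> square_integrable M" and g: "g \<in> square_integrable M"
  shows "cmod (ip M f g) \<le> nrm M f * nrm M g"
proof (rule le_mult_of_scaled)
  fix t :: real assume t: "0 < t"
  have "cmod (ip M f g) \<le> (LINT x|M. cmod (f x) * cmod (g x))"
    unfolding ip_def using integral_norm_bound[of M "\<lambda>x. f x * cnj (g x)"] by (simp add: norm_mult)
  also have "2 * \<dots> = (LINT x|M. 2 * (cmod (f x) * cmod (g x)))" by simp
  also have "\<dots> \<le> (LINT x|M. t * (cmod (f x))\<^sup>2 + (cmod (g x))\<^sup>2 / t)"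
  proof (rule integral_mono)
    show "integrable M (\<lambda>x. 2 * (cmod (f x) * cmod (g x)))"
      using sq_mult_integrable(2)[OF f g] by simp
    show "integrable M (\<lambda>x. t * (cmod (f x))\<^sup>2 + (cmod (g x))\<^sup>2 / t)"
      using f g by (intro Bochner_Integration.integrable_add integrable_mult_right integrable_divide sq_integrable)
    fix x
    have "2 * (cmod (f x) * t) * cmod (g x) \<le> (cmod (f x) * t)\<^sup>2 + (cmod (g x))\<^sup>2"
      by (rule sum_squares_bound)
    then show "2 * (cmod (f x) * cmod (g x)) \<le> t * (cmod (f x))\<^sup>2 + (cmod (g x))\<^sup>2 / t"
      using t by (simp add: field_simps power2_eq_square)
  qed
  also have "\<dots> = t * (nrm M f)\<^sup>2 + (nrm M g)\<^sup>2 / t"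
    unfolding nrm_power2 using sq_integrable[OF f] sq_integrable[OF g] by simp
  finally show "2 * cmod (ip M f g) \<le> t * (nrm M f)\<^sup>2 + (nrm M g)\<^sup>2 / t" by simp
qed (simp_all add: nrm_nonneg)

lemma nrm_add_power2:
  assumes f: "f \<in> square_integrable M" and g: "g \<in> square_integrable M"
  shows "(nrm M (\<lambda>x. f x + g x))\<^sup>2 = (nrm M f)\<^sup>2 + (nrm M g)\<^sup>2 + 2 * Re (ip M f g)"
proof -
  let ?h = "\<lambda>x. f x + g x"
  have "complex_of_real ((nrm M ?h)\<^sup>2) = ip M ?h ?h" using sq_add[OF f g] by (rule ip_self[symmetric])
  also have "\<dots> = ip M f f + ip M g g + (ip M f g + cnj (ip M f g))"
    using f g by (simp add: ip_add_left ip_add_right sq_add ip_cnj[of M g f])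
  also have "\<dots> = complex_of_real ((nrm M f)\<^sup>2 + (nrm M g)\<^sup>2 + 2 * Re (ip M f g))"
    using f g by (simp add: ip_self complex_add_cnj)
  finally show ?thesis by (simp only: of_real_eq_iff)
qed

lemma nrm_triangle:
  assumes f: "f \<in> square_integrable M" and g: "g \<in> square_integrable M"
  shows "nrm M (\<lambda>x. f x + g x) \<le> nrm M f + nrm M g"
proof (rule power2_le_imp_le)
  have "Re (ip M f g) \<le> nrm M f * nrm M g"
    using ip_Cauchy_Schwarz[OF f g] complex_Re_le_cmod[of "ip M f g"] by linarith
  then show "(nrm M (\<lambda>x. f x + g x))\<^sup>2 \<le> (nrm M f + nrm M g)\<^sup>2"
    unfolding nrm_add_power2[OF f g] by (simp add: power2_sum)
qed (simp add: nrm_nonneg)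

lemma nrm_scale: "nrm M (\<lambda>x. c * f x) = cmod c * nrm M f"
  by (simp add: nrm_def norm_mult power_mult_distrib real_sqrt_mult)

lemma nrm_zero_AE:
  assumes "f \<in> square_integrable M" "nrm M f = 0"
  shows "AE x in M. f x = 0"
proof -
  have "(LINT x|M. (cmod (f x))\<^sup>2) = 0" using assms(2) by (simp add: nrm_def)
  then show ?thesis
    using integral_nonneg_eq_0_iff_AE[OF sq_integrable[OF assms(1)]] by simp
qed

section \<open>Passage between square integrable functions and their classes\<close>

lemma l2_class_eq_iff:
  assumes "f \<in> square_integrable M" "g \<in> square_integrable M"
  shows "l2_class M f = l2_class M g \<longleftrightarrow> (AE x in M. f x = g x)"
proof
  assume "l2_class M f = l2_class M g"
  moreover have "f \<in> l2_class M f" using assms by (simp add: l2_class_def)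
  ultimately show "AE x in M. f x = g x" by (simp add: l2_class_def)
next
  assume *: "AE x in M. f x = g x"
  have "(AE x in M. h x = f x) \<longleftrightarrow> (AE x in M. h x = g x)" for h
  proof
    assume "AE x in M. h x = f x"
    with * show "AE x in M. h x = g x" by eventually_elim simp
  next
    assume "AE x in M. h x = g x"
    with * show "AE x in M. h x = f x" by eventually_elim simp
  qed
  then show "l2_class M f = l2_class M g" by (simp add: l2_class_def)
qed

lemma rep_l2_class:
  assumes "f \<in> square_integrable M"
  shows "rep (l2_class M f) \<in> square_integrable M" "AE x in M. rep (l2_class M f) x = f x"
proof -
  have "f \<in> l2_class M f" using assms by (simp add: l2_class_def)
  then have "rep (l2_class M f) \<in> l2_class M f" unfolding rep_def some_in_eq by auto
  then show "rep (l2_class M f) \<in> square_integrable M" "AE x in M. rep (l2_class M f) x = f x"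
    by (auto simp: l2_class_def)
qed

lemma L2_rep:
  assumes "F \<in> L2 M"
  shows "rep F \<in> square_integrable M" "l2_class M (rep F) = F"
proof -
  obtain f where f: "f \<in> square_integrable M" "F = l2_class M f" using assms by (auto simp: L2_def)
  show "rep F \<in> square_integrable M" unfolding f(2) by (rule rep_l2_class[OF f(1)])
  show "l2_class M (rep F) = F"
    unfolding f(2) using rep_l2_class[OF f(1)] f(1) by (subst l2_class_eq_iff) auto
qed

lemma l2_class_in_L2: "f \<in> square_integrable M \<Longrightarrow> l2_class M f \<in> L2 M"
  by (simp add: L2_def)

lemma l2_inner_class:
  assumes "f \<in> square_integrable M" "g \<in> square_integrable M"
  shows "l2_inner M (l2_class M f) (l2_class M g) = ip M f g"
  unfolding l2_inner_def ip_def[symmetric]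
  using rep_l2_class[OF assms(1)] rep_l2_class[OF assms(2)] assms
  by (intro ip_cong_AE sq_measurable) auto

lemma l2_norm_class:
  assumes "f \<in> square_integrable M"
  shows "l2_norm M (l2_class M f) = nrm M f"
  using assms by (simp add: l2_norm_def l2_inner_class ip_self nrm_nonneg del: of_real_power)

lemma l2_dist_class:
  assumes "f \<in> square_integrable M" "g \<in> square_integrable M"
  shows "l2_dist M (l2_class M f) (l2_class M g) = nrm M (\<lambda>x. f x - g x)"
  unfolding l2_dist_def nrm_def[symmetric]
proof (rule nrm_cong_AE)
  show "AE x in M. rep (l2_class M f) x - rep (l2_class M g) x = f x - g x"
    using rep_l2_class(2)[OF assms(1)] rep_l2_class(2)[OF assms(2)] by eventually_elim simp
qed (use rep_l2_class(1)[OF assms(1)] rep_l2_class(1)[OF assms(2)] assms in \<open>auto intro: sq_measurable sq_diff\<close>)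

lemma l2_add_class:
  assumes "f \<in> square_integrable M" "g \<in> square_integrable M"
  shows "l2_add M (l2_class M f) (l2_class M g) = l2_class M (\<lambda>x. f x + g x)"
  unfolding l2_add_def
proof (subst l2_class_eq_iff)
  show "AE x in M. rep (l2_class M f) x + rep (l2_class M g) x = f x + g x"
    using rep_l2_class(2)[OF assms(1)] rep_l2_class(2)[OF assms(2)] by eventually_elim simp
qed (use rep_l2_class(1)[OF assms(1)] rep_l2_class(1)[OF assms(2)] assms in \<open>auto intro: sq_add\<close>)

lemma l2_scale_class:
  assumes "f \<in> square_integrable M"
  shows "l2_scale M c (l2_class M f) = l2_class M (\<lambda>x. c * f x)"
  unfolding l2_scale_def
proof (subst l2_class_eq_iff)
  show "AE x in M. c * rep (l2_class M f) x = c * f x"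
    using rep_l2_class(2)[OF assms] by eventually_elim simp
qed (use rep_l2_class(1)[OF assms] assms in \<open>auto intro: sq_scale\<close>)

lemma l2_nonneg_class:
  assumes "f \<in> square_integrable M"
  shows "l2_nonneg M (l2_class M f) \<longleftrightarrow> (AE x in M. f x \<in> \<real>\<^sub>\<ge>\<^sub>0)"
  unfolding l2_nonneg_def
proof
  assume "AE x in M. rep (l2_class M f) x \<in> \<real>\<^sub>\<ge>\<^sub>0"
  with rep_l2_class(2)[OF assms] show "AE x in M. f x \<in> \<real>\<^sub>\<ge>\<^sub>0" by eventually_elim simp
next
  assume "AE x in M. f x \<in> \<real>\<^sub>\<ge>\<^sub>0"
  with rep_l2_class(2)[OF assms] show "AE x in M. rep (l2_class M f) x \<in> \<real>\<^sub>\<ge>\<^sub>0"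
    by eventually_elim simp
qed

lemma Metric_space_L2: "Metric_space (L2 M) (l2_dist M)"
proof
  have L2: "\<exists>f\<in>square_integrable M. F = l2_class M f" if "F \<in> L2 M" for F
    using that by (auto simp: L2_def)
  fix F G H
  show "0 \<le> l2_dist M F G" by (simp add: l2_dist_def)
  show "l2_dist M F G = l2_dist M G F" by (simp add: l2_dist_def norm_minus_commute)
  show "(l2_dist M F G = 0) = (F = G)" if "F \<in> L2 M" "G \<in> L2 M"
  proof -
    obtain f g where fg: "f \<in> square_integrable M" "g \<in> square_integrable M" "F = l2_class M f" "G = l2_class M g"
      using L2 \<open>F \<in> L2 M\<close> \<open>G \<in> L2 M\<close> by blast
    show ?thesis
    proof
      assume "l2_dist M F G = 0"
      then have "AE x in M. f x - g x = 0"
        using fg by (intro nrm_zero_AE sq_diff) (simp_all add: l2_dist_class)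
      then have "AE x in M. f x = g x" by simp
      then show "F = G" unfolding fg(3,4) using fg(1,2) by (subst l2_class_eq_iff)
    qed (simp add: l2_dist_def)
  qed
  show "l2_dist M F H \<le> l2_dist M F G + l2_dist M G H" if "F \<in> L2 M" "G \<in> L2 M" "H \<in> L2 M"
  proof -
    obtain f where f: "f \<in> square_integrable M" "F = l2_class M f" using L2 \<open>F \<in> L2 M\<close> by blast
    obtain g where g: "g \<in> square_integrable M" "G = l2_class M g" using L2 \<open>G \<in> L2 M\<close> by blast
    obtain h where h: "h \<in> square_integrable M" "H = l2_class M h" using L2 \<open>H \<in> L2 M\<close> by blast
    note fg = f(1) g(1) h(1) f(2) g(2) h(2)
    show ?thesis
      using nrm_triangle[OF sq_diff[OF fg(1,2)] sq_diff[OF fg(2,3)]] fg by (simp add: l2_dist_class)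
  qed
qed

section \<open>Contractive and Markov forms\<close>

text \<open>The matrix coefficients of an operator as a sesquilinear form on functions. Limits of
  operators are first found as such forms, which is why contractions and Markov operators get
  counterparts for forms.\<close>

definition op_form :: "'a measure \<Rightarrow> 'a l2_op \<Rightarrow> ('a \<Rightarrow> complex) \<Rightarrow> ('a \<Rightarrow> complex) \<Rightarrow> complex" where
  "op_form M K f g = l2_inner M (K (l2_class M f)) (l2_class M g)"

definition contraction_form :: "'a measure \<Rightarrow> (('a \<Rightarrow> complex) \<Rightarrow> ('a \<Rightarrow> complex) \<Rightarrow> complex) \<Rightarrow> bool" where
  "contraction_form M b \<longleftrightarrow>
     (\<forall>f\<in>square_integrable M. \<forall>g\<in>square_integrable M. \<forall>h\<in>square_integrable M.
        b (\<lambda>x. f x + g x) h = b f h + b g h \<and> b h (\<lambda>x. f x + g x) = b h f + b h g) \<and>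
     (\<forall>f\<in>square_integrable M. \<forall>g\<in>square_integrable M. \<forall>c.
        b (\<lambda>x. c * f x) g = c * b f g \<and> b f (\<lambda>x. c * g x) = cnj c * b f g) \<and>
     (\<forall>f\<in>square_integrable M. \<forall>g\<in>square_integrable M. cmod (b f g) \<le> nrm M f * nrm M g)"

text \<open>The two conditions on the constant 1 correspond to \<open>K\<close> and to its adjoint:
  fixing 1 is expressed in the first argument for \<open>K\<close> and in the second one for the
  adjoint.\<close>

definition markov_form :: "'a measure \<Rightarrow> (('a \<Rightarrow> complex) \<Rightarrow> ('a \<Rightarrow> complex) \<Rightarrow> complex) \<Rightarrow> bool" where
  "markov_form M b \<longleftrightarrow> contraction_form M b \<and>
     (\<forall>f\<in>square_integrable M. b (\<lambda>_. 1) f = ip M (\<lambda>_. 1) f \<and> b f (\<lambda>_. 1) = ip M f (\<lambda>_. 1)) \<and>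
     (\<forall>f\<in>square_integrable M. \<forall>g\<in>square_integrable M.
        (AE x in M. f x \<in> \<real>\<^sub>\<ge>\<^sub>0) \<longrightarrow> (AE x in M. g x \<in> \<real>\<^sub>\<ge>\<^sub>0) \<longrightarrow> b f g \<in> \<real>\<^sub>\<ge>\<^sub>0)"

lemma contraction_formD:
  assumes "contraction_form M b" "f \<in> square_integrable M" "g \<in> square_integrable M"
  shows "cmod (b f g) \<le> nrm M f * nrm M g"
    and "b (\<lambda>x. c * f x) g = c * b f g" and "b f (\<lambda>x. c * g x) = cnj c * b f g"
    and "h \<in> square_integrable M \<Longrightarrow> b (\<lambda>x. f x + g x) h = b f h + b g h"
    and "h \<in> square_integrable M \<Longrightarrow> b h (\<lambda>x. f x + g x) = b h f + b h g"
  using assms unfolding contraction_form_def by blast+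

lemma contraction_form_diff:
  assumes "contraction_form M b" "f \<in> square_integrable M" "g \<in> square_integrable M" "h \<in> square_integrable M"
  shows "b (\<lambda>x. f x - g x) h = b f h - b g h" and "b h (\<lambda>x. f x - g x) = b h f - b h g"
  using contraction_formD(4)[OF assms(1,2) sq_scale[OF assms(3), of "-1"] assms(4)]
    contraction_formD(2)[OF assms(1,3,4), of "-1"]
    contraction_formD(5)[OF assms(1,2) sq_scale[OF assms(3), of "-1"] assms(4)]
    contraction_formD(3)[OF assms(1,4,3), of "-1"]
  by simp_all

lemma contraction_form_zero:
  assumes "contraction_form M b" "g \<in> square_integrable M"
  shows "b (\<lambda>x. 0) g = 0" "b g (\<lambda>x. 0) = 0"
  using contraction_form_diff[OF assms(1,2,2,2)] by simp_all

lemma contraction_form_sum: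
  assumes b: "contraction_form M b" and f: "\<And>i. i \<in> I \<Longrightarrow> f i \<in> square_integrable M"
    and g: "g \<in> square_integrable M"
  shows "b (\<lambda>x. \<Sum>i\<in>I. f i x) g = (\<Sum>i\<in>I. b (f i) g)"
    and "b g (\<lambda>x. \<Sum>i\<in>I. f i x) = (\<Sum>i\<in>I. b g (f i))"
proof -
  have "b (\<lambda>x. \<Sum>i\<in>I. f i x) g = (\<Sum>i\<in>I. b (f i) g) \<and> b g (\<lambda>x. \<Sum>i\<in>I. f i x) = (\<Sum>i\<in>I. b g (f i))"
    using f
  proof (induction I rule: infinite_finite_induct)
    case (insert i I)
    have "(\<lambda>x. \<Sum>i\<in>I. f i x) \<in> square_integrable M" using insert.prems by (intro sq_sum) auto
    moreover have "f i \<in> square_integrable M" using insert.prems by auto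
    ultimately show ?case
      using insert contraction_formD(4,5)[OF b _ _ g, of "f i" "\<lambda>x. \<Sum>i\<in>I. f i x"] by simp
  qed (simp_all add: contraction_form_zero[OF b g])
  then show "b (\<lambda>x. \<Sum>i\<in>I. f i x) g = (\<Sum>i\<in>I. b (f i) g)"
    and "b g (\<lambda>x. \<Sum>i\<in>I. f i x) = (\<Sum>i\<in>I. b g (f i))" by auto
qed

text \<open>A difference that vanishes almost everywhere has norm zero, and the norm bound then
  annihilates it; so the form depends on classes only.\<close>

lemma contraction_form_cong_AE:
  assumes b: "contraction_form M b" and f: "f \<in> square_integrable M" "f' \<in> square_integrable M"
    and g: "g \<in> square_integrable M" "g' \<in> square_integrable M"
    and eq: "AE x in M. f x = f' x" "AE x in M. g x = g' x"
  shows "b f g = b f' g'"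
proof -
  have z: "nrm M (\<lambda>x. u x - u' x) = 0"
    if "AE x in M. u x = u' x" "u \<in> square_integrable M" "u' \<in> square_integrable M" for u u'
  proof -
    have "nrm M (\<lambda>x. u x - u' x) = nrm M (\<lambda>x. 0)"
      using that(1) sq_measurable[OF that(2)] sq_measurable[OF that(3)] by (intro nrm_cong_AE) auto
    then show ?thesis by (simp add: nrm_def)
  qed
  have "b f g - b f' g = 0"
    using contraction_formD(1)[OF b sq_diff[OF f] g(1)] z[OF eq(1) f] contraction_form_diff(1)[OF b f g(1)] by simp
  moreover have "b f' g - b f' g' = 0"
    using contraction_formD(1)[OF b f(2) sq_diff[OF g]] z[OF eq(2) g] contraction_form_diff(2)[OF b g f(2)] by simp
  ultimately show ?thesis by simp
qed

text \<open>Dominated convergence for simple functions bounded by twice the modulus of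
  \<open>f\<close>; the sets \<open>A v\<close> are the fibres of one of these functions over its
  finitely many values \<open>v\<close>.\<close>

lemma (in finite_measure) sq_simple_approx:
  assumes f: "f \<in> square_integrable M" and e: "0 < e"
  obtains V :: "complex set" and A where "finite V" "\<And>v. A v \<in> sets M"
    "nrm M (\<lambda>x. f x - (\<Sum>v\<in>V. v * indicator (A v) x)) < e"
proof -
  note [measurable] = sq_measurable[OF f]
  obtain s where s': "\<forall>i. simple_function M (s i)" "\<forall>x\<in>space M. (\<lambda>i. s i x) \<longlonglongrightarrow> f x"
    "\<forall>i. \<forall>x\<in>space M. dist (s i x) 0 \<le> 2 * dist (f x) 0"
    using borel_measurable_implies_sequence_metric[OF sq_measurable[OF f], of 0] by blast
  then have s: "\<And>i. simple_function M (s i)" "\<And>x. x \<in> space M \<Longrightarrow> (\<lambda>i. s i x) \<longlonglongrightarrow> f x"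
    "\<And>i x. x \<in> space M \<Longrightarrow> dist (s i x) 0 \<le> 2 * dist (f x) 0" by simp_all
  note [measurable] = borel_measurable_simple_function[OF s(1)]
  have "(\<lambda>i. LINT x|M. (cmod (f x - s i x))\<^sup>2) \<longlonglongrightarrow> (LINT x|M. 0)"
  proof (rule integral_dominated_convergence)
    \<comment> \<open>The modulus of \<open>f - s i\<close> is at most three times that of
      \<open>f\<close>, hence the factor 9 after squaring.\<close>
    show "integrable M (\<lambda>x. 9 * (cmod (f x))\<^sup>2)" using sq_integrable[OF f] by simp
    show "AE x in M. (\<lambda>i. (cmod (f x - s i x))\<^sup>2) \<longlonglongrightarrow> 0"
    proof (rule AE_I2)
      fix x assume "x \<in> space M"
      then have "(\<lambda>i. (cmod (f x - s i x))\<^sup>2) \<longlonglongrightarrow> (cmod (f x - f x))\<^sup>2"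
        by (intro tendsto_intros s)
      then show "(\<lambda>i. (cmod (f x - s i x))\<^sup>2) \<longlonglongrightarrow> 0" by simp
    qed
    fix i show "AE x in M. norm ((cmod (f x - s i x))\<^sup>2) \<le> 9 * (cmod (f x))\<^sup>2"
    proof (rule AE_I2)
      fix x assume "x \<in> space M"
      then have "cmod (f x - s i x) \<le> 3 * cmod (f x)"
        using s(3)[of x i] norm_triangle_ineq4[of "f x" "s i x"] by simp
      then have "(cmod (f x - s i x))\<^sup>2 \<le> (3 * cmod (f x))\<^sup>2" by (intro power_mono) auto
      then show "norm ((cmod (f x - s i x))\<^sup>2) \<le> 9 * (cmod (f x))\<^sup>2" by (simp add: power_mult_distrib)
    qed
  qed measurable
  then have "(\<lambda>i. nrm M (\<lambda>x. f x - s i x)) \<longlonglongrightarrow> sqrt 0"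
    unfolding nrm_def by (intro tendsto_real_sqrt) simp
  then have "eventually (\<lambda>i. nrm M (\<lambda>x. f x - s i x) < e) sequentially"
    using e by (simp add: order_tendstoD(2))
  then obtain i where i: "nrm M (\<lambda>x. f x - s i x) < e"
    using eventually_happens'[OF sequentially_bot] by blast
  define A where "A v = s i -` {v} \<inter> space M" for v
  have A: "A v \<in> sets M" for v unfolding A_def by (rule simple_functionD(2)[OF s(1)])
  have "finite (s i ` space M)" using s(1) by (rule simple_functionD(1))
  moreover have "nrm M (\<lambda>x. f x - (\<Sum>v\<in>s i ` space M. v * indicator (A v) x)) < e"
  proof -
    have eq: "s i x = (\<Sum>v\<in>s i ` space M. v * indicator (A v) x)" if x: "x \<in> space M" for x
    proof -
      have "(\<Sum>v\<in>s i ` space M. v * indicator (A v) x) = (\<Sum>v\<in>s i ` space M. if v = s i x then v else 0)"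
        using x by (intro sum.cong) (auto simp: A_def indicator_def)
      also have "\<dots> = s i x" using x simple_functionD(1)[OF s(1)] by (subst sum.delta) auto
      finally show ?thesis by simp
    qed
    have "nrm M (\<lambda>x. f x - (\<Sum>v\<in>s i ` space M. v * indicator (A v) x)) = nrm M (\<lambda>x. f x - s i x)"
      unfolding nrm_def
      by (intro arg_cong[where f = sqrt] Bochner_Integration.integral_cong refl) (simp only: eq[symmetric])
    then show ?thesis using i by simp
  qed
  ultimately show ?thesis by (rule that[OF _ A])
qed

text \<open>Finitely many coefficients on indicators control the coefficient at
  \<open>(f, g)\<close> uniformly over all contractive forms. This is what allows the weak operator
  topology to be described by measures of intersections.\<close>

lemma (in finite_measure) contraction_form_approx:
  assumes f: "f \<in> square_integrable M" and g: "g \<in> square_integrable M" and e: "0 < e"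
  obtains \<A> \<delta> where "finite \<A>" "\<A> \<subseteq> sets M" "0 < \<delta>"
    "\<And>b b'. contraction_form M b \<Longrightarrow> contraction_form M b' \<Longrightarrow>
       (\<forall>A\<in>\<A>. \<forall>B\<in>\<A>. cmod (b (indicator A) (indicator B) - b' (indicator A) (indicator B)) < \<delta>) \<Longrightarrow>
       cmod (b f g - b' f g) < e"
proof -
  \<comment> \<open>Passing from \<open>f\<close> to \<open>s\<close> and from \<open>g\<close> to
    \<open>t\<close> costs at most \<open>e / 6\<close> each, so each of the two forms moves by at
    most \<open>e / 3\<close>, and \<open>e / 3\<close> is left for the coefficients on indicators.
    The tolerance \<open>e2\<close> involves the norm of \<open>s\<close>, so \<open>g\<close> is
    approximated only after \<open>f\<close>.\<close>
  define e1 where "e1 = e / (6 * (nrm M g + 1))"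
  have e1: "0 < e1" using e nrm_nonneg[of M g] by (simp add: e1_def add_nonneg_pos)
  obtain V A where V: "finite V" "\<And>v. A v \<in> sets M"
    "nrm M (\<lambda>x. f x - (\<Sum>v\<in>V. v * indicator (A v) x)) < e1"
    by (rule sq_simple_approx[OF f e1]) (rule that)
  define s where "s x = (\<Sum>v\<in>V. v * indicator (A v) x)" for x
  have s: "s \<in> square_integrable M" unfolding s_def using V(2) by (intro sq_sum sq_scale sq_indicator)
  define e2 where "e2 = e / (6 * (nrm M s + 1))"
  have e2: "0 < e2" using e nrm_nonneg[of M s] by (simp add: e2_def add_nonneg_pos)
  obtain W B where W: "finite W" "\<And>w. B w \<in> sets M"
    "nrm M (\<lambda>x. g x - (\<Sum>w\<in>W. w * indicator (B w) x)) < e2"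
    by (rule sq_simple_approx[OF g e2]) (rule that)
  define t where "t x = (\<Sum>w\<in>W. w * indicator (B w) x)" for x
  have t: "t \<in> square_integrable M" unfolding t_def using W(2) by (intro sq_sum sq_scale sq_indicator)
  define c where "c = (\<Sum>v\<in>V. \<Sum>w\<in>W. cmod v * cmod w)"
  have c: "0 \<le> c" unfolding c_def by (intro sum_nonneg) auto
  define \<delta> where "\<delta> = e / (3 * (c + 1))"
  have \<delta>: "0 < \<delta>" "c * \<delta> < e / 3" using c e by (auto simp: \<delta>_def field_simps add_nonneg_pos)
  have small: "nrm M (\<lambda>x. f x - s x) * nrm M g \<le> e / 6" "nrm M s * nrm M (\<lambda>x. g x - t x) \<le> e / 6"
  proof -
    have "nrm M (\<lambda>x. f x - s x) * nrm M g \<le> e1 * nrm M g"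
      using V(3) nrm_nonneg by (intro mult_right_mono) (auto simp: s_def)
    also have "\<dots> \<le> e / 6" using e nrm_nonneg[of M g] by (simp add: e1_def field_simps add_nonneg_pos)
    finally show "nrm M (\<lambda>x. f x - s x) * nrm M g \<le> e / 6" .
    have "nrm M s * nrm M (\<lambda>x. g x - t x) \<le> nrm M s * e2"
      using W(3) nrm_nonneg by (intro mult_left_mono) (auto simp: t_def)
    also have "\<dots> \<le> e / 6" using e nrm_nonneg[of M s] by (simp add: e2_def field_simps add_nonneg_pos)
    finally show "nrm M s * nrm M (\<lambda>x. g x - t x) \<le> e / 6" .
  qed
  have near: "cmod (b f g - b s t) \<le> e / 3" if b: "contraction_form M b" for b
  proof -
    have "b f g - b s t = b (\<lambda>x. f x - s x) g + b s (\<lambda>x. g x - t x)"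
      using contraction_form_diff[OF b f s g] contraction_form_diff[OF b g t s] by simp
    then have "cmod (b f g - b s t) \<le> cmod (b (\<lambda>x. f x - s x) g) + cmod (b s (\<lambda>x. g x - t x))"
      by (simp add: norm_triangle_ineq)
    also have "\<dots> \<le> e / 6 + e / 6"
      using contraction_formD(1)[OF b sq_diff[OF f s] g] contraction_formD(1)[OF b s sq_diff[OF g t]] small
      by linarith
    finally show ?thesis by simp
  qed
  have expand: "b s t = (\<Sum>v\<in>V. \<Sum>w\<in>W. v * cnj w * b (indicator (A v)) (indicator (B w)))"
    if b: "contraction_form M b" for b
  proof -
    have "b s t = (\<Sum>v\<in>V. b (\<lambda>x. v * indicator (A v) x) t)"
      unfolding s_def using V(2) t by (intro contraction_form_sum(1)[OF b] sq_scale sq_indicator)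
    also have "\<dots> = (\<Sum>v\<in>V. \<Sum>w\<in>W. b (\<lambda>x. v * indicator (A v) x) (\<lambda>x. w * indicator (B w) x))"
      unfolding t_def using V(2) W(2) by (intro sum.cong refl contraction_form_sum(2)[OF b] sq_scale sq_indicator)
    also have "\<dots> = (\<Sum>v\<in>V. \<Sum>w\<in>W. v * cnj w * b (indicator (A v)) (indicator (B w)))"
    proof (intro sum.cong refl)
      fix v w assume "v \<in> V" "w \<in> W"
      have "indicator (A v) \<in> square_integrable M" "indicator (B w) \<in> square_integrable M"
        using V(2) W(2) by (auto intro: sq_indicator)
      then show "b (\<lambda>x. v * indicator (A v) x) (\<lambda>x. w * indicator (B w) x) =
          v * cnj w * b (indicator (A v)) (indicator (B w))"
        using contraction_formD(2)[OF b, of "indicator (A v)" "\<lambda>x. w * indicator (B w) x" v]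
          contraction_formD(3)[OF b, of "indicator (A v)" "indicator (B w)" w] by (simp add: sq_scale)
    qed
    finally show ?thesis .
  qed
  show ?thesis
  proof
    show "finite (A ` V \<union> B ` W)" "A ` V \<union> B ` W \<subseteq> sets M" "0 < \<delta>"
      using V W \<delta> by auto
    fix b b' assume b: "contraction_form M b" "contraction_form M b'"
      and close: "\<forall>X\<in>A ` V \<union> B ` W. \<forall>Y\<in>A ` V \<union> B ` W.
        cmod (b (indicator X) (indicator Y) - b' (indicator X) (indicator Y)) < \<delta>"
    have "b s t - b' s t = (\<Sum>v\<in>V. \<Sum>w\<in>W. v * cnj w *
        (b (indicator (A v)) (indicator (B w)) - b' (indicator (A v)) (indicator (B w))))"
      unfolding expand[OF b(1)] expand[OF b(2)] by (simp add: sum_subtractf right_diff_distrib)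
    also have "cmod \<dots> \<le> (\<Sum>v\<in>V. \<Sum>w\<in>W. cmod v * cmod w * \<delta>)"
    proof (intro sum_norm_le)
      fix v w assume vw: "v \<in> V" "w \<in> W"
      then have "cmod (b (indicator (A v)) (indicator (B w)) - b' (indicator (A v)) (indicator (B w))) \<le> \<delta>"
        using close[rule_format, of "A v" "B w"] by auto
      then show "cmod (v * cnj w * (b (indicator (A v)) (indicator (B w)) - b' (indicator (A v)) (indicator (B w))))
          \<le> cmod v * cmod w * \<delta>"
        by (simp add: norm_mult mult_left_mono)
    qed
    also have "\<dots> = c * \<delta>" by (simp add: c_def sum_distrib_right)
    also have "\<dots> < e / 3" by (rule \<delta>)
    finally have mid: "cmod (b s t - b' s t) < e / 3" .
    have tri: "cmod (p + q - r) \<le> cmod p + cmod q + cmod r" for p q r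
      using norm_triangle_ineq4[of "p + q" r] norm_triangle_ineq[of p q] by linarith
    have "cmod (b f g - b' f g) \<le> cmod (b f g - b s t) + cmod (b s t - b' s t) + cmod (b' f g - b' s t)"
      using tri[of "b f g - b s t" "b s t - b' s t" "b' f g - b' s t"] by simp
    then show "cmod (b f g - b' f g) < e" using mid near[OF b(1)] near[OF b(2)] by linarith
  qed
qed

lemma nonneg_Reals_integral:
  fixes f :: "'a \<Rightarrow> complex"
  assumes "AE x in M. f x \<in> \<real>\<^sub>\<ge>\<^sub>0" "f \<in> borel_measurable M"
  shows "(LINT x|M. f x) \<in> \<real>\<^sub>\<ge>\<^sub>0"
proof -
  have "(LINT x|M. f x) = (LINT x|M. complex_of_real (max 0 (Re (f x))))"
  proof (rule integral_cong_AE)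
    show "AE x in M. f x = complex_of_real (max 0 (Re (f x)))"
      using assms(1) by eventually_elim (auto simp: complex_nonneg_Reals_iff complex_eq_iff)
  qed (use assms(2) in measurable)
  also have "\<dots> = complex_of_real (LINT x|M. max 0 (Re (f x)))"
    by (rule integral_complex_of_real)
  also have "\<dots> \<in> \<real>\<^sub>\<ge>\<^sub>0" by (simp add: integral_nonneg_AE)
  finally show ?thesis .
qed

lemma ip_nonneg:
  assumes "f \<in> square_integrable M" "g \<in> square_integrable M"
    "AE x in M. f x \<in> \<real>\<^sub>\<ge>\<^sub>0" "AE x in M. g x \<in> \<real>\<^sub>\<ge>\<^sub>0"
  shows "ip M f g \<in> \<real>\<^sub>\<ge>\<^sub>0"
  unfolding ip_def
proof (rule nonneg_Reals_integral)
  show "AE x in M. f x * cnj (g x) \<in> \<real>\<^sub>\<ge>\<^sub>0"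
    using assms(3,4) by eventually_elim (auto simp: complex_nonneg_Reals_iff)
qed (use sq_measurable[OF assms(1)] sq_measurable[OF assms(2)] in measurable)

section \<open>Positive functionals and their densities\<close>

context finite_measure
begin

text \<open>
  Riesz representation of a positive functional: the set function \<open>A \<mapsto> b f 1\<^sub>A\<close> is an absolutely
  continuous measure, and testing against simple minorants of its density bounds the density in $L_2$.
\<close>

lemma positive_form_representation:
  assumes b: "contraction_form M b" and f: "f \<in> square_integrable M"
    and pos: "\<And>g. g \<in> square_integrable M \<Longrightarrow> AE x in M. g x \<in> \<real>\<^sub>\<ge>\<^sub>0 \<Longrightarrow> b f g \<in> \<real>\<^sub>\<ge>\<^sub>0"
  obtains k where "k \<in> square_integrable M" "AE x in M. k x \<in> \<real>\<^sub>\<ge>\<^sub>0"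
    "\<And>g. g \<in> square_integrable M \<Longrightarrow> b f g = ip M k g"
proof -
  define \<nu> where "\<nu> A = Re (b f (indicator A))" for A
  have b\<nu>: "b f (indicator A) = complex_of_real (\<nu> A)" and \<nu>0: "0 \<le> \<nu> A" if "A \<in> sets M" for A
  proof -
    have "b f (indicator A) \<in> \<real>\<^sub>\<ge>\<^sub>0" using that by (intro pos sq_indicator) (auto simp: indicator_def)
    then show "b f (indicator A) = complex_of_real (\<nu> A)" "0 \<le> \<nu> A"
      by (auto simp: \<nu>_def complex_nonneg_Reals_iff complex_eq_iff)
  qed
  have nrm_ind: "nrm M (indicator A) = sqrt (measure M A)" if "A \<in> sets M" for A
  proof -
    have "(\<lambda>x. (cmod (indicator A x))\<^sup>2) = (indicator A :: 'a \<Rightarrow> real)" by (auto simp: indicator_def)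
    then show ?thesis using that sets.sets_into_space[OF that] by (simp add: nrm_def Int_absorb2)
  qed
  \<comment> \<open>The source of countable additivity as well as of absolute continuity.\<close>
  have \<nu>_le: "\<nu> A \<le> nrm M f * sqrt (measure M A)" if A: "A \<in> sets M" for A
    using contraction_formD(1)[OF b f sq_indicator[OF A]] b\<nu>[OF A] \<nu>0[OF A] nrm_ind[OF A] by simp
  have \<nu>_Un: "\<nu> (A \<union> B) = \<nu> A + \<nu> B" if "A \<in> sets M" "B \<in> sets M" "A \<inter> B = {}" for A B
  proof -
    have "indicator (A \<union> B) = (\<lambda>x. indicator A x + indicator B x :: complex)"
      using that(3) by (auto simp: fun_eq_iff indicator_def)
    then show ?thesis
      using contraction_formD(5)[OF b sq_indicator[OF that(1)] sq_indicator[OF that(2)] f] by (simp add: \<nu>_def)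
  qed
  have \<nu>_empty: "\<nu> {} = 0" using \<nu>_Un[of "{}" "{}"] by simp
  define N where "N = measure_of (space M) (sets M) (\<lambda>A. ennreal (\<nu> A))"
  have setsN: "sets N = sets M" by (simp add: N_def)
  have N: "emeasure N A = ennreal (\<nu> A)" if "A \<in> sets M" for A
  proof (rule emeasure_measure_of[OF N_def])
    show "positive (sets N) (\<lambda>A. ennreal (\<nu> A))" by (simp add: positive_def \<nu>_empty)
    show "countably_additive (sets N) (\<lambda>A. ennreal (\<nu> A))"
      unfolding countably_additive_def
    proof (intro allI impI)
      fix A :: "nat \<Rightarrow> 'a set"
      assume A: "range A \<subseteq> sets N" "disjoint_family A" "\<Union> (range A) \<in> sets N"
      then have As: "A i \<in> sets M" for i using setsN by auto
      define U where "U n = (\<Union>i<n. A i)" for n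
      have U: "U n \<in> sets M" for n using As by (auto simp: U_def)
      have \<nu>U: "\<nu> (U n) = (\<Sum>i<n. \<nu> (A i))" for n
      proof (induction n)
        case (Suc n)
        have "U n \<inter> A n = {}"
        proof -
          have "A i \<inter> A n = {}" if "i < n" for i
            using A(2) that by (auto simp: disjoint_family_on_def)
          then show ?thesis by (auto simp: U_def)
        qed
        moreover have "U (Suc n) = U n \<union> A n" by (auto simp: U_def lessThan_Suc)
        ultimately show ?case using \<nu>_Un[OF U As] Suc by simp
      qed (simp add: U_def \<nu>_empty)
      let ?U = "\<Union>(range A)"
      have Us: "?U \<in> sets M" using A(3) setsN by simp
      \<comment> \<open>Finite additivity leaves the tail \<open>?U - U n\<close>, whose value is at
        most a multiple of the square root of a measure tending to 0.\<close>
      have "(\<lambda>n. measure M (U n)) \<longlonglongrightarrow> measure M (\<Union>n. U n)"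
      proof (rule finite_Lim_measure_incseq)
        show "incseq U" unfolding incseq_def U_def by (intro allI impI UN_mono) auto
      qed (use U in auto)
      moreover have "(\<Union>n. U n) = ?U" by (auto simp: U_def)
      ultimately have "(\<lambda>n. nrm M f * sqrt (measure M ?U - measure M (U n))) \<longlonglongrightarrow> nrm M f * sqrt (measure M ?U - measure M ?U)"
        by (intro tendsto_intros) simp
      then have lim0: "(\<lambda>n. nrm M f * sqrt (measure M ?U - measure M (U n))) \<longlonglongrightarrow> 0" by simp
      have "(\<lambda>n. \<nu> ?U - \<nu> (U n)) \<longlonglongrightarrow> 0"
      proof (rule tendsto_sandwich[OF _ _ tendsto_const lim0]; intro always_eventually allI)
        fix n
        have UU: "U n \<subseteq> ?U" by (auto simp: U_def)
        have "\<nu> ?U = \<nu> (U n) + \<nu> (?U - U n)"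
          using \<nu>_Un[of "U n" "?U - U n"] U Us UU by (simp add: Un_absorb1)
        then have eq: "\<nu> ?U - \<nu> (U n) = \<nu> (?U - U n)" by simp
        show "0 \<le> \<nu> ?U - \<nu> (U n)" unfolding eq using U Us by (intro \<nu>0) auto
        show "\<nu> ?U - \<nu> (U n) \<le> nrm M f * sqrt (measure M ?U - measure M (U n))"
          unfolding eq using \<nu>_le[of "?U - U n"] U Us UU by (simp add: finite_measure_Diff)
      qed
      then have "(\<lambda>n. \<nu> ?U - (\<nu> ?U - \<nu> (U n))) \<longlonglongrightarrow> \<nu> ?U - 0" by (intro tendsto_diff tendsto_const)
      then have "(\<lambda>i. \<nu> (A i)) sums \<nu> ?U" by (simp add: sums_def \<nu>U)
      then show "(\<Sum>i. ennreal (\<nu> (A i))) = ennreal (\<nu> ?U)"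
        using \<nu>0[OF As] by (intro sums_unique[symmetric]) (simp add: sums_ennreal \<nu>0 Us)
    qed
  qed (use that setsN sets.space_closed in auto)
  have "absolutely_continuous M N"
    unfolding absolutely_continuous_def
  proof
    fix A assume "A \<in> null_sets M"
    then have A: "A \<in> sets M" "measure M A = 0" by (auto simp: measure_eq_0_null_sets)
    then show "A \<in> null_sets N"
      using \<nu>_le[OF A(1)] \<nu>0[OF A(1)] N[OF A(1)] setsN by (auto simp: null_sets_def)
  qed
  then obtain d where d [measurable]: "d \<in> borel_measurable M" and dN: "density M d = N"
    using Radon_Nikodym[of N] setsN by blast
  have dA: "(\<integral>\<^sup>+x. d x * indicator A x \<partial>M) = ennreal (\<nu> A)" if "A \<in> sets M" for A
    using N[OF that] emeasure_density[OF d that] dN by simp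
  \<comment> \<open>\<open>enn2real\<close> sends an infinite density to 0; since the total mass is
    finite this changes \<open>d\<close> only on a null set.\<close>
  define r where "r x = enn2real (d x)" for x
  have r [measurable]: "r \<in> borel_measurable M" unfolding r_def by measurable
  have r0: "0 \<le> r x" for x by (simp add: r_def)
  have "(\<integral>\<^sup>+x. d x \<partial>M) \<noteq> \<infinity>"
    using dA[OF sets.top] by (simp cong: nn_integral_cong)
  then have dfin: "AE x in M. d x = ennreal (r x)"
    using nn_integral_noteq_infinite[OF d] by (auto simp: r_def less_top)
  have rA: "has_bochner_integral M (\<lambda>x. r x * indicator A x) (\<nu> A)" if A: "A \<in> sets M" for A
  proof (rule has_bochner_integral_nn_integral)
    have "(\<integral>\<^sup>+x. ennreal (r x * indicator A x) \<partial>M) = (\<integral>\<^sup>+x. d x * indicator A x \<partial>M)"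
      using dfin by (intro nn_integral_cong_AE, eventually_elim) (simp add: ennreal_mult'' ennreal_indicator)
    then show "(\<integral>\<^sup>+x. ennreal (r x * indicator A x) \<partial>M) = ennreal (\<nu> A)" using dA[OF A] by simp
  qed (use A r0 \<nu>0 in auto)
  define k where "k x = complex_of_real (r x)" for x
  have k [measurable]: "k \<in> borel_measurable M" unfolding k_def by measurable
  have kA: "has_bochner_integral M (\<lambda>x. k x * cnj (v * indicator A x)) (cnj v * complex_of_real (\<nu> A))"
    if A: "A \<in> sets M" for A v
  proof -
    have "has_bochner_integral M (\<lambda>x. cnj v * complex_of_real (r x * indicator A x)) (cnj v * complex_of_real (\<nu> A))"
      by (intro has_bochner_integral_mult_right has_bochner_integral_of_real rA[OF A])
    moreover have "(\<lambda>x. cnj v * complex_of_real (r x * indicator A x)) = (\<lambda>x. k x * cnj (v * indicator A x))"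
      by (auto simp: k_def indicator_def)
    ultimately show ?thesis by simp
  qed
  have simple: "has_bochner_integral M (\<lambda>x. k x * cnj (\<Sum>v\<in>V. v * indicator (A v) x))
      (b f (\<lambda>x. \<Sum>v\<in>V. v * indicator (A v) x))" if "\<And>v. A v \<in> sets M" for V A
  proof -
    have "b f (\<lambda>x. \<Sum>v\<in>V. v * indicator (A v) x) = (\<Sum>v\<in>V. cnj v * complex_of_real (\<nu> (A v)))"
      using that
      by (subst contraction_form_sum(2)[OF b _ f])
         (auto intro!: sq_scale sq_indicator sum.cong simp: contraction_formD(3)[OF b f sq_indicator] b\<nu>)
    moreover have "has_bochner_integral M (\<lambda>x. \<Sum>v\<in>V. k x * cnj (v * indicator (A v) x))
        (\<Sum>v\<in>V. cnj v * complex_of_real (\<nu> (A v)))"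
      using that by (intro has_bochner_integral_sum kA)
    ultimately show ?thesis by (simp add: sum_distrib_left)
  qed
  obtain s where s: "incseq s" "\<And>i. simple_function M (s i)" "\<And>x. bdd_above (range (\<lambda>i. s i x))"
    "\<And>i x. 0 \<le> s i x" "r = (SUP i. s i)"
  proof -
    from borel_measurable_implies_simple_function_sequence_real[OF r r0]
    obtain s where "incseq s \<and> (\<forall>i. simple_function M (s i)) \<and> (\<forall>x. bdd_above (range (\<lambda>i. s i x))) \<and>
             (\<forall>i x. 0 \<le> s i x) \<and> r = (SUP i. s i)" by (elim exE) (rule that)
    then show ?thesis by (intro that[of s]) auto
  qed
  have smono: "s i x \<le> s j x" if "i \<le> j" for i j x using s(1) that by (auto simp: incseq_def le_fun_def)
  have rS: "r x = (SUP i. s i x)" for x by (simp add: s(5) image_image)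
  have s_le: "s i x \<le> r x" for i x unfolding rS using s(3) by (intro cSUP_upper) auto
  have s_lim: "(\<lambda>i. s i x) \<longlonglongrightarrow> r x" for x
    unfolding rS using s(3) smono by (intro LIMSEQ_incseq_SUP) (auto simp: incseq_def)
  have sm [measurable]: "s i \<in> borel_measurable M" for i using s(2) by (rule borel_measurable_simple_function)
  have s2: "integrable M (\<lambda>x. (s i x)\<^sup>2) \<and> (LINT x|M. (s i x)\<^sup>2) \<le> (nrm M f)\<^sup>2" for i
  proof -
    define S where "S x = complex_of_real (s i x)" for x
    have SS: "simple_function M S" unfolding S_def using s(2) by (rule simple_function_compose1)
    define A where "A v = S -` {v} \<inter> space M" for v
    have A: "A v \<in> sets M" for v unfolding A_def by (rule simple_functionD(2)[OF SS])
    have SA: "S x = (\<Sum>v\<in>S ` space M. v * indicator (A v) x)" if x: "x \<in> space M" for x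
    proof -
      have "(\<Sum>v\<in>S ` space M. v * indicator (A v) x) = (\<Sum>v\<in>S ` space M. if v = S x then v else 0)"
        using x by (intro sum.cong) (auto simp: A_def indicator_def)
      also have "\<dots> = S x" using x simple_functionD(1)[OF SS] by (subst sum.delta) auto
      finally show ?thesis by simp
    qed
    obtain C where C: "\<And>x. x \<in> space M \<Longrightarrow> cmod (S x) \<le> C"
      using bounded_iff[of "S ` space M"] finite_imp_bounded[OF simple_functionD(1)[OF SS]] by auto
    have Ssq: "S \<in> square_integrable M" using C borel_measurable_simple_function[OF SS] by (rule sq_bounded[rotated])
    let ?S = "\<lambda>x. \<Sum>v\<in>S ` space M. v * indicator (A v) x"
    have Ssq': "?S \<in> square_integrable M" by (intro sq_sum sq_scale sq_indicator A)
    have bS: "b f S = b f ?S"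
    proof (rule contraction_form_cong_AE[OF b f f Ssq Ssq'])
      show "AE x in M. S x = ?S x" by (rule AE_I2) (rule SA)
    qed simp
    have "has_bochner_integral M (\<lambda>x. k x * cnj (S x)) (b f S)"
    proof -
      have "has_bochner_integral M (\<lambda>x. k x * cnj (S x)) (b f S) \<longleftrightarrow>
          has_bochner_integral M (\<lambda>x. k x * cnj (?S x)) (b f ?S)"
      proof (rule has_bochner_integral_cong)
        fix x assume x: "x \<in> space M"
        show "k x * cnj (S x) = k x * cnj (?S x)" by (subst SA[OF x]) (rule refl)
      qed (simp_all add: bS)
      then show ?thesis using simple[of A, OF A] by blast
    qed
    then have hb: "has_bochner_integral M (\<lambda>x. Re (k x * cnj (S x))) (Re (b f S))"
      by (rule has_bochner_integral_Re)
    have int: "integrable M (\<lambda>x. (s i x)\<^sup>2)" using sq_integrable[OF Ssq] by (simp add: S_def)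
    have nS: "(nrm M S)\<^sup>2 = (LINT x|M. (s i x)\<^sup>2)" by (simp add: nrm_power2 S_def)
    \<comment> \<open>The minorant is tested against itself: the square of \<open>nrm M S\<close> is
      at most the integral of \<open>k\<close> against \<open>S\<close>, which equals
      \<open>b f S\<close> and is at most \<open>nrm M f * nrm M S\<close>. Division by
      \<open>nrm M S\<close> gives a bound that does not depend on \<open>i\<close>.\<close>
    have "(LINT x|M. (s i x)\<^sup>2) \<le> (LINT x|M. Re (k x * cnj (S x)))"
    proof (rule integral_mono[OF int])
      show "integrable M (\<lambda>x. Re (k x * cnj (S x)))" using hb by (rule has_bochner_integral_iff[THEN iffD1, THEN conjunct1])
      show "(s i x)\<^sup>2 \<le> Re (k x * cnj (S x))" for x
        using s_le[of i x] s(4)[of i x] by (simp add: k_def S_def power2_eq_square mult_right_mono)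
    qed
    also have "\<dots> = Re (b f S)" using hb by (simp add: has_bochner_integral_iff)
    also have "\<dots> \<le> nrm M f * nrm M S"
      using contraction_formD(1)[OF b f Ssq] complex_Re_le_cmod[of "b f S"] by linarith
    finally have *: "(nrm M S)\<^sup>2 \<le> nrm M f * nrm M S" by (simp add: nS)
    have "nrm M S \<le> nrm M f"
    proof (cases "nrm M S = 0")
      case False
      then have "0 < nrm M S" using nrm_nonneg[of M S] by simp
      then show ?thesis using * by (simp add: power2_eq_square)
    qed (simp add: nrm_nonneg)
    then have "(nrm M S)\<^sup>2 \<le> (nrm M f)\<^sup>2" by (intro power_mono nrm_nonneg)
    then show ?thesis using int nS by simp
  qed
  have "integrable M (\<lambda>x. (r x)\<^sup>2)"
  proof -
    have "incseq (\<lambda>i. LINT x|M. (s i x)\<^sup>2)"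
      using s2 smono s(4) by (intro incseq_SucI integral_mono) (auto intro!: power_mono)
    then obtain l where "(\<lambda>i. LINT x|M. (s i x)\<^sup>2) \<longlonglongrightarrow> l"
      using s2 by (elim incseq_convergent[of _ "(nrm M f)\<^sup>2"]) auto
    then show ?thesis
    proof (rule integrable_monotone_convergence[rotated 3])
      show "AE x in M. (\<lambda>i. (s i x)\<^sup>2) \<longlonglongrightarrow> (r x)\<^sup>2" by (intro AE_I2 tendsto_intros s_lim)
      show "AE x in M. mono (\<lambda>i. (s i x)\<^sup>2)" using smono s(4) by (intro AE_I2 monoI power_mono)
    qed (use s2 in auto)
  qed
  then have ksq: "k \<in> square_integrable M" by (simp add: square_integrable_def k_def)
  have "b f g = ip M k g" if g: "g \<in> square_integrable M" for g
  proof -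
    have "cmod (b f g - ip M k g) \<le> 0 + e" if e: "0 < e" for e
    proof -
      \<comment> \<open>Both functionals agree on simple functions and are bounded, with constants
        \<open>nrm M f\<close> and \<open>nrm M k\<close>, which determines the quality of
        approximation required.\<close>
      define e' where "e' = e / (nrm M f + nrm M k + 1)"
      have e': "0 < e'" using e nrm_nonneg[of M f] nrm_nonneg[of M k] by (simp add: e'_def add_nonneg_pos)
      obtain V A where VA: "finite V" "\<And>v. A v \<in> sets M"
        "nrm M (\<lambda>x. g x - (\<Sum>v\<in>V. v * indicator (A v) x)) < e'"
        by (rule sq_simple_approx[OF g e']) (rule that)
      define t where "t x = (\<Sum>v\<in>V. v * indicator (A v) x)" for x
      have t: "t \<in> square_integrable M" unfolding t_def by (intro sq_sum sq_scale sq_indicator VA)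
      have "b f t = ip M k t"
        unfolding ip_def t_def using simple[of A V, OF VA(2)] by (rule has_bochner_integral_integral_eq[symmetric])
      then have "b f g - ip M k g = b f (\<lambda>x. g x - t x) - ip M k (\<lambda>x. g x - t x)"
        using contraction_form_diff(2)[OF b g t f] ip_diff_right[OF g t ksq] by simp
      then have "cmod (b f g - ip M k g) \<le> cmod (b f (\<lambda>x. g x - t x)) + cmod (ip M k (\<lambda>x. g x - t x))"
        by (simp add: norm_triangle_ineq4)
      also have "\<dots> \<le> (nrm M f + nrm M k) * nrm M (\<lambda>x. g x - t x)"
        using contraction_formD(1)[OF b f sq_diff[OF g t]] ip_Cauchy_Schwarz[OF ksq sq_diff[OF g t]]
        by (simp add: distrib_right)
      also have "\<dots> \<le> (nrm M f + nrm M k) * e'"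
        using VA(3) nrm_nonneg[of M f] nrm_nonneg[of M k] by (intro mult_left_mono) (auto simp: t_def)
      also have "\<dots> \<le> e" using e nrm_nonneg[of M f] nrm_nonneg[of M k] by (simp add: e'_def field_simps add_nonneg_pos)
      finally show ?thesis by simp
    qed
    then have "cmod (b f g - ip M k g) \<le> 0" by (rule field_le_epsilon)
    then show ?thesis by simp
  qed
  then show ?thesis using that[OF ksq] r0 by (simp add: k_def)
qed

end

section \<open>The correspondence between Markov operators and Markov forms\<close>

lemma l2_eqI:
  assumes F: "F \<in> L2 M" and G: "G \<in> L2 M"
    and eq: "\<And>g. g \<in> square_integrable M \<Longrightarrow> l2_inner M F (l2_class M g) = l2_inner M G (l2_class M g)"
  shows "F = G"
proof -
  define f where "f = rep F"
  define g where "g = rep G"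
  have f: "f \<in> square_integrable M" "F = l2_class M f" using L2_rep[OF F] by (simp_all add: f_def)
  have g: "g \<in> square_integrable M" "G = l2_class M g" using L2_rep[OF G] by (simp_all add: g_def)
  have d: "(\<lambda>x. f x - g x) \<in> square_integrable M" using f(1) g(1) by (rule sq_diff)
  have "ip M f (\<lambda>x. f x - g x) = ip M g (\<lambda>x. f x - g x)"
    using eq[OF d] f g d by (simp add: l2_inner_class)
  then have "ip M (\<lambda>x. f x - g x) (\<lambda>x. f x - g x) = 0"
    using ip_diff_left[OF f(1) g(1) d] by simp
  then have "nrm M (\<lambda>x. f x - g x) = 0" using ip_self[OF d] by simp
  then have "AE x in M. f x = g x" using nrm_zero_AE[OF d] by simp
  then show ?thesis unfolding f(2) g(2) using f(1) g(1) by (subst l2_class_eq_iff)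
qed

lemma l2_norm_rep: "F \<in> L2 M \<Longrightarrow> l2_norm M F = nrm M (rep F)"
  using L2_rep[of F M] l2_norm_class[of "rep F" M] by simp

lemma op_form_rep:
  assumes "K (l2_class M f) \<in> L2 M" "g \<in> square_integrable M"
  shows "op_form M K f g = ip M (rep (K (l2_class M f))) g"
  using L2_rep[OF assms(1)] l2_inner_class[OF L2_rep(1)[OF assms(1)] assms(2)] by (simp add: op_form_def)

lemma bounded_ops_L2: "K \<in> bounded_ops M \<Longrightarrow> F \<in> L2 M \<Longrightarrow> K F \<in> L2 M"
  by (auto simp: bounded_ops_def PiE_iff)

text \<open>By homogeneity the vector may be normalised. The bound \<open>B\<close> of a bounded
  operator does two further things: it settles vectors of norm zero, and it shows that the supremum
  in \<open>op_norm\<close> is taken over a bounded set, without which its value would say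
  nothing.\<close>

lemma contractions_norm_le:
  assumes K: "K \<in> contractions M" and F: "F \<in> L2 M"
  shows "l2_norm M (K F) \<le> l2_norm M F"
proof -
  have Kb: "K \<in> bounded_ops M" and K1: "op_norm M K \<le> 1" using K by (auto simp: contractions_def)
  obtain B where B': "\<forall>F\<in>L2 M. l2_norm M (K F) \<le> B * l2_norm M F"
    using Kb by (auto simp: bounded_ops_def)
  then have B: "l2_norm M (K F) \<le> B * l2_norm M F" if "F \<in> L2 M" for F using that by auto
  define n where "n = l2_norm M F"
  have n0: "0 \<le> n" using F by (simp add: n_def l2_norm_rep nrm_nonneg)
  show ?thesis
  proof (cases "n = 0")
    case True
    then show ?thesis using B[OF F] by (simp add: n_def)
  next
    case False
    then have n: "0 < n" using n0 by simp
    let ?c = "complex_of_real (1 / n)"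
    have scale: "l2_norm M (l2_scale M ?c G) = l2_norm M G / n" if G: "G \<in> L2 M" for G
    proof -
      have "l2_norm M (l2_scale M c (l2_class M (rep G))) = cmod c * l2_norm M (l2_class M (rep G))" for c
        using L2_rep(1)[OF G] by (simp add: l2_scale_class l2_norm_class sq_scale nrm_scale)
      then show ?thesis using L2_rep(2)[OF G] n by (simp add: norm_divide)
    qed
    have cF: "l2_scale M ?c F \<in> L2 M"
      using L2_rep[OF F] l2_scale_class[of "rep F" M ?c] sq_scale l2_class_in_L2 by metis
    have "l2_norm M (K (l2_scale M ?c F)) \<le> op_norm M K"
      unfolding op_norm_def
    proof (rule cSUP_upper)
      show "l2_scale M ?c F \<in> {F \<in> L2 M. l2_norm M F \<le> 1}"
        using cF scale[OF F] n by (simp add: n_def)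
      show "bdd_above ((\<lambda>F. l2_norm M (K F)) ` {F \<in> L2 M. l2_norm M F \<le> 1})"
      proof (rule bdd_aboveI2)
        fix G assume G: "G \<in> {F \<in> L2 M. l2_norm M F \<le> 1}"
        have "0 \<le> l2_norm M G" using G by (simp add: l2_norm_rep nrm_nonneg)
        then have "B * l2_norm M G \<le> \<bar>B\<bar> * l2_norm M G" by (intro mult_right_mono) auto
        also have "\<dots> \<le> \<bar>B\<bar> * 1" using G by (intro mult_left_mono) auto
        finally show "l2_norm M (K G) \<le> \<bar>B\<bar>" using B[of G] G by simp
      qed
    qed
    moreover have "K (l2_scale M ?c F) = l2_scale M ?c (K F)"
      using Kb F by (auto simp: bounded_ops_def)
    ultimately have "l2_norm M (K F) / n \<le> 1"
      using scale[OF bounded_ops_L2[OF Kb F]] K1 by simp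
    then show ?thesis using n by (simp add: n_def)
  qed
qed

lemma contraction_form_op_form:
  assumes K: "K \<in> contractions M"
  shows "contraction_form M (op_form M K)"
proof -
  have Kb: "K \<in> bounded_ops M" using K by (simp add: contractions_def)
  have KL: "K (l2_class M f) \<in> L2 M" if "f \<in> square_integrable M" for f
    using bounded_ops_L2[OF Kb l2_class_in_L2[OF that]] .
  define \<kappa> where "\<kappa> f = rep (K (l2_class M f))" for f
  have \<kappa>: "\<kappa> f \<in> square_integrable M" "K (l2_class M f) = l2_class M (\<kappa> f)" if "f \<in> square_integrable M" for f
    using L2_rep[OF KL[OF that]] by (simp_all add: \<kappa>_def)
  have form: "op_form M K f g = ip M (\<kappa> f) g" if "f \<in> square_integrable M" "g \<in> square_integrable M" for f g
    using op_form_rep[of K M f g, OF KL[OF that(1)] that(2)] by (simp add: \<kappa>_def)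
  have add: "K (l2_class M (\<lambda>x. f x + g x)) = l2_class M (\<lambda>x. \<kappa> f x + \<kappa> g x)"
    if fg: "f \<in> square_integrable M" "g \<in> square_integrable M" for f g
  proof -
    have "K (l2_add M (l2_class M f) (l2_class M g)) = l2_add M (K (l2_class M f)) (K (l2_class M g))"
      using Kb l2_class_in_L2[OF fg(1)] l2_class_in_L2[OF fg(2)] by (simp add: bounded_ops_def)
    then show ?thesis using fg by (simp add: l2_add_class \<kappa>)
  qed
  have scale: "K (l2_class M (\<lambda>x. c * f x)) = l2_class M (\<lambda>x. c * \<kappa> f x)"
    if f: "f \<in> square_integrable M" for f c
  proof -
    have "K (l2_scale M c (l2_class M f)) = l2_scale M c (K (l2_class M f))"
      using Kb l2_class_in_L2[OF f] by (simp add: bounded_ops_def)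
    then show ?thesis using f by (simp add: l2_scale_class \<kappa>)
  qed
  show ?thesis
    unfolding contraction_form_def
  proof (intro conjI ballI allI)
    fix f g h assume fgh: "f \<in> square_integrable M" "g \<in> square_integrable M" "h \<in> square_integrable M"
    show "op_form M K (\<lambda>x. f x + g x) h = op_form M K f h + op_form M K g h"
      using fgh by (simp add: form op_form_def[of M K "\<lambda>x. f x + g x"] add l2_inner_class sq_add \<kappa> ip_add_left)
    show "op_form M K h (\<lambda>x. f x + g x) = op_form M K h f + op_form M K h g"
      using fgh by (simp add: form sq_add \<kappa> ip_add_right)
  next
    fix f g c assume fg: "f \<in> square_integrable M" "g \<in> square_integrable M"
    show "op_form M K (\<lambda>x. c * f x) g = c * op_form M K f g"
      using fg by (simp add: form op_form_def[of M K "\<lambda>x. c * f x"] scale l2_inner_class sq_scale \<kappa> ip_scale_left)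
    show "op_form M K f (\<lambda>x. c * g x) = cnj c * op_form M K f g"
      using fg by (simp add: form sq_scale \<kappa> ip_scale_right)
  next
    fix f g assume fg: "f \<in> square_integrable M" "g \<in> square_integrable M"
    have "nrm M (\<kappa> f) \<le> nrm M f"
      using contractions_norm_le[OF K l2_class_in_L2[OF fg(1)]] fg by (simp add: \<kappa> l2_norm_class)
    then show "cmod (op_form M K f g) \<le> nrm M f * nrm M g"
      using ip_Cauchy_Schwarz[OF \<kappa>(1)[OF fg(1)] fg(2)] mult_right_mono[OF _ nrm_nonneg[of M g]]
      unfolding form[OF fg] by (meson order_trans)
  qed
qed

text \<open>\<open>op_adjoint\<close> is a definite description. Uniqueness holds because a vector
  is determined by its inner products; existence is supplied by the candidate
  \<open>H\<close>.\<close>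

lemma op_adjointI:
  assumes "H \<in> L2 M" "G \<in> L2 M" "\<And>F. F \<in> L2 M \<Longrightarrow> l2_inner M (K F) G = l2_inner M F H"
  shows "op_adjoint M K G = H"
proof -
  have "(THE H. H \<in> L2 M \<and> (\<forall>F\<in>L2 M. l2_inner M (K F) G = l2_inner M F H)) = H"
  proof (rule the_equality)
    fix H' assume H': "H' \<in> L2 M \<and> (\<forall>F\<in>L2 M. l2_inner M (K F) G = l2_inner M F H')"
    show "H' = H"
    proof (rule l2_eqI)
      fix g assume g: "g \<in> square_integrable M"
      have "l2_inner M (l2_class M g) H' = l2_inner M (l2_class M g) H"
        using H' assms(3) l2_class_in_L2[OF g] by metis
      then show "l2_inner M H' (l2_class M g) = l2_inner M H (l2_class M g)"
        unfolding l2_inner_def ip_def[symmetric] by (subst (1 2) ip_cnj) simp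
    qed (use H' assms in auto)
  qed (use assms in auto)
  then show ?thesis using assms(2) by (simp add: op_adjoint_def)
qed

context finite_measure
begin

lemma l2_one_L2: "l2_one M \<in> L2 M"
  unfolding l2_one_def by (rule l2_class_in_L2[OF sq_one])

text \<open>The hypothesis on the adjoint becomes usable only after a vector with the defining
  property of the description has been exhibited. Such a vector exists because pairing
  \<open>K F\<close> with 1 is a positive functional and hence has a density.\<close>

lemma markov_form_op_form:
  assumes K: "K \<in> markov_ops M"
  shows "markov_form M (op_form M K)"
proof -
  have Kc: "K \<in> contractions M" and K1: "K (l2_one M) = l2_one M" "op_adjoint M K (l2_one M) = l2_one M"
    and Kpos: "\<And>F. F \<in> L2 M \<Longrightarrow> l2_nonneg M F \<Longrightarrow> l2_nonneg M (K F)"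
    using K by (auto simp: markov_ops_def)
  have Kb: "K \<in> bounded_ops M" using Kc by (simp add: contractions_def)
  have cf: "contraction_form M (op_form M K)" using Kc by (rule contraction_form_op_form)
  have pos: "op_form M K f g \<in> \<real>\<^sub>\<ge>\<^sub>0"
    if fg: "f \<in> square_integrable M" "g \<in> square_integrable M" "AE x in M. f x \<in> \<real>\<^sub>\<ge>\<^sub>0" "AE x in M. g x \<in> \<real>\<^sub>\<ge>\<^sub>0" for f g
  proof -
    have L: "K (l2_class M f) \<in> L2 M" using bounded_ops_L2[OF Kb l2_class_in_L2[OF fg(1)]] .
    have "l2_nonneg M (K (l2_class M f))"
      using fg by (intro Kpos l2_class_in_L2) (simp_all add: l2_nonneg_class)
    then show ?thesis
      unfolding op_form_rep[of K M f g, OF L fg(2)] l2_nonneg_def using L2_rep(1)[OF L] fg by (intro ip_nonneg)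
  qed
  \<comment> \<open>The form of the adjoint of \<open>K\<close>; representing it at the constant 1
    yields the adjoint vector.\<close>
  define b where "b f g = cnj (op_form M K g f)" for f g
  have b: "contraction_form M b"
    unfolding contraction_form_def b_def
    by (intro conjI ballI allI)
       (simp_all add: contraction_formD(2-5)[OF cf] contraction_formD(1)[OF cf, THEN order_trans] mult.commute)
  obtain k where k: "k \<in> square_integrable M" "\<And>g. g \<in> square_integrable M \<Longrightarrow> b (\<lambda>_. 1) g = ip M k g"
  proof (rule positive_form_representation[OF b sq_one])
    show "b (\<lambda>_. 1) g \<in> \<real>\<^sub>\<ge>\<^sub>0" if "g \<in> square_integrable M" "AE x in M. g x \<in> \<real>\<^sub>\<ge>\<^sub>0" for g
      using pos[OF that(1) sq_one that(2)] by (auto simp: b_def complex_nonneg_Reals_iff)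
  qed (rule that)
  have adj: "l2_inner M (K F) (l2_one M) = l2_inner M F (l2_class M k)" if F: "F \<in> L2 M" for F
  proof -
    have f: "rep F \<in> square_integrable M" "l2_class M (rep F) = F" using L2_rep[OF F] by auto
    have "op_form M K (rep F) (\<lambda>_. 1) = cnj (ip M k (rep F))"
      using k(2)[OF f(1)] unfolding b_def by (metis complex_cnj_cnj)
    also have "\<dots> = ip M (rep F) k" using ip_cnj by metis
    finally show ?thesis
      using l2_inner_class[OF f(1) k(1)] f(2) by (simp add: op_form_def l2_one_def)
  qed
  have "op_adjoint M K (l2_one M) = l2_class M k"
    using adj by (intro op_adjointI l2_class_in_L2 k l2_one_L2)
  then have k1: "l2_class M k = l2_one M" using K1(2) by simp
  show ?thesis
    unfolding markov_form_def
  proof (intro conjI ballI impI cf pos)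
    fix f assume f: "f \<in> square_integrable M"
    show "op_form M K (\<lambda>_. 1) f = ip M (\<lambda>_. 1) f"
      using K1(1) l2_inner_class[OF sq_one f] by (simp add: op_form_def l2_one_def)
    show "op_form M K f (\<lambda>_. 1) = ip M f (\<lambda>_. 1)"
      using adj[OF l2_class_in_L2[OF f]] k1 l2_inner_class[OF f sq_one] by (simp add: op_form_def l2_one_def)
  qed
qed

text \<open>Positivity of the form represents it at nonnegative arguments; a general
  \<open>f\<close> is a combination of the positive and negative parts of its real and imaginary
  part, and representability is preserved by linear combinations.\<close>

lemma markov_form_representation:
  assumes mb: "markov_form M b" and f: "f \<in> square_integrable M"
  shows "\<exists>k\<in>square_integrable M. \<forall>g\<in>square_integrable M. b f g = ip M k g"
proof -
  have b: "contraction_form M b" using mb by (simp add: markov_form_def)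
  have pos: "\<exists>k\<in>square_integrable M. \<forall>g\<in>square_integrable M. b u g = ip M k g"
    if u: "u \<in> square_integrable M" "AE x in M. u x \<in> \<real>\<^sub>\<ge>\<^sub>0" for u
  proof -
    obtain k where "k \<in> square_integrable M" "\<And>g. g \<in> square_integrable M \<Longrightarrow> b u g = ip M k g"
    proof (rule positive_form_representation[OF b u(1)])
      show "b u g \<in> \<real>\<^sub>\<ge>\<^sub>0" if "g \<in> square_integrable M" "AE x in M. g x \<in> \<real>\<^sub>\<ge>\<^sub>0" for g
        using mb u that by (simp add: markov_form_def)
    qed (rule that)
    then show ?thesis by blast
  qed
  define P where "P u \<longleftrightarrow> u \<in> square_integrable M \<and>
    (\<exists>k\<in>square_integrable M. \<forall>g\<in>square_integrable M. b u g = ip M k g)" for u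
  have Padd: "P (\<lambda>x. u x + c * v x)" if Pu: "P u" and Pv: "P v" for u v c
  proof -
    have uv: "u \<in> square_integrable M" "v \<in> square_integrable M" using Pu Pv by (auto simp: P_def)
    obtain k where k: "k \<in> square_integrable M" "\<forall>g\<in>square_integrable M. b u g = ip M k g"
      using Pu by (auto simp: P_def)
    obtain l where l: "l \<in> square_integrable M" "\<forall>g\<in>square_integrable M. b v g = ip M l g"
      using Pv by (auto simp: P_def)
    have "b (\<lambda>x. u x + c * v x) g = ip M (\<lambda>x. k x + c * l x) g" if g: "g \<in> square_integrable M" for g
      using contraction_formD(4)[OF b uv(1) sq_scale[OF uv(2), of c] g] contraction_formD(2)[OF b uv(2) g, of c]
        ip_add_left[OF k(1) sq_scale[OF l(1), of c] g] ip_scale_left[of M c l g] k(2)[rule_format, OF g] l(2)[rule_format, OF g] by simp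
    then show ?thesis
      unfolding P_def using uv k(1) l(1) by (auto intro!: sq_add sq_scale bexI[of _ "\<lambda>x. k x + c * l x"])
  qed
  have part: "P (\<lambda>x. complex_of_real (max 0 (h (f x))))"
    if h: "h \<in> borel_measurable borel" "\<And>z. \<bar>h z\<bar> \<le> cmod z" for h
  proof -
    have [measurable]: "f \<in> borel_measurable M" using sq_measurable[OF f] .
    note h(1)[measurable]
    have "integrable M (\<lambda>x. (cmod (complex_of_real (max 0 (h (f x)))))\<^sup>2)"
    proof (rule Bochner_Integration.integrable_bound[OF sq_integrable[OF f]])
      have "\<bar>max 0 (h z)\<bar> \<le> cmod z" for z using h(2)[of z] by (auto simp: max_def)
      then show "AE x in M. norm ((cmod (complex_of_real (max 0 (h (f x)))))\<^sup>2) \<le> norm ((cmod (f x))\<^sup>2)"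
        by (intro AE_I2) (simp add: abs_le_square_iff[symmetric])
    qed measurable
    then have "(\<lambda>x. complex_of_real (max 0 (h (f x)))) \<in> square_integrable M"
      by (simp add: square_integrable_def)
    then show ?thesis unfolding P_def using pos by auto
  qed
  have "P (\<lambda>x. (((complex_of_real (max 0 (Re (f x))) + (-1) * complex_of_real (max 0 (- Re (f x))))
      + \<i> * complex_of_real (max 0 (Im (f x)))) + (- \<i>) * complex_of_real (max 0 (- Im (f x)))))"
    using abs_Re_le_cmod abs_Im_le_cmod
    by (intro Padd part part[of Re] part[of "\<lambda>z. - Re z"] part[of Im] part[of "\<lambda>z. - Im z"]) auto
  moreover have "(\<lambda>x. (((complex_of_real (max 0 (Re (f x))) + (-1) * complex_of_real (max 0 (- Re (f x))))
      + \<i> * complex_of_real (max 0 (Im (f x)))) + (- \<i>) * complex_of_real (max 0 (- Im (f x))))) = f"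
    by (auto simp: fun_eq_iff complex_eq_iff max_def)
  ultimately have "P f" by simp
  then show ?thesis by (simp add: P_def)
qed

text \<open>The operator sends a vector to a representing density. Densities are unique up to null
  sets, so every algebraic property of the operator is verified by testing against all
  \<open>g\<close>; this is the role of \<open>KclassI\<close>.\<close>

lemma markov_form_op:
  assumes mb: "markov_form M b"
  obtains K where "K \<in> markov_ops M"
    "\<And>f g. f \<in> square_integrable M \<Longrightarrow> g \<in> square_integrable M \<Longrightarrow> op_form M K f g = b f g"
proof -
  have b: "contraction_form M b" using mb by (simp add: markov_form_def)
  have "\<forall>f\<in>square_integrable M. \<exists>k. k \<in> square_integrable M \<and> (\<forall>g\<in>square_integrable M. b f g = ip M k g)"
    using markov_form_representation[OF mb] by blast
  from this[unfolded bchoice_iff] obtain \<kappa> where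
    \<kappa>': "\<forall>f\<in>square_integrable M. \<kappa> f \<in> square_integrable M \<and> (\<forall>g\<in>square_integrable M. b f g = ip M (\<kappa> f) g)"
    by (elim exE) (rule that)
  then have \<kappa>: "\<kappa> f \<in> square_integrable M" "\<And>g. g \<in> square_integrable M \<Longrightarrow> b f g = ip M (\<kappa> f) g"
    if "f \<in> square_integrable M" for f using that by auto
  define K where "K = (\<lambda>F\<in>L2 M. l2_class M (\<kappa> (rep F)))"
  have K: "K F = l2_class M (\<kappa> (rep F))" "K F \<in> L2 M" if "F \<in> L2 M" for F
    using that L2_rep(1)[OF that] by (auto simp: K_def intro: l2_class_in_L2 \<kappa>)
  have inner: "l2_inner M (K (l2_class M f)) (l2_class M g) = b f g"
    if fg: "f \<in> square_integrable M" "g \<in> square_integrable M" for f g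
  proof -
    have F: "l2_class M f \<in> L2 M" using fg(1) by (rule l2_class_in_L2)
    have "l2_inner M (K (l2_class M f)) (l2_class M g) = b (rep (l2_class M f)) g"
      using K(1)[OF F] \<kappa>[OF L2_rep(1)[OF F]] fg(2) by (simp add: l2_inner_class)
    also have "\<dots> = b f g"
      using rep_l2_class[OF fg(1)] fg by (intro contraction_form_cong_AE[OF b]) auto
    finally show ?thesis .
  qed
  have KeqI: "K F = G" if FG: "F \<in> L2 M" "G \<in> L2 M"
    "\<And>g. g \<in> square_integrable M \<Longrightarrow> b (rep F) g = l2_inner M G (l2_class M g)" for F G
    using inner[OF L2_rep(1)[OF FG(1)]] FG L2_rep(2)[OF FG(1)]
    by (intro l2_eqI[OF K(2)[OF FG(1)] FG(2)]) simp
  have KclassI: "K (l2_class M f) = l2_class M h" if fh: "f \<in> square_integrable M" "h \<in> square_integrable M"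
    "\<And>g. g \<in> square_integrable M \<Longrightarrow> b f g = ip M h g" for f h
    using fh inner[OF fh(1)] by (intro l2_eqI[where M = M] K(2) l2_class_in_L2) (simp_all add: l2_inner_class)
  have Kclass: "K (l2_class M f) = l2_class M (\<kappa> f)" if "f \<in> square_integrable M" for f
    using that \<kappa>[OF that] by (intro KclassI) auto
  \<comment> \<open>The representing function is paired with itself, and the form bound is divided
    by its norm.\<close>
  have norm: "l2_norm M (K F) \<le> l2_norm M F" if F: "F \<in> L2 M" for F
  proof -
    have f: "rep F \<in> square_integrable M" "l2_class M (rep F) = F" using L2_rep[OF F] by auto
    let ?k = "\<kappa> (rep F)"
    have k: "?k \<in> square_integrable M" using \<kappa>[OF f(1)] by simp
    have "complex_of_real ((nrm M ?k)\<^sup>2) = b (rep F) ?k" using \<kappa>(2)[OF f(1) k] ip_self[OF k] by simp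
    then have "(nrm M ?k)\<^sup>2 = cmod (b (rep F) ?k)" by (metis abs_power2 norm_of_real)
    then have "(nrm M ?k)\<^sup>2 \<le> nrm M (rep F) * nrm M ?k" using contraction_formD(1)[OF b f(1) k] by simp
    then have "nrm M ?k \<le> nrm M (rep F)"
      using nrm_nonneg[of M ?k] nrm_nonneg[of M "rep F"] by (cases "nrm M ?k = 0") (auto simp: power2_eq_square)
    then show ?thesis using K(1)[OF F] k f l2_norm_class[OF f(1)] by (simp add: l2_norm_class)
  qed
  have "K \<in> bounded_ops M"
    unfolding bounded_ops_def
  proof (intro CollectI conjI ballI allI)
    show "K \<in> L2 M \<rightarrow>\<^sub>E L2 M" using K(2) by (auto simp: K_def)
    show "\<exists>B. \<forall>F\<in>L2 M. l2_norm M (K F) \<le> B * l2_norm M F" using norm by (intro exI[of _ 1]) simp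
    fix F assume F: "F \<in> L2 M"
    have f: "rep F \<in> square_integrable M" "l2_class M (rep F) = F" using L2_rep[OF F] by auto
    show "K (l2_scale M c F) = l2_scale M c (K F)" for c
    proof -
      have "K (l2_class M (\<lambda>x. c * rep F x)) = l2_class M (\<lambda>x. c * \<kappa> (rep F) x)"
        using f(1) \<kappa>[OF f(1)]
        by (intro KclassI) (simp_all add: sq_scale contraction_formD(2)[OF b] ip_scale_left)
      then show ?thesis
        using l2_scale_class[OF f(1), of c] l2_scale_class[OF \<kappa>(1)[OF f(1)], of c] K(1)[OF F] f(2) by simp
    qed
    fix G assume G: "G \<in> L2 M"
    have g: "rep G \<in> square_integrable M" "l2_class M (rep G) = G" using L2_rep[OF G] by auto
    have "K (l2_class M (\<lambda>x. rep F x + rep G x)) = l2_class M (\<lambda>x. \<kappa> (rep F) x + \<kappa> (rep G) x)"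
      using f(1) g(1) \<kappa>[OF f(1)] \<kappa>[OF g(1)]
      by (intro KclassI) (simp_all add: sq_add contraction_formD(4)[OF b] ip_add_left)
    then show "K (l2_add M F G) = l2_add M (K F) (K G)"
      using l2_add_class[OF f(1) g(1)] l2_add_class[OF \<kappa>(1)[OF f(1)] \<kappa>(1)[OF g(1)]] K(1)[OF F] K(1)[OF G] f(2) g(2)
      by simp
  qed
  moreover have "op_norm M K \<le> 1"
    unfolding op_norm_def
  proof (rule cSUP_least)
    have "l2_class M (\<lambda>x. 0) \<in> L2 M" "l2_norm M (l2_class M (\<lambda>x. 0)) \<le> 1"
      using l2_class_in_L2[OF sq_zero] l2_norm_class[OF sq_zero, of M] by (simp_all add: nrm_def)
    then show "{F \<in> L2 M. l2_norm M F \<le> 1} \<noteq> {}" by blast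
    show "l2_norm M (K F) \<le> 1" if "F \<in> {F \<in> L2 M. l2_norm M F \<le> 1}" for F
      using that norm[of F] by auto
  qed
  moreover have "K (l2_one M) = l2_one M"
    unfolding l2_one_def using mb sq_one by (intro KclassI) (auto simp: markov_form_def)
  moreover have "op_adjoint M K (l2_one M) = l2_one M"
  proof (rule op_adjointI[OF l2_one_L2 l2_one_L2])
    fix F assume F: "F \<in> L2 M"
    have f: "rep F \<in> square_integrable M" "l2_class M (rep F) = F" using L2_rep[OF F] by auto
    have "b (rep F) (\<lambda>_. 1) = ip M (rep F) (\<lambda>_. 1)" using mb f(1) by (simp add: markov_form_def)
    then show "l2_inner M (K F) (l2_one M) = l2_inner M F (l2_one M)"
      using inner[OF f(1) sq_one] l2_inner_class[OF f(1) sq_one] f(2) by (simp add: l2_one_def)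
  qed
  moreover have "l2_nonneg M (K F)" if F: "F \<in> L2 M" "l2_nonneg M F" for F
  proof -
    have f: "rep F \<in> square_integrable M" "l2_class M (rep F) = F" using L2_rep[OF F(1)] by auto
    have fpos: "AE x in M. rep F x \<in> \<real>\<^sub>\<ge>\<^sub>0" using F(2) by (simp add: l2_nonneg_def)
    \<comment> \<open>The representing functions \<open>\<kappa> f\<close> were chosen without
      regard to sign; a nonnegative density exists, and uniqueness puts it into the same
      class.\<close>
    obtain k where k: "k \<in> square_integrable M" "AE x in M. k x \<in> \<real>\<^sub>\<ge>\<^sub>0"
      "\<And>g. g \<in> square_integrable M \<Longrightarrow> b (rep F) g = ip M k g"
    proof (rule positive_form_representation[OF b f(1)])
      show "b (rep F) g \<in> \<real>\<^sub>\<ge>\<^sub>0" if "g \<in> square_integrable M" "AE x in M. g x \<in> \<real>\<^sub>\<ge>\<^sub>0" for g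
        using mb f(1) fpos that by (simp add: markov_form_def)
    qed (rule that)
    have "K F = l2_class M k" using KclassI[OF f(1) k(1,3)] f(2) by simp
    then show ?thesis using k by (simp add: l2_nonneg_class)
  qed
  ultimately have "K \<in> markov_ops M" by (simp add: markov_ops_def contractions_def)
  then show ?thesis using that inner by (simp add: op_form_def)
qed

end

section \<open>Compactness of the space of Markov operators\<close>

definition op_matrix :: "'a measure \<Rightarrow> 'a l2_op \<Rightarrow> 'a l2 \<times> 'a l2 \<Rightarrow> complex" where
  "op_matrix M K = (\<lambda>(F, G)\<in>L2 M \<times> L2 M. l2_inner M (K F) G)"

definition wot_gauge :: "'a measure \<Rightarrow> 'a l2 \<times> 'a l2 \<Rightarrow> 'a l2_op \<Rightarrow> 'a l2_op \<Rightarrow> real" where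
  "wot_gauge M p K K' = dist (op_matrix M K p) (op_matrix M K' p)"

abbreviation markov_uniformity :: "'a measure \<Rightarrow> ('a l2_op \<times> 'a l2_op) filter" where
  "markov_uniformity M \<equiv> gauge_uniformity (markov_ops M) (L2 M \<times> L2 M) (wot_gauge M)"

lemma subtopology_pullback_topology:
  assumes "B \<subseteq> A"
  shows "subtopology (pullback_topology A f T) B = pullback_topology B f T"
  unfolding topology_eq openin_subtopology openin_pullback_topology
proof (intro allI iffI)
  fix S assume "\<exists>V. (\<exists>U. openin T U \<and> V = f -` U \<inter> A) \<and> S = V \<inter> B"
  then obtain U where "openin T U" "S = f -` U \<inter> A \<inter> B" by blast
  then show "\<exists>U. openin T U \<and> S = f -` U \<inter> B" using assms by (intro exI[of _ U]) auto
next
  fix S assume "\<exists>U. openin T U \<and> S = f -` U \<inter> B"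
  then obtain U where "openin T U" "S = f -` U \<inter> B" by blast
  then show "\<exists>V. (\<exists>U. openin T U \<and> V = f -` U \<inter> A) \<and> S = V \<inter> B"
    using assms by (intro exI[of _ "f -` U \<inter> A"]) auto
qed

text \<open>Every open set of the pullback is the preimage of an open set, so a cover of
  \<open>A\<close> descends to a cover of its image and a finite subcover lifts back.\<close>

lemma compact_space_pullback_topology:
  assumes "compactin T (f ` A)"
  shows "compact_space (pullback_topology A f T)"
  unfolding compact_space_alt
proof (intro allI impI)
  fix \<U> assume "(\<forall>U\<in>\<U>. openin (pullback_topology A f T) U) \<and> topspace (pullback_topology A f T) \<subseteq> \<Union>\<U>"
  then have \<U>: "\<forall>U\<in>\<U>. openin (pullback_topology A f T) U" "topspace (pullback_topology A f T) \<subseteq> \<Union>\<U>"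
    by auto
  have top: "topspace (pullback_topology A f T) = A"
    using compactin_subset_topspace[OF assms] by (auto simp: topspace_pullback_topology)
  have "\<forall>U\<in>\<U>. \<exists>V. openin T V \<and> U = f -` V \<inter> A"
    using \<U>(1) by (simp add: openin_pullback_topology)
  from this[unfolded bchoice_iff] obtain V where V: "\<forall>U\<in>\<U>. openin T (V U) \<and> U = f -` V U \<inter> A"
    by (elim exE) (rule that)
  have cover: "f ` A \<subseteq> \<Union>(V ` \<U>)"
  proof
    fix y assume "y \<in> f ` A"
    then obtain x where x: "x \<in> A" "y = f x" by blast
    then obtain U where "U \<in> \<U>" "x \<in> U" using \<U>(2) top by auto
    then show "y \<in> \<Union>(V ` \<U>)" using V x by blast
  qed
  have "\<exists>\<F>. finite \<F> \<and> \<F> \<subseteq> V ` \<U> \<and> f ` A \<subseteq> \<Union>\<F>"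
    using assms by (rule compactinD) (use V cover in auto)
  then obtain \<F> where "finite \<F>" "\<F> \<subseteq> V ` \<U>" "f ` A \<subseteq> \<Union>\<F>" by (elim exE conjE)
  then obtain \<G> where \<G>: "finite \<G>" "\<G> \<subseteq> \<U>" "f ` A \<subseteq> \<Union>(V ` \<G>)"
    by (metis finite_subset_image)
  have "A \<subseteq> \<Union>\<G>"
  proof
    fix x assume x: "x \<in> A"
    then obtain U where "U \<in> \<G>" "f x \<in> V U" using \<G>(3) by blast
    then show "x \<in> \<Union>\<G>" using V \<G>(2) x by blast
  qed
  then show "\<exists>\<F>. finite \<F> \<and> \<F> \<subseteq> \<U> \<and> topspace (pullback_topology A f T) \<subseteq> \<Union>\<F>"
    using \<G> top by (intro exI[of _ \<G>]) simp
qed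

lemma markov_ops_bounded: "markov_ops M \<subseteq> bounded_ops M"
  by (auto simp: markov_ops_def contractions_def)

lemma markov_topology_pullback:
  "markov_topology M = pullback_topology (markov_ops M) (op_matrix M)
     (product_topology (\<lambda>_. euclidean) (L2 M \<times> L2 M))"
  unfolding markov_topology_def weak_operator_topology_def op_matrix_def
  by (rule subtopology_pullback_topology[OF markov_ops_bounded])

lemma op_matrix_class:
  assumes "F \<in> L2 M" "G \<in> L2 M"
  shows "op_matrix M K (F, G) = op_form M K (rep F) (rep G)"
  using assms L2_rep(2)[OF assms(1)] L2_rep(2)[OF assms(2)] by (simp add: op_matrix_def op_form_def)

lemma
  shows gauge_markov: "gauge (markov_ops M) (L2 M \<times> L2 M) (wot_gauge M)"
    and markov_topology_gauge: "markov_topology M = uniform_topology (markov_ops M) (markov_uniformity M)"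
proof -
  have 1: "Metric_space (UNIV :: complex set) dist" by (rule Met_TC.Metric_space_axioms)
  have 2: "op_matrix M K \<in> (\<Pi>\<^sub>E p\<in>L2 M \<times> L2 M. UNIV)" for K
    by (auto simp: op_matrix_def)
  note * = pullback_product_gauge[where I = "L2 M \<times> L2 M" and X = "\<lambda>_. UNIV :: complex set" and D = "\<lambda>_. dist"
      and f = "op_matrix M" and S = "markov_ops M", OF 1 2]
  show "gauge (markov_ops M) (L2 M \<times> L2 M) (wot_gauge M)"
    using *(1) unfolding wot_gauge_def[abs_def] .
  show "markov_topology M = uniform_topology (markov_ops M) (markov_uniformity M)"
    using *(2) unfolding wot_gauge_def[abs_def] markov_topology_pullback mtopology_is_euclidean .
qed

lemma markov_ops_eqI:
  assumes K: "K \<in> markov_ops M" and K': "K' \<in> markov_ops M"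
    and eq: "\<And>F G. F \<in> L2 M \<Longrightarrow> G \<in> L2 M \<Longrightarrow> op_matrix M K (F, G) = op_matrix M K' (F, G)"
  shows "K = K'"
proof (rule extensionalityI[of _ "L2 M"])
  have "K \<in> bounded_ops M" "K' \<in> bounded_ops M" using K K' markov_ops_bounded by auto
  then show "K \<in> extensional (L2 M)" "K' \<in> extensional (L2 M)" by (auto simp: bounded_ops_def PiE_def)
  fix F assume F: "F \<in> L2 M"
  show "K F = K' F"
  proof (rule l2_eqI)
    show "K F \<in> L2 M" "K' F \<in> L2 M" using F K K' markov_ops_bounded by (auto intro: bounded_ops_L2)
    show "l2_inner M (K F) (l2_class M g) = l2_inner M (K' F) (l2_class M g)" if "g \<in> square_integrable M" for g
      using eq[OF F l2_class_in_L2[OF that]] F l2_class_in_L2[OF that] by (simp add: op_matrix_def)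
  qed
qed

lemma wot_gauge_separates:
  assumes "K \<in> markov_ops M" "K' \<in> markov_ops M" "\<forall>p\<in>L2 M \<times> L2 M. wot_gauge M p K K' = 0"
  shows "K = K'"
  using assms by (intro markov_ops_eqI) (auto simp: wot_gauge_def)

lemma Hausdorff_markov_topology: "Hausdorff_space (markov_topology M)"
  unfolding markov_topology_gauge
  by (rule gauge.Hausdorff_gauge[OF gauge_markov]) (rule wot_gauge_separates)

context finite_measure
begin

text \<open>Each clause of \<open>markov_form\<close> is a closed condition on finitely many
  coordinates and therefore survives in the closure; the limit form is then realised by a Markov
  operator.\<close>

lemma closure_of_markov_matrices:
  assumes B: "B \<in> product_topology (\<lambda>_. euclidean) (L2 M \<times> L2 M) closure_of (op_matrix M ` markov_ops M)"
  shows "B \<in> op_matrix M ` markov_ops M"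
proof -
  let ?P = "product_topology (\<lambda>_. euclidean :: complex topology) (L2 M \<times> L2 M)"
  have cont: "continuous_map ?P euclidean (\<lambda>B. c * B p)" if "p \<in> L2 M \<times> L2 M" for p c
  proof -
    have "continuous_map ?P euclidean ((\<lambda>z. c * z) \<circ> (\<lambda>B. B p))"
      using continuous_map_product_projection[OF that, of "\<lambda>_. euclidean :: complex topology"]
      by (rule continuous_map_compose) (auto intro: continuous_intros)
    then show ?thesis by (simp add: o_def)
  qed
  have cont1: "continuous_map ?P euclidean (\<lambda>B. B p)" if "p \<in> L2 M \<times> L2 M" for p
    using cont[OF that, of 1] by simp
  \<comment> \<open>Two principles cover all clauses: an identity between continuous functions, and
    membership of a coordinate in a closed set, both pass to the closure.\<close>
  have Beq: "u B = v B" if "continuous_map ?P euclidean u" "continuous_map ?P euclidean v"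
    "\<And>K. K \<in> markov_ops M \<Longrightarrow> u (op_matrix M K) = v (op_matrix M K)" for u v :: "('a l2 \<times> 'a l2 \<Rightarrow> complex) \<Rightarrow> complex"
    using B by (rule forall_in_closure_of_eq[where f = u and g = v, OF _ _ that(1,2)]) (use that(3) in auto)
  have Bclosed: "B p \<in> C" if p: "p \<in> L2 M \<times> L2 M" and C: "closed C"
    "\<And>K. K \<in> markov_ops M \<Longrightarrow> op_matrix M K p \<in> C" for p C
    using B
  proof (rule forall_in_closure_of)
    show "closedin ?P {B \<in> topspace ?P. B p \<in> C}"
      using closedin_continuous_map_preimage[OF cont1[OF p], of C] C(1) by simp
  qed (use C(2) in auto)
  define b where "b f g = B (l2_class M f, l2_class M g)" for f g
  have idx: "(l2_class M f, l2_class M g) \<in> L2 M \<times> L2 M" if "f \<in> square_integrable M" "g \<in> square_integrable M" for f g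
    using that by (simp add: l2_class_in_L2)
  have mat: "op_matrix M K (l2_class M f, l2_class M g) = op_form M K f g"
    if "f \<in> square_integrable M" "g \<in> square_integrable M" for K f g
    using idx[OF that] by (simp add: op_matrix_def op_form_def)
  have cf: "contraction_form M (op_form M K)" if "K \<in> markov_ops M" for K
    using markov_form_op_form[OF that] by (simp add: markov_form_def)
  have "markov_form M b"
    unfolding markov_form_def contraction_form_def
  proof (intro conjI ballI allI impI)
    fix f g h assume fgh: "f \<in> square_integrable M" "g \<in> square_integrable M" "h \<in> square_integrable M"
    show "b (\<lambda>x. f x + g x) h = b f h + b g h"
      unfolding b_def
      by (rule Beq) (auto intro!: continuous_map_add cont1 l2_class_in_L2 sq_add fgh simp: mat sq_add fgh contraction_formD[OF cf])
    show "b h (\<lambda>x. f x + g x) = b h f + b h g"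
      unfolding b_def
      by (rule Beq) (auto intro!: continuous_map_add cont1 l2_class_in_L2 sq_add fgh simp: mat sq_add fgh contraction_formD[OF cf])
  next
    fix f g c assume fg: "f \<in> square_integrable M" "g \<in> square_integrable M"
    show "b (\<lambda>x. c * f x) g = c * b f g"
      unfolding b_def
      by (rule Beq) (auto intro!: cont cont1 l2_class_in_L2 sq_scale fg simp: mat sq_scale fg contraction_formD[OF cf])
    show "b f (\<lambda>x. c * g x) = cnj c * b f g"
      unfolding b_def
      by (rule Beq) (auto intro!: cont cont1 l2_class_in_L2 sq_scale fg simp: mat sq_scale fg contraction_formD[OF cf])
  next
    fix f g assume fg: "f \<in> square_integrable M" "g \<in> square_integrable M"
    have "b f g \<in> cball 0 (nrm M f * nrm M g)"
      unfolding b_def using contraction_formD(1)[OF cf fg] by (intro Bclosed idx fg) (simp_all add: mat fg)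
    then show "cmod (b f g) \<le> nrm M f * nrm M g" by simp
    assume pos: "AE x in M. f x \<in> \<real>\<^sub>\<ge>\<^sub>0" "AE x in M. g x \<in> \<real>\<^sub>\<ge>\<^sub>0"
    show "b f g \<in> \<real>\<^sub>\<ge>\<^sub>0"
      unfolding b_def
    proof (intro Bclosed idx fg)
      show "op_matrix M K (l2_class M f, l2_class M g) \<in> \<real>\<^sub>\<ge>\<^sub>0" if "K \<in> markov_ops M" for K
        using markov_form_op_form[OF that] pos fg by (simp add: mat markov_form_def)
    qed simp
  next
    fix f assume f: "f \<in> square_integrable M"
    have "b (\<lambda>_. 1) f \<in> {ip M (\<lambda>_. 1) f}"
      unfolding b_def
    proof (intro Bclosed idx f sq_one)
      show "op_matrix M K (l2_class M (\<lambda>_. 1), l2_class M f) \<in> {ip M (\<lambda>_. 1) f}" if "K \<in> markov_ops M" for K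
        using markov_form_op_form[OF that] f by (simp add: mat sq_one markov_form_def)
    qed simp
    then show "b (\<lambda>_. 1) f = ip M (\<lambda>_. 1) f" by simp
    have "b f (\<lambda>_. 1) \<in> {ip M f (\<lambda>_. 1)}"
      unfolding b_def
    proof (intro Bclosed idx f sq_one)
      show "op_matrix M K (l2_class M f, l2_class M (\<lambda>_. 1)) \<in> {ip M f (\<lambda>_. 1)}" if "K \<in> markov_ops M" for K
        using markov_form_op_form[OF that] f by (simp add: mat sq_one markov_form_def)
    qed simp
    then show "b f (\<lambda>_. 1) = ip M f (\<lambda>_. 1)" by simp
  qed
  then obtain K where K: "K \<in> markov_ops M"
    "\<And>f g. f \<in> square_integrable M \<Longrightarrow> g \<in> square_integrable M \<Longrightarrow> op_form M K f g = b f g"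
    by (rule markov_form_op) (rule that)
  have "B = op_matrix M K"
  proof (rule extensionalityI[of _ "L2 M \<times> L2 M"])
    show "B \<in> extensional (L2 M \<times> L2 M)"
      using B closure_of_subset_topspace[of ?P] by (auto simp: PiE_def)
    show "op_matrix M K \<in> extensional (L2 M \<times> L2 M)" by (simp add: op_matrix_def)
    show "B p = op_matrix M K p" if p: "p \<in> L2 M \<times> L2 M" for p
    proof -
      obtain F G where FG: "p = (F, G)" "F \<in> L2 M" "G \<in> L2 M" using p by auto
      show ?thesis
        unfolding FG(1) op_matrix_class[OF FG(2,3)]
        using K(2)[of "rep F" "rep G"] L2_rep[OF FG(2)] L2_rep[OF FG(3)] by (simp add: b_def)
    qed
  qed
  then show ?thesis using K(1) by blast
qed

text \<open>The contraction bound places the matrices in a product of closed discs, which is compact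
  by Tychonoff's theorem, and they form a closed subset of it.\<close>

lemma compact_markov_topology: "compact_space (markov_topology M)"
proof -
  let ?P = "product_topology (\<lambda>_. euclidean :: complex topology) (L2 M \<times> L2 M)"
  let ?Z = "op_matrix M ` markov_ops M"
  let ?C = "\<Pi>\<^sub>E p\<in>L2 M \<times> L2 M. cball (0::complex) (l2_norm M (fst p) * l2_norm M (snd p))"
  have "compactin ?P ?C" by (simp add: compactin_PiE)
  moreover have "?Z \<subseteq> ?C"
  proof
    fix B assume "B \<in> ?Z"
    then obtain K where K: "K \<in> markov_ops M" "B = op_matrix M K" by blast
    have cf: "contraction_form M (op_form M K)"
      using markov_form_op_form[OF K(1)] by (simp add: markov_form_def)
    have "op_matrix M K (F, G) \<in> cball 0 (l2_norm M F * l2_norm M G)" if "F \<in> L2 M" "G \<in> L2 M" for F G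
      using contraction_formD(1)[OF cf L2_rep(1)[OF that(1)] L2_rep(1)[OF that(2)]] that
      by (simp add: op_matrix_class l2_norm_rep)
    then show "B \<in> ?C" unfolding K(2) by (auto simp: PiE_iff op_matrix_def)
  qed
  moreover have "closedin ?P ?Z"
  proof -
    have "?Z \<subseteq> topspace ?P" by (intro image_subsetI) (simp add: op_matrix_def restrict_PiE_iff)
    then show ?thesis
      using closure_of_markov_matrices closure_of_subset[of ?Z ?P] by (metis closure_of_eq subsetI subset_antisym)
  qed
  ultimately have "compactin ?P ?Z" by (rule closed_compactin)
  then show ?thesis unfolding markov_topology_pullback by (rule compact_space_pullback_topology)
qed

lemma compatible_markov_uniformity: "compatible_uniformity (markov_topology M) (markov_uniformity M)"
proof -
  have us: "uniform_structure (markov_ops M) (markov_uniformity M)"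
    by (rule gauge.uniform_structure_gauge[OF gauge_markov])
  have "topspace (markov_topology M) = markov_ops M"
    unfolding markov_topology_gauge by (rule topspace_uniform_topology[OF us])
  then show ?thesis
    unfolding compatible_uniformity_def using us markov_topology_gauge[of M, symmetric] by metis
qed

end

section \<open>The automorphism group and its Koopman representation\<close>

lemma mp_transformationsD:
  assumes "t \<in> mp_transformations M"
  shows "t \<in> M \<rightarrow>\<^sub>M M" "bij_betw t (space M) (space M)" "inv_into (space M) t \<in> M \<rightarrow>\<^sub>M M" "distr M M t = M"
  using assms by (auto simp: mp_transformations_def)

lemma mp_inv_simps:
  assumes t: "t \<in> mp_transformations M" and x: "x \<in> space M"
  shows "inv_into (space M) t (t x) = x" "t (inv_into (space M) t x) = x"
    "t x \<in> space M" "inv_into (space M) t x \<in> space M"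
  using bij_betw_inv_into_left[OF mp_transformationsD(2)[OF t] x]
    bij_betw_inv_into_right[OF mp_transformationsD(2)[OF t] x]
    measurable_space[OF mp_transformationsD(1)[OF t] x] measurable_space[OF mp_transformationsD(3)[OF t] x]
  by auto

lemma mp_AE:
  assumes t: "t \<in> mp_transformations M" and P: "AE x in M. P x"
  shows "AE x in M. P (t x)"
proof (rule AE_distrD[OF mp_transformationsD(1)[OF t]])
  show "AE x in distr M M t. P x" using P by (simp only: mp_transformationsD(4)[OF t])
qed

lemma mp_integral:
  fixes g :: "'a \<Rightarrow> 'b::{banach, second_countable_topology}"
  assumes t: "t \<in> mp_transformations M" and g: "g \<in> borel_measurable M"
  shows "(LINT x|M. g (t x)) = (LINT x|M. g x)" "integrable M (\<lambda>x. g (t x)) \<longleftrightarrow> integrable M g"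
  using integral_distr[OF mp_transformationsD(1)[OF t] g] integrable_distr_eq[OF mp_transformationsD(1)[OF t] g]
    mp_transformationsD(4)[OF t] by simp_all

lemma mp_measure:
  assumes t: "t \<in> mp_transformations M" and A: "A \<in> sets M"
  shows "{x \<in> space M. t x \<in> A} \<in> sets M" "measure M {x \<in> space M. t x \<in> A} = measure M A"
proof -
  have eq: "{x \<in> space M. t x \<in> A} = t -` A \<inter> space M" by auto
  show "{x \<in> space M. t x \<in> A} \<in> sets M"
    unfolding eq using mp_transformationsD(1)[OF t] A by (rule measurable_sets)
  show "measure M {x \<in> space M. t x \<in> A} = measure M A"
    unfolding eq using measure_distr[OF mp_transformationsD(1)[OF t] A] mp_transformationsD(4)[OF t] by simp
qed

lemma mp_id: "(\<lambda>x. x) \<in> mp_transformations M"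
proof -
  have "inv_into (space M) (\<lambda>x. x) \<in> M \<rightarrow>\<^sub>M M"
    by (subst measurable_cong[where g = "\<lambda>x. x"]) (auto simp: inv_into_f_f inj_on_def intro: inv_into_f_eq)
  then show ?thesis by (auto simp: mp_transformations_def bij_betw_def intro: distr_id)
qed

lemma mp_inv:
  assumes t: "t \<in> mp_transformations M"
  shows "inv_into (space M) t \<in> mp_transformations M"
proof -
  let ?u = "inv_into (space M) t"
  note D = mp_transformationsD[OF t]
  have bu: "bij_betw ?u (space M) (space M)" using D(2) by (rule bij_betw_inv_into)
  have "inv_into (space M) ?u x = t x" if x: "x \<in> space M" for x
  proof (rule inv_into_f_eq)
    show "inj_on ?u (space M)" using bu by (simp add: bij_betw_def)
  qed (use mp_inv_simps[OF t x] in auto)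
  then have "inv_into (space M) ?u \<in> M \<rightarrow>\<^sub>M M"
    using D(1) measurable_cong[of M "inv_into (space M) ?u" t M] by simp
  moreover have "distr M M ?u = M"
  proof -
    have "distr M M ?u = distr (distr M M t) M ?u" using D(4) by simp
    also have "\<dots> = distr M M (?u \<circ> t)" using D(1,3) by (simp add: distr_distr)
    also have "\<dots> = distr M M (\<lambda>x. x)" by (rule distr_cong) (simp_all add: mp_inv_simps[OF t])
    also have "\<dots> = M" by (rule distr_id)
    finally show ?thesis .
  qed
  ultimately show ?thesis using D(3) bu by (simp add: mp_transformations_def)
qed

lemma mp_comp:
  assumes s: "s \<in> mp_transformations M" and t: "t \<in> mp_transformations M"
  shows "s \<circ> t \<in> mp_transformations M"
    and "x \<in> space M \<Longrightarrow> inv_into (space M) (s \<circ> t) x = inv_into (space M) t (inv_into (space M) s x)"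
proof -
  note S = mp_transformationsD[OF s] and T = mp_transformationsD[OF t]
  have b: "bij_betw (s \<circ> t) (space M) (space M)" using T(2) S(2) by (rule bij_betw_trans)
  have inv: "inv_into (space M) (s \<circ> t) x = inv_into (space M) t (inv_into (space M) s x)" if x: "x \<in> space M" for x
  proof (rule inv_into_f_eq)
    show "inj_on (s \<circ> t) (space M)" using b by (simp add: bij_betw_def)
  qed (use mp_inv_simps[OF s x] mp_inv_simps[OF t, of "inv_into (space M) s x"] in auto)
  have "inv_into (space M) (s \<circ> t) \<in> M \<rightarrow>\<^sub>M M"
  proof (subst measurable_cong)
    show "inv_into (space M) (s \<circ> t) x = (inv_into (space M) t \<circ> inv_into (space M) s) x" if "x \<in> space M" for x
      using inv[OF that] by simp
    show "inv_into (space M) t \<circ> inv_into (space M) s \<in> M \<rightarrow>\<^sub>M M" using S(3) T(3) by (rule measurable_comp)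
  qed
  moreover have "distr M M (s \<circ> t) = M"
    using distr_distr[OF S(1) T(1)] S(4) T(4) by simp
  moreover have "s \<circ> t \<in> M \<rightarrow>\<^sub>M M" using T(1) S(1) by (rule measurable_comp)
  ultimately show "s \<circ> t \<in> mp_transformations M" using b by (simp add: mp_transformations_def)
  show "x \<in> space M \<Longrightarrow> inv_into (space M) (s \<circ> t) x = inv_into (space M) t (inv_into (space M) s x)" by (rule inv)
qed

text \<open>The exceptional null set is pulled back along the inverse of \<open>t\<close>, which
  preserves null sets; at the remaining points \<open>s\<close> and \<open>t\<close> agree at the
  inverse image under \<open>t\<close>.\<close>

lemma mp_inv_AE:
  assumes s: "s \<in> mp_transformations M" and t: "t \<in> mp_transformations M" and eq: "AE x in M. s x = t x"
  shows "AE x in M. inv_into (space M) s x = inv_into (space M) t x"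
proof -
  have "AE x in M. s (inv_into (space M) t x) = t (inv_into (space M) t x)"
    using mp_AE[OF mp_inv[OF t] eq] .
  then show ?thesis
  proof (rule AE_mp, intro AE_I2 impI)
    fix x assume x: "x \<in> space M" and h: "s (inv_into (space M) t x) = t (inv_into (space M) t x)"
    have "inv_into (space M) s (s (inv_into (space M) t x)) = inv_into (space M) t x"
      using mp_inv_simps[OF s mp_inv_simps(4)[OF t x]] by simp
    then show "inv_into (space M) s x = inv_into (space M) t x"
      using h mp_inv_simps(2)[OF t x] by simp
  qed
qed

lemma aut_class_eq_iff:
  assumes "s \<in> mp_transformations M" "t \<in> mp_transformations M"
  shows "aut_class M s = aut_class M t \<longleftrightarrow> (AE x in M. s x = t x)"
proof
  assume "aut_class M s = aut_class M t"
  moreover have "s \<in> aut_class M s" using assms by (simp add: aut_class_def)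
  ultimately show "AE x in M. s x = t x" by (simp add: aut_class_def)
next
  assume *: "AE x in M. s x = t x"
  have "(AE x in M. h x = s x) \<longleftrightarrow> (AE x in M. h x = t x)" for h
  proof
    assume "AE x in M. h x = s x"
    with * show "AE x in M. h x = t x" by eventually_elim simp
  next
    assume "AE x in M. h x = t x"
    with * show "AE x in M. h x = s x" by eventually_elim simp
  qed
  then show "aut_class M s = aut_class M t" by (simp add: aut_class_def)
qed

lemma rep_aut_class:
  assumes "t \<in> mp_transformations M"
  shows "rep (aut_class M t) \<in> mp_transformations M" "AE x in M. rep (aut_class M t) x = t x"
proof -
  have "t \<in> aut_class M t" using assms by (simp add: aut_class_def)
  then have "rep (aut_class M t) \<in> aut_class M t" unfolding rep_def some_in_eq by auto
  then show "rep (aut_class M t) \<in> mp_transformations M" "AE x in M. rep (aut_class M t) x = t x"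
    by (auto simp: aut_class_def)
qed

lemma carrier_Aut: "carrier (Aut M) = aut_class M ` mp_transformations M"
  by (simp add: Aut_def)

lemma aut_class_carrier: "t \<in> mp_transformations M \<Longrightarrow> aut_class M t \<in> carrier (Aut M)"
  by (simp add: carrier_Aut)

lemma Aut_rep:
  assumes "T \<in> carrier (Aut M)"
  shows "rep T \<in> mp_transformations M" "aut_class M (rep T) = T"
proof -
  obtain t where t: "t \<in> mp_transformations M" "T = aut_class M t" using assms by (auto simp: carrier_Aut)
  show "rep T \<in> mp_transformations M" unfolding t(2) by (rule rep_aut_class[OF t(1)])
  show "aut_class M (rep T) = T"
    unfolding t(2) using rep_aut_class[OF t(1)] t(1) by (subst aut_class_eq_iff) auto
qed

text \<open>Changing the outer representative alters the composition only on the preimage of a null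
  set under the inner one, which is again null.\<close>

lemma mult_aut_class:
  assumes s: "s \<in> mp_transformations M" and t: "t \<in> mp_transformations M"
  shows "aut_class M s \<otimes>\<^bsub>Aut M\<^esub> aut_class M t = aut_class M (s \<circ> t)"
proof -
  let ?s = "rep (aut_class M s)" and ?t = "rep (aut_class M t)"
  have "AE x in M. ?s (?t x) = s (?t x)" using mp_AE[OF rep_aut_class(1)[OF t] rep_aut_class(2)[OF s]] .
  with rep_aut_class(2)[OF t] have "AE x in M. (?s \<circ> ?t) x = (s \<circ> t) x" by eventually_elim simp
  then have "aut_class M (?s \<circ> ?t) = aut_class M (s \<circ> t)"
    using rep_aut_class(1)[OF s] rep_aut_class(1)[OF t] s t by (subst aut_class_eq_iff) (auto intro: mp_comp)
  then show ?thesis by (simp add: Aut_def)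
qed

lemma one_Aut: "\<one>\<^bsub>Aut M\<^esub> = aut_class M (\<lambda>x. x)" by (simp add: Aut_def)

lemma inv_mult_aut_class:
  assumes t: "t \<in> mp_transformations M"
  shows "aut_class M (inv_into (space M) t) \<otimes>\<^bsub>Aut M\<^esub> aut_class M t = \<one>\<^bsub>Aut M\<^esub>"
  unfolding mult_aut_class[OF mp_inv[OF t] t] one_Aut
  using mp_comp(1)[OF mp_inv[OF t] t] mp_id mp_inv_simps(1)[OF t]
  by (subst aut_class_eq_iff) (auto intro!: AE_I2)

lemma group_Aut: "group (Aut M)"
proof (rule groupI)
  show "\<one>\<^bsub>Aut M\<^esub> \<in> carrier (Aut M)" unfolding one_Aut by (rule aut_class_carrier[OF mp_id])
  fix X assume "X \<in> carrier (Aut M)"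
  then obtain x where x: "x \<in> mp_transformations M" "X = aut_class M x" by (auto simp: carrier_Aut)
  show "\<one>\<^bsub>Aut M\<^esub> \<otimes>\<^bsub>Aut M\<^esub> X = X"
    unfolding x(2) one_Aut mult_aut_class[OF mp_id x(1)] by (simp add: o_def)
  show "\<exists>Y\<in>carrier (Aut M). Y \<otimes>\<^bsub>Aut M\<^esub> X = \<one>\<^bsub>Aut M\<^esub>"
    using inv_mult_aut_class[OF x(1)] aut_class_carrier[OF mp_inv[OF x(1)]] x(2) by auto
  fix Y assume "Y \<in> carrier (Aut M)"
  then obtain y where y: "y \<in> mp_transformations M" "Y = aut_class M y" by (auto simp: carrier_Aut)
  show "X \<otimes>\<^bsub>Aut M\<^esub> Y \<in> carrier (Aut M)"
    unfolding x(2) y(2) mult_aut_class[OF x(1) y(1)] by (rule aut_class_carrier[OF mp_comp(1)[OF x(1) y(1)]])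
  fix Z assume "Z \<in> carrier (Aut M)"
  then obtain z where z: "z \<in> mp_transformations M" "Z = aut_class M z" by (auto simp: carrier_Aut)
  show "X \<otimes>\<^bsub>Aut M\<^esub> Y \<otimes>\<^bsub>Aut M\<^esub> Z = X \<otimes>\<^bsub>Aut M\<^esub> (Y \<otimes>\<^bsub>Aut M\<^esub> Z)"
    unfolding x(2) y(2) z(2) mult_aut_class[OF x(1) y(1)] mult_aut_class[OF y(1) z(1)]
      mult_aut_class[OF mp_comp(1)[OF x(1) y(1)] z(1)] mult_aut_class[OF x(1) mp_comp(1)[OF y(1) z(1)]]
    by (simp add: o_assoc)
qed

lemma inv_aut_class:
  assumes t: "t \<in> mp_transformations M"
  shows "inv\<^bsub>Aut M\<^esub> aut_class M t = aut_class M (inv_into (space M) t)"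
  using group.inv_equality[OF group_Aut inv_mult_aut_class[OF t]] aut_class_carrier[OF t]
    aut_class_carrier[OF mp_inv[OF t]] by simp

section \<open>Koopman operators as unitary Markov operators\<close>

lemma sq_comp:
  assumes t: "t \<in> mp_transformations M" and f: "f \<in> square_integrable M"
  shows "(\<lambda>x. f (t x)) \<in> square_integrable M" "nrm M (\<lambda>x. f (t x)) = nrm M f"
proof -
  note fm = sq_measurable[OF f]
  have m: "(\<lambda>x. (cmod (f x))\<^sup>2) \<in> borel_measurable M" using fm by measurable
  have "(\<lambda>x. f (t x)) \<in> borel_measurable M" using mp_transformationsD(1)[OF t] fm by (rule measurable_compose)
  then show "(\<lambda>x. f (t x)) \<in> square_integrable M"
    using mp_integral(2)[OF t m] sq_integrable[OF f] by (simp add: square_integrable_def)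
  show "nrm M (\<lambda>x. f (t x)) = nrm M f" using mp_integral(1)[OF t m] by (simp add: nrm_def)
qed

lemma ip_comp:
  assumes t: "t \<in> mp_transformations M" and f: "f \<in> square_integrable M" and g: "g \<in> square_integrable M"
  shows "ip M (\<lambda>x. f (t x)) (\<lambda>x. g (t x)) = ip M f g"
proof -
  have "(\<lambda>x. f x * cnj (g x)) \<in> borel_measurable M"
    using sq_measurable[OF f] sq_measurable[OF g] by measurable
  from mp_integral(1)[OF t this] show ?thesis by (simp add: ip_def)
qed

text \<open>Removes both choices made by \<open>rep\<close> in the definition of
  \<open>koopman\<close>, that of a transformation and that of a function.\<close>

lemma koopman_class:
  assumes t: "t \<in> mp_transformations M" and f: "f \<in> square_integrable M"
  shows "koopman M (aut_class M t) (l2_class M f) = l2_class M (\<lambda>x. f (inv_into (space M) t x))"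
proof -
  let ?t = "rep (aut_class M t)" and ?f = "rep (l2_class M f)"
  note r = rep_aut_class[OF t] and rf = rep_l2_class[OF f]
  have "AE x in M. ?f (inv_into (space M) ?t x) = f (inv_into (space M) ?t x)"
    using mp_AE[OF mp_inv[OF r(1)] rf(2)] .
  with mp_inv_AE[OF r(1) t r(2)]
  have "AE x in M. ?f (inv_into (space M) ?t x) = f (inv_into (space M) t x)" by eventually_elim simp
  then have "l2_class M (\<lambda>x. ?f (inv_into (space M) ?t x)) = l2_class M (\<lambda>x. f (inv_into (space M) t x))"
    using sq_comp(1)[OF mp_inv[OF r(1)] rf(1)] sq_comp(1)[OF mp_inv[OF t] f] by (subst l2_class_eq_iff) auto
  then show ?thesis using l2_class_in_L2[OF f] by (simp add: koopman_def)
qed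

lemma koopman_L2:
  assumes T: "T \<in> carrier (Aut M)" and F: "F \<in> L2 M"
  shows "koopman M T F \<in> L2 M"
    and "koopman M T F = l2_class M (\<lambda>x. rep F (inv_into (space M) (rep T) x))"
  using koopman_class[OF Aut_rep(1)[OF T] L2_rep(1)[OF F]] Aut_rep(2)[OF T] L2_rep(2)[OF F]
    l2_class_in_L2[OF sq_comp(1)[OF mp_inv[OF Aut_rep(1)[OF T]] L2_rep(1)[OF F]]] by simp_all

lemma koopman_mult:
  assumes S: "S \<in> carrier (Aut M)" and T: "T \<in> carrier (Aut M)" and F: "F \<in> L2 M"
  shows "koopman M (S \<otimes>\<^bsub>Aut M\<^esub> T) F = koopman M S (koopman M T F)"
proof -
  define s t f where "s = rep S" and "t = rep T" and "f = rep F"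
  have s: "s \<in> mp_transformations M" "aut_class M s = S" and t: "t \<in> mp_transformations M" "aut_class M t = T"
    and f: "f \<in> square_integrable M" "l2_class M f = F"
    using Aut_rep[OF S] Aut_rep[OF T] L2_rep[OF F] by (simp_all add: s_def t_def f_def)
  have "koopman M (S \<otimes>\<^bsub>Aut M\<^esub> T) F = l2_class M (\<lambda>x. f (inv_into (space M) (s \<circ> t) x))"
    using koopman_class[OF mp_comp(1)[OF s(1) t(1)] f(1)] mult_aut_class[OF s(1) t(1)] s(2) t(2) f(2) by simp
  also have "\<dots> = l2_class M (\<lambda>x. f (inv_into (space M) t (inv_into (space M) s x)))"
    using sq_comp(1)[OF mp_inv[OF mp_comp(1)[OF s(1) t(1)]] f(1)]
      sq_comp(1)[OF mp_inv[OF s(1)] sq_comp(1)[OF mp_inv[OF t(1)] f(1)]] mp_comp(2)[OF s(1) t(1)]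
    by (subst l2_class_eq_iff) (auto intro!: AE_I2)
  also have "\<dots> = koopman M S (koopman M T F)"
    using koopman_class[OF s(1) sq_comp(1)[OF mp_inv[OF t(1)] f(1)]] koopman_class[OF t(1) f(1)] s(2) t(2) f(2) by simp
  finally show ?thesis .
qed

lemma koopman_one:
  assumes F: "F \<in> L2 M"
  shows "koopman M \<one>\<^bsub>Aut M\<^esub> F = F"
proof -
  have "koopman M \<one>\<^bsub>Aut M\<^esub> (l2_class M (rep F)) = l2_class M (\<lambda>x. rep F (inv_into (space M) (\<lambda>x. x) x))"
    unfolding one_Aut by (rule koopman_class[OF mp_id L2_rep(1)[OF F]])
  also have "\<dots> = l2_class M (rep F)"
    using sq_comp(1)[OF mp_inv[OF mp_id] L2_rep(1)[OF F]] L2_rep(1)[OF F] mp_inv_simps(1)[OF mp_id]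
    by (subst l2_class_eq_iff) (auto intro!: AE_I2)
  finally show ?thesis using L2_rep(2)[OF F] by simp
qed

lemma koopman_inner:
  assumes T: "T \<in> carrier (Aut M)" and F: "F \<in> L2 M" and G: "G \<in> L2 M"
  shows "l2_inner M (koopman M T F) (koopman M T G) = l2_inner M F G"
proof -
  note t = mp_inv[OF Aut_rep(1)[OF T]] and f = L2_rep(1)[OF F] and g = L2_rep(1)[OF G]
  show ?thesis
    unfolding koopman_L2(2)[OF T F] koopman_L2(2)[OF T G] l2_inner_class[OF sq_comp(1)[OF t f] sq_comp(1)[OF t g]]
      ip_comp[OF t f g] by (simp add: l2_inner_def ip_def)
qed

lemma koopman_norm:
  assumes T: "T \<in> carrier (Aut M)" and F: "F \<in> L2 M"
  shows "l2_norm M (koopman M T F) = l2_norm M F"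
  using koopman_inner[OF T F F] by (simp add: l2_norm_def)

lemma koopman_bounded_ops:
  assumes T: "T \<in> carrier (Aut M)"
  shows "koopman M T \<in> bounded_ops M"
  unfolding bounded_ops_def
proof (intro CollectI conjI ballI allI)
  show "koopman M T \<in> L2 M \<rightarrow>\<^sub>E L2 M" using koopman_L2(1)[OF T] by (auto simp: koopman_def)
  show "\<exists>B. \<forall>F\<in>L2 M. l2_norm M (koopman M T F) \<le> B * l2_norm M F"
    using koopman_norm[OF T] by (intro exI[of _ 1]) simp
  define t where "t = rep T"
  have t: "t \<in> mp_transformations M" "aut_class M t = T" using Aut_rep[OF T] by (simp_all add: t_def)
  note k = koopman_class[OF t(1), unfolded t(2)] and c = sq_comp(1)[OF mp_inv[OF t(1)]]
  fix F assume F: "F \<in> L2 M"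
  define f where "f = rep F"
  have f: "f \<in> square_integrable M" "F = l2_class M f" using L2_rep[OF F] by (simp_all add: f_def)
  show "koopman M T (l2_scale M a F) = l2_scale M a (koopman M T F)" for a
    unfolding f(2) l2_scale_class[OF f(1)] k[OF f(1)] k[OF sq_scale[OF f(1)]] l2_scale_class[OF c[OF f(1)]] ..
  fix G assume G: "G \<in> L2 M"
  define g where "g = rep G"
  have g: "g \<in> square_integrable M" "G = l2_class M g" using L2_rep[OF G] by (simp_all add: g_def)
  show "koopman M T (l2_add M F G) = l2_add M (koopman M T F) (koopman M T G)"
    unfolding f(2) g(2) l2_add_class[OF f(1) g(1)] k[OF f(1)] k[OF g(1)] k[OF sq_add[OF f(1) g(1)]]
      l2_add_class[OF c[OF f(1)] c[OF g(1)]] ..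
qed

lemma koopman_unitary:
  assumes T: "T \<in> carrier (Aut M)"
  shows "koopman M T \<in> unitary_ops M"
proof -
  interpret group "Aut M" by (rule group_Aut)
  have "bij_betw (koopman M T) (L2 M) (L2 M)"
  proof (rule bij_betw_byWitness[where f' = "koopman M (inv\<^bsub>Aut M\<^esub> T)"])
    show "\<forall>F\<in>L2 M. koopman M (inv\<^bsub>Aut M\<^esub> T) (koopman M T F) = F"
    proof
      fix F assume F: "F \<in> L2 M"
      show "koopman M (inv\<^bsub>Aut M\<^esub> T) (koopman M T F) = F"
        using koopman_mult[OF inv_closed[OF T] T F] koopman_one[OF F] T by simp
    qed
    show "\<forall>F\<in>L2 M. koopman M T (koopman M (inv\<^bsub>Aut M\<^esub> T) F) = F"
    proof
      fix F assume F: "F \<in> L2 M"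
      show "koopman M T (koopman M (inv\<^bsub>Aut M\<^esub> T) F) = F"
        using koopman_mult[OF T inv_closed[OF T] F] koopman_one[OF F] T by simp
    qed
  qed (use koopman_L2(1)[OF T] koopman_L2(1)[OF inv_closed[OF T]] in auto)
  then show ?thesis
    using koopman_bounded_ops[OF T] koopman_inner[OF T] by (simp add: unitary_ops_def)
qed

context finite_measure
begin

lemma koopman_markov:
  assumes T: "T \<in> carrier (Aut M)"
  shows "koopman M T \<in> markov_ops M"
proof -
  define t where "t = rep T"
  have t: "t \<in> mp_transformations M" "aut_class M t = T" using Aut_rep[OF T] by (simp_all add: t_def)
  note k = koopman_class[OF t(1), unfolded t(2)] and c = sq_comp[OF mp_inv[OF t(1)]]
  have "op_norm M (koopman M T) \<le> 1"
    unfolding op_norm_def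
  proof (rule cSUP_least)
    have "l2_class M (\<lambda>x. 0) \<in> L2 M" "l2_norm M (l2_class M (\<lambda>x. 0)) \<le> 1"
      using l2_class_in_L2[OF sq_zero] l2_norm_class[OF sq_zero, of M] by (simp_all add: nrm_def)
    then show "{F \<in> L2 M. l2_norm M F \<le> 1} \<noteq> {}" by blast
  qed (use koopman_norm[OF T] in auto)
  moreover have k1: "koopman M T (l2_one M) = l2_one M"
    unfolding l2_one_def k[OF sq_one] ..
  \<comment> \<open>The operator preserves inner products and fixes 1, so pairing the image of
    \<open>F\<close> with 1 is pairing \<open>F\<close> with 1.\<close>
  moreover have "op_adjoint M (koopman M T) (l2_one M) = l2_one M"
    by (rule op_adjointI[OF l2_one_L2 l2_one_L2]) (metis k1 koopman_inner[OF T] l2_one_L2)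
  moreover have "l2_nonneg M (koopman M T F)" if F: "F \<in> L2 M" "l2_nonneg M F" for F
    unfolding koopman_L2(2)[OF T F(1)] t_def[symmetric] l2_nonneg_class[OF c(1)[OF L2_rep(1)[OF F(1)]]]
    using mp_AE[OF mp_inv[OF t(1)]] F(2) by (simp add: l2_nonneg_def)
  ultimately show ?thesis
    using koopman_bounded_ops[OF T] by (simp add: markov_ops_def contractions_def)
qed

text \<open>The inverse in the definition of the Koopman operator disappears by the substitution of
  \<open>t x\<close> for \<open>x\<close>, which moves the transformation to the second
  argument.\<close>

lemma koopman_form_indicator:
  assumes T: "T \<in> carrier (Aut M)" and t: "t \<in> mp_transformations M" "T = aut_class M t"
    and A: "A \<in> sets M" and B: "B \<in> sets M"
  shows "op_form M (koopman M T) (indicator A) (indicator B) = complex_of_real (measure M {x \<in> A. t x \<in> B})"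
proof -
  let ?u = "inv_into (space M) t"
  have AS: "A \<subseteq> space M" using sets.sets_into_space[OF A] .
  have set: "{x \<in> A. t x \<in> B} = A \<inter> {x \<in> space M. t x \<in> B}" using AS by auto
  have m: "{x \<in> A. t x \<in> B} \<in> sets M" unfolding set using A mp_measure(1)[OF t(1) B] by auto
  have "op_form M (koopman M T) (indicator A) (indicator B) = ip M (\<lambda>x. indicator A (?u x)) (indicator B)"
    unfolding op_form_def t(2) koopman_class[OF t(1) sq_indicator[OF A]]
    by (rule l2_inner_class[OF sq_comp(1)[OF mp_inv[OF t(1)] sq_indicator[OF A]] sq_indicator[OF B]])
  also have "\<dots> = ip M (\<lambda>x. indicator A (?u (t x))) (\<lambda>x. indicator B (t x))"
    by (rule ip_comp[symmetric, OF t(1) sq_comp(1)[OF mp_inv[OF t(1)] sq_indicator[OF A]] sq_indicator[OF B]])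
  also have "\<dots> = (LINT x|M. complex_of_real (indicator {x \<in> A. t x \<in> B} x))"
    unfolding ip_def
    by (rule Bochner_Integration.integral_cong) (simp_all add: mp_inv_simps(1)[OF t(1)] indicator_def)
  also have "\<dots> = complex_of_real (measure M {x \<in> A. t x \<in> B})"
    using m sets.sets_into_space[OF m] by (simp add: integral_complex_of_real Int_absorb2)
  finally show ?thesis .
qed

end

section \<open>Transport of atoms\<close>

text \<open>The label \<open>L\<close> lists the members of the family that contain the point.
  Running over all subsets of the family gives disjoint, possibly empty atoms that cover the
  space.\<close>

definition atom :: "'a measure \<Rightarrow> 'a set set \<Rightarrow> 'a set set \<Rightarrow> 'a set" where
  "atom M \<A> L = {x \<in> space M. {A \<in> \<A>. x \<in> A} = L}"

lemma atom_sets: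
  assumes "finite \<A>" "\<A> \<subseteq> sets M" "L \<subseteq> \<A>"
  shows "atom M \<A> L \<in> sets M"
proof -
  have "atom M \<A> L = {x \<in> space M. \<forall>A\<in>\<A>. x \<in> A \<longleftrightarrow> A \<in> L}"
    using assms(3) by (auto simp: atom_def)
  also have "\<dots> \<in> sets M"
  proof (rule sets.sets_Collect_finite_All[OF _ assms(1)])
    fix A assume "A \<in> \<A>"
    then have [measurable]: "A \<in> sets M" using assms(2) by auto
    show "{x \<in> space M. x \<in> A \<longleftrightarrow> A \<in> L} \<in> sets M" by measurable
  qed
  finally show ?thesis .
qed

lemma disjoint_atoms: "L \<noteq> L' \<Longrightarrow> atom M \<A> L \<inter> atom M \<A> L' = {}"
  by (auto simp: atom_def)

text \<open>Every point lies in exactly one atom. The conditions used are \<open>A \<in> L\<close>,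
  which recovers the indicator of \<open>A\<close>, and the trivial one, which gives the constant
  1.\<close>

lemma sum_indicator_atoms:
  assumes "finite \<A>" "x \<in> space M"
  shows "(\<Sum>L\<in>{L \<in> Pow \<A>. P L}. indicator (atom M \<A> L) x) = (if P {A \<in> \<A>. x \<in> A} then 1 else (0::complex))"
proof -
  have "(\<Sum>L\<in>{L \<in> Pow \<A>. P L}. indicator (atom M \<A> L) x) =
      (\<Sum>L\<in>{L \<in> Pow \<A>. P L}. if L = {A \<in> \<A>. x \<in> A} then 1 else (0::complex))"
    using assms(2) by (intro sum.cong) (auto simp: atom_def indicator_def)
  also have "\<dots> = (if P {A \<in> \<A>. x \<in> A} then 1 else 0)"
    using assms(1) by (subst sum.delta) auto
  finally show ?thesis .
qed

text \<open>For an automorphism \<open>v\<close> these are the points that change their atom.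
  Smallness of this set for some finite family is the form in which neighbourhoods of the identity
  are used.\<close>

definition displacement :: "'a measure \<Rightarrow> 'a set set \<Rightarrow> ('a \<Rightarrow> 'a) \<Rightarrow> 'a set" where
  "displacement M \<A> v = {x \<in> space M. \<exists>A\<in>\<A>. (x \<in> A) \<noteq> (v x \<in> A)}"

lemma displacement_sets:
  assumes v: "v \<in> mp_transformations M" and \<A>: "finite \<A>" "\<A> \<subseteq> sets M"
  shows "displacement M \<A> v \<in> sets M"
  unfolding displacement_def
proof (rule sets.sets_Collect_finite_Ex[OF _ \<A>(1)])
  fix A assume "A \<in> \<A>"
  then have [measurable]: "A \<in> sets M" using \<A>(2) by auto
  have [measurable]: "v \<in> M \<rightarrow>\<^sub>M M" using mp_transformationsD(1)[OF v] .
  show "{x \<in> space M. (x \<in> A) \<noteq> (v x \<in> A)} \<in> sets M" by measurable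
qed

context finite_measure
begin

lemma contraction_form_atoms:
  assumes b: "contraction_form M b" and \<A>: "finite \<A>" "\<A> \<subseteq> sets M" and AB: "A \<in> \<A>" "B \<in> \<A>"
  shows "b (indicator A) (indicator B) = (\<Sum>L\<in>{L \<in> Pow \<A>. A \<in> L}. \<Sum>L'\<in>{L \<in> Pow \<A>. B \<in> L}.
    b (indicator (atom M \<A> L)) (indicator (atom M \<A> L')))"
proof -
  have at: "indicator (atom M \<A> L) \<in> square_integrable M" if "L \<in> {L \<in> Pow \<A>. C \<in> L}" for L C
    using that \<A> by (intro sq_indicator atom_sets) auto
  have ind: "indicator C \<in> square_integrable M" "AE x in M. indicator C x = (\<Sum>L\<in>{L \<in> Pow \<A>. C \<in> L}. indicator (atom M \<A> L) x :: complex)"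
    "(\<lambda>x. \<Sum>L\<in>{L \<in> Pow \<A>. C \<in> L}. indicator (atom M \<A> L) x) \<in> square_integrable M" if C: "C \<in> \<A>" for C
  proof -
    show "indicator C \<in> square_integrable M" using C \<A> by (intro sq_indicator) auto
    show "AE x in M. indicator C x = (\<Sum>L\<in>{L \<in> Pow \<A>. C \<in> L}. indicator (atom M \<A> L) x :: complex)"
    proof (rule AE_I2)
      fix x assume "x \<in> space M"
      from sum_indicator_atoms[OF \<A>(1) this, of "\<lambda>L. C \<in> L"]
      show "indicator C x = (\<Sum>L\<in>{L \<in> Pow \<A>. C \<in> L}. indicator (atom M \<A> L) x :: complex)"
        using C by (simp add: indicator_def)
    qed
    show "(\<lambda>x. \<Sum>L\<in>{L \<in> Pow \<A>. C \<in> L}. indicator (atom M \<A> L) x) \<in> square_integrable M"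
      by (rule sq_sum) (rule at)
  qed
  have "b (indicator A) (indicator B) = b (\<lambda>x. \<Sum>L\<in>{L \<in> Pow \<A>. A \<in> L}. indicator (atom M \<A> L) x)
      (\<lambda>x. \<Sum>L\<in>{L \<in> Pow \<A>. B \<in> L}. indicator (atom M \<A> L) x)"
    using ind[OF AB(1)] ind[OF AB(2)] by (intro contraction_form_cong_AE[OF b])
  also have "\<dots> = (\<Sum>L\<in>{L \<in> Pow \<A>. A \<in> L}. b (indicator (atom M \<A> L))
      (\<lambda>x. \<Sum>L\<in>{L \<in> Pow \<A>. B \<in> L}. indicator (atom M \<A> L) x))"
    by (rule contraction_form_sum(1)[OF b at ind(3)[OF AB(2)]])
  also have "\<dots> = (\<Sum>L\<in>{L \<in> Pow \<A>. A \<in> L}. \<Sum>L'\<in>{L \<in> Pow \<A>. B \<in> L}.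
    b (indicator (atom M \<A> L)) (indicator (atom M \<A> L')))"
    by (intro sum.cong refl contraction_form_sum(2)[OF b] at)
  finally show ?thesis .
qed

text \<open>Outside the displacement set \<open>x \<in> B\<close> and \<open>v x \<in> B\<close> are
  equivalent.\<close>

lemma transport_displacement:
  assumes v: "v \<in> mp_transformations M" and \<A>: "finite \<A>" "\<A> \<subseteq> sets M" and AB: "A \<in> \<A>" "B \<in> \<A>"
  shows "\<bar>measure M {x \<in> A. v x \<in> B} - measure M (A \<inter> B)\<bar> \<le> measure M (displacement M \<A> v)"
proof -
  have As: "A \<in> sets M" "B \<in> sets M" using AB \<A> by auto
  have AS: "A \<subseteq> space M" using sets.sets_into_space[OF As(1)] .
  have "{x \<in> A. v x \<in> B} = A \<inter> {x \<in> space M. v x \<in> B}" using AS by auto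
  then have s: "{x \<in> A. v x \<in> B} \<in> sets M" using As mp_measure(1)[OF v As(2)] by auto
  note d = displacement_sets[OF v \<A>]
  have "measure M {x \<in> A. v x \<in> B} \<le> measure M ((A \<inter> B) \<union> displacement M \<A> v)"
    using As d AB AS by (intro finite_measure_mono) (auto simp: displacement_def)
  also have "\<dots> \<le> measure M (A \<inter> B) + measure M (displacement M \<A> v)"
    using As d by (intro measure_Un_le) auto
  finally have 1: "measure M {x \<in> A. v x \<in> B} \<le> measure M (A \<inter> B) + measure M (displacement M \<A> v)" .
  have "measure M (A \<inter> B) \<le> measure M ({x \<in> A. v x \<in> B} \<union> displacement M \<A> v)"
    using s d AB AS by (intro finite_measure_mono) (auto simp: displacement_def)
  also have "\<dots> \<le> measure M {x \<in> A. v x \<in> B} + measure M (displacement M \<A> v)"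
    using s d by (intro measure_Un_le)
  finally show ?thesis using 1 by linarith
qed

end

section \<open>Automorphisms realising given transport matrices\<close>

context atomless_standard_measure
begin

text \<open>The sublevel sets of a uniform coordinate run through all measures up to that of
  \<open>B\<close>.\<close>

lemma subset_of_measure:
  assumes B: "B \<in> sets M" and m: "0 \<le> m" "m \<le> measure M B"
  obtains C where "C \<in> sets M" "C \<subseteq> B" "measure M C = m"
proof -
  obtain h :: "'a \<Rightarrow> real" and A where h: "h \<in> borel_measurable M"
    "\<And>t. measure M {x \<in> B. h x \<le> t} = max 0 (min t (measure M B))"
    by (rule uniform_coordinate[OF B]) (rule that)
  have "{x \<in> B. h x \<le> m} = B \<inter> {x \<in> space M. h x \<le> m}" using sets.sets_into_space[OF B] by auto
  also have "\<dots> \<in> sets M" using B h(1) by measurable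
  finally show ?thesis using h(2)[of m] m by (intro that[of "{x \<in> B. h x \<le> m}"]) auto
qed

text \<open>Pieces are carved off one at a time; the bound on the sum guarantees that enough remains
  for the others.\<close>

lemma split_measure:
  assumes "finite I" "Y \<in> sets M" "\<And>k. k \<in> I \<Longrightarrow> 0 \<le> m k" "(\<Sum>k\<in>I. m k) \<le> measure M Y"
  shows "\<exists>Q. (\<forall>k\<in>I. Q k \<in> sets M \<and> Q k \<subseteq> Y \<and> measure M (Q k) = m k) \<and> disjoint_family_on Q I"
  using assms
proof (induction I arbitrary: Y rule: finite_induct)
  case empty
  then show ?case by (simp add: disjoint_family_on_def)
next
  case (insert i I)
  have "0 \<le> (\<Sum>k\<in>I. m k)" using insert.prems by (intro sum_nonneg) auto
  then have mi: "0 \<le> m i" "m i \<le> measure M Y" using insert by auto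
  obtain C where C: "C \<in> sets M" "C \<subseteq> Y" "measure M C = m i"
    using subset_of_measure[OF insert.prems(1) mi] by blast
  have YC: "Y - C \<in> sets M" using insert.prems C by auto
  have "(\<Sum>k\<in>I. m k) \<le> measure M (Y - C)"
    using insert C by (simp add: finite_measure_Diff)
  then obtain Q where Q: "\<forall>k\<in>I. Q k \<in> sets M \<and> Q k \<subseteq> Y - C \<and> measure M (Q k) = m k" "disjoint_family_on Q I"
    using insert.IH[OF YC] insert.prems(2) by auto
  show ?case
  proof (intro exI conjI)
    show "disjoint_family_on (Q(i := C)) (insert i I)"
      using Q insert.hyps by (fastforce simp: disjoint_family_on_def)
    show "\<forall>k\<in>insert i I. (Q(i := C)) k \<in> sets M \<and> (Q(i := C)) k \<subseteq> Y \<and> measure M ((Q(i := C)) k) = m k"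
      using Q(1) C insert.hyps by auto
  qed
qed

text \<open>For each pair of atoms, the part of the first that \<open>s\<close> sends into the
  second is matched, after trimming to a common measure, with the corresponding part for
  \<open>t\<close>. Source and target of the matching share both labels: the second label makes
  \<open>z\<close> respect the atoms, the first one makes the composite with the inverse of
  \<open>t\<close> and with \<open>s\<close> respect them.\<close>

lemma close_transport_factorisation:
  assumes \<A>: "finite \<A>" "\<A> \<subseteq> sets M" and \<epsilon>: "0 < \<epsilon>"
  obtains \<delta> where "0 < \<delta>"
    "\<And>s t. s \<in> mp_transformations M \<Longrightarrow> t \<in> mp_transformations M \<Longrightarrow>
      (\<forall>L\<in>Pow \<A>. \<forall>L'\<in>Pow \<A>.
        \<bar>measure M {x \<in> atom M \<A> L. s x \<in> atom M \<A> L'} - measure M {x \<in> atom M \<A> L. t x \<in> atom M \<A> L'}\<bar> < \<delta>) \<Longrightarrow>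
      \<exists>z\<in>mp_transformations M. measure M (displacement M \<A> z) < \<epsilon> \<and>
        measure M (displacement M \<A> (inv_into (space M) t \<circ> z \<circ> s)) < \<epsilon>"
proof -
  define I where "I = Pow \<A> \<times> Pow \<A>"
  have I: "finite I" using \<A>(1) by (simp add: I_def)
  \<comment> \<open>At each of the \<open>card I\<close> pairs of labels trimming costs at most
    \<open>\<delta>\<close>; the added 1 makes the total strictly smaller than
    \<open>\<epsilon>\<close>.\<close>
  define \<delta> where "\<delta> = \<epsilon> / (card I + 1)"
  have \<delta>: "0 < \<delta>" "card I * \<delta> < \<epsilon>" using \<epsilon> by (auto simp: \<delta>_def field_simps)
  show ?thesis
  proof (rule that[OF \<delta>(1)])
    fix s t assume s: "s \<in> mp_transformations M" and t: "t \<in> mp_transformations M"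
      and close: "\<forall>L\<in>Pow \<A>. \<forall>L'\<in>Pow \<A>.
        \<bar>measure M {x \<in> atom M \<A> L. s x \<in> atom M \<A> L'} - measure M {x \<in> atom M \<A> L. t x \<in> atom M \<A> L'}\<bar> < \<delta>"
    \<comment> \<open>The image under \<open>v\<close> of the atom \<open>fst k\<close>, cut with
      the atom \<open>snd k\<close>. Working with images lets the matching act after
      \<open>s\<close>.\<close>
    define Y where "Y v k = {x \<in> space M. inv_into (space M) v x \<in> atom M \<A> (fst k) \<and> x \<in> atom M \<A> (snd k)}"
      for v :: "'a \<Rightarrow> 'a" and k
    have at: "atom M \<A> (fst k) \<in> sets M" "atom M \<A> (snd k) \<in> sets M" if "k \<in> I" for k
      using that \<A> by (auto simp: I_def intro: atom_sets)
    have Y: "Y v k \<in> sets M" "measure M (Y v k) = measure M {x \<in> atom M \<A> (fst k). v x \<in> atom M \<A> (snd k)}"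
      if v: "v \<in> mp_transformations M" and k: "k \<in> I" for v k
    proof -
      have "Y v k = {x \<in> space M. inv_into (space M) v x \<in> atom M \<A> (fst k)} \<inter> atom M \<A> (snd k)"
        by (auto simp: Y_def atom_def)
      then show Ys: "Y v k \<in> sets M" using mp_measure(1)[OF mp_inv[OF v] at(1)[OF k]] at(2)[OF k] by auto
      have "v x \<in> Y v k \<longleftrightarrow> x \<in> atom M \<A> (fst k) \<and> v x \<in> atom M \<A> (snd k)" if "x \<in> space M" for x
        using mp_inv_simps(1,3)[OF v that] by (simp add: Y_def)
      then have "{x \<in> space M. v x \<in> Y v k} = {x \<in> atom M \<A> (fst k). v x \<in> atom M \<A> (snd k)}"
        by (auto simp: atom_def)
      then show "measure M (Y v k) = measure M {x \<in> atom M \<A> (fst k). v x \<in> atom M \<A> (snd k)}"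
        using mp_measure(2)[OF v Ys] by simp
    qed
    have Ydisj: "disjoint_family_on (Y v) I" for v
      by (auto simp: disjoint_family_on_def Y_def atom_def)
    have Ycover: "\<exists>k\<in>I. x \<in> Y v k" if v: "v \<in> mp_transformations M" and x: "x \<in> space M" for v x
      using mp_inv_simps(4)[OF v x] x
      by (intro bexI[of _ "({A \<in> \<A>. inv_into (space M) v x \<in> A}, {A \<in> \<A>. x \<in> A})"]) (auto simp: Y_def atom_def I_def)
    define m where "m k = min (measure M (Y s k)) (measure M (Y t k))" for k
    have m: "0 \<le> m k" "m k \<le> measure M (Y s k)" "m k \<le> measure M (Y t k)" for k
      by (auto simp: m_def)
    have md: "measure M (Y s k) - m k \<le> \<delta>" if k: "k \<in> I" for k
    proof -
      have "fst k \<in> Pow \<A>" "snd k \<in> Pow \<A>" using k by (auto simp: I_def)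
      from close[rule_format, OF this] show ?thesis using Y(2)[OF s k] Y(2)[OF t k] \<delta>(1) by (auto simp: m_def min_def)
    qed
    have "\<forall>k\<in>I. \<exists>C. C \<in> sets M \<and> C \<subseteq> Y v k \<and> measure M C = m k"
      if v: "v \<in> {s, t}" for v
    proof
      fix k assume k: "k \<in> I"
      have Ys: "Y v k \<in> sets M" "m k \<le> measure M (Y v k)" using v Y(1)[OF s k] Y(1)[OF t k] m[of k] by (cases "v = s"; simp)+
      obtain C where "C \<in> sets M" "C \<subseteq> Y v k" "measure M C = m k"
        by (rule subset_of_measure[OF Ys(1) m(1) Ys(2)]) (rule that)
      then show "\<exists>C. C \<in> sets M \<and> C \<subseteq> Y v k \<and> measure M C = m k" by blast
    qed
    from this[of s, unfolded bchoice_iff] this[of t, unfolded bchoice_iff] obtain B C where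
      B: "\<forall>k\<in>I. B k \<in> sets M \<and> B k \<subseteq> Y s k \<and> measure M (B k) = m k" and
      C: "\<forall>k\<in>I. C k \<in> sets M \<and> C k \<subseteq> Y t k \<and> measure M (C k) = m k" by auto
    have disj: "disjoint_family_on B I" "disjoint_family_on C I"
      using B C Ydisj unfolding disjoint_family_on_def by blast+
    obtain z D where z: "z \<in> mp_transformations M" and D: "D \<in> sets M" "measure M D = measure M (space M)"
      and zD: "\<And>k x. k \<in> I \<Longrightarrow> x \<in> D \<Longrightarrow> x \<in> B k \<Longrightarrow> z x \<in> C k"
      using B C by (rule_tac matching[OF I _ disj(1) _ disj(2)]) auto
    define X where "X = (space M - D) \<union> (\<Union>k\<in>I. Y s k - B k)"
    have U: "(\<Union>k\<in>I. Y s k - B k) \<in> sets M"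
      using B by (intro sets.finite_UN[OF I] sets.Diff Y(1)[OF s]) simp_all
    have Xs: "X \<in> sets M" unfolding X_def using D(1) U by auto
    have "measure M X \<le> measure M (space M - D) + measure M (\<Union>k\<in>I. Y s k - B k)"
      unfolding X_def using D(1) U by (intro measure_Un_le) auto
    also have "measure M (space M - D) = 0" using D finite_measure_compl by simp
    also have "measure M (\<Union>k\<in>I. Y s k - B k) \<le> (\<Sum>k\<in>I. measure M (Y s k - B k))"
      using I B Y(1)[OF s] by (intro finite_measure_subadditive_finite) auto
    also have "\<dots> \<le> (\<Sum>k\<in>I. \<delta>)"
      using B Y(1)[OF s] md by (intro sum_mono) (simp add: finite_measure_Diff)
    finally have X: "measure M X < \<epsilon>" using \<delta>(2) by simp
    \<comment> \<open>Outside the exceptional set \<open>X\<close> the point lies in a trimmed piece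
      and in the conull set \<open>D\<close>, so the matching applies to it.\<close>
    have good: "\<exists>k\<in>I. x \<in> Y s k \<and> z x \<in> Y t k" if xS: "x \<in> space M" and xX: "x \<notin> X" for x
    proof -
      obtain k where k: "k \<in> I" "x \<in> Y s k" using Ycover[OF s xS] by blast
      then have "x \<in> B k" "x \<in> D" using xS xX by (auto simp: X_def)
      then show ?thesis using zD[OF k(1)] C k by blast
    qed
    have "displacement M \<A> z \<subseteq> X"
    proof
      fix x assume x: "x \<in> displacement M \<A> z"
      show "x \<in> X"
      proof (rule ccontr)
        assume xX: "x \<notin> X"
        have "x \<in> space M" using x by (simp add: displacement_def)
        then obtain k where "x \<in> Y s k" "z x \<in> Y t k" using good[OF _ xX] by blast
        then have "{A \<in> \<A>. x \<in> A} = {A \<in> \<A>. z x \<in> A}" by (simp add: Y_def atom_def)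
        then show False using x by (auto simp: displacement_def)
      qed
    qed
    then have 1: "measure M (displacement M \<A> z) < \<epsilon>"
      using finite_measure_mono[of "displacement M \<A> z" X] Xs X by simp
    \<comment> \<open>Here the exceptional set is met at \<open>s x\<close>; its preimage under
      \<open>s\<close> has the same measure as \<open>X\<close>.\<close>
    have "displacement M \<A> (inv_into (space M) t \<circ> z \<circ> s) \<subseteq> {x \<in> space M. s x \<in> X}"
    proof
      fix x assume x: "x \<in> displacement M \<A> (inv_into (space M) t \<circ> z \<circ> s)"
      then have xS: "x \<in> space M" by (simp add: displacement_def)
      have "s x \<in> X"
      proof (rule ccontr)
        assume "s x \<notin> X"
        then obtain k where "s x \<in> Y s k" "z (s x) \<in> Y t k" using good[of "s x"] mp_inv_simps(3)[OF s xS] by auto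
        then have "{A \<in> \<A>. x \<in> A} = {A \<in> \<A>. inv_into (space M) t (z (s x)) \<in> A}"
          using mp_inv_simps(1)[OF s xS] by (simp add: Y_def atom_def)
        then show False using x by (auto simp: displacement_def)
      qed
      then show "x \<in> {x \<in> space M. s x \<in> X}" using xS by simp
    qed
    then have "measure M (displacement M \<A> (inv_into (space M) t \<circ> z \<circ> s)) \<le> measure M {x \<in> space M. s x \<in> X}"
      using mp_measure(1)[OF s Xs] by (rule finite_measure_mono)
    then have 2: "measure M (displacement M \<A> (inv_into (space M) t \<circ> z \<circ> s)) < \<epsilon>"
      using mp_measure(2)[OF s Xs] X by simp
    show "\<exists>z\<in>mp_transformations M. measure M (displacement M \<A> z) < \<epsilon> \<and>
        measure M (displacement M \<A> (inv_into (space M) t \<circ> z \<circ> s)) < \<epsilon>"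
      using z 1 2 by blast
  qed
qed

text \<open>The coefficients of \<open>K\<close> on the atoms form a nonnegative matrix whose row
  and column sums are the measures of the atoms, because the adjoint and \<open>K\<close> fix 1.
  Hence every atom can be split as a source according to its row and as a target according to its
  column, and pieces with the same pair of labels are matched.\<close>

lemma markov_operator_transport:
  assumes K: "K \<in> markov_ops M" and \<A>: "finite \<A>" "\<A> \<subseteq> sets M"
  obtains T where "T \<in> carrier (Aut M)"
    "\<And>A B. A \<in> \<A> \<Longrightarrow> B \<in> \<A> \<Longrightarrow>
      op_form M (koopman M T) (indicator A) (indicator B) = op_form M K (indicator A) (indicator B)"
proof -
  define b where "b = op_form M K"
  have mb: "markov_form M b" unfolding b_def using K by (rule markov_form_op_form)
  then have cb: "contraction_form M b" by (simp add: markov_form_def)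
  define P where "P = Pow \<A>"
  have P: "finite P" using \<A>(1) by (simp add: P_def)
  define a where "a L = atom M \<A> L" for L
  have a: "a L \<in> sets M" if "L \<in> P" for L using that \<A> by (auto simp: a_def P_def intro: atom_sets)
  have ia: "indicator (a L) \<in> square_integrable M" if "L \<in> P" for L using a[OF that] by (rule sq_indicator)
  define m where "m L L' = Re (b (indicator (a L)) (indicator (a L')))" for L L'
  have bm: "b (indicator (a L)) (indicator (a L')) = complex_of_real (m L L')" "0 \<le> m L L'"
    if "L \<in> P" "L' \<in> P" for L L'
  proof -
    have "b (indicator (a L)) (indicator (a L')) \<in> \<real>\<^sub>\<ge>\<^sub>0"
      using mb ia[OF that(1)] ia[OF that(2)] by (auto simp: markov_form_def indicator_def)
    then show "b (indicator (a L)) (indicator (a L')) = complex_of_real (m L L')" "0 \<le> m L L'"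
      by (auto simp: m_def complex_nonneg_Reals_iff complex_eq_iff)
  qed
  have one: "(\<lambda>x. \<Sum>L\<in>P. indicator (a L) x :: complex) \<in> square_integrable M"
    "AE x in M. (\<Sum>L\<in>P. indicator (a L) x :: complex) = 1"
  proof -
    show "(\<lambda>x. \<Sum>L\<in>P. indicator (a L) x :: complex) \<in> square_integrable M" using ia by (rule sq_sum)
    show "AE x in M. (\<Sum>L\<in>P. indicator (a L) x :: complex) = 1"
      using sum_indicator_atoms[OF \<A>(1), of _ M "\<lambda>_. True"] by (intro AE_I2) (simp add: P_def a_def Pow_def)
  qed
  have ipa: "ip M (indicator (a L)) (\<lambda>_. 1) = complex_of_real (measure M (a L))"
    "ip M (\<lambda>_. 1) (indicator (a L)) = complex_of_real (measure M (a L))" if "L \<in> P" for L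
  proof -
    show 1: "ip M (indicator (a L)) (\<lambda>_. 1) = complex_of_real (measure M (a L))"
    proof -
      have "ip M (indicator (a L)) (\<lambda>_. 1) = (LINT x|M. complex_of_real (indicator (a L) x))"
        unfolding ip_def by (rule Bochner_Integration.integral_cong) (simp_all add: indicator_def)
      also have "\<dots> = complex_of_real (LINT x|M. indicator (a L) x)" by (rule integral_complex_of_real)
      finally show ?thesis using a[OF that] sets.sets_into_space[OF a[OF that]] by (simp add: Int_absorb2)
    qed
    show "ip M (\<lambda>_. 1) (indicator (a L)) = complex_of_real (measure M (a L))"
      using 1 ip_cnj[of M "\<lambda>_. 1" "indicator (a L)"] by simp
  qed
  have row: "(\<Sum>L'\<in>P. m L L') = measure M (a L)" if L: "L \<in> P" for L
  proof -
    have "complex_of_real (\<Sum>L'\<in>P. m L L') = (\<Sum>L'\<in>P. b (indicator (a L)) (indicator (a L')))"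
      using bm L by simp
    also have "\<dots> = b (indicator (a L)) (\<lambda>x. \<Sum>L'\<in>P. indicator (a L') x)"
      by (rule contraction_form_sum(2)[OF cb ia ia[OF L], symmetric])
    also have "\<dots> = b (indicator (a L)) (\<lambda>_. 1)"
      using one ia[OF L] sq_one by (intro contraction_form_cong_AE[OF cb]) auto
    also have "\<dots> = complex_of_real (measure M (a L))"
      using mb ia[OF L] ipa(1)[OF L] by (simp add: markov_form_def)
    finally show ?thesis by (simp only: of_real_eq_iff)
  qed
  have col: "(\<Sum>L\<in>P. m L L') = measure M (a L')" if L': "L' \<in> P" for L'
  proof -
    have "complex_of_real (\<Sum>L\<in>P. m L L') = (\<Sum>L\<in>P. b (indicator (a L)) (indicator (a L')))"
      using bm L' by simp
    also have "\<dots> = b (\<lambda>x. \<Sum>L\<in>P. indicator (a L) x) (indicator (a L'))"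
      by (rule contraction_form_sum(1)[OF cb ia ia[OF L'], symmetric])
    also have "\<dots> = b (\<lambda>_. 1) (indicator (a L'))"
      using one ia[OF L'] sq_one by (intro contraction_form_cong_AE[OF cb]) auto
    also have "\<dots> = complex_of_real (measure M (a L'))"
      using mb ia[OF L'] ipa(2)[OF L'] by (simp add: markov_form_def)
    finally show ?thesis by (simp only: of_real_eq_iff)
  qed
  \<comment> \<open>\<open>Q L k\<close> is the part of the atom \<open>L\<close> that is to be sent
    to the atom \<open>k\<close>; below, \<open>R L k\<close> is the part of \<open>L\<close>
    reserved for what arrives from \<open>k\<close>, so its measure has the two indices
    exchanged.\<close>
  have "\<forall>L\<in>P. \<exists>Q. (\<forall>k\<in>P. Q k \<in> sets M \<and> Q k \<subseteq> a L \<and> measure M (Q k) = m L k) \<and> disjoint_family_on Q P"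
    using row bm(2) a by (intro ballI split_measure[OF P]) auto
  from this[unfolded bchoice_iff] obtain Q where
    Q: "\<forall>L\<in>P. (\<forall>k\<in>P. Q L k \<in> sets M \<and> Q L k \<subseteq> a L \<and> measure M (Q L k) = m L k) \<and> disjoint_family_on (Q L) P"
    by (elim exE) (rule that)
  have "\<forall>L\<in>P. \<exists>R. (\<forall>k\<in>P. R k \<in> sets M \<and> R k \<subseteq> a L \<and> measure M (R k) = m k L) \<and> disjoint_family_on R P"
    using col bm(2) a by (intro ballI split_measure[OF P]) auto
  from this[unfolded bchoice_iff] obtain R where
    R: "\<forall>L\<in>P. (\<forall>k\<in>P. R L k \<in> sets M \<and> R L k \<subseteq> a L \<and> measure M (R L k) = m k L) \<and> disjoint_family_on (R L) P"
    by (elim exE) (rule that)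
  define B where "B k = Q (fst k) (snd k)" for k
  define C where "C k = R (snd k) (fst k)" for k
  have PP: "finite (P \<times> P)" using P by simp
  have B: "B k \<in> sets M" "B k \<subseteq> a (fst k)" "measure M (B k) = m (fst k) (snd k)"
    and C: "C k \<in> sets M" "C k \<subseteq> a (snd k)" "measure M (C k) = m (fst k) (snd k)" if "k \<in> P \<times> P" for k
  proof -
    have "fst k \<in> P" "snd k \<in> P" using that by auto
    then show "B k \<in> sets M" "B k \<subseteq> a (fst k)" "measure M (B k) = m (fst k) (snd k)"
      "C k \<in> sets M" "C k \<subseteq> a (snd k)" "measure M (C k) = m (fst k) (snd k)"
      using Q R unfolding B_def C_def by blast+
  qed
  have adisj: "a L \<inter> a L' = {}" if "L \<noteq> L'" for L L' using disjoint_atoms[OF that] by (simp add: a_def)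
  have Bd: "disjoint_family_on B (P \<times> P)"
    unfolding disjoint_family_on_def
  proof (intro ballI impI)
    fix k l assume kl: "k \<in> P \<times> P" "l \<in> P \<times> P" "k \<noteq> l"
    show "B k \<inter> B l = {}"
    proof (cases "fst k = fst l")
      case True
      then have "snd k \<noteq> snd l" using kl(3) by (auto simp: prod_eq_iff)
      moreover have "disjoint_family_on (Q (fst k)) P" "snd k \<in> P" "snd l \<in> P" using Q kl by auto
      ultimately show ?thesis using True by (auto simp: B_def disjoint_family_on_def)
    next
      case False
      then show ?thesis using adisj B(2)[OF kl(1)] B(2)[OF kl(2)] by blast
    qed
  qed
  have Cd: "disjoint_family_on C (P \<times> P)"
    unfolding disjoint_family_on_def
  proof (intro ballI impI)
    fix k l assume kl: "k \<in> P \<times> P" "l \<in> P \<times> P" "k \<noteq> l"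
    show "C k \<inter> C l = {}"
    proof (cases "snd k = snd l")
      case True
      then have "fst k \<noteq> fst l" using kl(3) by (auto simp: prod_eq_iff)
      moreover have "disjoint_family_on (R (snd k)) P" "fst k \<in> P" "fst l \<in> P" using R kl by auto
      ultimately show ?thesis using True by (auto simp: C_def disjoint_family_on_def)
    next
      case False
      then show ?thesis using adisj C(2)[OF kl(1)] C(2)[OF kl(2)] by blast
    qed
  qed
  obtain z D where z: "z \<in> mp_transformations M" and D: "D \<in> sets M" "measure M D = measure M (space M)"
    and zD: "\<And>k x. k \<in> P \<times> P \<Longrightarrow> x \<in> D \<Longrightarrow> x \<in> B k \<Longrightarrow> z x \<in> C k"
    using B C by (rule_tac matching[OF PP _ Bd _ Cd]) auto
  define n where "n L L' = measure M {x \<in> a L. z x \<in> a L'}" for L L'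
  have nset: "{x \<in> a L. z x \<in> a L'} \<in> sets M" if "L \<in> P" "L' \<in> P" for L L'
  proof -
    have "{x \<in> a L. z x \<in> a L'} = a L \<inter> {x \<in> space M. z x \<in> a L'}" by (auto simp: a_def atom_def)
    then show ?thesis using a mp_measure(1)[OF z] that by auto
  qed
  \<comment> \<open>The matching only guarantees that at least \<open>m L L'\<close> is transported,
    up to a null set. Both matrices have the same row sums, and this forces equality of the
    entries.\<close>
  have mn: "m L L' \<le> n L L'" if LL: "L \<in> P" "L' \<in> P" for L L'
  proof -
    let ?k = "(L, L')"
    have k: "?k \<in> P \<times> P" using LL by simp
    have "measure M (B ?k) \<le> measure M ({x \<in> a L. z x \<in> a L'} \<union> (space M - D))"
    proof (rule finite_measure_mono)
      show "B ?k \<subseteq> {x \<in> a L. z x \<in> a L'} \<union> (space M - D)"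
        using zD[OF k] B(2)[OF k] C(2)[OF k] sets.sets_into_space[OF B(1)[OF k]] by auto
    qed (use nset[OF LL] D(1) in auto)
    also have "\<dots> \<le> n L L' + measure M (space M - D)"
      unfolding n_def using nset[OF LL] D(1) by (intro measure_Un_le) auto
    also have "measure M (space M - D) = 0" using D finite_measure_compl by simp
    finally show ?thesis using B(3)[OF k] by simp
  qed
  have nrow: "(\<Sum>L'\<in>P. n L L') = measure M (a L)" if L: "L \<in> P" for L
  proof -
    have "(\<Sum>L'\<in>P. n L L') = measure M (\<Union>L'\<in>P. {x \<in> a L. z x \<in> a L'})"
      unfolding n_def using P nset[OF L] adisj
      by (intro finite_measure_finite_Union[symmetric]) (auto simp: disjoint_family_on_def)
    also have "(\<Union>L'\<in>P. {x \<in> a L. z x \<in> a L'}) = a L"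
    proof
      show "a L \<subseteq> (\<Union>L'\<in>P. {x \<in> a L. z x \<in> a L'})"
      proof
        fix x assume x: "x \<in> a L"
        then have "z x \<in> space M" using mp_inv_simps(3)[OF z] by (simp add: a_def atom_def)
        then have "z x \<in> a {A \<in> \<A>. z x \<in> A}" by (simp add: a_def atom_def)
        moreover have "{A \<in> \<A>. z x \<in> A} \<in> P" by (auto simp: P_def)
        ultimately show "x \<in> (\<Union>L'\<in>P. {x \<in> a L. z x \<in> a L'})" using x by blast
      qed
    qed auto
    finally show ?thesis .
  qed
  have nm: "n L L' = m L L'" if LL: "L \<in> P" "L' \<in> P" for L L'
  proof -
    have "(\<Sum>L'\<in>P. n L L' - m L L') = 0" using nrow[OF LL(1)] row[OF LL(1)] by (simp add: sum_subtractf)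
    then have "\<forall>L'\<in>P. n L L' - m L L' = 0"
      using sum_nonneg_eq_0_iff[OF P, of "\<lambda>L'. n L L' - m L L'"] mn[OF LL(1)] by auto
    then show ?thesis using LL(2) by simp
  qed
  let ?T = "aut_class M z"
  have T: "?T \<in> carrier (Aut M)" using z by (rule aut_class_carrier)
  have cT: "contraction_form M (op_form M (koopman M ?T))"
    using markov_form_op_form[OF koopman_markov[OF T]] by (simp add: markov_form_def)
  have agree: "op_form M (koopman M ?T) (indicator (atom M \<A> L)) (indicator (atom M \<A> L')) =
      b (indicator (atom M \<A> L)) (indicator (atom M \<A> L'))" if LL: "L \<in> P" "L' \<in> P" for L L'
    using koopman_form_indicator[OF T z refl a[OF LL(1)] a[OF LL(2)]] bm(1)[OF LL] nm[OF LL]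
    by (simp add: n_def a_def)
  show ?thesis
  proof (rule that[OF T])
    fix A B assume AB: "A \<in> \<A>" "B \<in> \<A>"
    show "op_form M (koopman M ?T) (indicator A) (indicator B) = op_form M K (indicator A) (indicator B)"
      unfolding contraction_form_atoms[OF cT \<A> AB] contraction_form_atoms[OF cb \<A> AB, unfolded b_def]
      using agree by (intro sum.cong refl) (simp add: P_def b_def)
  qed
qed

end

section \<open>The Roelcke uniform structure\<close>

lemma l2_inner_diff_le:
  assumes F: "F \<in> L2 M" "F' \<in> L2 M" and G: "G \<in> L2 M"
  shows "cmod (l2_inner M F G - l2_inner M F' G) \<le> l2_dist M F F' * l2_norm M G"
    and "cmod (l2_inner M G F - l2_inner M G F') \<le> l2_norm M G * l2_dist M F F'"
proof -
  define f f' g where "f = rep F" and "f' = rep F'" and "g = rep G"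
  have f: "f \<in> square_integrable M" "F = l2_class M f" and f': "f' \<in> square_integrable M" "F' = l2_class M f'"
    and g: "g \<in> square_integrable M" "G = l2_class M g"
    using L2_rep[OF F(1)] L2_rep[OF F(2)] L2_rep[OF G] by (simp_all add: f_def f'_def g_def)
  show "cmod (l2_inner M F G - l2_inner M F' G) \<le> l2_dist M F F' * l2_norm M G"
    unfolding f(2) f'(2) g(2) l2_inner_class[OF f(1) g(1)] l2_inner_class[OF f'(1) g(1)]
      l2_dist_class[OF f(1) f'(1)] l2_norm_class[OF g(1)] ip_diff_left[OF f(1) f'(1) g(1), symmetric]
    by (rule ip_Cauchy_Schwarz[OF sq_diff[OF f(1) f'(1)] g(1)])
  show "cmod (l2_inner M G F - l2_inner M G F') \<le> l2_norm M G * l2_dist M F F'"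
    unfolding f(2) f'(2) g(2) l2_inner_class[OF g(1) f(1)] l2_inner_class[OF g(1) f'(1)]
      l2_dist_class[OF f(1) f'(1)] l2_norm_class[OF g(1)] ip_diff_right[OF f(1) f'(1) g(1), symmetric]
    by (rule ip_Cauchy_Schwarz[OF g(1) sq_diff[OF f(1) f'(1)]])
qed

text \<open>For vectors of equal norm the squared distance is twice the real part of the inner
  product of \<open>F - G\<close> with \<open>F\<close>. Hence weak closeness together with equality
  of norms is strong closeness.\<close>

lemma l2_dist_power2:
  assumes F: "F \<in> L2 M" and G: "G \<in> L2 M" and eq: "l2_norm M F = l2_norm M G"
  shows "(l2_dist M F G)\<^sup>2 \<le> 2 * cmod (l2_inner M F F - l2_inner M G F)"
proof -
  define f g where "f = rep F" and "g = rep G"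
  have f: "f \<in> square_integrable M" "F = l2_class M f" and g: "g \<in> square_integrable M" "G = l2_class M g"
    using L2_rep[OF F] L2_rep[OF G] by (simp_all add: f_def g_def)
  have n: "nrm M f = nrm M g" using eq unfolding f(2) g(2) l2_norm_class[OF f(1)] l2_norm_class[OF g(1)] .
  have "(nrm M (\<lambda>x. f x - g x))\<^sup>2 = (nrm M f)\<^sup>2 + (nrm M g)\<^sup>2 - 2 * Re (ip M f g)"
    using nrm_add_power2[OF f(1) sq_scale[OF g(1), of "-1"]] nrm_scale[of M "-1" g] ip_scale_right[of M f "-1" g]
    by simp
  also have "\<dots> = 2 * Re (ip M f f - ip M g f)"
    using n ip_self[OF f(1)] ip_cnj[of M g f] by simp
  also have "\<dots> \<le> 2 * cmod (ip M f f - ip M g f)" by (intro mult_left_mono complex_Re_le_cmod) simp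
  finally show ?thesis
    unfolding f(2) g(2) l2_inner_class[OF f(1) f(1)] l2_inner_class[OF g(1) f(1)] l2_dist_class[OF f(1) g(1)] .
qed

lemma koopman_dist:
  assumes T: "T \<in> carrier (Aut M)" and F: "F \<in> L2 M" and G: "G \<in> L2 M"
  shows "l2_dist M (koopman M T F) (koopman M T G) = l2_dist M F G"
proof -
  note t = mp_inv[OF Aut_rep(1)[OF T]] and f = L2_rep(1)[OF F] and g = L2_rep(1)[OF G]
  have "nrm M (\<lambda>x. rep F (inv_into (space M) (rep T) x) - rep G (inv_into (space M) (rep T) x)) =
      nrm M (\<lambda>x. rep F x - rep G x)"
    using sq_comp(2)[OF t sq_diff[OF f g]] .
  then show ?thesis
    unfolding koopman_L2(2)[OF T F] koopman_L2(2)[OF T G] l2_dist_class[OF sq_comp(1)[OF t f] sq_comp(1)[OF t g]]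
    using l2_dist_class[OF f g] L2_rep(2)[OF F] L2_rep(2)[OF G] by simp
qed

definition sot_gauge :: "'a measure \<Rightarrow> 'a l2 \<Rightarrow> ('a \<Rightarrow> 'a) set \<Rightarrow> ('a \<Rightarrow> 'a) set \<Rightarrow> real" where
  "sot_gauge M F S T = l2_dist M (koopman M S F) (koopman M T F)"

abbreviation koopman_uniformity :: "'a measure \<Rightarrow> (('a \<Rightarrow> 'a) set \<times> ('a \<Rightarrow> 'a) set) filter" where
  "koopman_uniformity M \<equiv> gauge_uniformity (carrier (Aut M)) (L2 M \<times> L2 M)
     (\<lambda>p S T. wot_gauge M p (koopman M S) (koopman M T))"

lemma wot_gauge_inner:
  "F \<in> L2 M \<Longrightarrow> G \<in> L2 M \<Longrightarrow> wot_gauge M (F, G) K K' = cmod (l2_inner M (K F) G - l2_inner M (K' F) G)"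
  by (simp add: wot_gauge_def op_matrix_def dist_norm)

lemma
  shows gauge_sot: "gauge (carrier (Aut M)) (L2 M) (sot_gauge M)"
    and weak_topology_sot: "weak_topology M =
      uniform_topology (carrier (Aut M)) (gauge_uniformity (carrier (Aut M)) (L2 M) (sot_gauge M))"
proof -
  let ?P = "product_topology (\<lambda>_. Metric_space.mtopology (L2 M) (l2_dist M)) (L2 M)"
  have mem: "koopman M T \<in> (\<Pi>\<^sub>E F\<in>L2 M. L2 M)" if "T \<in> carrier (Aut M)" for T
    using koopman_bounded_ops[OF that] by (simp add: bounded_ops_def)
  note * = pullback_product_gauge[where I = "L2 M" and X = "\<lambda>_. L2 M" and D = "\<lambda>_. l2_dist M"
      and f = "koopman M" and S = "carrier (Aut M)", OF Metric_space_L2 mem]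
  show "gauge (carrier (Aut M)) (L2 M) (sot_gauge M)"
    using *(1) unfolding sot_gauge_def[abs_def] .
  have "weak_topology M = pullback_topology (carrier (Aut M)) (koopman M) ?P"
    unfolding weak_topology_def strong_operator_topology_def subtopology_subtopology topology_eq
      openin_pullback_topology openin_subtopology
  proof (intro allI iffI)
    fix V assume "\<exists>U. (\<exists>W. openin ?P W \<and> U = W \<inter> (bounded_ops M \<inter> unitary_ops M)) \<and> V = koopman M -` U \<inter> carrier (Aut M)"
    then obtain W where "openin ?P W" "V = koopman M -` (W \<inter> (bounded_ops M \<inter> unitary_ops M)) \<inter> carrier (Aut M)" by blast
    then show "\<exists>U. openin ?P U \<and> V = koopman M -` U \<inter> carrier (Aut M)"
      using koopman_unitary koopman_bounded_ops by (intro exI[of _ W]) auto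
  next
    fix V assume "\<exists>U. openin ?P U \<and> V = koopman M -` U \<inter> carrier (Aut M)"
    then obtain W where "openin ?P W" "V = koopman M -` W \<inter> carrier (Aut M)" by blast
    then show "\<exists>U. (\<exists>W. openin ?P W \<and> U = W \<inter> (bounded_ops M \<inter> unitary_ops M)) \<and> V = koopman M -` U \<inter> carrier (Aut M)"
      using koopman_unitary koopman_bounded_ops
      by (intro exI[of _ "W \<inter> (bounded_ops M \<inter> unitary_ops M)"]) auto
  qed
  then show "weak_topology M =
      uniform_topology (carrier (Aut M)) (gauge_uniformity (carrier (Aut M)) (L2 M) (sot_gauge M))"
    using *(2) unfolding sot_gauge_def[abs_def] by simp
qed

text \<open>A comparison at a fixed centre: the controlling index \<open>j\<close> may depend on
  \<open>x\<close>, which is enough for topologies but says nothing about uniform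
  structures.\<close>

lemma gauge_topology_finer:
  assumes d: "gauge S I d" and d': "gauge S I' d'"
    and le: "\<And>x i e. x \<in> S \<Longrightarrow> i \<in> I' \<Longrightarrow> 0 < e \<Longrightarrow> \<exists>j\<in>I. \<exists>r>0. \<forall>y\<in>S. d j x y < r \<longrightarrow> d' i x y < e"
    and U: "openin (uniform_topology S (gauge_uniformity S I' d')) U"
  shows "openin (uniform_topology S (gauge_uniformity S I d)) U"
  unfolding gauge.openin_gauge[OF d]
proof (intro conjI ballI)
  show "U \<subseteq> S" using U unfolding gauge.openin_gauge[OF d'] by blast
  fix x assume x: "x \<in> U"
  then obtain J e where J: "finite J" "J \<subseteq> I'" "0 < e" "{y \<in> S. \<forall>i\<in>J. d' i x y < e} \<subseteq> U" "x \<in> S"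
    using U unfolding gauge.openin_gauge[OF d'] by blast
  have "\<forall>i\<in>J. \<exists>j r. j \<in> I \<and> 0 < r \<and> (\<forall>y\<in>S. d j x y < r \<longrightarrow> d' i x y < e)"
  proof
    fix i assume "i \<in> J"
    then show "\<exists>j r. j \<in> I \<and> 0 < r \<and> (\<forall>y\<in>S. d j x y < r \<longrightarrow> d' i x y < e)"
      using le[OF J(5) _ J(3), of i] J(2) by blast
  qed
  from this[unfolded bchoice_iff] obtain j r where
    jr: "\<forall>i\<in>J. j i \<in> I \<and> (0::real) < r i \<and> (\<forall>y\<in>S. d (j i) x y < r i \<longrightarrow> d' i x y < e)"
    by (elim exE) (rule that)
  define m where "m = Min (insert 1 (r ` J))"
  have m: "0 < m" "\<And>i. i \<in> J \<Longrightarrow> m \<le> r i" using J(1) jr by (auto simp: m_def)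
  have "{y \<in> S. \<forall>i\<in>j ` J. d i x y < m} \<subseteq> U"
  proof
    fix y assume y: "y \<in> {y \<in> S. \<forall>i\<in>j ` J. d i x y < m}"
    have "d' i x y < e" if i: "i \<in> J" for i
    proof -
      have "d (j i) x y < r i" using y m(2)[OF i] i by fastforce
      then show ?thesis using jr i y by blast
    qed
    then show "y \<in> U" using y J(4) by blast
  qed
  then show "\<exists>K e. finite K \<and> K \<subseteq> I \<and> 0 < e \<and> {y \<in> S. \<forall>i\<in>K. d i x y < e} \<subseteq> U"
    using J(1) jr m(1) by (intro exI[of _ "j ` J"] exI[of _ m]) auto
qed

lemma eventually_left_uniformity:
  assumes T: "\<one>\<^bsub>G\<^esub> \<in> topspace T"
  shows "eventually P (left_uniformity G T) \<longleftrightarrow> (\<exists>U. openin T U \<and> \<one>\<^bsub>G\<^esub> \<in> U \<and>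
     (\<forall>x\<in>carrier G. \<forall>y\<in>carrier G. inv\<^bsub>G\<^esub> x \<otimes>\<^bsub>G\<^esub> y \<in> U \<longrightarrow> P (x, y)))"
  unfolding left_uniformity_def
proof (subst eventually_INF_base)
  show "{U. openin T U \<and> \<one>\<^bsub>G\<^esub> \<in> U} \<noteq> {}" using T by blast
  fix U V assume "U \<in> {U. openin T U \<and> \<one>\<^bsub>G\<^esub> \<in> U}" "V \<in> {U. openin T U \<and> \<one>\<^bsub>G\<^esub> \<in> U}"
  then show "\<exists>W\<in>{U. openin T U \<and> \<one>\<^bsub>G\<^esub> \<in> U}.
      principal {(x, y) \<in> carrier G \<times> carrier G. inv\<^bsub>G\<^esub> x \<otimes>\<^bsub>G\<^esub> y \<in> W} \<le>
      inf (principal {(x, y) \<in> carrier G \<times> carrier G. inv\<^bsub>G\<^esub> x \<otimes>\<^bsub>G\<^esub> y \<in> U})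
        (principal {(x, y) \<in> carrier G \<times> carrier G. inv\<^bsub>G\<^esub> x \<otimes>\<^bsub>G\<^esub> y \<in> V})"
    by (intro bexI[of _ "U \<inter> V"]) auto
qed (simp add: eventually_principal, blast)

lemma eventually_right_uniformity:
  assumes T: "\<one>\<^bsub>G\<^esub> \<in> topspace T"
  shows "eventually P (right_uniformity G T) \<longleftrightarrow> (\<exists>U. openin T U \<and> \<one>\<^bsub>G\<^esub> \<in> U \<and>
     (\<forall>x\<in>carrier G. \<forall>y\<in>carrier G. x \<otimes>\<^bsub>G\<^esub> inv\<^bsub>G\<^esub> y \<in> U \<longrightarrow> P (x, y)))"
  unfolding right_uniformity_def
proof (subst eventually_INF_base)
  show "{U. openin T U \<and> \<one>\<^bsub>G\<^esub> \<in> U} \<noteq> {}" using T by blast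
  fix U V assume "U \<in> {U. openin T U \<and> \<one>\<^bsub>G\<^esub> \<in> U}" "V \<in> {U. openin T U \<and> \<one>\<^bsub>G\<^esub> \<in> U}"
  then show "\<exists>W\<in>{U. openin T U \<and> \<one>\<^bsub>G\<^esub> \<in> U}.
      principal {(x, y) \<in> carrier G \<times> carrier G. x \<otimes>\<^bsub>G\<^esub> inv\<^bsub>G\<^esub> y \<in> W} \<le>
      inf (principal {(x, y) \<in> carrier G \<times> carrier G. x \<otimes>\<^bsub>G\<^esub> inv\<^bsub>G\<^esub> y \<in> U})
        (principal {(x, y) \<in> carrier G \<times> carrier G. x \<otimes>\<^bsub>G\<^esub> inv\<^bsub>G\<^esub> y \<in> V})"
    by (intro bexI[of _ "U \<inter> V"]) auto
qed (simp add: eventually_principal, blast)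

text \<open>\<open>v\<close> carries its own displacement set onto that of its inverse.\<close>

lemma displacement_inv:
  assumes v: "v \<in> mp_transformations M" and \<A>: "finite \<A>" "\<A> \<subseteq> sets M"
  shows "measure M (displacement M \<A> (inv_into (space M) v)) = measure M (displacement M \<A> v)"
proof -
  have "v x \<in> displacement M \<A> (inv_into (space M) v) \<longleftrightarrow> x \<in> displacement M \<A> v" if "x \<in> space M" for x
    using mp_inv_simps[OF v that] that by (auto simp: displacement_def)
  then have "{x \<in> space M. v x \<in> displacement M \<A> (inv_into (space M) v)} = displacement M \<A> v"
    by (auto simp: displacement_def)
  then show ?thesis using mp_measure(2)[OF v displacement_sets[OF mp_inv[OF v] \<A>]] by simp
qed

lemma displacement_mono: "\<A> \<subseteq> \<B> \<Longrightarrow> displacement M \<A> v \<subseteq> displacement M \<B> v"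
  by (auto simp: displacement_def)

section \<open>Matrix coefficients compared with the weak topology and with the left and right
  structures\<close>

context finite_measure
begin

text \<open>The approximation by indicators, made simultaneous for the finitely many pairs in
  \<open>J\<close> by uniting the families of sets.\<close>

lemma wot_gauge_approx:
  assumes J: "finite J" "J \<subseteq> L2 M \<times> L2 M" and e: "0 < e"
  obtains \<A> \<delta> where "finite \<A>" "\<A> \<subseteq> sets M" "0 < \<delta>"
    "\<And>K K' p. K \<in> markov_ops M \<Longrightarrow> K' \<in> markov_ops M \<Longrightarrow>
      (\<forall>A\<in>\<A>. \<forall>B\<in>\<A>.
        cmod (op_form M K (indicator A) (indicator B) - op_form M K' (indicator A) (indicator B)) < \<delta>) \<Longrightarrow>
      p \<in> J \<Longrightarrow> wot_gauge M p K K' < e"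
proof -
  have "\<forall>p\<in>J. \<exists>\<A> \<delta>. finite \<A> \<and> \<A> \<subseteq> sets M \<and> 0 < \<delta> \<and> (\<forall>K\<in>markov_ops M. \<forall>K'\<in>markov_ops M.
      (\<forall>A\<in>\<A>. \<forall>B\<in>\<A>. cmod (op_form M K (indicator A) (indicator B) - op_form M K' (indicator A) (indicator B)) < \<delta>) \<longrightarrow>
      wot_gauge M p K K' < e)"
  proof
    fix p assume "p \<in> J"
    then obtain F G where p: "p = (F, G)" "F \<in> L2 M" "G \<in> L2 M" using J(2) by auto
    obtain \<A> \<delta> where A: "finite \<A>" "\<A> \<subseteq> sets M" "0 < \<delta>"
      "\<And>b b'. contraction_form M b \<Longrightarrow> contraction_form M b' \<Longrightarrow>
       (\<forall>A\<in>\<A>. \<forall>B\<in>\<A>. cmod (b (indicator A) (indicator B) - b' (indicator A) (indicator B)) < \<delta>) \<Longrightarrow>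
       cmod (b (rep F) (rep G) - b' (rep F) (rep G)) < e"
      by (rule contraction_form_approx[OF L2_rep(1)[OF p(2)] L2_rep(1)[OF p(3)] e]) (rule that)
    have "wot_gauge M p K K' < e" if K: "K \<in> markov_ops M" "K' \<in> markov_ops M"
      "\<forall>A\<in>\<A>. \<forall>B\<in>\<A>. cmod (op_form M K (indicator A) (indicator B) - op_form M K' (indicator A) (indicator B)) < \<delta>" for K K'
    proof -
      have "contraction_form M (op_form M K)" "contraction_form M (op_form M K')"
        using markov_form_op_form[OF K(1)] markov_form_op_form[OF K(2)] by (simp_all add: markov_form_def)
      from A(4)[OF this K(3)] show ?thesis
        unfolding wot_gauge_def p(1) op_matrix_class[OF p(2,3)] dist_norm .
    qed
    then show "\<exists>\<A> \<delta>. finite \<A> \<and> \<A> \<subseteq> sets M \<and> 0 < \<delta> \<and> (\<forall>K\<in>markov_ops M. \<forall>K'\<in>markov_ops M.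
      (\<forall>A\<in>\<A>. \<forall>B\<in>\<A>. cmod (op_form M K (indicator A) (indicator B) - op_form M K' (indicator A) (indicator B)) < \<delta>) \<longrightarrow>
      wot_gauge M p K K' < e)" using A(1-3) by blast
  qed
  from this[unfolded bchoice_iff] obtain \<A> \<delta> where
    A: "\<forall>p\<in>J. finite (\<A> p) \<and> \<A> p \<subseteq> sets M \<and> 0 < \<delta> p \<and> (\<forall>K\<in>markov_ops M. \<forall>K'\<in>markov_ops M.
      (\<forall>A\<in>\<A> p. \<forall>B\<in>\<A> p. cmod (op_form M K (indicator A) (indicator B) - op_form M K' (indicator A) (indicator B)) < \<delta> p) \<longrightarrow>
      wot_gauge M p K K' < e)"
    by (elim exE) (rule that)
  define m where "m = Min (insert 1 (\<delta> ` J))"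
  have m: "0 < m" "\<And>p. p \<in> J \<Longrightarrow> m \<le> \<delta> p" using J(1) A by (auto simp: m_def)
  show ?thesis
  proof (rule that[of "\<Union>p\<in>J. \<A> p" m])
    show "finite (\<Union>p\<in>J. \<A> p)" "(\<Union>p\<in>J. \<A> p) \<subseteq> sets M" "0 < m" using J(1) A m(1) by auto
    fix K K' p assume K: "K \<in> markov_ops M" "K' \<in> markov_ops M" and p: "p \<in> J"
      and close: "\<forall>A\<in>\<Union>p\<in>J. \<A> p. \<forall>B\<in>\<Union>p\<in>J. \<A> p.
        cmod (op_form M K (indicator A) (indicator B) - op_form M K' (indicator A) (indicator B)) < m"
    have "cmod (op_form M K (indicator A) (indicator B) - op_form M K' (indicator A) (indicator B)) < \<delta> p"
      if "A \<in> \<A> p" "B \<in> \<A> p" for A B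
    proof -
      have "A \<in> (\<Union>p\<in>J. \<A> p)" "B \<in> (\<Union>p\<in>J. \<A> p)" using that p by auto
      then show ?thesis using close m(2)[OF p] by (meson less_le_trans)
    qed
    then show "wot_gauge M p K K' < e" using A p K by blast
  qed
qed

lemma koopman_image: "koopman M ` carrier (Aut M) \<subseteq> markov_ops M"
  using koopman_markov by auto

lemma gauge_koopman: "gauge (carrier (Aut M)) (L2 M \<times> L2 M) (\<lambda>p S T. wot_gauge M p (koopman M S) (koopman M T))"
  by (rule gauge_comp[OF gauge_markov koopman_image])

lemma wot_le_sot:
  assumes S: "S \<in> carrier (Aut M)" and T: "T \<in> carrier (Aut M)" and F: "F \<in> L2 M" and G: "G \<in> L2 M"
  shows "wot_gauge M (F, G) (koopman M S) (koopman M T) \<le> sot_gauge M F S T * l2_norm M G"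
  unfolding wot_gauge_inner[OF F G] sot_gauge_def
  by (rule l2_inner_diff_le(1)[OF koopman_L2(1)[OF S F] koopman_L2(1)[OF T F] G])

text \<open>Koopman operators preserve norms, so near a fixed \<open>S\<close> the strong distance
  at \<open>F\<close> is controlled by the single coefficient at \<open>(F, koopman M S F)\<close>;
  the bound is \<open>e\<^sup>2 / 2\<close> because the estimate concerns the squared distance. The
  index depends on \<open>S\<close>, so only the topologies are identified here. The other direction
  is the Cauchy-Schwarz inequality.\<close>

lemma weak_topology_koopman: "weak_topology M = uniform_topology (carrier (Aut M)) (koopman_uniformity M)"
  unfolding weak_topology_sot topology_eq
proof (intro allI iffI)
  fix U assume "openin (uniform_topology (carrier (Aut M)) (gauge_uniformity (carrier (Aut M)) (L2 M) (sot_gauge M))) U"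
  then show "openin (uniform_topology (carrier (Aut M)) (koopman_uniformity M)) U"
  proof (rule gauge_topology_finer[OF gauge_koopman gauge_sot, rotated])
    fix S F and e :: real assume S: "S \<in> carrier (Aut M)" and F: "F \<in> L2 M" and e: "0 < e"
    have KS: "koopman M S F \<in> L2 M" using koopman_L2(1)[OF S F] .
    show "\<exists>p\<in>L2 M \<times> L2 M. \<exists>r>0. \<forall>T\<in>carrier (Aut M). wot_gauge M p (koopman M S) (koopman M T) < r \<longrightarrow> sot_gauge M F S T < e"
    proof (intro bexI[of _ "(F, koopman M S F)"] exI[of _ "e\<^sup>2 / 2"] conjI ballI impI)
      fix T assume T: "T \<in> carrier (Aut M)" and lt: "wot_gauge M (F, koopman M S F) (koopman M S) (koopman M T) < e\<^sup>2 / 2"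
      have "(sot_gauge M F S T)\<^sup>2 \<le> 2 * wot_gauge M (F, koopman M S F) (koopman M S) (koopman M T)"
        unfolding sot_gauge_def wot_gauge_inner[OF F KS]
        using koopman_norm[OF S F] koopman_norm[OF T F] by (intro l2_dist_power2[OF KS koopman_L2(1)[OF T F]]) simp
      then have "(sot_gauge M F S T)\<^sup>2 < e\<^sup>2" using lt by simp
      then show "sot_gauge M F S T < e" by (rule power_less_imp_less_base) (use e in simp)
    qed (use e F KS in auto)
  qed
next
  fix U assume "openin (uniform_topology (carrier (Aut M)) (koopman_uniformity M)) U"
  then show "openin (uniform_topology (carrier (Aut M)) (gauge_uniformity (carrier (Aut M)) (L2 M) (sot_gauge M))) U"
  proof (rule gauge_topology_finer[OF gauge_sot gauge_koopman, rotated])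
    fix S p and e :: real assume S: "S \<in> carrier (Aut M)" and p: "p \<in> L2 M \<times> L2 M" and e: "0 < e"
    obtain F G where FG: "p = (F, G)" "F \<in> L2 M" "G \<in> L2 M" using p by auto
    have n: "0 \<le> l2_norm M G" using FG(3) by (simp add: l2_norm_rep nrm_nonneg)
    show "\<exists>F\<in>L2 M. \<exists>r>0. \<forall>T\<in>carrier (Aut M). sot_gauge M F S T < r \<longrightarrow> wot_gauge M p (koopman M S) (koopman M T) < e"
    proof (intro bexI[of _ F] exI[of _ "e / (l2_norm M G + 1)"] conjI ballI impI)
      fix T assume T: "T \<in> carrier (Aut M)" and lt: "sot_gauge M F S T < e / (l2_norm M G + 1)"
      have "wot_gauge M p (koopman M S) (koopman M T) \<le> sot_gauge M F S T * l2_norm M G"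
        unfolding FG(1) by (rule wot_le_sot[OF S T FG(2,3)])
      also have "\<dots> \<le> e / (l2_norm M G + 1) * l2_norm M G" using lt n by (intro mult_right_mono) auto
      also have "\<dots> < e" using e n by (simp add: field_simps)
      finally show "wot_gauge M p (koopman M S) (koopman M T) < e" .
    qed (use e n FG in auto)
  qed
qed

lemma topspace_weak: "topspace (weak_topology M) = carrier (Aut M)"
  unfolding weak_topology_koopman
  by (rule topspace_uniform_topology[OF gauge.uniform_structure_gauge[OF gauge_koopman]])

lemma one_topspace_weak: "\<one>\<^bsub>Aut M\<^esub> \<in> topspace (weak_topology M)"
  unfolding topspace_weak by (meson group.is_monoid group_Aut monoid.one_closed)

lemma sot_neighbourhood:
  assumes "finite \<F>" "\<F> \<subseteq> L2 M"
  shows "openin (weak_topology M) {T \<in> carrier (Aut M). \<forall>F\<in>\<F>. sot_gauge M F \<one>\<^bsub>Aut M\<^esub> T < r}"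
  unfolding weak_topology_sot
  using one_topspace_weak[unfolded topspace_weak] assms by (rule gauge.openin_gauge_ball[OF gauge_sot])

lemma sot_small:
  assumes J: "finite J" "J \<subseteq> L2 M \<times> L2 M" and e: "0 < e"
  obtains r where "0 < r" "\<And>F G. (F, G) \<in> J \<Longrightarrow> r * l2_norm M F < e" "\<And>F G. (F, G) \<in> J \<Longrightarrow> r * l2_norm M G < e"
proof -
  define c where "c = (\<Sum>p\<in>J. l2_norm M (fst p) + l2_norm M (snd p))"
  have n: "0 \<le> l2_norm M (fst p)" "0 \<le> l2_norm M (snd p)" if "p \<in> J" for p
  proof -
    have "fst p \<in> L2 M" "snd p \<in> L2 M" using J(2) that by auto
    then show "0 \<le> l2_norm M (fst p)" "0 \<le> l2_norm M (snd p)" by (simp_all add: l2_norm_rep nrm_nonneg)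
  qed
  have c: "l2_norm M (fst p) + l2_norm M (snd p) \<le> c" if "p \<in> J" for p
    unfolding c_def using J(1) n that by (intro member_le_sum) auto
  have c0: "0 \<le> c" unfolding c_def using n by (intro sum_nonneg) auto
  have "e / (c + 1) * x < e" if "0 \<le> x" "x \<le> c" for x
  proof -
    have "e / (c + 1) * x \<le> e / (c + 1) * c" using that e c0 by (intro mult_left_mono) auto
    also have "\<dots> < e" using e c0 by (simp add: field_simps)
    finally show ?thesis .
  qed
  note bound = this
  show ?thesis
  proof (rule that[of "e / (c + 1)"])
    show "0 < e / (c + 1)" using e c0 by simp
    fix F G assume "(F, G) \<in> J"
    then show "e / (c + 1) * l2_norm M F < e" "e / (c + 1) * l2_norm M G < e"
      using n[of "(F, G)"] c[of "(F, G)"] by (intro bound; simp)+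
  qed
qed

text \<open>Write \<open>Y\<close> as the product of \<open>X\<close> and \<open>W\<close>. Since
  the operator of \<open>X\<close> is isometric, the distance of the images of \<open>F\<close>
  under \<open>X\<close> and \<open>Y\<close> is the distance of \<open>F\<close> and its image
  under \<open>W\<close>, so \<open>W\<close> has to be close to the identity only at the first
  vectors of \<open>J\<close>.\<close>

lemma left_uniformity_le: "left_uniformity (Aut M) (weak_topology M) \<le> koopman_uniformity M"
proof (rule filter_leI)
  interpret group "Aut M" by (rule group_Aut)
  fix P assume "eventually P (koopman_uniformity M)"
  then obtain J e where J: "finite J" "J \<subseteq> L2 M \<times> L2 M" "0 < e"
    and P: "\<And>X Y. X \<in> carrier (Aut M) \<Longrightarrow> Y \<in> carrier (Aut M) \<Longrightarrow>
      (\<forall>p\<in>J. wot_gauge M p (koopman M X) (koopman M Y) < e) \<Longrightarrow> P (X, Y)"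
    unfolding eventually_gauge_uniformity by blast
  obtain r where r: "0 < r" "\<And>F G. (F, G) \<in> J \<Longrightarrow> r * l2_norm M G < e"
    by (rule sot_small[OF J]) (rule that)
  let ?U = "{T \<in> carrier (Aut M). \<forall>F\<in>fst ` J. sot_gauge M F \<one>\<^bsub>Aut M\<^esub> T < r}"
  show "eventually P (left_uniformity (Aut M) (weak_topology M))"
    unfolding eventually_left_uniformity[OF one_topspace_weak]
  proof (intro exI[of _ ?U] conjI ballI impI)
    show "openin (weak_topology M) ?U" using J(1,2) by (intro sot_neighbourhood) auto
    show "\<one>\<^bsub>Aut M\<^esub> \<in> ?U" using r(1) by (auto simp: sot_gauge_def l2_dist_def)
    fix X Y assume XY: "X \<in> carrier (Aut M)" "Y \<in> carrier (Aut M)" and near: "inv\<^bsub>Aut M\<^esub> X \<otimes>\<^bsub>Aut M\<^esub> Y \<in> ?U"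
    show "P (X, Y)"
    proof (rule P[OF XY], rule ballI)
      fix p assume p: "p \<in> J"
      obtain F G where FG: "p = (F, G)" "F \<in> L2 M" "G \<in> L2 M" using p J(2) by auto
      let ?W = "inv\<^bsub>Aut M\<^esub> X \<otimes>\<^bsub>Aut M\<^esub> Y"
      have W: "?W \<in> carrier (Aut M)" "X \<otimes>\<^bsub>Aut M\<^esub> ?W = Y" using XY by (simp_all add: m_assoc[symmetric])
      have "sot_gauge M F X Y = l2_dist M (koopman M X F) (koopman M X (koopman M ?W F))"
        unfolding sot_gauge_def using koopman_mult[OF XY(1) W(1) FG(2)] W(2) by simp
      also have "\<dots> = sot_gauge M F \<one>\<^bsub>Aut M\<^esub> ?W"
        unfolding sot_gauge_def koopman_one[OF FG(2)] by (rule koopman_dist[OF XY(1) FG(2) koopman_L2(1)[OF W(1) FG(2)]])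
      also have "\<dots> \<le> r" using near p FG(1) by force
      finally have "sot_gauge M F X Y * l2_norm M G \<le> r * l2_norm M G"
        using FG(3) by (intro mult_right_mono) (simp_all add: l2_norm_rep nrm_nonneg)
      then show "wot_gauge M p (koopman M X) (koopman M Y) < e"
        using wot_le_sot[OF XY FG(2,3)] r(2)[of F G] p FG(1) by simp
    qed
  qed
qed

text \<open>Write \<open>X\<close> as the product of \<open>Z\<close> and \<open>Y\<close>. Applying
  \<open>Z\<close> to both arguments of the coefficient of \<open>Y\<close> makes the first
  arguments equal, and the difference of coefficients is a pairing with \<open>G - Z G\<close>.
  Preservation of norms makes the bound independent of \<open>Y\<close>; here the second vectors of
  \<open>J\<close> matter.\<close>

lemma right_uniformity_le: "right_uniformity (Aut M) (weak_topology M) \<le> koopman_uniformity M"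
proof (rule filter_leI)
  interpret group "Aut M" by (rule group_Aut)
  fix P assume "eventually P (koopman_uniformity M)"
  then obtain J e where J: "finite J" "J \<subseteq> L2 M \<times> L2 M" "0 < e"
    and P: "\<And>X Y. X \<in> carrier (Aut M) \<Longrightarrow> Y \<in> carrier (Aut M) \<Longrightarrow>
      (\<forall>p\<in>J. wot_gauge M p (koopman M X) (koopman M Y) < e) \<Longrightarrow> P (X, Y)"
    unfolding eventually_gauge_uniformity by blast
  obtain r where r: "0 < r" "\<And>F G. (F, G) \<in> J \<Longrightarrow> r * l2_norm M F < e"
    by (rule sot_small[OF J]) (rule that)
  let ?U = "{T \<in> carrier (Aut M). \<forall>F\<in>snd ` J. sot_gauge M F \<one>\<^bsub>Aut M\<^esub> T < r}"
  show "eventually P (right_uniformity (Aut M) (weak_topology M))"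
    unfolding eventually_right_uniformity[OF one_topspace_weak]
  proof (intro exI[of _ ?U] conjI ballI impI)
    show "openin (weak_topology M) ?U" using J(1,2) by (intro sot_neighbourhood) auto
    show "\<one>\<^bsub>Aut M\<^esub> \<in> ?U" using r(1) by (auto simp: sot_gauge_def l2_dist_def)
    fix X Y assume XY: "X \<in> carrier (Aut M)" "Y \<in> carrier (Aut M)" and near: "X \<otimes>\<^bsub>Aut M\<^esub> inv\<^bsub>Aut M\<^esub> Y \<in> ?U"
    show "P (X, Y)"
    proof (rule P[OF XY], rule ballI)
      fix p assume p: "p \<in> J"
      obtain F G where FG: "p = (F, G)" "F \<in> L2 M" "G \<in> L2 M" using p J(2) by auto
      let ?Z = "X \<otimes>\<^bsub>Aut M\<^esub> inv\<^bsub>Aut M\<^esub> Y"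
      have Z: "?Z \<in> carrier (Aut M)" "?Z \<otimes>\<^bsub>Aut M\<^esub> Y = X" using XY by (simp_all add: m_assoc)
      have YF: "koopman M Y F \<in> L2 M" using koopman_L2(1)[OF XY(2) FG(2)] .
      have ZYF: "koopman M ?Z (koopman M Y F) \<in> L2 M" and ZG: "koopman M ?Z G \<in> L2 M"
        using koopman_L2(1)[OF Z(1)] YF FG(3) by auto
      have XF: "koopman M X F = koopman M ?Z (koopman M Y F)" using koopman_mult[OF Z(1) XY(2) FG(2)] Z(2) by simp
      have "wot_gauge M p (koopman M X) (koopman M Y) =
          cmod (l2_inner M (koopman M ?Z (koopman M Y F)) G - l2_inner M (koopman M ?Z (koopman M Y F)) (koopman M ?Z G))"
        unfolding FG(1) wot_gauge_inner[OF FG(2,3)] XF koopman_inner[OF Z(1) YF FG(3)] ..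
      also have "\<dots> \<le> l2_norm M (koopman M ?Z (koopman M Y F)) * l2_dist M G (koopman M ?Z G)"
        by (rule l2_inner_diff_le(2)[OF FG(3) ZG ZYF])
      also have "\<dots> = l2_norm M F * sot_gauge M G \<one>\<^bsub>Aut M\<^esub> ?Z"
        unfolding koopman_norm[OF Z(1) YF] koopman_norm[OF XY(2) FG(2)] sot_gauge_def koopman_one[OF FG(3)] ..
      also have "\<dots> \<le> l2_norm M F * r"
        using near p FG by (intro mult_left_mono) (force simp: l2_norm_rep nrm_nonneg)+
      also have "\<dots> < e" using r(2)[of F G] p FG(1) by (simp add: mult.commute)
      finally show "wot_gauge M p (koopman M X) (koopman M Y) < e" .
    qed
  qed
qed

text \<open>A neighbourhood of the identity is controlled by finitely many coefficients on
  indicators, and for an automorphism these differ from the coefficients of the identity by at most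
  the measure of its displacement set.\<close>

lemma weak_neighbourhood_displacement:
  assumes U: "openin (weak_topology M) U" "\<one>\<^bsub>Aut M\<^esub> \<in> U"
  obtains \<A> \<epsilon> where "finite \<A>" "\<A> \<subseteq> sets M" "0 < \<epsilon>"
    "\<And>v. v \<in> mp_transformations M \<Longrightarrow> measure M (displacement M \<A> v) < \<epsilon> \<Longrightarrow> aut_class M v \<in> U"
proof -
  have one: "\<one>\<^bsub>Aut M\<^esub> \<in> carrier (Aut M)" using one_topspace_weak topspace_weak by simp
  obtain J e where J: "finite J" "J \<subseteq> L2 M \<times> L2 M" "0 < e"
    "{T \<in> carrier (Aut M). \<forall>p\<in>J. wot_gauge M p (koopman M \<one>\<^bsub>Aut M\<^esub>) (koopman M T) < e} \<subseteq> U"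
    using U unfolding weak_topology_koopman gauge.openin_gauge[OF gauge_koopman] by blast
  obtain \<A> \<delta> where A: "finite \<A>" "\<A> \<subseteq> sets M" "0 < \<delta>"
    "\<And>K K' p. K \<in> markov_ops M \<Longrightarrow> K' \<in> markov_ops M \<Longrightarrow>
      (\<forall>A\<in>\<A>. \<forall>B\<in>\<A>.
        cmod (op_form M K (indicator A) (indicator B) - op_form M K' (indicator A) (indicator B)) < \<delta>) \<Longrightarrow>
      p \<in> J \<Longrightarrow> wot_gauge M p K K' < e"
    by (rule wot_gauge_approx[OF J(1-3)]) (rule that)
  show ?thesis
  proof (rule that[OF A(1-3)])
    fix v assume v: "v \<in> mp_transformations M" and small: "measure M (displacement M \<A> v) < \<delta>"
    let ?V = "aut_class M v"
    have V: "?V \<in> carrier (Aut M)" using v by (rule aut_class_carrier)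
    have "wot_gauge M p (koopman M \<one>\<^bsub>Aut M\<^esub>) (koopman M ?V) < e" if p: "p \<in> J" for p
    proof (rule A(4)[OF koopman_markov[OF one] koopman_markov[OF V] _ p], intro ballI)
      fix A B assume AB: "A \<in> \<A>" "B \<in> \<A>"
      then have s: "A \<in> sets M" "B \<in> sets M" using A(2) by auto
      have "{x \<in> A. x \<in> B} = A \<inter> B" by auto
      then have "op_form M (koopman M \<one>\<^bsub>Aut M\<^esub>) (indicator A) (indicator B) - op_form M (koopman M ?V) (indicator A) (indicator B) =
          complex_of_real (measure M (A \<inter> B) - measure M {x \<in> A. v x \<in> B})"
        using koopman_form_indicator[OF one mp_id one_Aut s] koopman_form_indicator[OF V v refl s] by simp
      then show "cmod (op_form M (koopman M \<one>\<^bsub>Aut M\<^esub>) (indicator A) (indicator B) -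
          op_form M (koopman M ?V) (indicator A) (indicator B)) < \<delta>"
        using transport_displacement[OF v A(1,2) AB] small by (simp only: norm_of_real)
    qed
    then show "?V \<in> U" using J(4) V by blast
  qed
qed

end

context finite_measure
begin

text \<open>On the indicators of a countable separating family the operator determines, up to a null
  set, which members contain the inverse image of a point. Countability unites the exceptional sets,
  so the inverses agree almost everywhere.\<close>

lemma inj_koopman:
  assumes std: "standard_borel_space M"
  shows "inj_on (koopman M) (carrier (Aut M))"
proof (rule inj_onI)
  fix S T assume ST: "S \<in> carrier (Aut M)" "T \<in> carrier (Aut M)" "koopman M S = koopman M T"
  define s t where "s = rep S" and "t = rep T"
  have s: "s \<in> mp_transformations M" "aut_class M s = S" and t: "t \<in> mp_transformations M" "aut_class M t = T"
    using Aut_rep[OF ST(1)] Aut_rep[OF ST(2)] by (simp_all add: s_def t_def)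
  let ?s = "inv_into (space M) s" and ?t = "inv_into (space M) t"
  note s' = mp_inv[OF s(1)] and t' = mp_inv[OF t(1)]
  obtain A :: "nat \<Rightarrow> 'a set" where A: "\<And>n. A n \<in> sets M"
    "\<And>x y. x \<in> space M \<Longrightarrow> y \<in> space M \<Longrightarrow> (\<And>n. x \<in> A n \<longleftrightarrow> y \<in> A n) \<Longrightarrow> x = y"
    using standard_borel_separating[OF std] by blast
  have "AE x in M. ?s x \<in> A n \<longleftrightarrow> ?t x \<in> A n" for n
  proof -
    have i: "indicator (A n) \<in> square_integrable M" using A(1) by (rule sq_indicator)
    have "l2_class M (\<lambda>x. indicator (A n) (?s x)) = l2_class M (\<lambda>x. indicator (A n) (?t x))"
      using koopman_class[OF s(1) i] koopman_class[OF t(1) i] s(2) t(2) ST(3) by simp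
    then have "AE x in M. (indicator (A n) (?s x) :: complex) = indicator (A n) (?t x)"
      using l2_class_eq_iff[OF sq_comp(1)[OF s' i] sq_comp(1)[OF t' i]] by simp
    then show ?thesis by eventually_elim (auto simp: indicator_def split: if_splits)
  qed
  then have "AE x in M. \<forall>n. ?s x \<in> A n \<longleftrightarrow> ?t x \<in> A n" by (simp add: AE_all_countable)
  then have eq: "AE x in M. ?s x = ?t x"
  proof (rule AE_mp, intro AE_I2 impI)
    fix x assume x: "x \<in> space M" and h: "\<forall>n. ?s x \<in> A n \<longleftrightarrow> ?t x \<in> A n"
    show "?s x = ?t x" using A(2)[of "?s x" "?t x"] h mp_inv_simps(4)[OF s(1) x] mp_inv_simps(4)[OF t(1) x] by blast
  qed
  have "AE x in M. inv_into (space M) ?s x = inv_into (space M) ?t x" by (rule mp_inv_AE[OF s' t' eq])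
  then have "AE x in M. s x = t x"
  proof (rule AE_mp, intro AE_I2 impI)
    fix x assume x: "x \<in> space M" and h: "inv_into (space M) ?s x = inv_into (space M) ?t x"
    show "s x = t x"
      using h inv_into_inv_into_eq[OF mp_transformationsD(2)[OF s(1)] x]
        inv_into_inv_into_eq[OF mp_transformationsD(2)[OF t(1)] x] by simp
  qed
  then show "S = T" using s t aut_class_eq_iff[OF s(1) t(1)] by simp
qed

end

section \<open>Density of the Koopman operators and identification of the Roelcke structure and
  algebra\<close>

context atomless_standard_measure
begin

lemma koopman_embedding: "embedding_map (weak_topology M) (markov_topology M) (koopman M)"
  unfolding weak_topology_koopman markov_topology_gauge
  by (rule embedding_gauge[OF gauge_markov koopman_image inj_koopman[OF standard]])

lemma koopman_dense: "(markov_topology M) closure_of (koopman M ` carrier (Aut M)) = markov_ops M"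
proof
  have "topspace (markov_topology M) = markov_ops M"
    unfolding markov_topology_gauge
    by (rule topspace_uniform_topology[OF gauge.uniform_structure_gauge[OF gauge_markov]])
  then show "(markov_topology M) closure_of (koopman M ` carrier (Aut M)) \<subseteq> markov_ops M"
    using closure_of_subset_topspace by metis
  show "markov_ops M \<subseteq> (markov_topology M) closure_of (koopman M ` carrier (Aut M))"
  proof
    fix K assume K: "K \<in> markov_ops M"
    show "K \<in> (markov_topology M) closure_of (koopman M ` carrier (Aut M))"
      unfolding markov_topology_gauge
    proof (rule gauge.in_closure_gauge[OF gauge_markov K koopman_image])
      fix J and e :: real assume J: "finite J" "J \<subseteq> L2 M \<times> L2 M" "0 < e"
      obtain \<A> \<delta> where A: "finite \<A>" "\<A> \<subseteq> sets M" "0 < \<delta>"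
        "\<And>K K' p. K \<in> markov_ops M \<Longrightarrow> K' \<in> markov_ops M \<Longrightarrow>
          (\<forall>A\<in>\<A>. \<forall>B\<in>\<A>.
            cmod (op_form M K (indicator A) (indicator B) - op_form M K' (indicator A) (indicator B)) < \<delta>) \<Longrightarrow>
          p \<in> J \<Longrightarrow> wot_gauge M p K K' < e"
        by (rule wot_gauge_approx[OF J]) (rule that)
      obtain T where T: "T \<in> carrier (Aut M)" "\<And>A B. A \<in> \<A> \<Longrightarrow> B \<in> \<A> \<Longrightarrow>
          op_form M (koopman M T) (indicator A) (indicator B) = op_form M K (indicator A) (indicator B)"
        by (rule markov_operator_transport[OF K A(1,2)]) (rule that)
      have "\<forall>p\<in>J. wot_gauge M p K (koopman M T) < e"
        using A(3) T(2) by (intro ballI A(4)[OF K koopman_markov[OF T(1)]]) auto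
      then show "\<exists>K'\<in>koopman M ` carrier (Aut M). \<forall>p\<in>J. wot_gauge M p K K' < e" using T(1) by blast
    qed
  qed
qed

text \<open>\<open>U\<close> and \<open>V\<close> are neighbourhoods of the identity that produce
  \<open>D\<close> from the left and from the right. If \<open>X\<close> and \<open>Y\<close> have
  close coefficients on atoms, then \<open>Y = Z X W\<close> with \<open>W\<close> in
  \<open>U\<close> and the inverse of \<open>Z\<close> in \<open>V\<close>; so \<open>D\<close>
  holds between \<open>X\<close> and \<open>X W\<close> and between \<open>X W\<close> and
  \<open>Y\<close>, and the composition axiom gives \<open>P (X, Y)\<close>.\<close>

lemma koopman_uniformity_le:
  assumes E: "uniform_structure (carrier (Aut M)) E"
    and L: "left_uniformity (Aut M) (weak_topology M) \<le> E"
    and R: "right_uniformity (Aut M) (weak_topology M) \<le> E"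
  shows "koopman_uniformity M \<le> E"
proof (rule filter_leI)
  interpret group "Aut M" by (rule group_Aut)
  fix P assume "eventually P E"
  then obtain D where D: "eventually D E" "\<And>x y z. D (x, y) \<Longrightarrow> D (y, z) \<Longrightarrow> P (x, z)"
    using uniform_structure_comp[OF E] by blast
  obtain U where U: "openin (weak_topology M) U" "\<one>\<^bsub>Aut M\<^esub> \<in> U"
    "\<forall>x\<in>carrier (Aut M). \<forall>y\<in>carrier (Aut M). inv\<^bsub>Aut M\<^esub> x \<otimes>\<^bsub>Aut M\<^esub> y \<in> U \<longrightarrow> D (x, y)"
    using filter_leD[OF L D(1)] unfolding eventually_left_uniformity[OF one_topspace_weak] by blast
  obtain V where V: "openin (weak_topology M) V" "\<one>\<^bsub>Aut M\<^esub> \<in> V"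
    "\<forall>x\<in>carrier (Aut M). \<forall>y\<in>carrier (Aut M). x \<otimes>\<^bsub>Aut M\<^esub> inv\<^bsub>Aut M\<^esub> y \<in> V \<longrightarrow> D (x, y)"
    using filter_leD[OF R D(1)] unfolding eventually_right_uniformity[OF one_topspace_weak] by blast
  obtain \<A>1 \<epsilon>1 where A1: "finite \<A>1" "\<A>1 \<subseteq> sets M" "0 < \<epsilon>1"
    "\<And>v. v \<in> mp_transformations M \<Longrightarrow> measure M (displacement M \<A>1 v) < \<epsilon>1 \<Longrightarrow> aut_class M v \<in> U"
    by (rule weak_neighbourhood_displacement[OF U(1,2)]) (rule that)
  obtain \<A>2 \<epsilon>2 where A2: "finite \<A>2" "\<A>2 \<subseteq> sets M" "0 < \<epsilon>2"
    "\<And>v. v \<in> mp_transformations M \<Longrightarrow> measure M (displacement M \<A>2 v) < \<epsilon>2 \<Longrightarrow> aut_class M v \<in> V"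
    by (rule weak_neighbourhood_displacement[OF V(1,2)]) (rule that)
  define \<A> where "\<A> = \<A>1 \<union> \<A>2"
  define \<epsilon> where "\<epsilon> = min \<epsilon>1 \<epsilon>2"
  have A: "finite \<A>" "\<A> \<subseteq> sets M" "0 < \<epsilon>" using A1 A2 by (auto simp: \<A>_def \<epsilon>_def)
  \<comment> \<open>The claim concerns inverses because \<open>W\<close> is the class of the inverse
    of the small map \<open>u\<close>, and \<open>Z\<close> enters the right structure through its
    inverse.\<close>
  have small: "aut_class M (inv_into (space M) v) \<in> U \<inter> V"
    if v: "v \<in> mp_transformations M" "measure M (displacement M \<A> v) < \<epsilon>" for v
  proof -
    let ?v = "inv_into (space M) v"
    have d: "measure M (displacement M \<A> ?v) < \<epsilon>" using displacement_inv[OF v(1) A(1,2)] v(2) by simp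
    have le: "measure M (displacement M \<B> ?v) \<le> measure M (displacement M \<A> ?v)" if "\<B> \<subseteq> \<A>" for \<B>
      by (rule finite_measure_mono[OF displacement_mono[OF that] displacement_sets[OF mp_inv[OF v(1)] A(1,2)]])
    have "measure M (displacement M \<A>1 ?v) < \<epsilon>1" "measure M (displacement M \<A>2 ?v) < \<epsilon>2"
      using le[of \<A>1] le[of \<A>2] d by (auto simp: \<A>_def \<epsilon>_def)
    then show ?thesis using A1(4) A2(4) mp_inv[OF v(1)] by blast
  qed
  obtain \<delta> where \<delta>: "0 < \<delta>"
    "\<And>s t. s \<in> mp_transformations M \<Longrightarrow> t \<in> mp_transformations M \<Longrightarrow>
      (\<forall>L\<in>Pow \<A>. \<forall>L'\<in>Pow \<A>.
        \<bar>measure M {x \<in> atom M \<A> L. s x \<in> atom M \<A> L'} - measure M {x \<in> atom M \<A> L. t x \<in> atom M \<A> L'}\<bar> < \<delta>) \<Longrightarrow>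
      \<exists>z\<in>mp_transformations M. measure M (displacement M \<A> z) < \<epsilon> \<and>
        measure M (displacement M \<A> (inv_into (space M) t \<circ> z \<circ> s)) < \<epsilon>"
    by (rule close_transport_factorisation[OF A]) (rule that)
  define c where "c L = l2_class M (indicator (atom M \<A> L))" for L
  have at: "atom M \<A> L \<in> sets M" if "L \<in> Pow \<A>" for L using A that by (intro atom_sets) auto
  have c: "c L \<in> L2 M" if "L \<in> Pow \<A>" for L
    unfolding c_def by (rule l2_class_in_L2[OF sq_indicator[OF at[OF that]]])
  show "eventually P (koopman_uniformity M)"
    unfolding eventually_gauge_uniformity
  proof (intro exI conjI ballI impI)
    \<comment> \<open>The coefficients on pairs of atoms are the measures of transport between atoms
      that the factorisation compares.\<close>
    let ?J = "(\<lambda>(L, L'). (c L, c L')) ` (Pow \<A> \<times> Pow \<A>)"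
    show "finite ?J" "?J \<subseteq> L2 M \<times> L2 M" "0 < \<delta>" using A(1) c \<delta>(1) by auto
    fix X Y assume X: "X \<in> carrier (Aut M)" and Y: "Y \<in> carrier (Aut M)"
      and close: "\<forall>p\<in>?J. wot_gauge M p (koopman M X) (koopman M Y) < \<delta>"
    define s t where "s = rep X" and "t = rep Y"
    have s: "s \<in> mp_transformations M" "X = aut_class M s" and t: "t \<in> mp_transformations M" "Y = aut_class M t"
      using Aut_rep[OF X] Aut_rep[OF Y] by (simp_all add: s_def t_def)
    have "\<bar>measure M {x \<in> atom M \<A> L. s x \<in> atom M \<A> L'} - measure M {x \<in> atom M \<A> L. t x \<in> atom M \<A> L'}\<bar> < \<delta>"
      if L: "L \<in> Pow \<A>" "L' \<in> Pow \<A>" for L L'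
    proof -
      have "(c L, c L') \<in> ?J" using L by (intro image_eqI[of _ _ "(L, L')"]) auto
      then have "wot_gauge M (c L, c L') (koopman M X) (koopman M Y) < \<delta>" using close by (rule bspec[rotated])
      then have "cmod (op_form M (koopman M X) (indicator (atom M \<A> L)) (indicator (atom M \<A> L')) -
          op_form M (koopman M Y) (indicator (atom M \<A> L)) (indicator (atom M \<A> L'))) < \<delta>"
        unfolding wot_gauge_inner[OF c[OF L(1)] c[OF L(2)]] by (simp only: op_form_def c_def)
      then show ?thesis
        unfolding koopman_form_indicator[OF X s at[OF L(1)] at[OF L(2)]]
          koopman_form_indicator[OF Y t at[OF L(1)] at[OF L(2)]] of_real_diff[symmetric] norm_of_real .
    qed
    then obtain z where z: "z \<in> mp_transformations M" "measure M (displacement M \<A> z) < \<epsilon>"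
      "measure M (displacement M \<A> (inv_into (space M) t \<circ> z \<circ> s)) < \<epsilon>"
      using \<delta>(2)[OF s(1) t(1)] by blast
    \<comment> \<open>With \<open>w\<close> the inverse of \<open>u\<close>, the composite of
      \<open>z\<close>, \<open>s\<close> and \<open>w\<close> is \<open>t\<close>: this is the
      required factorisation.\<close>
    define u where "u = inv_into (space M) t \<circ> z \<circ> s"
    have u: "u \<in> mp_transformations M"
      unfolding u_def by (intro mp_comp(1) mp_inv s(1) t(1) z(1))
    define w where "w = inv_into (space M) u"
    have w: "w \<in> mp_transformations M" unfolding w_def by (rule mp_inv[OF u])
    define Z W where "Z = aut_class M z" and "W = aut_class M w"
    have ZW: "Z \<in> carrier (Aut M)" "W \<in> carrier (Aut M)"
      unfolding Z_def W_def using z(1) w by (auto intro: aut_class_carrier)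
    have WU: "W \<in> U" and ZV: "inv\<^bsub>Aut M\<^esub> Z \<in> V"
      using small[OF u] small[OF z(1,2)] z(3) by (auto simp: W_def Z_def w_def u_def inv_aut_class[OF z(1)])
    have "(z \<circ> (s \<circ> w)) x = t x" if x: "x \<in> space M" for x
    proof -
      have wx: "w x \<in> space M" using mp_inv_simps(4)[OF u x] by (simp add: w_def)
      have "inv_into (space M) t (z (s (w x))) = x" using mp_inv_simps(2)[OF u x] by (simp add: w_def u_def)
      then show ?thesis
        using mp_inv_simps(2)[OF t(1) mp_inv_simps(3)[OF z(1) mp_inv_simps(3)[OF s(1) wx]]] by simp
    qed
    then have Yeq: "Z \<otimes>\<^bsub>Aut M\<^esub> (X \<otimes>\<^bsub>Aut M\<^esub> W) = Y"
      unfolding Z_def W_def s(2) t(2) mult_aut_class[OF s(1) w] mult_aut_class[OF z(1) mp_comp(1)[OF s(1) w]]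
      using aut_class_eq_iff[OF mp_comp(1)[OF z(1) mp_comp(1)[OF s(1) w]] t(1)] by (simp add: AE_I2)
    have XW: "X \<otimes>\<^bsub>Aut M\<^esub> W \<in> carrier (Aut M)" using X ZW by simp
    have "inv\<^bsub>Aut M\<^esub> X \<otimes>\<^bsub>Aut M\<^esub> (X \<otimes>\<^bsub>Aut M\<^esub> W) = W" using X ZW by (simp add: m_assoc[symmetric])
    then have 1: "D (X, X \<otimes>\<^bsub>Aut M\<^esub> W)" using U(3) X XW WU by simp
    have "(X \<otimes>\<^bsub>Aut M\<^esub> W) \<otimes>\<^bsub>Aut M\<^esub> inv\<^bsub>Aut M\<^esub> Y = inv\<^bsub>Aut M\<^esub> Z"
      unfolding Yeq[symmetric] using XW ZW by (simp add: inv_mult_group m_assoc[symmetric])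
    then have 2: "D (X \<otimes>\<^bsub>Aut M\<^esub> W, Y)" using V(3) XW Y ZV by simp
    show "P (X, Y)" using D(2)[OF 1 2] .
  qed
qed

lemma roelcke_uniformity_koopman:
  "roelcke_uniformity (Aut M) (weak_topology M) = koopman_uniformity M"
  unfolding roelcke_uniformity_def
proof (rule antisym)
  show "Inf {E. uniform_structure (carrier (Aut M)) E \<and> left_uniformity (Aut M) (weak_topology M) \<le> E \<and>
      right_uniformity (Aut M) (weak_topology M) \<le> E} \<le> koopman_uniformity M"
    using gauge.uniform_structure_gauge[OF gauge_koopman] left_uniformity_le right_uniformity_le
    by (intro Inf_lower) simp
  show "koopman_uniformity M \<le> Inf {E. uniform_structure (carrier (Aut M)) E \<and>
      left_uniformity (Aut M) (weak_topology M) \<le> E \<and> right_uniformity (Aut M) (weak_topology M) \<le> E}"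
    by (intro Inf_greatest) (auto intro: koopman_uniformity_le)
qed

text \<open>A function in the algebra defines, through the distance of its values, a uniform
  structure coarser than both group structures, hence coarser than the Koopman structure; so it is
  uniformly continuous for the latter and extends from the dense image. Conversely, compactness
  makes a continuous function on the Markov operators bounded and uniformly continuous, and both
  group structures are finer than the Koopman one.\<close>

lemma roelcke_algebra_iff:
  "f \<in> roelcke_algebra (Aut M) (weak_topology M) \<longleftrightarrow>
    (\<exists>h. continuous_map (markov_topology M) euclidean h \<and> (\<forall>T\<in>carrier (Aut M). f T = h (koopman M T)))"
proof
  assume f: "f \<in> roelcke_algebra (Aut M) (weak_topology M)"
  \<comment> \<open>A single pseudometric, hence the one-point index set. Uniform continuity for two
    structures is thereby expressed by one uniform structure, to which the comparison above
    applies.\<close>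
  define E where "E = gauge_uniformity (carrier (Aut M)) {()} (\<lambda>_ S T. dist (f S) (f T))"
  have gE: "gauge (carrier (Aut M)) {()} (\<lambda>_ S T. dist (f S) (f T))"
    by unfold_locales (auto simp: dist_commute dist_triangle)
  have le: "F \<le> E" if F: "LIM (x, y) F. (f x, f y) :> uniformity"
    and carr: "F \<le> principal (carrier (Aut M) \<times> carrier (Aut M))" for F
  proof (rule filter_leI)
    fix P assume "eventually P E"
    then obtain J e where J: "finite J" "J \<subseteq> {()}" "0 < e"
      "\<forall>x\<in>carrier (Aut M). \<forall>y\<in>carrier (Aut M). (\<forall>i\<in>J. dist (f x) (f y) < e) \<longrightarrow> P (x, y)"
      unfolding E_def eventually_gauge_uniformity by blast
    have "eventually (\<lambda>(u, v). dist u v < e) (uniformity :: (complex \<times> complex) filter)"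
      using J(3) unfolding eventually_uniformity_metric by blast
    then have "eventually (\<lambda>(x, y). dist (f x) (f y) < e) F"
      using F unfolding filterlim_iff by (auto simp: case_prod_unfold)
    moreover have "eventually (\<lambda>p. p \<in> carrier (Aut M) \<times> carrier (Aut M)) F"
      using carr by (simp add: le_principal)
    ultimately show "eventually P F"
      by eventually_elim (use J(4) in auto)
  qed
  have carr: "koopman_uniformity M \<le> principal (carrier (Aut M) \<times> carrier (Aut M))"
    using gauge.uniform_structure_gauge[OF gauge_koopman] by (simp add: uniform_structure_def)
  have "koopman_uniformity M \<le> E"
  proof (rule koopman_uniformity_le)
    show "uniform_structure (carrier (Aut M)) E"
      unfolding E_def by (rule gauge.uniform_structure_gauge[OF gE])
    show "left_uniformity (Aut M) (weak_topology M) \<le> E" "right_uniformity (Aut M) (weak_topology M) \<le> E"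
      using f order_trans[OF left_uniformity_le carr] order_trans[OF right_uniformity_le carr]
      by (simp_all add: roelcke_algebra_def le)
  qed
  moreover have "eventually (\<lambda>(x, y). dist (f x) (f y) < e) E" if "0 < e" for e
    unfolding E_def eventually_gauge_uniformity using that by (intro exI[of _ "{()}"] exI[of _ e]) auto
  ultimately have "eventually (\<lambda>(x, y). dist (f x) (f y) < e) (koopman_uniformity M)" if "0 < e" for e
    using that by (meson filter_leD)
  then show "\<exists>h. continuous_map (markov_topology M) euclidean h \<and> (\<forall>T\<in>carrier (Aut M). f T = h (koopman M T))"
    unfolding markov_topology_gauge
    by (intro gauge_extension[OF gauge_markov koopman_image inj_koopman[OF standard]
        koopman_dense[unfolded markov_topology_gauge]])
next
  assume "\<exists>h. continuous_map (markov_topology M) euclidean h \<and> (\<forall>T\<in>carrier (Aut M). f T = h (koopman M T))"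
  then obtain h where h: "continuous_map (markov_topology M) euclidean h"
    "\<And>T. T \<in> carrier (Aut M) \<Longrightarrow> f T = h (koopman M T)" by blast
  have us: "uniform_structure (markov_ops M) (markov_uniformity M)"
    by (rule gauge.uniform_structure_gauge[OF gauge_markov])
  have top: "topspace (markov_topology M) = markov_ops M"
    unfolding markov_topology_gauge by (rule topspace_uniform_topology[OF us])
  have unif: "eventually (\<lambda>(x, y). dist (f x) (f y) < e) (koopman_uniformity M)" if e: "0 < e" for e
  proof -
    have "eventually (\<lambda>(x, y). dist (h x) (h y) < e) (markov_uniformity M)"
      using compact_markov_topology h(1) e unfolding markov_topology_gauge
      by (intro compact_uniform_continuous[OF us])
    then obtain J r where J: "finite J" "J \<subseteq> L2 M \<times> L2 M" "0 < r" "\<forall>x\<in>markov_ops M. \<forall>y\<in>markov_ops M.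
        (\<forall>i\<in>J. wot_gauge M i x y < r) \<longrightarrow> dist (h x) (h y) < e"
      unfolding eventually_gauge_uniformity by auto
    show ?thesis
      unfolding eventually_gauge_uniformity
    proof (intro exI[of _ J] exI[of _ r] conjI ballI impI)
      fix S T assume "S \<in> carrier (Aut M)" "T \<in> carrier (Aut M)"
        "\<forall>i\<in>J. wot_gauge M i (koopman M S) (koopman M T) < r"
      then show "case (S, T) of (x, y) \<Rightarrow> dist (f x) (f y) < e"
        using J(4) koopman_markov h(2) by simp
    qed (use J in auto)
  qed
  have lim: "LIM (x, y) F. (f x, f y) :> uniformity" if F: "F \<le> koopman_uniformity M" for F
    unfolding filterlim_iff
  proof (intro allI impI)
    fix P :: "complex \<times> complex \<Rightarrow> bool" assume "eventually P uniformity"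
    then obtain e where e: "0 < e" "\<And>x y. dist x y < e \<Longrightarrow> P (x, y)"
      unfolding eventually_uniformity_metric by auto
    have "eventually (\<lambda>(x, y). dist (f x) (f y) < e) F" using filter_leD[OF F unif[OF e(1)]] .
    then show "eventually (\<lambda>x. P (case x of (x, y) \<Rightarrow> (f x, f y))) F"
      by eventually_elim (use e(2) in auto)
  qed
  have "compactin euclidean (h ` markov_ops M)"
    using image_compactin[OF _ h(1)] compact_markov_topology top by (simp add: compact_space_def)
  then have "bounded (h ` markov_ops M)" by (simp add: compact_imp_bounded)
  moreover have "f ` carrier (Aut M) \<subseteq> h ` markov_ops M" using h(2) koopman_markov by auto
  ultimately have "bounded (f ` carrier (Aut M))" by (rule bounded_subset)
  then show "f \<in> roelcke_algebra (Aut M) (weak_topology M)"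
    using lim[OF left_uniformity_le] lim[OF right_uniformity_le] by (simp add: roelcke_algebra_def)
qed

end

theorem theorem1p1:
  fixes M :: "'a measure"
  assumes "prob_space M" and "standard_borel_space M" and "atomless M"
  shows "(\<exists>!E. compatible_uniformity (markov_topology M) E) \<and>
    embedding_map (weak_topology M) (markov_topology M) (koopman M) \<and>
    induced_uniformity (carrier (Aut M)) (koopman M) (the_compatible_uniformity (markov_topology M))
      = roelcke_uniformity (Aut M) (weak_topology M) \<and>
    precompact_uniformity (carrier (Aut M)) (roelcke_uniformity (Aut M) (weak_topology M)) \<and>
    roelcke_compactification (Aut M) (weak_topology M) (markov_topology M) (koopman M)"
proof -
  interpret prob_space M by fact
  interpret atomless_standard_measure M
    by unfold_locales (fact assms)+
  have unique: "E = markov_uniformity M" if "compatible_uniformity (markov_topology M) E" for E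
    by (rule compatible_uniformity_unique[OF compact_markov_topology that compatible_markov_uniformity])
  then have the: "the_compatible_uniformity (markov_topology M) = markov_uniformity M"
    unfolding the_compatible_uniformity_def
    by (intro the_equality compatible_markov_uniformity)
  show ?thesis
  proof (intro conjI)
    show "\<exists>!E. compatible_uniformity (markov_topology M) E"
      using compatible_markov_uniformity unique by blast
    show "embedding_map (weak_topology M) (markov_topology M) (koopman M)" by (rule koopman_embedding)
    show "induced_uniformity (carrier (Aut M)) (koopman M) (the_compatible_uniformity (markov_topology M))
        = roelcke_uniformity (Aut M) (weak_topology M)"
      unfolding the roelcke_uniformity_koopman by (rule induced_gauge_uniformity[OF koopman_image])
    show "precompact_uniformity (carrier (Aut M)) (roelcke_uniformity (Aut M) (weak_topology M))"
    proof (rule precompact_uniformity_dense[OF gauge_markov koopman_image])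
      show "compact_space (uniform_topology (markov_ops M) (markov_uniformity M))"
        using compact_markov_topology unfolding markov_topology_gauge .
      show "uniform_topology (markov_ops M) (markov_uniformity M) closure_of (koopman M ` carrier (Aut M)) = markov_ops M"
        using koopman_dense unfolding markov_topology_gauge .
    qed (rule wot_gauge_separates, assumption+, rule roelcke_uniformity_koopman)
    show "roelcke_compactification (Aut M) (weak_topology M) (markov_topology M) (koopman M)"
      unfolding roelcke_compactification_def compactification_of_algebra_def topspace_weak koopman_dense
    proof (intro conjI allI compact_markov_topology Hausdorff_markov_topology roelcke_algebra_iff)
      show "continuous_map (weak_topology M) (markov_topology M) (koopman M)"
        using koopman_embedding homeomorphic_imp_continuous_map continuous_map_in_subtopology
        unfolding embedding_map_def by blast
      show "markov_ops M = topspace (markov_topology M)"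
        unfolding markov_topology_gauge
        by (rule topspace_uniform_topology[OF gauge.uniform_structure_gauge[OF gauge_markov], symmetric])
    qed
  qed
qed

end
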